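(* Fix $\beta\in(0,\infty)$ and a bounded closed box $\Lambda\subset\mathbb R^d$. Let $W\colon\mathbb R^d\to\mathbb R\cup\{\infty\}$ be continuous in $\Lambda$ and equal to $\infty$ on $\Lambda^{\mathrm c}$. Then $$\lim_{N\to\infty}\frac1N\log\mathrm{Tr}_+\big(e^{-\beta\mathcal H_N}\big)=\beta\lambda_\Lambda(-W).$$
   Context: $\mathcal H_N=\sum_{i=1}^N(-\Delta_i+W(x_i))$ is the $N$-particle Hamilton operator, and $\mathrm{Tr}_+(e^{-\beta\mathcal H_N})$ is the trace of $e^{-\beta\mathcal H_N}$ restricted to symmetric wave functions, given (via Feynman–Kac) by $$\mathrm{Tr}_+\big(e^{-\beta\mathcal H_N}\big)=\frac1{N!}\sum_{\sigma\in\mathfrak S_N}\int_{\mathbb R^{dN}}dx_1\cdots dx_N\int_{\mathcal C^N}\Big(\bigotimes_{i=1}^N\mu^\beta_{x_i,x_{\sigma(i)}}\Big)(d\omega)\exp\Big\{-\sum_{i=1}^N\int_0^\beta W(\omega^{(i)}_s)ds\Big\},$$ where $\mathfrak S_N$ is the permutation group of $\{1,\dots,N\}$, $\mathcal C=\mathcal C([0,\beta];\mathbb R^d)$, $\omega=(\omega^{(1)},\dots,\omega^{(N)})$, and $\mu^\beta_{x,y}(A)=\mathbb P_x(B\in A;B_\beta\in dy)/dy$ is the canonical Brownian bridge measure for Brownian motion $B$ with generator $\Delta$ (under $\mathbb P_x$, $B_0=x$). For $f$ continuous on $\Lambda$, $$\lambda_\Lambda(f)=\sup\Big\{\int f\varphi^2\,dx-\|\nabla\varphi\|_2^2:\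 \varphi\in\mathcal C^\infty(\mathbb R^d),\ \mathrm{supp}(\varphi)\subset\Lambda,\ \|\varphi\|_2=1\Big\},$$ the principal eigenvalue of $\Delta+f$ in $\Lambda$ with Dirichlet boundary condition. *)

theory Defs
  imports "HOL-Probability.Probability" "HOL-Combinatorics.Permutations"
begin

section \<open>Heat kernel of the generator \<Delta> (not 1/2 \<Delta>)\<close>

definition heat_kernel :: "real \<Rightarrow> 'a::euclidean_space \<Rightarrow> 'a \<Rightarrow> real" where
  "heat_kernel t x y =
     (4 * pi * t) powr (- real DIM('a) / 2) * exp (- (norm (x - y))\<^sup>2 / (4 * t))"

text \<open>Paths are extensional functions on [0,beta] (as in PiM), continuous on [0,beta].
  The sigma-algebra is the one generated by the evaluation maps.\<close>

definition path_space :: "real \<Rightarrow> (real \<Rightarrow> 'a::euclidean_space) set" where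
  "path_space \<beta> =
     {\<omega> \<in> space (PiM {0..\<beta>} (\<lambda>_. (lborel :: 'a measure))). continuous_on {0..\<beta>} \<omega>}"

definition path_measurable_space :: "real \<Rightarrow> (real \<Rightarrow> 'a::euclidean_space) measure" where
  "path_measurable_space \<beta> =
     restrict_space (PiM {0..\<beta>} (\<lambda>_. (lborel :: 'a measure))) (path_space \<beta>)"

text \<open>Finite-dimensional marginals of mu^beta_{x,y}: for times s < t_1 < ... < t_n < T,
  starting point z at time s and endpoint y at time T, the value
  int_{A_1}...int_{A_n} p_{t_1-s}(z,w_1) p_{t_2-t_1}(w_1,w_2) ... p_{T-t_n}(w_n,y) dw.\<close>

fun bridge_fdd :: "real \<Rightarrow> 'a::euclidean_space \<Rightarrow> (real \<times> 'a set) list \<Rightarrow> real \<Rightarrow> 'a \<Rightarrow> ennreal" where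
  "bridge_fdd s z [] T y = ennreal (heat_kernel (T - s) z y)"
| "bridge_fdd s z ((t, A) # r) T y =
     (\<integral>\<^sup>+ w. indicator A w * ennreal (heat_kernel (t - s) z w) * bridge_fdd t w r T y \<partial>lborel)"

definition is_brownian_bridge :: "real \<Rightarrow> 'a::euclidean_space \<Rightarrow> 'a \<Rightarrow> (real \<Rightarrow> 'a) measure \<Rightarrow> bool" where
  "is_brownian_bridge \<beta> x y \<mu> \<longleftrightarrow>
     sets \<mu> = sets (path_measurable_space \<beta>) \<and>
     (\<forall>J A. finite J \<and> J \<subseteq> {0<..<\<beta>} \<and> (\<forall>j\<in>J. A j \<in> sets (lborel :: 'a measure)) \<longrightarrow>
        emeasure \<mu> {\<omega> \<in> path_space \<beta>. \<forall>j\<in>J. \<omega> j \<in> A j}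
          = bridge_fdd 0 x (map (\<lambda>t. (t, A t)) (sorted_list_of_set J)) \<beta> y)"

text \<open>The canonical Brownian bridge measure mu^beta_{x,y} on C([0,beta];R^d): the (unique)
  measure on continuous paths with the above finite-dimensional distributions.\<close>

definition brownian_bridge :: "real \<Rightarrow> 'a::euclidean_space \<Rightarrow> 'a \<Rightarrow> (real \<Rightarrow> 'a) measure" where
  "brownian_bridge \<beta> x y = (SOME \<mu>. is_brownian_bridge \<beta> x y \<mu>)"

text \<open>exp(- int_0^beta W(omega_s) ds), with the convention exp(-infinity) = 0: the integral
  is +infinity exactly when the path hits the set where W = infinity.\<close>

definition path_weight :: "real \<Rightarrow> ('a::euclidean_space \<Rightarrow> ereal) \<Rightarrow> (real \<Rightarrow> 'a) \<Rightarrow> ennreal" where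
  "path_weight \<beta> W \<omega> =
     (if \<forall>s\<in>{0..\<beta>}. W (\<omega> s) \<noteq> \<infinity>
      then ennreal (exp (- integral {0..\<beta>} (\<lambda>s. real_of_ereal (W (\<omega> s)))))
      else 0)"

definition trace_sym :: "real \<Rightarrow> ('a::euclidean_space \<Rightarrow> ereal) \<Rightarrow> nat \<Rightarrow> ennreal" where
  "trace_sym \<beta> W N =
     ennreal (1 / fact N) *
     (\<Sum>\<sigma> \<in> {\<sigma>. \<sigma> permutes {..<N}}.
        \<integral>\<^sup>+ x. (\<integral>\<^sup>+ \<omega>. (\<Prod>i<N. path_weight \<beta> W (\<omega> i))
                  \<partial>(PiM {..<N} (\<lambda>i. brownian_bridge \<beta> (x i) (x (\<sigma> i)))))
          \<partial>(PiM {..<N} (\<lambda>_. (lborel :: 'a measure))))"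

fun C_k :: "nat \<Rightarrow> ('a::euclidean_space \<Rightarrow> real) \<Rightarrow> bool" where
  "C_k 0 f = continuous_on UNIV f"
| "C_k (Suc k) f = ((\<forall>x. f differentiable (at x)) \<and>
                    (\<forall>i\<in>Basis. C_k k (\<lambda>x. frechet_derivative f (at x) i)))"

definition smooth_fun :: "('a::euclidean_space \<Rightarrow> real) \<Rightarrow> bool" where
  "smooth_fun f \<longleftrightarrow> (\<forall>k. C_k k f)"

definition grad :: "('a::euclidean_space \<Rightarrow> real) \<Rightarrow> 'a \<Rightarrow> 'a" where
  "grad \<phi> x = (\<Sum>i\<in>Basis. frechet_derivative \<phi> (at x) i *\<^sub>R i)"

definition dirichlet_eigenvalue :: "'a::euclidean_space set \<Rightarrow> ('a \<Rightarrow> real) \<Rightarrow> real" where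
  "dirichlet_eigenvalue \<Lambda> f =
     Sup {(\<integral>x. f x * (\<phi> x)\<^sup>2 \<partial>lborel) - (\<integral>x. (norm (grad \<phi> x))\<^sup>2 \<partial>lborel) | \<phi>.
            smooth_fun \<phi> \<and> closure {x. \<phi> x \<noteq> 0} \<subseteq> \<Lambda> \<and> (\<integral>x. (\<phi> x)\<^sup>2 \<partial>lborel) = 1}"

end

theory Submission
  imports Defs "HOL-Real_Asymp.Real_Asymp"
begin

text \<open>Let \<open>K\<close> be the Feynman--Kac kernel at time \<open>\<beta>\<close>. Integrating out the points one after the other along
  the cycles of the permutation turns \<open>N!\<close> times the symmetrised trace into a sum of products of traces of powers
  of \<open>K\<close>. If \<open>tr K\<^sup>n \<le> c r\<^sup>n\<close> for all \<open>n \<ge> 1\<close>, the sum is at most \<open>c (c + 1) \<dots> (c + N - 1) r\<^sup>N\<close>, which after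
  division by \<open>N!\<close> is \<open>r\<^sup>N\<close> up to a polynomial factor; the \<open>(N - 1)!\<close> full cycles alone contribute
  \<open>tr K\<^sup>N / N\<close>. So it remains to see that \<open>tr K\<^sup>n\<close> grows like \<open>exp (n \<beta> \<lambda>)\<close>, with \<open>\<lambda>\<close> the Dirichlet eigenvalue.

  Spectral theory is avoided by the Trotter approximation of \<open>K\<close> by powers of the explicit kernel \<open>A\<^sub>h\<close> of
  \<open>exp (-hV/2) exp (h\<Delta>) exp (-hV/2)\<close> on the box. For the upper bound, the quadratic form of \<open>A\<^sub>h\<close> is at most
  \<open>exp (h\<mu>)\<close> for every \<open>\<mu> > \<lambda>\<close> and small dyadic \<open>h\<close>: the energy
  \<open>\<integral>\<integral> p\<^sub>h(x, y) (g x - g y)\<^sup>2\<close> at most doubles when the time \<open>h\<close> is doubled, so functions of energy \<open>O(h)\<close>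
  are close to their mollifications, and a mollification, shrunk into the box, is a test function for \<open>\<lambda>\<close>.
  For the lower bound, repeated use of the Cauchy--Schwarz inequality bounds \<open>tr A\<^sub>h\<^sup>n\<close>, \<open>n\<close> a power of two, from
  below by the \<open>n\<close>-th power of the form at a test function, and the upper bound carries this over to all exponents.\<close>

section \<open>The heat kernel\<close>

text \<open>The bridge measure is chosen by its marginals at interior times, so its existence must
  be proved before anything can be computed, and the values of a path at the times 0 and
  \<open>\<beta>\<close> are not directly accessible. Statements about the hard wall therefore go
  through interior grid points and a limit.

  A trace of a power is an integral of quadratic forms taken at the columns of a nonnegative factor
  of that power. Forms on nonnegative functions are thus the right object, and all kernels can live
  in \<open>ennreal\<close>, where interchanging integrals asks for measurability only.

  The delicate point of the upper bound is uniformity in the mesh. For a fixed mollification width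
  the energy at time h controls the Dirichlet integral up to O(sqrt h), but the error of the
  mollification is governed by the energy at a fixed, much larger time. The doubling inequality
  links the two times, which is why the meshes are \<open>\<beta> / 2 ^ m\<close>; the lower bound
  needs the same meshes because squaring kernels produces powers of two.\<close>

text \<open>The generator is the full Laplacian, hence variance 2t in each coordinate. The product
  form lets Gaussian integrals over the space factor into one-dimensional ones.\<close>

lemma heat_kernel_eq_prod:
  fixes x y :: "'a::euclidean_space"
  assumes "t > 0"
  shows "heat_kernel t x y = (\<Prod>b\<in>Basis. normal_density (x \<bullet> b) (sqrt (2 * t)) (y \<bullet> b))"
proof -
  have n: "(norm (x - y))\<^sup>2 = (\<Sum>b\<in>Basis. (y \<bullet> b - x \<bullet> b)\<^sup>2)"
    unfolding power2_norm_eq_inner euclidean_inner[of "x-y" "x-y"]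
    by (intro sum.cong refl) (simp add: power2_eq_square inner_diff_left algebra_simps)
  have "(\<Prod>b\<in>Basis. normal_density (x \<bullet> b) (sqrt (2 * t)) (y \<bullet> b))
     = (\<Prod>b\<in>(Basis::'a set). (1 / sqrt (4 * pi * t)) * exp (- (y \<bullet> b - x \<bullet> b)\<^sup>2 / (4 * t)))"
    using assms by (intro prod.cong refl) (simp add: normal_density_def mult.assoc mult.commute)
  also have "\<dots> = (1 / sqrt (4 * pi * t)) ^ DIM('a) * exp (- (norm (x - y))\<^sup>2 / (4 * t))"
    by (simp only: prod.distrib prod_constant exp_sum[symmetric, OF finite_Basis] n sum_negf[symmetric] sum_divide_distrib)
  also have "(1 / sqrt (4 * pi * t)) ^ DIM('a) = (4 * pi * t) powr (- real DIM('a) / 2)"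
  proof -
    have "(1 / sqrt (4 * pi * t)) = (4 * pi * t) powr (-1/2)"
      using assms by (simp add: powr_minus_divide powr_half_sqrt[symmetric])
    then show ?thesis using assms by (simp add: powr_power)
  qed
  finally show ?thesis by (simp add: heat_kernel_def)
qed

lemma heat_kernel_nonneg [simp]: "0 \<le> heat_kernel t x y"
  by (simp add: heat_kernel_def)

lemma heat_kernel_pos: "t > 0 \<Longrightarrow> 0 < heat_kernel t x y"
  by (simp add: heat_kernel_def)

lemma heat_kernel_commute: "heat_kernel t x y = heat_kernel t y x"
  by (simp add: heat_kernel_def norm_minus_commute)

lemma heat_kernel_diff: "heat_kernel t x y = heat_kernel t 0 (y - x)"
  by (simp add: heat_kernel_def norm_minus_commute)

lemma heat_kernel_uminus: "heat_kernel t 0 (- z) = heat_kernel t 0 z"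
  by (simp add: heat_kernel_def)

lemma heat_kernel_le:
  "heat_kernel t (x::'a::euclidean_space) y \<le> (4 * pi * t) powr (- real DIM('a) / 2)" if "t \<ge> 0"
  using that by (simp add: heat_kernel_def mult_left_le)

lemma heat_kernel_measurable [measurable (raw)]:
  assumes [measurable]: "f \<in> borel_measurable M" "g \<in> borel_measurable M" 
  shows "(\<lambda>w. heat_kernel t (f w) (g w :: 'a::euclidean_space)) \<in> borel_measurable M"
  unfolding heat_kernel_def by measurable

lemma nn_integral_translate:
  fixes f :: "'a::euclidean_space \<Rightarrow> ennreal"
  assumes [measurable]: "f \<in> borel_measurable borel"
  shows "(\<integral>\<^sup>+x. f (x + a) \<partial>lborel) = (\<integral>\<^sup>+x. f x \<partial>lborel)"
proof -
  have "(\<integral>\<^sup>+x. f x \<partial>lborel) = (\<integral>\<^sup>+x. f x \<partial>(distr lborel borel ((+) a)))"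
    by (simp add: lborel_distr_plus)
  also have "\<dots> = (\<integral>\<^sup>+x. f (a + x) \<partial>lborel)"
    by (subst nn_integral_distr) auto
  finally show ?thesis by (simp add: add.commute)
qed

lemma nn_integral_reflect:
  fixes f :: "'a::euclidean_space \<Rightarrow> ennreal"
  assumes [measurable]: "f \<in> borel_measurable borel"
  shows "(\<integral>\<^sup>+x. f (a - x) \<partial>lborel) = (\<integral>\<^sup>+x. f x \<partial>lborel)"
proof -
  have "lborel = density (distr lborel borel (\<lambda>x::'a. a + (- 1) *\<^sub>R x)) (\<lambda>_. ennreal (\<bar>- 1\<bar>^DIM('a)))"
    by (rule lborel_affine) auto
  then have e: "lborel = distr lborel borel (\<lambda>x::'a. a - x)"
    by (simp add: density_1)
  have "(\<integral>\<^sup>+x. f x \<partial>lborel) = (\<integral>\<^sup>+x. f x \<partial>distr lborel borel (\<lambda>x::'a. a - x))"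
    using e by simp
  then show ?thesis by (simp add: nn_integral_distr)
qed

lemma nn_integral_scale:
  fixes f :: "'a::euclidean_space \<Rightarrow> ennreal"
  assumes [measurable]: "f \<in> borel_measurable borel" and c: "c > 0"
  shows "(\<integral>\<^sup>+x. f (a + c *\<^sub>R x) \<partial>lborel) = ennreal ((1 / c) ^ DIM('a)) * (\<integral>\<^sup>+x. f x \<partial>lborel)"
proof -
  have "lborel = density (distr lborel borel (\<lambda>x. a + c *\<^sub>R x)) (\<lambda>_. ennreal (\<bar>c\<bar>^DIM('a)))"
    by (rule lborel_affine) (use c in auto)
  then have "(\<integral>\<^sup>+x. f x \<partial>lborel) = (\<integral>\<^sup>+x. f x \<partial>density (distr lborel borel (\<lambda>x. a + c *\<^sub>R x)) (\<lambda>_. ennreal (\<bar>c\<bar>^DIM('a))))"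
    by simp
  also have "\<dots> = ennreal (c ^ DIM('a)) * (\<integral>\<^sup>+x. f (a + c *\<^sub>R x) \<partial>lborel)"
    using c by (subst nn_integral_density, simp, simp)
      (subst nn_integral_distr, simp, simp, simp add: nn_integral_cmult)
  finally have "ennreal ((1 / c) ^ DIM('a)) * (\<integral>\<^sup>+x. f x \<partial>lborel) = ennreal ((1 / c) ^ DIM('a)) * ennreal (c ^ DIM('a)) * (\<integral>\<^sup>+x. f (a + c *\<^sub>R x) \<partial>lborel)"
    by (simp add: mult.assoc)
  also have "ennreal ((1 / c) ^ DIM('a)) * ennreal (c ^ DIM('a)) = 1"
    using c by (simp add: ennreal_mult[symmetric] power_mult_distrib[symmetric] power_divide)
  finally show ?thesis by simp
qed

lemma nn_integral_heat_kernel: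
  fixes x :: "'a::euclidean_space"
  assumes t: "t > 0"
  shows "(\<integral>\<^sup>+y. ennreal (heat_kernel t x y) \<partial>lborel) = 1"
proof -
  have "(\<integral>\<^sup>+y. ennreal (heat_kernel t x y) \<partial>lborel)
      = (\<integral>\<^sup>+y. (\<Prod>b\<in>Basis. ennreal (normal_density (x \<bullet> b) (sqrt (2 * t)) (y \<bullet> b))) \<partial>lborel)"
    by (simp add: heat_kernel_eq_prod[OF t] prod_ennreal)
  also have "\<dots> = (\<Prod>b\<in>(Basis::'a set). (\<integral>\<^sup>+y. ennreal (normal_density (x \<bullet> b) (sqrt (2 * t)) y) \<partial>lborel))"
    by (rule nn_integral_lborel_prod) auto
  also have "\<dots> = 1"
    using t by (intro prod.neutral ballI) (simp add: nn_integral_eq_integral)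
  finally show ?thesis .
qed

lemma nn_integral_heat_kernel_right:
  fixes y :: "'a::euclidean_space"
  assumes t: "t > 0"
  shows "(\<integral>\<^sup>+x. ennreal (heat_kernel t x y) \<partial>lborel) = 1"
  by (subst heat_kernel_commute) (rule nn_integral_heat_kernel[OF t])

text \<open>The integrand is a product over coordinates. In one coordinate a translation turns the
  integral into the convolution of two centred normal densities, whose variances 2s and 2t
  add.\<close>

lemma heat_kernel_Chapman_Kolmogorov:
  fixes x y :: "'a::euclidean_space"
  assumes s: "s > 0" and t: "t > 0"
  shows "(\<integral>\<^sup>+w. ennreal (heat_kernel s x w) * ennreal (heat_kernel t w y) \<partial>lborel) = ennreal (heat_kernel (s + t) x y)"
proof -
  have one: "(\<integral>\<^sup>+w. ennreal (normal_density a (sqrt (2 * s)) w) * ennreal (normal_density b (sqrt (2 * t)) w) \<partial>lborel)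
     = ennreal (normal_density a (sqrt (2 * (s + t))) b)" for a b
  proof -
    have "(\<integral>\<^sup>+w. ennreal (normal_density a (sqrt (2 * s)) w) * ennreal (normal_density b (sqrt (2 * t)) w) \<partial>lborel)
      = (\<integral>\<^sup>+w. ennreal (normal_density 0 (sqrt (2 * t)) ((b - a) - (w - a)) * normal_density 0 (sqrt (2 * s)) (w - a)) \<partial>lborel)"
      by (intro nn_integral_cong) (simp add: normal_density_def ennreal_mult[symmetric] mult.commute power2_commute)
    also have "\<dots> = (\<integral>\<^sup>+w. ennreal (normal_density 0 (sqrt (2 * t)) ((b - a) - w) * normal_density 0 (sqrt (2 * s)) w) \<partial>lborel)"
      using nn_integral_translate[of "\<lambda>w. ennreal (normal_density 0 (sqrt (2 * t)) ((b - a) - w) * normal_density 0 (sqrt (2 * s)) w)" "- a"]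
      by simp
    also have "\<dots> = ennreal (normal_density 0 (sqrt ((sqrt (2 * t))\<^sup>2 + (sqrt (2 * s))\<^sup>2)) (b - a))"
      using conv_normal_density_zero_mean[of "sqrt (2 * t)" "sqrt (2 * s)"] s t
      by (auto dest!: fun_cong[of _ _ "b - a"])
    also have "\<dots> = ennreal (normal_density a (sqrt (2 * (s + t))) b)"
      using s t by (simp add: normal_density_def algebra_simps)
    finally show ?thesis .
  qed
  have "(\<integral>\<^sup>+w. ennreal (heat_kernel s x w) * ennreal (heat_kernel t w y) \<partial>lborel)
      = (\<integral>\<^sup>+w. (\<Prod>b\<in>Basis. ennreal (normal_density (x \<bullet> b) (sqrt (2 * s)) (w \<bullet> b)) *
                  ennreal (normal_density (y \<bullet> b) (sqrt (2 * t)) (w \<bullet> b))) \<partial>lborel)"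
    by (subst (2) heat_kernel_commute)
      (simp add: heat_kernel_eq_prod[OF s] heat_kernel_eq_prod[OF t] prod_ennreal prod.distrib)
  also have "\<dots> = (\<Prod>b\<in>(Basis::'a set). (\<integral>\<^sup>+w. ennreal (normal_density (x \<bullet> b) (sqrt (2 * s)) w) *
                  ennreal (normal_density (y \<bullet> b) (sqrt (2 * t)) w) \<partial>lborel))"
    by (rule nn_integral_lborel_prod) auto
  also have "\<dots> = (\<Prod>b\<in>(Basis::'a set). ennreal (normal_density (x \<bullet> b) (sqrt (2 * (s + t))) (y \<bullet> b)))"
    by (simp add: one)
  also have "\<dots> = ennreal (heat_kernel (s + t) x y)"
    using s t by (simp add: heat_kernel_eq_prod prod_ennreal)
  finally show ?thesis .
qed

text \<open>Half of the Gaussian exponent absorbs the fourth power by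
  \<open>v\<^sup>2 / 2 \<le> exp v\<close>; the other half is the heat kernel at twice the time, up
  to a dimensional factor. The order t^2 is what later gives continuous paths and makes jumps over a
  fixed distance negligible.\<close>

lemma norm4_heat_kernel_le:
  fixes z :: "'a::euclidean_space"
  assumes t: "t > 0"
  shows "norm z ^ 4 * heat_kernel t 0 z \<le> 128 * t\<^sup>2 * 2 powr (real DIM('a) / 2) * heat_kernel (2 * t) 0 z"
proof -
  define v where "v = (norm z)\<^sup>2 / (8 * t)"
  have v0: "v \<ge> 0" using t by (simp add: v_def)
  have "v\<^sup>2 / 2 \<le> exp v"
    using exp_lower_Taylor_quadratic[OF v0] v0 by simp
  then have 1: "v\<^sup>2 \<le> 2 * exp v" by simp
  have n4: "norm z ^ 4 = 64 * t\<^sup>2 * v\<^sup>2" using t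
    by (simp add: v_def power2_eq_square power4_eq_xxxx field_simps)
  have 2: "norm z ^ 4 \<le> 128 * t\<^sup>2 * exp v"
    unfolding n4 using mult_left_mono[OF 1, of "64 * t\<^sup>2"] by (simp add: mult.assoc)
  have e: "exp v * exp (- ((norm z)\<^sup>2 / (4 * t))) = exp (- ((norm z)\<^sup>2 / (8 * t)))"
    using t unfolding exp_add[symmetric] v_def by (simp add: field_simps)
  have p: "(4 * pi * t) powr (- real DIM('a) / 2) = 2 powr (real DIM('a) / 2) * (4 * pi * (2 * t)) powr (- real DIM('a) / 2)"
  proof -
    have "(4 * pi * (2 * t)) powr (- real DIM('a) / 2) = 2 powr (- real DIM('a) / 2) * (4 * pi * t) powr (- real DIM('a) / 2)"
      using t by (simp add: powr_mult[symmetric] mult_ac)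
    then show ?thesis by (simp add: powr_add[symmetric] mult.assoc[symmetric])
  qed
  have "norm z ^ 4 * heat_kernel t 0 z \<le> (128 * t\<^sup>2 * exp v) * heat_kernel t 0 z"
    by (intro mult_right_mono 2) simp
  also have "\<dots> = 128 * t\<^sup>2 * (4 * pi * t) powr (- real DIM('a) / 2) * (exp v * exp (- ((norm z)\<^sup>2 / (4 * t))))"
    by (simp add: heat_kernel_def)
  also have "\<dots> = 128 * t\<^sup>2 * 2 powr (real DIM('a) / 2) * heat_kernel (2 * t) 0 z"
    unfolding e p by (simp add: heat_kernel_def)
  finally show ?thesis .
qed

text \<open>The constant comes from \<open>r\<^sup>4 \<le> 128 t\<^sup>2 exp (r\<^sup>2 / (8 t))\<close>.\<close>

definition gauss4 :: "'a::euclidean_space itself \<Rightarrow> real" where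
  "gauss4 _ = 128 * 2 powr (real DIM('a) / 2)"

lemma gauss4_pos: "gauss4 TYPE('a::euclidean_space) > 0" by (simp add: gauss4_def)

lemma nn_integral_norm4_heat_kernel_le:
  assumes t: "t > 0"
  shows "(\<integral>\<^sup>+z. ennreal (norm (z::'a::euclidean_space) ^ 4 * heat_kernel t 0 z) \<partial>lborel) \<le> ennreal (gauss4 TYPE('a) * t\<^sup>2)"
proof -
  have "(\<integral>\<^sup>+z. ennreal (norm (z::'a) ^ 4 * heat_kernel t 0 z) \<partial>lborel)
     \<le> (\<integral>\<^sup>+z. ennreal (gauss4 TYPE('a) * t\<^sup>2) * ennreal (heat_kernel (2 * t) 0 (z::'a)) \<partial>lborel)"
    using norm4_heat_kernel_le[OF t]
    by (intro nn_integral_mono) (simp add: gauss4_def ennreal_mult[symmetric] ennreal_leI mult_ac)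
  also have "\<dots> = ennreal (gauss4 TYPE('a) * t\<^sup>2)"
    using t by (simp add: nn_integral_cmult nn_integral_heat_kernel)
  finally show ?thesis .
qed

section \<open>Existence of the Brownian bridge\<close>

fun bridge_density :: "real \<Rightarrow> 'a::euclidean_space \<Rightarrow> real list \<Rightarrow> real \<Rightarrow> 'a \<Rightarrow> (real \<Rightarrow> 'a) \<Rightarrow> ennreal" where
  "bridge_density s z [] T y \<omega> = ennreal (heat_kernel (T - s) z y)"
| "bridge_density s z (t # r) T y \<omega> = ennreal (heat_kernel (t - s) z (\<omega> t)) * bridge_density t (\<omega> t) r T y \<omega>"

text \<open>The recursion of \<open>bridge_fdd\<close> with nonnegative functions in place of
  indicators. The function 1 then stands for an unconstrained time, and Boltzmann weights can be
  inserted directly.\<close>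

fun bridge_integral :: "real \<Rightarrow> 'a::euclidean_space \<Rightarrow> (real \<times> ('a \<Rightarrow> ennreal)) list \<Rightarrow> real \<Rightarrow> 'a \<Rightarrow> ennreal" where
  "bridge_integral s z [] T y = ennreal (heat_kernel (T - s) z y)"
| "bridge_integral s z ((t, f) # r) T y =
     (\<integral>\<^sup>+ w. f w * ennreal (heat_kernel (t - s) z w) * bridge_integral t w r T y \<partial>lborel)"

lemma bridge_fdd_eq_integral:
  "bridge_fdd s z r T y = bridge_integral s z (map (\<lambda>(t, A). (t, indicator A)) r) T y"
  by (induction s z r T y rule: bridge_fdd.induct) auto

lemma measurable_bridge_integral:
  fixes g h :: "'p \<Rightarrow> 'a::euclidean_space"
  assumes r: "\<forall>(t, f)\<in>set r. f \<in> borel_measurable borel" and "g \<in> borel_measurable M" "h \<in> borel_measurable M"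
  shows "(\<lambda>p. bridge_integral s (g p) r T (h p)) \<in> borel_measurable M"
proof -
  have "(\<lambda>p::'a \<times> 'a. bridge_integral s (fst p) r T (snd p)) \<in> borel_measurable (borel \<Otimes>\<^sub>M borel)"
    using r
  proof (induction r arbitrary: s)
    case (Cons a r)
    obtain t f where a: "a = (t, f)" by (cases a)
    have [measurable]: "f \<in> borel_measurable borel"
      using Cons.prems a by auto
    have IH: "(\<lambda>p::'a \<times> 'a. bridge_integral t (fst p) r T (snd p)) \<in> borel_measurable (borel \<Otimes>\<^sub>M borel)"
      by (rule Cons.IH) (use Cons.prems a in auto)
    have "(\<lambda>q::('a \<times> 'a) \<times> 'a. bridge_integral t (fst (snd q, snd (fst q))) r T (snd (snd q, snd (fst q)))) \<in> borel_measurable ((borel \<Otimes>\<^sub>M borel) \<Otimes>\<^sub>M lborel)"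
      by (rule measurable_compose[OF _ IH]) measurable
    then have [measurable]: "(\<lambda>q::('a \<times> 'a) \<times> 'a. bridge_integral t (snd q) r T (snd (fst q))) \<in> borel_measurable ((borel \<Otimes>\<^sub>M borel) \<Otimes>\<^sub>M lborel)"
      by simp
    show ?case unfolding a by simp measurable
  qed simp
  then have "(\<lambda>p. bridge_integral s (fst (g p, h p)) r T (snd (g p, h p))) \<in> borel_measurable M"
    by (rule measurable_compose[rotated]) (use assms in measurable)
  then show ?thesis by simp
qed

lemma bridge_density_cong:
  "(\<And>t. t \<in> set r \<Longrightarrow> \<omega> t = \<omega>' t) \<Longrightarrow> bridge_density s z r T y \<omega> = bridge_density s z r T y \<omega>'"
  by (induction r arbitrary: s z) auto

lemma measurable_bridge_density:
  assumes "\<And>t. t \<in> set r \<Longrightarrow> (\<lambda>\<omega>. \<omega> t) \<in> borel_measurable M" "g \<in> borel_measurable M"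
  shows "(\<lambda>\<omega>. bridge_density s (g \<omega>) r T y \<omega>) \<in> borel_measurable M"
  using assms
proof (induction r arbitrary: s g)
  case Nil
  note Nil[measurable]
  show ?case by simp
next
  case (Cons t r)
  have [measurable]: "(\<lambda>\<omega>. \<omega> t) \<in> borel_measurable M" "g \<in> borel_measurable M"
    using Cons.prems by auto
  have [measurable]: "(\<lambda>\<omega>. bridge_density t (\<omega> t) r T y \<omega>) \<in> borel_measurable M"
    by (rule Cons.IH) (use Cons.prems in auto)
  show ?case by simp
qed

lemma sorted_list_of_set_insert_min:
  assumes "finite J" "\<forall>j\<in>J. m < (j::'a::linorder)"
  shows "sorted_list_of_set (insert m J) = m # sorted_list_of_set J"
  using assms by (subst sorted_list_of_set.fold_insort_key.insert) (auto intro!: insort_is_Cons less_imp_le)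

interpretation lborel_product: product_sigma_finite "\<lambda>_. lborel :: 'a::euclidean_space measure"
  by (intro product_sigma_finite.intro) (rule sigma_finite_lborel)

text \<open>Induction removes the earliest time: it is the head of the sorted list, so integrating
  out its coordinate reproduces one step of the recursion in \<open>bridge_integral\<close>.\<close>

lemma nn_integral_bridge_density:
  fixes F :: "real \<Rightarrow> 'a::euclidean_space \<Rightarrow> ennreal"
  assumes "finite J" "\<And>j. j \<in> J \<Longrightarrow> F j \<in> borel_measurable borel"
  shows "(\<integral>\<^sup>+\<omega>. bridge_density s z (sorted_list_of_set J) T y \<omega> * (\<Prod>j\<in>J. F j (\<omega> j)) \<partial>PiM J (\<lambda>_. lborel))
     = bridge_integral s z (map (\<lambda>t. (t, F t)) (sorted_list_of_set J)) T y"
  using assms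
proof (induction J arbitrary: s z rule: finite_linorder_min_induct)
  case empty
  then show ?case by (simp add: space_PiM)
next
  case (insert m J)
  have [measurable]: "F j \<in> borel_measurable borel" if "j \<in> insert m J" for j using insert.prems that by auto
  have mJ: "m \<notin> J" using insert by auto
  let ?D = "\<lambda>s z J. bridge_density s z (sorted_list_of_set J) T y"
  have [measurable]: "(\<lambda>\<omega>. ?D s (g \<omega>) J' \<omega>) \<in> borel_measurable (PiM J'' (\<lambda>_. lborel))"
    if "finite J'" "J' \<subseteq> J''" "g \<in> borel_measurable (PiM J'' (\<lambda>_. lborel))" for s g J' and J'' :: "real set"
    by (rule measurable_bridge_density) (use that in auto)
  have "(\<integral>\<^sup>+\<omega>. ?D s z (insert m J) \<omega> * (\<Prod>j\<in>insert m J. F j (\<omega> j)) \<partial>PiM (insert m J) (\<lambda>_. lborel))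
    = (\<integral>\<^sup>+ w. (\<integral>\<^sup>+ \<omega>. ?D s z (insert m J) (fun_upd \<omega> m w) * (\<Prod>j\<in>insert m J. F j ((fun_upd \<omega> m w) j)) \<partial>PiM J (\<lambda>_. lborel)) \<partial>lborel)"
    using insert(1) mJ by (intro lborel_product.product_nn_integral_insert_rev borel_measurable_times_ennreal borel_measurable_prod_ennreal measurable_bridge_density) (auto simp: set_insort_key)
  also have "\<dots> = (\<integral>\<^sup>+ w. F m w * ennreal (heat_kernel (m - s) z w) * (\<integral>\<^sup>+ \<omega>. ?D m w J \<omega> * (\<Prod>j\<in>J. F j (\<omega> j)) \<partial>PiM J (\<lambda>_. lborel)) \<partial>lborel)"
  proof (intro nn_integral_cong)
    fix w :: 'a
    have "(\<integral>\<^sup>+ \<omega>. ?D s z (insert m J) (fun_upd \<omega> m w) * (\<Prod>j\<in>insert m J. F j ((fun_upd \<omega> m w) j)) \<partial>PiM J (\<lambda>_. lborel))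
      = (\<integral>\<^sup>+ \<omega>. (F m w * ennreal (heat_kernel (m - s) z w)) * (?D m w J \<omega> * (\<Prod>j\<in>J. F j (\<omega> j))) \<partial>PiM J (\<lambda>_. lborel))"
    proof (intro nn_integral_cong)
      fix \<omega>
      have 1: "bridge_density m w (sorted_list_of_set J) T y (fun_upd \<omega> m w) = ?D m w J \<omega>"
        by (rule bridge_density_cong) (use insert(1) mJ in auto)
      have 2: "(\<Prod>j\<in>J. F j ((fun_upd \<omega> m w) j)) = (\<Prod>j\<in>J. F j (\<omega> j))"
        by (rule prod.cong) (use mJ in auto)
      show "?D s z (insert m J) (fun_upd \<omega> m w) * (\<Prod>j\<in>insert m J. F j ((fun_upd \<omega> m w) j)) = (F m w * ennreal (heat_kernel (m - s) z w)) * (?D m w J \<omega> * (\<Prod>j\<in>J. F j (\<omega> j)))"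
        by (simp only: sorted_list_of_set_insert_min[OF insert(1,2)] bridge_density.simps fun_upd_same 1 prod.insert[OF insert(1) mJ] 2 mult_ac)
    qed
    also have "\<dots> = (F m w * ennreal (heat_kernel (m - s) z w)) * (\<integral>\<^sup>+ \<omega>. ?D m w J \<omega> * (\<Prod>j\<in>J. F j (\<omega> j)) \<partial>PiM J (\<lambda>_. lborel))"
      using insert(1) by (intro nn_integral_cmult borel_measurable_times_ennreal borel_measurable_prod_ennreal) auto
    finally show "(\<integral>\<^sup>+ \<omega>. ?D s z (insert m J) (fun_upd \<omega> m w) * (\<Prod>j\<in>insert m J. F j ((fun_upd \<omega> m w) j)) \<partial>PiM J (\<lambda>_. lborel)) = \<dots>" .
  qed
  also have "\<dots> = bridge_integral s z (map (\<lambda>t. (t, F t)) (sorted_list_of_set (insert m J))) T y"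
    using insert.prems by (simp add: sorted_list_of_set_insert_min[OF insert(1,2)] insert.IH)
  finally show ?case .
qed

text \<open>Kolmogorov consistency for the earliest time. Integrating it out merges the two adjacent
  heat kernels by Chapman-Kolmogorov; the right neighbour is the terminal time when no other time is
  left.\<close>

lemma bridge_integral_Cons_one:
  assumes "\<forall>(t, f)\<in>set r. f \<in> borel_measurable borel" and "s < t" "t < T" and "\<forall>(u, f)\<in>set r. t < u"
  shows "bridge_integral s z ((t, \<lambda>_. 1) # r) T y = bridge_integral s z r T y"
proof (cases r)
  case Nil
  then show ?thesis using assms heat_kernel_Chapman_Kolmogorov[of "t - s" "T - t" z y] by simp
next
  case (Cons a r')
  obtain u f where a: "a = (u, f)" by (cases a)
  have [measurable]: "f \<in> borel_measurable borel" using assms a Cons by auto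
  have [measurable]: "(\<lambda>w. bridge_integral u w r' T y) \<in> borel_measurable lborel"
    by (rule measurable_bridge_integral) (use assms Cons in auto)
  have tu: "t < u" using assms a Cons by auto
  have "bridge_integral s z ((t, \<lambda>_. 1) # r) T y
     = (\<integral>\<^sup>+ w. (\<integral>\<^sup>+ v. ennreal (heat_kernel (t - s) z w) * (f v * ennreal (heat_kernel (u - t) w v) * bridge_integral u v r' T y) \<partial>lborel) \<partial>lborel)"
    by (simp add: a Cons nn_integral_cmult)
  also have "\<dots> = (\<integral>\<^sup>+ v. (\<integral>\<^sup>+ w. ennreal (heat_kernel (t - s) z w) * (f v * ennreal (heat_kernel (u - t) w v) * bridge_integral u v r' T y) \<partial>lborel) \<partial>lborel)"
    by (rule lborel_pair.Fubini') measurable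
  also have "\<dots> = (\<integral>\<^sup>+ v. f v * bridge_integral u v r' T y * (\<integral>\<^sup>+ w. ennreal (heat_kernel (t - s) z w) * ennreal (heat_kernel (u - t) w v) \<partial>lborel) \<partial>lborel)"
    by (subst nn_integral_cmult[symmetric]) (auto simp: mult_ac)
  also have "\<dots> = bridge_integral s z r T y"
    using assms tu by (simp add: heat_kernel_Chapman_Kolmogorov a Cons mult_ac)
  finally show ?thesis .
qed

text \<open>Either the new time precedes all the others, which is the previous case, or the earliest
  time stays at the head and the induction hypothesis acts under its integral.\<close>

lemma bridge_integral_insert_one:
  fixes F :: "real \<Rightarrow> 'a::euclidean_space \<Rightarrow> ennreal"
  assumes "finite J" "\<And>j. j \<in> J \<Longrightarrow> F j \<in> borel_measurable borel"
    and "J \<subseteq> {s<..<T}" "t \<in> {s<..<T} - J" "F t = (\<lambda>_. 1)"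
  shows "bridge_integral s z (map (\<lambda>t. (t, F t)) (sorted_list_of_set (insert t J))) T y
     = bridge_integral s z (map (\<lambda>t. (t, F t)) (sorted_list_of_set J)) T y"
  using assms
proof (induction J arbitrary: s z rule: finite_linorder_min_induct)
  case empty
  then show ?case using bridge_integral_Cons_one[of "[]" s t T z y] by simp
next
  case (insert m J)
  show ?case
  proof (cases "t < m")
    case True
    then have "\<forall>j\<in>insert m J. t < j" using insert by auto
    then show ?thesis
      using insert.prems insert(1) bridge_integral_Cons_one[of "map (\<lambda>t. (t, F t)) (sorted_list_of_set (insert m J))" s t T z y]
      by (subst sorted_list_of_set_insert_min) (auto simp del: sorted_list_of_set_insert_remove bridge_integral.simps)
  next
    case False
    then have mt: "m < t" using insert.prems by auto
    have "sorted_list_of_set (insert t (insert m J)) = sorted_list_of_set (insert m (insert t J))"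
      by (simp add: insert_commute)
    also have "\<dots> = m # sorted_list_of_set (insert t J)"
      by (rule sorted_list_of_set_insert_min) (use insert mt in auto)
    finally have e: "sorted_list_of_set (insert t (insert m J)) = m # sorted_list_of_set (insert t J)" .
    have IH: "bridge_integral m w (map (\<lambda>t. (t, F t)) (sorted_list_of_set (insert t J))) T y
     = bridge_integral m w (map (\<lambda>t. (t, F t)) (sorted_list_of_set J)) T y" for w
      by (rule insert.IH) (use insert mt in auto)
    show ?thesis
      unfolding e sorted_list_of_set_insert_min[OF insert(1,2)] list.map bridge_integral.simps IH ..
  qed
qed

lemma bridge_integral_superset:
  fixes F :: "real \<Rightarrow> 'a::euclidean_space \<Rightarrow> ennreal"
  assumes "finite H" "J \<subseteq> H" "\<And>j. j \<in> H \<Longrightarrow> F j \<in> borel_measurable borel"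
    and "H \<subseteq> {s<..<T}" "\<And>t. t \<in> H - J \<Longrightarrow> F t = (\<lambda>_. 1)"
  shows "bridge_integral s z (map (\<lambda>t. (t, F t)) (sorted_list_of_set H)) T y
     = bridge_integral s z (map (\<lambda>t. (t, F t)) (sorted_list_of_set J)) T y"
proof -
  have fJ: "finite J" using assms finite_subset by auto
  have "bridge_integral s z (map (\<lambda>t. (t, F t)) (sorted_list_of_set (J \<union> K))) T y
     = bridge_integral s z (map (\<lambda>t. (t, F t)) (sorted_list_of_set J)) T y" if "finite K" "K \<subseteq> H - J" for K
    using that
  proof (induction K)
    case (insert t K)
    have "bridge_integral s z (map (\<lambda>t. (t, F t)) (sorted_list_of_set (insert t (J \<union> K)))) T y
       = bridge_integral s z (map (\<lambda>t. (t, F t)) (sorted_list_of_set (J \<union> K))) T y"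
      by (rule bridge_integral_insert_one) (use insert assms fJ in auto)
    then show ?case using insert by simp
  qed simp
  from this[of "H - J"] show ?thesis using assms by (simp add: Un_absorb1)
qed

section \<open>Kolmogorov extension of the bridge marginals\<close>

locale bridge_parameters =
  fixes \<beta> :: real and x y :: "'a::euclidean_space"
  assumes \<beta>_pos: "\<beta> > 0"
begin

text \<open>Divided by the total mass \<open>heat_kernel \<beta> x y\<close>, because the extension
  theorem is about probability measures; the mass is restored when the bridge is assembled.\<close>

definition fdd :: "real set \<Rightarrow> (real \<Rightarrow> 'a) measure" where
  "fdd J = density (PiM J (\<lambda>_. lborel))
     (\<lambda>\<omega>. ennreal (1 / heat_kernel \<beta> x y) * bridge_density 0 x (sorted_list_of_set J) \<beta> y \<omega>)"

lemma sets_fdd [measurable_cong, simp]: "sets (fdd J) = sets (PiM J (\<lambda>_. borel))"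
  by (simp add: fdd_def cong: sets_PiM_cong)

lemma space_fdd [simp]: "space (fdd J) = space (PiM J (\<lambda>_. borel))"
  by (simp add: fdd_def space_PiM)

lemma measurable_component_borel [measurable (raw)]:
  "t \<in> J \<Longrightarrow> (\<lambda>\<omega>. \<omega> t) \<in> borel_measurable (PiM J (\<lambda>_. lborel))"
  using measurable_component_singleton[of t J "\<lambda>_. lborel"] by simp

lemma measurable_fdd_density:
  "finite J \<Longrightarrow> bridge_density 0 x (sorted_list_of_set J) \<beta> y \<in> borel_measurable (PiM J (\<lambda>_. lborel))"
  by (rule measurable_bridge_density) auto

lemma nn_integral_fdd_prod:
  fixes F :: "real \<Rightarrow> 'a \<Rightarrow> ennreal"
  assumes "finite J" "\<And>j. j \<in> J \<Longrightarrow> F j \<in> borel_measurable borel"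
  shows "(\<integral>\<^sup>+\<omega>. (\<Prod>j\<in>J. F j (\<omega> j)) \<partial>fdd J)
     = ennreal (1 / heat_kernel \<beta> x y) * bridge_integral 0 x (map (\<lambda>t. (t, F t)) (sorted_list_of_set J)) \<beta> y"
proof -
  note measurable_fdd_density[OF assms(1), measurable]
  have [measurable]: "(\<lambda>\<omega>. \<Prod>j\<in>J. F j (\<omega> j)) \<in> borel_measurable (PiM J (\<lambda>_. lborel))"
    using assms by (intro borel_measurable_prod_ennreal) (auto intro!: measurable_compose[OF measurable_component_borel])
  show ?thesis
    unfolding fdd_def
    by (subst nn_integral_density, simp, simp)
      (simp add: mult.assoc nn_integral_cmult nn_integral_bridge_density[OF assms])
qed

lemma emeasure_fdd:
  assumes "finite J" "\<And>j. j \<in> J \<Longrightarrow> A j \<in> sets borel"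
  shows "emeasure (fdd J) (Pi\<^sub>E J A)
     = ennreal (1 / heat_kernel \<beta> x y) * bridge_integral 0 x (map (\<lambda>t. (t, indicator (A t))) (sorted_list_of_set J)) \<beta> y"
proof -
  have "Pi\<^sub>E J A \<in> sets (fdd J)" using assms by auto
  then have "emeasure (fdd J) (Pi\<^sub>E J A) = (\<integral>\<^sup>+\<omega>. indicator (Pi\<^sub>E J A) \<omega> \<partial>fdd J)" by simp
  also have "\<dots> = (\<integral>\<^sup>+\<omega>. (\<Prod>j\<in>J. indicator (A j) (\<omega> j)) \<partial>fdd J)"
  proof (rule nn_integral_cong)
    fix \<omega> assume "\<omega> \<in> space (fdd J)"
    then have "\<omega> \<in> extensional J" by (auto simp: space_PiM PiE_def)
    then have "\<omega> \<in> Pi\<^sub>E J A \<longleftrightarrow> (\<forall>j\<in>J. \<omega> j \<in> A j)" by (auto simp: PiE_def)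
    then show "indicator (Pi\<^sub>E J A) \<omega> = (\<Prod>j\<in>J. indicator (A j) (\<omega> j) :: ennreal)"
      using \<open>finite J\<close> by (auto simp: indicator_def prod_zero_iff)
  qed
  also have "\<dots> = ennreal (1 / heat_kernel \<beta> x y) * bridge_integral 0 x (map (\<lambda>t. (t, indicator (A t))) (sorted_list_of_set J)) \<beta> y"
    using assms by (intro nn_integral_fdd_prod) auto
  finally show ?thesis .
qed

text \<open>Both measures are compared on rectangles. A rectangle over \<open>J\<close> is pulled
  back to a rectangle over \<open>H\<close> whose additional sides are the whole space, and these
  times drop out by consistency.\<close>

lemma fdd_projective:
  assumes "J \<subseteq> H" "finite H" "H \<subseteq> {0<..<\<beta>}"
  shows "fdd J = distr (fdd H) (PiM J (\<lambda>_. borel)) (\<lambda>f. restrict f J)"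
proof -
  have fJ: "finite J" using assms finite_subset by auto
  have [measurable]: "(\<lambda>f. restrict f J) \<in> fdd H \<rightarrow>\<^sub>M PiM J (\<lambda>_. borel)"
    unfolding measurable_cong_sets[OF sets_fdd refl] by (rule measurable_restrict_subset) fact
  show ?thesis
  proof (rule measure_eqI_PiM_finite[of J _ "\<lambda>_. borel" _ "\<lambda>_. space (PiM J (\<lambda>_. borel))"])
    fix A :: "real \<Rightarrow> 'a set" assume A: "\<And>j. j \<in> J \<Longrightarrow> A j \<in> sets borel"
    define B where "B j = (if j \<in> J then A j else UNIV)" for j
    have B: "B j \<in> sets borel" for j using A by (auto simp: B_def)
    have "emeasure (distr (fdd H) (PiM J (\<lambda>_. borel)) (\<lambda>f. restrict f J)) (Pi\<^sub>E J A)
        = emeasure (fdd H) (Pi\<^sub>E H B)"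
    proof (subst emeasure_distr)
      show "Pi\<^sub>E J A \<in> sets (PiM J (\<lambda>_. borel))" using A fJ by auto
      have "(\<lambda>f. restrict f J) -` Pi\<^sub>E J A \<inter> space (fdd H) = Pi\<^sub>E H B"
      proof (intro set_eqI)
        fix f
        have "(\<forall>j\<in>H. f j \<in> B j) \<longleftrightarrow> (\<forall>j\<in>J. f j \<in> A j)"
          using assms(1) by (auto simp: B_def)
        then show "f \<in> (\<lambda>f. restrict f J) -` Pi\<^sub>E J A \<inter> space (fdd H) \<longleftrightarrow> f \<in> Pi\<^sub>E H B"
          by (auto simp: space_PiM PiE_iff)
      qed
      then show "emeasure (fdd H) ((\<lambda>f. restrict f J) -` Pi\<^sub>E J A \<inter> space (fdd H)) = emeasure (fdd H) (Pi\<^sub>E H B)"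
        by simp
    qed simp
    also have "\<dots> = ennreal (1 / heat_kernel \<beta> x y) * bridge_integral 0 x (map (\<lambda>t. (t, indicator (B t))) (sorted_list_of_set H)) \<beta> y"
      by (rule emeasure_fdd) (use assms B in auto)
    also have "\<dots> = ennreal (1 / heat_kernel \<beta> x y) * bridge_integral 0 x (map (\<lambda>t. (t, indicator (B t))) (sorted_list_of_set J)) \<beta> y"
      by (subst bridge_integral_superset[of H J]) (use assms B in \<open>auto simp: B_def fun_eq_iff\<close>)
    also have "\<dots> = emeasure (fdd J) (Pi\<^sub>E J B)"
      by (rule emeasure_fdd[symmetric]) (use fJ B in auto)
    also have "Pi\<^sub>E J B = Pi\<^sub>E J A" by (intro PiE_cong) (simp add: B_def)
    finally show "emeasure (fdd J) (Pi\<^sub>E J A) = emeasure (distr (fdd H) (PiM J (\<lambda>_. borel)) (\<lambda>f. restrict f J)) (Pi\<^sub>E J A)" ..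
  next
    have "space (PiM J (\<lambda>_. borel)) = Pi\<^sub>E J (\<lambda>_. UNIV :: 'a set)" by (simp add: space_PiM)
    then have "emeasure (fdd J) (space (PiM J (\<lambda>_. borel))) = ennreal (1 / heat_kernel \<beta> x y) * bridge_integral 0 x (map (\<lambda>t. (t, indicator UNIV)) (sorted_list_of_set J)) \<beta> y"
      using fJ by (simp only:) (rule emeasure_fdd, auto)
    also have "\<dots> = ennreal (1 / heat_kernel \<beta> x y) * bridge_integral 0 x (map (\<lambda>t. (t, indicator UNIV)) (sorted_list_of_set {})) \<beta> y"
      using fJ assms by (subst bridge_integral_superset[of J "{}"]) (auto simp: fun_eq_iff)
    finally show "emeasure (fdd J) (space (PiM J (\<lambda>_. borel))) \<noteq> \<infinity>"
      by (simp add: ennreal_mult_eq_top_iff)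
  qed (use fJ in \<open>auto intro!: prod_algebraI_finite simp: space_PiM\<close>)
qed

lemma prob_space_fdd:
  assumes "finite J" "J \<subseteq> {0<..<\<beta>}"
  shows "prob_space (fdd J)"
proof
  have "space (fdd J) = Pi\<^sub>E J (\<lambda>_. UNIV :: 'a set)" by (simp add: space_PiM)
  then have "emeasure (fdd J) (space (fdd J)) = ennreal (1 / heat_kernel \<beta> x y) * bridge_integral 0 x (map (\<lambda>t. (t, indicator UNIV)) (sorted_list_of_set J)) \<beta> y"
    using assms by (simp only:) (rule emeasure_fdd, auto)
  also have "\<dots> = ennreal (1 / heat_kernel \<beta> x y) * bridge_integral 0 x (map (\<lambda>t. (t, indicator UNIV)) (sorted_list_of_set {})) \<beta> y"
    using assms by (subst bridge_integral_superset[of J "{}"]) (auto simp: fun_eq_iff)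
  also have "\<dots> = 1"
    using heat_kernel_pos[OF \<beta>_pos, of x y] by (simp add: ennreal_mult[symmetric])
  finally show "emeasure (fdd J) (space (fdd J)) = 1" .
qed

sublocale fdd: polish_projective "{0<..<\<beta>}" fdd
  by (intro polish_projective.intro projective_family.intro fdd_projective prob_space_fdd)

lemma distr_lim:
  assumes "finite J" "J \<subseteq> {0<..<\<beta>}"
  shows "distr fdd.lim (PiM J (\<lambda>_. borel)) (\<lambda>f. restrict f J) = fdd J"
proof (rule measure_eqI)
  fix X assume X: "X \<in> sets (distr fdd.lim (PiM J (\<lambda>_. borel)) (\<lambda>f. restrict f J))"
  have [measurable]: "(\<lambda>f. restrict f J) \<in> fdd.lim \<rightarrow>\<^sub>M PiM J (\<lambda>_. borel :: 'a measure)"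
    unfolding measurable_cong_sets[OF fdd.sets_lim refl] by (rule measurable_restrict_subset) fact
  have "emeasure (distr fdd.lim (PiM J (\<lambda>_. borel)) (\<lambda>f. restrict f J)) X
      = emeasure fdd.lim ((\<lambda>f. restrict f J) -` X \<inter> space fdd.lim)"
    using X by (subst emeasure_distr) simp_all
  also have "(\<lambda>f. restrict f J) -` X \<inter> space fdd.lim = prod_emb {0<..<\<beta>} (\<lambda>_. borel) J X"
    by (simp add: prod_emb_def space_PiM)
  also have "emeasure fdd.lim \<dots> = emeasure (fdd J) X"
    using X assms by (intro fdd.emeasure_lim_emb) auto
  finally show "emeasure (distr fdd.lim (PiM J (\<lambda>_. borel)) (\<lambda>f. restrict f J)) X = emeasure (fdd J) X" .
qed simp

text \<open>Markov's inequality for the fourth power. As \<open>t - s \<le> \<beta> / 2\<close>, one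
  of the two outer time intervals has length at least \<open>\<beta> / 4\<close>; its heat kernel is
  bounded by a constant, the other outer kernel integrates to 1, and the middle one contributes its
  fourth moment.\<close>

lemma increment_bound:
  assumes s: "0 < s" "s < t" "t < \<beta>" and ts: "t - s \<le> \<beta> / 2" and a: "a > 0"
  shows "emeasure fdd.lim {\<omega> \<in> space fdd.lim. a \<le> norm (\<omega> t - \<omega> s)}
     \<le> ennreal ((1 / heat_kernel \<beta> x y) * (pi * \<beta>) powr (- real DIM('a) / 2) * gauss4 TYPE('a) * (t - s)\<^sup>2 / a ^ 4)"
proof -
  let ?c = "1 / heat_kernel \<beta> x y"
  \<comment> \<open>The sup of the heat kernel at time \<open>\<beta> / 4\<close>, which bounds it
    at all later times.\<close>
  define M where "M = (pi * \<beta>) powr (- real DIM('a) / 2)"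
  have M0: "M \<ge> 0" by (simp add: M_def)
  have J: "finite {s, t}" "{s, t} \<subseteq> {0<..<\<beta>}" using s by auto
  have srt: "sorted_list_of_set {s, t} = [s, t]" using s by simp
  have [measurable]: "(\<lambda>\<omega>. \<omega> s) \<in> borel_measurable (PiM {s, t} (\<lambda>_. borel :: 'a measure))"
     "(\<lambda>\<omega>. \<omega> t) \<in> borel_measurable (PiM {s, t} (\<lambda>_. borel :: 'a measure))"
     "(\<lambda>\<omega>. \<omega> s) \<in> borel_measurable (PiM {s, t} (\<lambda>_. lborel :: 'a measure))"
     "(\<lambda>\<omega>. \<omega> t) \<in> borel_measurable (PiM {s, t} (\<lambda>_. lborel :: 'a measure))"
    by (auto intro: measurable_component_borel)
  have [measurable]: "(\<lambda>f. restrict f {s,t}) \<in> fdd.lim \<rightarrow>\<^sub>M PiM {s,t} (\<lambda>_. borel :: 'a measure)"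
    unfolding measurable_cong_sets[OF fdd.sets_lim refl] by (rule measurable_restrict_subset) fact
  have m1: "(\<lambda>\<omega>. ennreal ?c * bridge_density 0 x [s, t] \<beta> y \<omega>) \<in> borel_measurable (PiM {s, t} (\<lambda>_. lborel))"
    using measurable_fdd_density[OF J(1)] unfolding srt by (rule borel_measurable_times_ennreal[OF borel_measurable_const])
  have m2: "(\<lambda>\<omega>. ennreal (norm (\<omega> t - \<omega> s :: 'a) ^ 4 / a ^ 4)) \<in> borel_measurable (PiM {s, t} (\<lambda>_. lborel))"
    by (intro measurable_compose[OF _ measurable_ennreal] borel_measurable_divide borel_measurable_power borel_measurable_norm borel_measurable_diff measurable_component_borel borel_measurable_const) auto
  have m3: "(\<lambda>(u, v). ennreal ?c * (ennreal (heat_kernel s x u) * ennreal (heat_kernel (t - s) u v) * ennreal (heat_kernel (\<beta> - t) v y)) * ennreal (norm (v - u) ^ 4 / a ^ 4))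
    \<in> borel_measurable (lborel \<Otimes>\<^sub>M lborel)"
    by measurable
  have large: "heat_kernel r u v \<le> M" if "r \<ge> \<beta> / 4" for r and u v :: 'a
  proof -
    have "heat_kernel r u v \<le> (4 * pi * r) powr (- real DIM('a) / 2)"
      using that \<beta>_pos by (intro heat_kernel_le) auto
    also have "\<dots> \<le> M" unfolding M_def
      by (rule powr_mono2') (use that \<beta>_pos in auto)
    finally show ?thesis .
  qed
  have "emeasure fdd.lim {\<omega> \<in> space fdd.lim. a \<le> norm (\<omega> t - \<omega> s)}
      = emeasure (distr fdd.lim (PiM {s,t} (\<lambda>_. borel)) (\<lambda>f. restrict f {s,t})) {\<omega> \<in> space (PiM {s,t} (\<lambda>_. borel)). a \<le> norm (\<omega> t - \<omega> s)}"
  proof (subst emeasure_distr)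
    have "{\<omega> \<in> space fdd.lim. a \<le> norm (\<omega> t - \<omega> s)}
       = (\<lambda>f. restrict f {s,t}) -` {\<omega> \<in> space (PiM {s,t} (\<lambda>_. borel)). a \<le> norm (\<omega> t - \<omega> s)} \<inter> space fdd.lim"
      by (auto simp: space_PiM)
    then show "emeasure fdd.lim {\<omega> \<in> space fdd.lim. a \<le> norm (\<omega> t - \<omega> s)}
       = emeasure fdd.lim ((\<lambda>f. restrict f {s,t}) -` {\<omega> \<in> space (PiM {s,t} (\<lambda>_. borel)). a \<le> norm (\<omega> t - \<omega> s)} \<inter> space fdd.lim)"
      by simp
  qed simp_all
  also have "\<dots> = (\<integral>\<^sup>+\<omega>. indicator {\<omega> \<in> space (PiM {s,t} (\<lambda>_. borel)). a \<le> norm (\<omega> t - \<omega> s)} \<omega> \<partial>fdd {s,t})"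
    unfolding distr_lim[OF J] by simp
  also have "\<dots> \<le> (\<integral>\<^sup>+\<omega>. ennreal (norm (\<omega> t - \<omega> s) ^ 4 / a ^ 4) \<partial>fdd {s,t})"
  proof (intro nn_integral_mono)
    fix \<omega>
    have "1 \<le> ennreal (norm (\<omega> t - \<omega> s) ^ 4 / a ^ 4)" if "a \<le> norm (\<omega> t - \<omega> s)"
      using that a by (simp add: power_mono le_divide_eq)
    then show "indicator {\<omega> \<in> space (PiM {s,t} (\<lambda>_. borel)). a \<le> norm (\<omega> t - \<omega> s)} \<omega> \<le> ennreal (norm (\<omega> t - \<omega> s) ^ 4 / a ^ 4)"
      by (auto simp: indicator_def)
  qed
  also have "\<dots> = (\<integral>\<^sup>+\<omega>. ennreal ?c * (ennreal (heat_kernel s x (\<omega> s)) * ennreal (heat_kernel (t - s) (\<omega> s) (\<omega> t)) * ennreal (heat_kernel (\<beta> - t) (\<omega> t) y)) * ennreal (norm (\<omega> t - \<omega> s) ^ 4 / a ^ 4) \<partial>PiM {s,t} (\<lambda>_. lborel))"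
    unfolding fdd_def srt nn_integral_density[OF m1 m2] by (intro nn_integral_cong) (simp add: mult.assoc)
  also have "\<dots> = (\<integral>\<^sup>+z. ennreal ?c * (ennreal (heat_kernel s x (fst z)) * ennreal (heat_kernel (t - s) (fst z) (snd z)) * ennreal (heat_kernel (\<beta> - t) (snd z) y)) * ennreal (norm (snd z - fst z) ^ 4 / a ^ 4) \<partial>(lborel \<Otimes>\<^sub>M lborel))"
    using lborel_product.product_nn_integral_pair[OF m3, of s t] s by simp
  also have "\<dots> \<le> ennreal (?c * M / a ^ 4) * ennreal (gauss4 TYPE('a) * (t - s)\<^sup>2)"
  proof (cases "\<beta> - t \<ge> \<beta> / 4")
    case True
    have "(\<integral>\<^sup>+z. ennreal ?c * (ennreal (heat_kernel s x (fst z)) * ennreal (heat_kernel (t - s) (fst z) (snd z)) * ennreal (heat_kernel (\<beta> - t) (snd z) y)) * ennreal (norm (snd z - fst z) ^ 4 / a ^ 4) \<partial>(lborel \<Otimes>\<^sub>M lborel))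
      \<le> (\<integral>\<^sup>+z. ennreal (?c * M / a ^ 4) * (ennreal (heat_kernel s x (fst z)) * ennreal (norm (snd z - fst z) ^ 4 * heat_kernel (t - s) 0 (snd z - fst z))) \<partial>(lborel \<Otimes>\<^sub>M lborel))"
    proof (intro nn_integral_mono)
      fix z :: "'a \<times> 'a"
      have "?c * (heat_kernel s x (fst z) * heat_kernel (t - s) (fst z) (snd z) * heat_kernel (\<beta> - t) (snd z) y) * (norm (snd z - fst z) ^ 4 / a ^ 4)
         \<le> ?c * (heat_kernel s x (fst z) * heat_kernel (t - s) (fst z) (snd z) * M) * (norm (snd z - fst z) ^ 4 / a ^ 4)"
        using a M0 by (intro mult_right_mono mult_left_mono large True) auto
      also have "\<dots> = (?c * M / a ^ 4) * (heat_kernel s x (fst z) * (norm (snd z - fst z) ^ 4 * heat_kernel (t - s) 0 (snd z - fst z)))"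
        by (simp add: heat_kernel_diff[of "t - s" "fst z"] mult_ac)
      finally show "ennreal ?c * (ennreal (heat_kernel s x (fst z)) * ennreal (heat_kernel (t - s) (fst z) (snd z)) * ennreal (heat_kernel (\<beta> - t) (snd z) y)) * ennreal (norm (snd z - fst z) ^ 4 / a ^ 4)
         \<le> ennreal (?c * M / a ^ 4) * (ennreal (heat_kernel s x (fst z)) * ennreal (norm (snd z - fst z) ^ 4 * heat_kernel (t - s) 0 (snd z - fst z)))"
        using a M0 by (simp add: ennreal_mult[symmetric] ennreal_leI)
    qed
    also have "\<dots> = (\<integral>\<^sup>+u. (\<integral>\<^sup>+v. ennreal (?c * M / a ^ 4) * (ennreal (heat_kernel s x u) * ennreal (norm (v - u) ^ 4 * heat_kernel (t - s) 0 (v - u))) \<partial>lborel) \<partial>lborel)"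
      by (subst lborel.nn_integral_fst[symmetric]) auto
    also have "\<dots> = (\<integral>\<^sup>+u. ennreal (?c * M / a ^ 4) * (ennreal (heat_kernel s x u) * (\<integral>\<^sup>+v. ennreal (norm (v::'a) ^ 4 * heat_kernel (t - s) 0 v) \<partial>lborel)) \<partial>lborel)"
    proof (intro nn_integral_cong)
      fix u :: 'a
      have "(\<integral>\<^sup>+v. ennreal (norm (v - u) ^ 4 * heat_kernel (t - s) 0 (v - u)) \<partial>lborel) = (\<integral>\<^sup>+v. ennreal (norm (v::'a) ^ 4 * heat_kernel (t - s) 0 v) \<partial>lborel)"
        using nn_integral_translate[of "\<lambda>v. ennreal (norm (v::'a) ^ 4 * heat_kernel (t - s) 0 v)" "- u"] by simp
      then show "(\<integral>\<^sup>+v. ennreal (?c * M / a ^ 4) * (ennreal (heat_kernel s x u) * ennreal (norm (v - u) ^ 4 * heat_kernel (t - s) 0 (v - u))) \<partial>lborel)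
          = ennreal (?c * M / a ^ 4) * (ennreal (heat_kernel s x u) * (\<integral>\<^sup>+v. ennreal (norm (v::'a) ^ 4 * heat_kernel (t - s) 0 v) \<partial>lborel))"
        by (simp add: nn_integral_cmult)
    qed
    also have "\<dots> = ennreal (?c * M / a ^ 4) * (\<integral>\<^sup>+v. ennreal (norm (v::'a) ^ 4 * heat_kernel (t - s) 0 v) \<partial>lborel)"
      using s by (simp add: nn_integral_cmult nn_integral_multc nn_integral_heat_kernel)
    also have "\<dots> \<le> ennreal (?c * M / a ^ 4) * ennreal (gauss4 TYPE('a) * (t - s)\<^sup>2)"
      using s by (intro mult_left_mono nn_integral_norm4_heat_kernel_le) auto
    finally show ?thesis .
  next
    case False
    then have sl: "s \<ge> \<beta> / 4" using ts by simp
    have "(\<integral>\<^sup>+z. ennreal ?c * (ennreal (heat_kernel s x (fst z)) * ennreal (heat_kernel (t - s) (fst z) (snd z)) * ennreal (heat_kernel (\<beta> - t) (snd z) y)) * ennreal (norm (snd z - fst z) ^ 4 / a ^ 4) \<partial>(lborel \<Otimes>\<^sub>M lborel))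
      \<le> (\<integral>\<^sup>+z. ennreal (?c * M / a ^ 4) * (ennreal (heat_kernel (\<beta> - t) (snd z) y) * ennreal (norm (snd z - fst z) ^ 4 * heat_kernel (t - s) 0 (snd z - fst z))) \<partial>(lborel \<Otimes>\<^sub>M lborel))"
    proof (intro nn_integral_mono)
      fix z :: "'a \<times> 'a"
      have "?c * (heat_kernel s x (fst z) * heat_kernel (t - s) (fst z) (snd z) * heat_kernel (\<beta> - t) (snd z) y) * (norm (snd z - fst z) ^ 4 / a ^ 4)
         \<le> ?c * (M * heat_kernel (t - s) (fst z) (snd z) * heat_kernel (\<beta> - t) (snd z) y) * (norm (snd z - fst z) ^ 4 / a ^ 4)"
        using a M0 by (intro mult_right_mono mult_left_mono large sl) auto
      also have "\<dots> = (?c * M / a ^ 4) * (heat_kernel (\<beta> - t) (snd z) y * (norm (snd z - fst z) ^ 4 * heat_kernel (t - s) 0 (snd z - fst z)))"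
        by (simp add: heat_kernel_diff[of "t - s" "fst z"] mult_ac)
      finally show "ennreal ?c * (ennreal (heat_kernel s x (fst z)) * ennreal (heat_kernel (t - s) (fst z) (snd z)) * ennreal (heat_kernel (\<beta> - t) (snd z) y)) * ennreal (norm (snd z - fst z) ^ 4 / a ^ 4)
         \<le> ennreal (?c * M / a ^ 4) * (ennreal (heat_kernel (\<beta> - t) (snd z) y) * ennreal (norm (snd z - fst z) ^ 4 * heat_kernel (t - s) 0 (snd z - fst z)))"
        using a M0 by (simp add: ennreal_mult[symmetric] ennreal_leI)
    qed
    also have "\<dots> = (\<integral>\<^sup>+v. (\<integral>\<^sup>+u. ennreal (?c * M / a ^ 4) * (ennreal (heat_kernel (\<beta> - t) v y) * ennreal (norm (v - u) ^ 4 * heat_kernel (t - s) 0 (v - u))) \<partial>lborel) \<partial>lborel)"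
      by (subst lborel_pair.nn_integral_snd[symmetric]) auto
    also have "\<dots> = (\<integral>\<^sup>+v. ennreal (?c * M / a ^ 4) * (ennreal (heat_kernel (\<beta> - t) v y) * (\<integral>\<^sup>+v. ennreal (norm (v::'a) ^ 4 * heat_kernel (t - s) 0 v) \<partial>lborel)) \<partial>lborel)"
    proof (intro nn_integral_cong)
      fix v :: 'a
      have "(\<integral>\<^sup>+u. ennreal (norm (v - u) ^ 4 * heat_kernel (t - s) 0 (v - u)) \<partial>lborel) = (\<integral>\<^sup>+v. ennreal (norm (v::'a) ^ 4 * heat_kernel (t - s) 0 v) \<partial>lborel)"
        using nn_integral_reflect[of "\<lambda>v. ennreal (norm (v::'a) ^ 4 * heat_kernel (t - s) 0 v)" v] by simp
      then show "(\<integral>\<^sup>+u. ennreal (?c * M / a ^ 4) * (ennreal (heat_kernel (\<beta> - t) v y) * ennreal (norm (v - u) ^ 4 * heat_kernel (t - s) 0 (v - u))) \<partial>lborel)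
          = ennreal (?c * M / a ^ 4) * (ennreal (heat_kernel (\<beta> - t) v y) * (\<integral>\<^sup>+v. ennreal (norm (v::'a) ^ 4 * heat_kernel (t - s) 0 v) \<partial>lborel))"
        by (simp add: nn_integral_cmult)
    qed
    also have "\<dots> = ennreal (?c * M / a ^ 4) * (\<integral>\<^sup>+v. ennreal (norm (v::'a) ^ 4 * heat_kernel (t - s) 0 v) \<partial>lborel)"
      using s by (simp add: nn_integral_cmult nn_integral_multc nn_integral_heat_kernel_right)
    also have "\<dots> \<le> ennreal (?c * M / a ^ 4) * ennreal (gauss4 TYPE('a) * (t - s)\<^sup>2)"
      using s by (intro mult_left_mono nn_integral_norm4_heat_kernel_le) auto
    finally show ?thesis .
  qed
  also have "\<dots> = ennreal (?c * M * gauss4 TYPE('a) * (t - s)\<^sup>2 / a ^ 4)"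
    using M0 a gauss4_pos[where 'a = 'a] by (simp add: ennreal_mult[symmetric] less_imp_le)
  finally show ?thesis by (simp add: M_def)
qed

end

section \<open>Dyadic chaining and the continuous modification\<close>

text \<open>The grid is clipped away from \<open>0\<close> and \<open>\<beta>\<close>: the bridge marginals are indexed by interior times only.\<close>

definition dyadic_index :: "real \<Rightarrow> nat \<Rightarrow> real \<Rightarrow> int" where
  "dyadic_index \<beta> n t = max 1 (min (2 ^ Suc n - 1) \<lfloor>2 ^ Suc n * t / \<beta>\<rfloor>)"

definition dyadic_time :: "real \<Rightarrow> nat \<Rightarrow> real \<Rightarrow> real" where
  "dyadic_time \<beta> n t = \<beta> * real_of_int (dyadic_index \<beta> n t) / 2 ^ Suc n"

lemma dyadic_index_bounds: "1 \<le> dyadic_index \<beta> n t" "dyadic_index \<beta> n t \<le> 2 ^ Suc n - 1"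
proof -
  have "(1::int) \<le> 2 ^ n" by (rule one_le_power) simp
  then have "2 \<le> (2::int) ^ Suc n" unfolding power_Suc by linarith
  then show "1 \<le> dyadic_index \<beta> n t" "dyadic_index \<beta> n t \<le> 2 ^ Suc n - 1"
    unfolding dyadic_index_def by linarith+
qed

text \<open>Doubling the argument of the floor gives twice the floor, possibly plus one, and the
  clipping to the interior of the two grids does not increase this discrepancy. So successive
  approximations of a time are equal or neighbours on the finer grid.\<close>

lemma dyadic_index_Suc: "\<bar>dyadic_index \<beta> (Suc n) t - 2 * dyadic_index \<beta> n t\<bar> \<le> 1"
proof -
  define P :: int where "P = 2 ^ Suc n"
  define r where "r = 2 ^ Suc n * t / \<beta>"
  have P: "P \<ge> 2" unfolding P_def by simp
  have e: "2 ^ Suc (Suc n) * t / \<beta> = 2 * r" "(2::int) ^ Suc (Suc n) = 2 * P" by (simp_all add: r_def P_def)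
  have "\<lfloor>2 * r\<rfloor> = 2 * \<lfloor>r\<rfloor> \<or> \<lfloor>2 * r\<rfloor> = 2 * \<lfloor>r\<rfloor> + 1" by linarith
  moreover have "\<bar>max 1 (min (2 * P - 1) m') - 2 * max 1 (min (P - 1) m)\<bar> \<le> 1"
    if "m' = 2 * m \<or> m' = 2 * m + 1" for m m' :: int
    using that P by (auto simp: max_def min_def)
  ultimately show ?thesis
    unfolding dyadic_index_def e r_def[symmetric] P_def[symmetric] by blast
qed

lemma dyadic_index_lipschitz:
  assumes "\<beta> > 0" "\<bar>s - t\<bar> < \<beta> / 2 ^ Suc n"
  shows "\<bar>dyadic_index \<beta> n s - dyadic_index \<beta> n t\<bar> \<le> 1"
proof -
  have "\<bar>2 ^ Suc n * s / \<beta> - 2 ^ Suc n * t / \<beta>\<bar> = 2 ^ Suc n * \<bar>s - t\<bar> / \<beta>"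
    using assms(1) by (simp add: diff_divide_distrib[symmetric] right_diff_distrib[symmetric] abs_mult)
  also have "\<dots> < 1" using assms by (simp add: field_simps)
  finally have "\<bar>\<lfloor>2 ^ Suc n * s / \<beta>\<rfloor> - \<lfloor>2 ^ Suc n * t / \<beta>\<rfloor>\<bar> \<le> 1" by linarith
  moreover have "\<bar>max 1 (min P m) - max 1 (min P m')\<bar> \<le> 1" if "\<bar>m - m'\<bar> \<le> 1" for P m m' :: int
    using that by linarith
  ultimately show ?thesis unfolding dyadic_index_def by blast
qed

lemma dyadic_time_bounds:
  assumes "\<beta> > 0" shows "dyadic_time \<beta> n t \<in> {0<..<\<beta>}"
proof -
  have "real_of_int (dyadic_index \<beta> n t) \<le> real_of_int (2 ^ Suc n - 1)"
    using dyadic_index_bounds(2) by (rule iffD2[OF of_int_le_iff])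
  then have "real_of_int (dyadic_index \<beta> n t) < 2 ^ Suc n" by simp
  moreover have "0 < real_of_int (dyadic_index \<beta> n t)" using dyadic_index_bounds(1)[of \<beta> n t] by simp
  ultimately show ?thesis using assms unfolding dyadic_time_def by (simp add: divide_less_eq)
qed

lemma dyadic_time_close:
  assumes "\<beta> > 0" "t \<in> {0..\<beta>}" shows "\<bar>t - dyadic_time \<beta> n t\<bar> \<le> \<beta> / 2 ^ Suc n"
proof -
  define P :: int where "P = 2 ^ Suc n"
  define r where "r = 2 ^ Suc n * t / \<beta>"
  have P: "P \<ge> 2" unfolding P_def by simp
  have r: "0 \<le> r" "r \<le> real_of_int P" using assms by (auto simp: r_def P_def field_simps)
  have "\<bar>r - real_of_int (max 1 (min (P - 1) \<lfloor>r\<rfloor>))\<bar> \<le> 1"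
  proof (cases "\<lfloor>r\<rfloor> < 1")
    case True then show ?thesis using r P by (auto simp: max_def min_def) linarith+
  next
    case False
    then show ?thesis using r P by (auto simp: max_def min_def) linarith+
  qed
  then have 1: "\<bar>r - real_of_int (dyadic_index \<beta> n t)\<bar> \<le> 1"
    by (simp add: dyadic_index_def r_def P_def)
  have "t - dyadic_time \<beta> n t = (\<beta> / 2 ^ Suc n) * (r - real_of_int (dyadic_index \<beta> n t))"
    using assms by (simp add: dyadic_time_def r_def field_simps)
  then have "\<bar>t - dyadic_time \<beta> n t\<bar> = (\<beta> / 2 ^ Suc n) * \<bar>r - real_of_int (dyadic_index \<beta> n t)\<bar>"
    using assms by (simp add: abs_mult)
  also have "\<dots> \<le> (\<beta> / 2 ^ Suc n) * 1" using 1 assms by (intro mult_left_mono) auto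
  finally show ?thesis by simp
qed

text \<open>The index stops at \<open>2 ^ Suc n - 2\<close> so that the right neighbour of each grid
  point is still an interior time.\<close>

definition dyadic_regular :: "real \<Rightarrow> real \<Rightarrow> nat \<Rightarrow> (real \<Rightarrow> 'a::real_normed_vector) \<Rightarrow> bool" where
  "dyadic_regular \<beta> q n f \<longleftrightarrow> (\<forall>k\<in>{1..2 ^ Suc n - 2::int}.
     norm (f (\<beta> * real_of_int (k + 1) / 2 ^ Suc n) - f (\<beta> * real_of_int k / 2 ^ Suc n)) \<le> q ^ n)"

text \<open>Successive dyadic approximations of a time differ by at most one grid step, so the
  values form a series dominated by a geometric one, uniformly in the time. Nearby times have
  neighbouring approximants at a fixed level, and the uniform tail bound then gives continuity of
  the limit. Only the values of \<open>f\<close> on the dyadic grid enter.\<close>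

lemma dyadic_chaining:
  fixes f :: "real \<Rightarrow> 'a::banach"
  assumes \<beta>: "\<beta> > 0" and q: "0 < q" "q < 1" and reg: "\<And>n. n \<ge> n0 \<Longrightarrow> dyadic_regular \<beta> q n f"
  shows "convergent (\<lambda>n. f (dyadic_time \<beta> n t))"
    and "continuous_on S (\<lambda>t. lim (\<lambda>n. f (dyadic_time \<beta> n t)))"
proof -
  have adjacent: "norm (f (\<beta> * real_of_int i / 2 ^ Suc n) - f (\<beta> * real_of_int j / 2 ^ Suc n)) \<le> q ^ n"
    if n: "n \<ge> n0" and ij: "1 \<le> i" "i \<le> 2 ^ Suc n - 1" "1 \<le> j" "j \<le> 2 ^ Suc n - 1" "\<bar>i - j\<bar> \<le> 1" for n and i j :: int
  proof -
    consider "i = j" | "i = j + 1" "j \<in> {1..2 ^ Suc n - 2}" | "j = i + 1" "i \<in> {1..2 ^ Suc n - 2}"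
      using ij by force
    then show ?thesis
    proof cases
      case 1 then show ?thesis using q by simp
    next
      case 2 then show ?thesis using reg[OF n] by (simp add: dyadic_regular_def del: power_Suc)
    next
      case 3 then show ?thesis using reg[OF n] by (subst norm_minus_commute) (simp add: dyadic_regular_def del: power_Suc)
    qed
  qed
  have step: "norm (f (dyadic_time \<beta> (Suc n) t) - f (dyadic_time \<beta> n t)) \<le> q ^ n" if n: "n \<ge> n0" for n t
  proof -
    have e: "dyadic_time \<beta> n t = \<beta> * real_of_int (2 * dyadic_index \<beta> n t) / 2 ^ Suc (Suc n)"
      by (simp add: dyadic_time_def)
    have "norm (f (dyadic_time \<beta> (Suc n) t) - f (dyadic_time \<beta> n t)) \<le> q ^ Suc n"
      unfolding e unfolding dyadic_time_def
      by (rule adjacent) (use n dyadic_index_Suc[of \<beta> n t] dyadic_index_bounds[of \<beta> n t] dyadic_index_bounds[of \<beta> "Suc n" t] in auto)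
    also have "\<dots> \<le> q ^ n" using q by (intro power_decreasing) auto
    finally show ?thesis .
  qed
  have tail: "norm (f (dyadic_time \<beta> (n + m) t) - f (dyadic_time \<beta> n t)) \<le> q ^ n / (1 - q)" if n: "n \<ge> n0" for n m t
  proof -
    have "norm (f (dyadic_time \<beta> (n + m) t) - f (dyadic_time \<beta> n t)) \<le> (\<Sum>i<m. q ^ (n + i))"
    proof (induction m)
      case (Suc m)
      have "norm (f (dyadic_time \<beta> (n + Suc m) t) - f (dyadic_time \<beta> n t))
        \<le> norm (f (dyadic_time \<beta> (Suc (n + m)) t) - f (dyadic_time \<beta> (n + m) t)) + norm (f (dyadic_time \<beta> (n + m) t) - f (dyadic_time \<beta> n t))"
        using norm_triangle_ineq[of "f (dyadic_time \<beta> (Suc (n + m)) t) - f (dyadic_time \<beta> (n + m) t)" "f (dyadic_time \<beta> (n + m) t) - f (dyadic_time \<beta> n t)"] by simp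
      then show ?case using step[of "n + m" t] n Suc by simp
    qed simp
    also have "\<dots> = q ^ n * (\<Sum>i<m. q ^ i)" by (simp add: power_add sum_distrib_left)
    also have "\<dots> \<le> q ^ n * (1 / (1 - q))"
    proof (intro mult_left_mono)
      have "(\<Sum>i<m. q ^ i) = (1 - q ^ m) / (1 - q)" using q sum_gp_strict[of q m] by auto
      also have "\<dots> \<le> 1 / (1 - q)" using q by (intro divide_right_mono) auto
      finally show "(\<Sum>i<m. q ^ i) \<le> 1 / (1 - q)" .
    qed (use q in auto)
    finally show ?thesis by simp
  qed
  \<comment> \<open>The final estimate adds two tails and one grid increment, each at most
    \<open>q ^ n / (1 - q)\<close>; the factor 4 leaves room for a strict inequality.\<close>
  have small: "\<exists>n\<ge>n0. 4 * (q ^ n / (1 - q)) < e" if "e > 0" for e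
  proof -
    have "(\<lambda>n. 4 * (q ^ n / (1 - q))) \<longlonglongrightarrow> 4 * (0 / (1 - q))"
      by (intro tendsto_intros LIMSEQ_realpow_zero) (use q in auto)
    then have "\<forall>\<^sub>F n in sequentially. 4 * (q ^ n / (1 - q)) < e"
      using that by (intro order_tendstoD(2)) auto
    then obtain N where "\<And>n. n \<ge> N \<Longrightarrow> 4 * (q ^ n / (1 - q)) < e" by (auto simp: eventually_sequentially)
    then show ?thesis by (intro exI[of _ "max N n0"]) auto
  qed
  have conv: "convergent (\<lambda>n. f (dyadic_time \<beta> n t))" for t
    unfolding Cauchy_convergent_iff[symmetric]
  proof (rule metric_CauchyI)
    fix e :: real assume "e > 0"
    then obtain N where N: "N \<ge> n0" "4 * (q ^ N / (1 - q)) < e" using small by blast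
    show "\<exists>M. \<forall>m\<ge>M. \<forall>n\<ge>M. dist (f (dyadic_time \<beta> m t)) (f (dyadic_time \<beta> n t)) < e"
    proof (intro exI[of _ N] allI impI)
      fix m n assume mn: "N \<le> m" "N \<le> n"
      have "dist (f (dyadic_time \<beta> m t)) (f (dyadic_time \<beta> n t)) \<le> dist (f (dyadic_time \<beta> m t)) (f (dyadic_time \<beta> N t)) + dist (f (dyadic_time \<beta> n t)) (f (dyadic_time \<beta> N t))"
        by (rule dist_triangle2)
      also have "\<dots> \<le> q ^ N / (1 - q) + q ^ N / (1 - q)"
        using tail[OF N(1), of "m - N" t] tail[OF N(1), of "n - N" t] mn by (intro add_mono) (auto simp: dist_norm)
      also have "\<dots> < e" using N(2) q by (smt (verit) divide_nonneg_pos zero_le_power)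
      finally show "dist (f (dyadic_time \<beta> m t)) (f (dyadic_time \<beta> n t)) < e" .
    qed
  qed
  then show "convergent (\<lambda>n. f (dyadic_time \<beta> n t))" .
  define g where "g t = lim (\<lambda>n. f (dyadic_time \<beta> n t))" for t
  have g: "(\<lambda>n. f (dyadic_time \<beta> n t)) \<longlonglongrightarrow> g t" for t
    using conv unfolding g_def by (simp add: convergent_LIMSEQ_iff)
  have gd: "norm (g t - f (dyadic_time \<beta> n t)) \<le> q ^ n / (1 - q)" if n: "n \<ge> n0" for n t
  proof (rule LIMSEQ_le_const2)
    show "(\<lambda>m. norm (f (dyadic_time \<beta> m t) - f (dyadic_time \<beta> n t))) \<longlonglongrightarrow> norm (g t - f (dyadic_time \<beta> n t))"
      by (intro tendsto_intros g)
    show "\<exists>N. \<forall>m\<ge>N. norm (f (dyadic_time \<beta> m t) - f (dyadic_time \<beta> n t)) \<le> q ^ n / (1 - q)"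
      using tail[OF n] by (intro exI[of _ n]) (metis le_add_diff_inverse)
  qed
  show "continuous_on S (\<lambda>t. lim (\<lambda>n. f (dyadic_time \<beta> n t)))"
    unfolding continuous_on_iff g_def[symmetric]
  proof (intro ballI allI impI)
    fix t e :: real assume "e > 0"
    then obtain N where N: "N \<ge> n0" "4 * (q ^ N / (1 - q)) < e" using small by blast
    show "\<exists>d>0. \<forall>s\<in>S. dist s t < d \<longrightarrow> dist (g s) (g t) < e"
    proof (intro exI[of _ "\<beta> / 2 ^ Suc N"] conjI ballI impI)
      fix s assume "dist s t < \<beta> / 2 ^ Suc N"
      then have "\<bar>dyadic_index \<beta> N s - dyadic_index \<beta> N t\<bar> \<le> 1"
        by (intro dyadic_index_lipschitz[OF \<beta>]) (auto simp: dist_real_def)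
      then have 1: "norm (f (dyadic_time \<beta> N s) - f (dyadic_time \<beta> N t)) \<le> q ^ N"
        unfolding dyadic_time_def by (intro adjacent N dyadic_index_bounds)
      have "norm (g s - g t) \<le> norm (g s - f (dyadic_time \<beta> N s)) + norm (f (dyadic_time \<beta> N s) - f (dyadic_time \<beta> N t)) + norm (g t - f (dyadic_time \<beta> N t))"
        by (smt (verit, ccfv_SIG) norm_diff_triangle_ineq norm_minus_commute norm_triangle_ineq diff_add_cancel add_diff_eq norm_diff_triangle_le)
      also have "\<dots> \<le> q ^ N / (1 - q) + q ^ N + q ^ N / (1 - q)"
        using gd[OF N(1)] 1 by (intro add_mono) auto
      also have "\<dots> \<le> 4 * (q ^ N / (1 - q))"
      proof -
        have "q ^ N \<le> q ^ N / (1 - q)" using q by (simp add: le_divide_eq mult_left_le)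
        then show ?thesis using q by (smt (verit) divide_nonneg_pos zero_le_power)
      qed
      finally show "dist (g s) (g t) < e" using N(2) by (simp add: dist_norm)
    qed (use \<beta> in auto)
  qed
qed

context bridge_parameters
begin

lemma measurable_lim_component [measurable]: "(\<lambda>\<omega>. \<omega> t) \<in> borel_measurable fdd.lim"
proof (cases "t \<in> {0<..<\<beta>}")
  case True
  then show ?thesis
    unfolding measurable_cong_sets[OF fdd.sets_lim refl] by (rule measurable_component_singleton)
next
  case False
  have "(\<lambda>\<omega>. \<omega> t) \<in> borel_measurable fdd.lim \<longleftrightarrow> (\<lambda>\<omega>. undefined :: 'a) \<in> borel_measurable fdd.lim"
    by (rule measurable_cong) (use False in \<open>auto simp: space_PiM PiE_def extensional_def\<close>)
  then show ?thesis by simp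
qed

definition incr_const :: real where
  "incr_const = (1 / heat_kernel \<beta> x y) * (pi * \<beta>) powr (- real DIM('a) / 2) * gauss4 TYPE('a)"

lemma incr_const_nonneg: "0 \<le> incr_const"
  using gauss4_pos[where 'a = 'a] by (simp add: incr_const_def)

lemma increment_tail_bound:
  assumes st: "s \<in> {0<..<\<beta>}" "t \<in> {0<..<\<beta>}" and d: "\<bar>t - s\<bar> \<le> d" "d \<le> \<beta> / 2" and a: "a > 0"
  shows "emeasure fdd.lim {\<omega> \<in> space fdd.lim. a < norm (\<omega> t - \<omega> s)} \<le> ennreal (incr_const * d\<^sup>2 / a ^ 4)"
proof -
  have "emeasure fdd.lim {\<omega> \<in> space fdd.lim. a < norm (\<omega> t - \<omega> s)} \<le> emeasure fdd.lim {\<omega> \<in> space fdd.lim. a \<le> norm (\<omega> t - \<omega> s)}"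
  proof (rule emeasure_mono)
    show "{\<omega> \<in> space fdd.lim. a \<le> norm (\<omega> t - \<omega> s)} \<in> sets fdd.lim" by measurable
  qed auto
  also have "\<dots> \<le> ennreal (incr_const * (t - s)\<^sup>2 / a ^ 4)"
  proof -
    consider "s < t" | "t < s" | "s = t" by linarith
    then show ?thesis
    proof cases
      case 1 then show ?thesis using increment_bound[of s t a] st d a by (simp add: incr_const_def)
    next
      case 2 then show ?thesis using increment_bound[of t s a] st d a
        by (simp add: incr_const_def norm_minus_commute power2_commute)
    next
      case 3 then show ?thesis using a by simp
    qed
  qed
  also have "\<dots> \<le> ennreal (incr_const * d\<^sup>2 / a ^ 4)"
    using d a incr_const_nonneg
    by (intro ennreal_leI divide_right_mono mult_left_mono) (auto simp: power2_le_iff_abs_le intro!: abs_le_square_iff[THEN iffD1])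
  finally show ?thesis .
qed

text \<open>There are about 2^n increments, each exceeding its threshold with probability of order
  4^(-n) (10/9)^(4n). The resulting ratio is (1/2) (10/9)^4 = 5000/6561.\<close>

lemma summable_increment_bounds: "summable (\<lambda>n. real (2 ^ Suc n) * (incr_const * (\<beta> / 2 ^ Suc n)\<^sup>2 / ((9/10) ^ n) ^ 4))"
proof -
  have "real (2 ^ Suc n) * (incr_const * (\<beta> / 2 ^ Suc n)\<^sup>2 / ((9/10) ^ n) ^ 4) = incr_const * \<beta>\<^sup>2 / 2 * (5000/6561) ^ n" for n
  proof -
    have "((9/10::real) ^ n) ^ 4 = (6561/10000) ^ n"
      by (simp add: power_mult[symmetric] mult.commute[of n]) (simp add: power_mult power_divide)
    moreover have "(6561/10000::real) ^ n * (5000/6561) ^ n * 2 ^ n = 1"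
      by (simp add: power_mult_distrib[symmetric])
    ultimately show ?thesis by (simp add: field_simps power2_eq_square)
  qed
  moreover have "summable (\<lambda>n. incr_const * \<beta>\<^sup>2 / 2 * (5000/6561) ^ n)"
    by (intro summable_mult summable_geometric) simp
  ultimately show ?thesis by (simp only:)
qed

text \<open>Borel-Cantelli applied to the event that some increment of level n exceeds its
  threshold, with a union bound over the grid.\<close>

lemma AE_dyadic_regular: "AE \<omega> in fdd.lim. \<forall>\<^sub>F n in sequentially. dyadic_regular \<beta> (9/10) n \<omega>"
proof -
  let ?q = "9/10 :: real"
  let ?B = "\<lambda>n k. {\<omega> \<in> space fdd.lim. ?q ^ n < norm (\<omega> (\<beta> * real_of_int (k + 1) / 2 ^ Suc n) - \<omega> (\<beta> * real_of_int k / 2 ^ Suc n))}"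
  define Bad where "Bad n = (\<Union>k\<in>{1..2 ^ Suc n - 2::int}. ?B n k)" for n
  have [measurable]: "Bad n \<in> sets fdd.lim" for n unfolding Bad_def by measurable
  have est: "emeasure fdd.lim (Bad n) \<le> ennreal (real (2 ^ Suc n) * (incr_const * (\<beta> / 2 ^ Suc n)\<^sup>2 / (?q ^ n) ^ 4))" for n
  proof -
    have "emeasure fdd.lim (Bad n) \<le> (\<Sum>k\<in>{1..2 ^ Suc n - 2::int}. emeasure fdd.lim (?B n k))"
      unfolding Bad_def
    proof (intro emeasure_subadditive_finite)
      have "?B n k \<in> sets fdd.lim" for k by measurable
      then show "?B n ` {1..2 ^ Suc n - 2} \<subseteq> sets fdd.lim" by blast
    qed simp
    also have "\<dots> \<le> (\<Sum>k\<in>{1..2 ^ Suc n - 2::int}. ennreal (incr_const * (\<beta> / 2 ^ Suc n)\<^sup>2 / (?q ^ n) ^ 4))"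
    proof (intro sum_mono increment_tail_bound)
      fix k :: int assume k: "k \<in> {1..2 ^ Suc n - 2}"
      then have "real_of_int (k + 1) \<le> real_of_int (2 ^ Suc n - 1)" by (subst of_int_le_iff) auto
      then have k1: "real_of_int k + 1 < 2 ^ Suc n" by simp
      have k0: "0 < real_of_int k" using k by simp
      show "\<beta> * real_of_int k / 2 ^ Suc n \<in> {0<..<\<beta>}" "\<beta> * real_of_int (k + 1) / 2 ^ Suc n \<in> {0<..<\<beta>}"
        using k0 k1 \<beta>_pos by (auto simp: divide_less_eq)
      show "\<bar>\<beta> * real_of_int (k + 1) / 2 ^ Suc n - \<beta> * real_of_int k / 2 ^ Suc n\<bar> \<le> \<beta> / 2 ^ Suc n"
        using \<beta>_pos by (simp add: diff_divide_distrib[symmetric] right_diff_distrib[symmetric])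
      show "\<beta> / 2 ^ Suc n \<le> \<beta> / 2"
        using \<beta>_pos by (intro divide_left_mono) auto
    qed auto
    also have "\<dots> = of_nat (card {1..2 ^ Suc n - 2::int}) * ennreal (incr_const * (\<beta> / 2 ^ Suc n)\<^sup>2 / (?q ^ n) ^ 4)" by simp
    also have "\<dots> \<le> ennreal (real (2 ^ Suc n)) * ennreal (incr_const * (\<beta> / 2 ^ Suc n)\<^sup>2 / (?q ^ n) ^ 4)"
    proof (intro mult_right_mono)
      have "card {1..2 ^ Suc n - 2::int} \<le> 2 ^ Suc n" by (simp add: nat_diff_distrib nat_power_eq nat_mult_distrib)
      then have "real (card {1..2 ^ Suc n - 2::int}) \<le> real (2 ^ Suc n)" by (rule iffD2[OF of_nat_le_iff])
      then show "of_nat (card {1..2 ^ Suc n - 2::int}) \<le> ennreal (real (2 ^ Suc n))"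
        by (subst ennreal_of_nat_eq_real_of_nat) (rule ennreal_leI)
    qed auto
    finally show ?thesis using incr_const_nonneg by (subst ennreal_mult) auto
  qed
  have "AE \<omega> in fdd.lim. \<forall>\<^sub>F n in sequentially. \<omega> \<in> space fdd.lim - Bad n"
  proof (rule borel_cantelli_AE1)
    show "emeasure fdd.lim (Bad n) < \<infinity>" for n by (simp add: less_top[symmetric])
    show "summable (\<lambda>n. measure fdd.lim (Bad n))"
    proof (rule summable_comparison_test'[OF summable_increment_bounds, of 0])
      show "norm (measure fdd.lim (Bad n)) \<le> real (2 ^ Suc n) * (incr_const * (\<beta> / 2 ^ Suc n)\<^sup>2 / (?q ^ n) ^ 4)" for n
        using est[of n] incr_const_nonneg unfolding fdd.P.emeasure_eq_measure by (subst (asm) ennreal_le_iff) auto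
    qed
  qed fact
  then show ?thesis
    by (rule AE_mp) (auto simp: Bad_def dyadic_regular_def not_less elim!: eventually_mono intro!: AE_I2)
qed

text \<open>This identifies the limit along the grid with the original coordinate, so that the
  continuous version has the prescribed marginals at every fixed interior time, dyadic or
  not.\<close>

lemma AE_dyadic_tendsto:
  assumes t: "t \<in> {0<..<\<beta>}"
  shows "AE \<omega> in fdd.lim. (\<lambda>n. \<omega> (dyadic_time \<beta> n t)) \<longlonglongrightarrow> \<omega> t"
proof -
  let ?q = "9/10 :: real"
  define Bad where "Bad n = {\<omega> \<in> space fdd.lim. ?q ^ n < norm (\<omega> (dyadic_time \<beta> n t) - \<omega> t)}" for n
  have [measurable]: "Bad n \<in> sets fdd.lim" for n unfolding Bad_def by measurable
  have est: "emeasure fdd.lim (Bad n) \<le> ennreal (real (2 ^ Suc n) * (incr_const * (\<beta> / 2 ^ Suc n)\<^sup>2 / (?q ^ n) ^ 4))" for n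
  proof -
    have "emeasure fdd.lim (Bad n) \<le> ennreal (incr_const * (\<beta> / 2 ^ Suc n)\<^sup>2 / (?q ^ n) ^ 4)"
      unfolding Bad_def
    proof (rule increment_tail_bound)
      show "\<bar>dyadic_time \<beta> n t - t\<bar> \<le> \<beta> / 2 ^ Suc n"
        using dyadic_time_close[OF \<beta>_pos, of t n] t by (auto simp: abs_minus_commute)
      show "\<beta> / 2 ^ Suc n \<le> \<beta> / 2"
        using \<beta>_pos by (intro divide_left_mono) auto
    qed (use t dyadic_time_bounds[OF \<beta>_pos] in auto)
    also have "\<dots> \<le> ennreal (real (2 ^ Suc n) * (incr_const * (\<beta> / 2 ^ Suc n)\<^sup>2 / (?q ^ n) ^ 4))"
    proof (intro ennreal_leI)
      have "1 \<le> real (2 ^ Suc n)" by (simp del: power_Suc)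
      moreover have "0 \<le> incr_const * (\<beta> / 2 ^ Suc n)\<^sup>2 / (?q ^ n) ^ 4"
        using incr_const_nonneg by simp
      ultimately have "1 * (incr_const * (\<beta> / 2 ^ Suc n)\<^sup>2 / (?q ^ n) ^ 4) \<le> real (2 ^ Suc n) * (incr_const * (\<beta> / 2 ^ Suc n)\<^sup>2 / (?q ^ n) ^ 4)"
        by (rule mult_right_mono)
      then show "incr_const * (\<beta> / 2 ^ Suc n)\<^sup>2 / (?q ^ n) ^ 4 \<le> real (2 ^ Suc n) * (incr_const * (\<beta> / 2 ^ Suc n)\<^sup>2 / (?q ^ n) ^ 4)"
        by (simp only: mult_1)
    qed
    finally show ?thesis .
  qed
  have "AE \<omega> in fdd.lim. \<forall>\<^sub>F n in sequentially. \<omega> \<in> space fdd.lim - Bad n"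
  proof (rule borel_cantelli_AE1)
    show "emeasure fdd.lim (Bad n) < \<infinity>" for n by (simp add: less_top[symmetric])
    show "summable (\<lambda>n. measure fdd.lim (Bad n))"
    proof (rule summable_comparison_test'[OF summable_increment_bounds, of 0])
      show "norm (measure fdd.lim (Bad n)) \<le> real (2 ^ Suc n) * (incr_const * (\<beta> / 2 ^ Suc n)\<^sup>2 / (?q ^ n) ^ 4)" for n
        using est[of n] incr_const_nonneg unfolding fdd.P.emeasure_eq_measure by (subst (asm) ennreal_le_iff) auto
    qed
  qed fact
  then show ?thesis
  proof (rule AE_mp, intro AE_I2 impI)
    fix \<omega> assume "\<forall>\<^sub>F n in sequentially. \<omega> \<in> space fdd.lim - Bad n"
    then have ev: "\<forall>\<^sub>F n in sequentially. norm (\<omega> (dyadic_time \<beta> n t) - \<omega> t) \<le> ?q ^ n"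
      by (auto simp: Bad_def not_less elim!: eventually_mono)
    have "(\<lambda>n. \<omega> (dyadic_time \<beta> n t) - \<omega> t) \<longlonglongrightarrow> 0"
      by (rule Lim_null_comparison[OF ev]) (auto intro: LIMSEQ_realpow_zero)
    then show "(\<lambda>n. \<omega> (dyadic_time \<beta> n t)) \<longlonglongrightarrow> \<omega> t" by (rule LIM_zero_cancel)
  qed
qed

text \<open>Fourth moments make any ratio between \<open>2 powr (-1/4)\<close> and \<open>1\<close> work in place of \<open>9/10\<close>.\<close>

definition continuous_version :: "(real \<Rightarrow> 'a) \<Rightarrow> real \<Rightarrow> 'a" where
  "continuous_version \<omega> = (\<lambda>t\<in>{0..\<beta>}. if \<exists>n0. \<forall>n\<ge>n0. dyadic_regular \<beta> (9/10) n \<omega> then lim (\<lambda>n. \<omega> (dyadic_time \<beta> n t)) else 0)"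

lemma continuous_version_in_path_space: "continuous_version \<omega> \<in> path_space \<beta>"
proof (cases "\<exists>n0. \<forall>n\<ge>n0. dyadic_regular \<beta> (9/10) n \<omega>")
  case True
  then obtain n0 where "\<And>n. n \<ge> n0 \<Longrightarrow> dyadic_regular \<beta> (9/10) n \<omega>" by blast
  then have "continuous_on {0..\<beta>} (\<lambda>t. lim (\<lambda>n. \<omega> (dyadic_time \<beta> n t)))"
    by (intro dyadic_chaining(2)[OF \<beta>_pos, of "9/10" n0]) auto
  then have "continuous_on {0..\<beta>} (continuous_version \<omega>)"
    by (rule continuous_on_eq) (use True in \<open>auto simp: continuous_version_def\<close>)
  then show ?thesis by (auto simp: path_space_def space_PiM continuous_version_def)
next
  case False
  then have "continuous_version \<omega> = (\<lambda>t\<in>{0..\<beta>}. 0)" by (simp only: continuous_version_def if_False)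
  moreover have "continuous_on {0..\<beta>} (\<lambda>t\<in>{0..\<beta>}. 0 :: 'a)" by (rule continuous_on_eq[OF continuous_on_const]) auto
  ultimately show ?thesis by (auto simp: path_space_def space_PiM)
qed

lemma measurable_continuous_version [measurable]:
  "continuous_version \<in> fdd.lim \<rightarrow>\<^sub>M path_measurable_space \<beta>"
  unfolding path_measurable_space_def
proof (rule measurable_restrict_space2)
  show "continuous_version \<in> space fdd.lim \<rightarrow> path_space \<beta>" using continuous_version_in_path_space by auto
  have [measurable]: "Measurable.pred fdd.lim (\<lambda>\<omega>. dyadic_regular \<beta> (9/10) n \<omega>)" for n
    unfolding dyadic_regular_def by measurable
  show "continuous_version \<in> fdd.lim \<rightarrow>\<^sub>M PiM {0..\<beta>} (\<lambda>_. lborel)"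
    unfolding continuous_version_def by (rule measurable_restrict) measurable
qed

lemma AE_continuous_version:
  assumes t: "t \<in> {0<..<\<beta>}"
  shows "AE \<omega> in fdd.lim. continuous_version \<omega> t = \<omega> t"
  using AE_dyadic_regular AE_dyadic_tendsto[OF t]
proof eventually_elim
  case (elim \<omega>)
  then show ?case using t by (auto simp: continuous_version_def eventually_sequentially intro: limI)
qed

text \<open>The continuous version agrees almost surely with the coordinate process at finitely many
  fixed times, so its law has the normalised marginals; scaling by
  \<open>heat_kernel \<beta> x y\<close> removes the normalisation.\<close>

lemma is_brownian_bridge_exists: "is_brownian_bridge \<beta> x y (scale_measure (ennreal (heat_kernel \<beta> x y)) (distr fdd.lim (path_measurable_space \<beta>) continuous_version))"
  unfolding is_brownian_bridge_def
proof (intro conjI allI impI)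
  fix J :: "real set" and A :: "real \<Rightarrow> 'a set"
  assume "finite J \<and> J \<subseteq> {0<..<\<beta>} \<and> (\<forall>j\<in>J. A j \<in> sets lborel)"
  then have J: "finite J" "J \<subseteq> {0<..<\<beta>}" and A: "\<And>j. j \<in> J \<Longrightarrow> A j \<in> sets borel" by auto
  have sp: "space (path_measurable_space \<beta>) = path_space \<beta>"
    by (auto simp: path_measurable_space_def space_restrict_space path_space_def)
  have [measurable]: "(\<lambda>\<omega>. \<omega> j) \<in> path_measurable_space \<beta> \<rightarrow>\<^sub>M (borel :: 'a measure)" if "j \<in> J" for j
    unfolding path_measurable_space_def
    by (rule measurable_restrict_space1, rule measurable_component_borel) (use that J in force)
  have S: "{\<omega> \<in> path_space \<beta>. \<forall>j\<in>J. \<omega> j \<in> A j} \<in> sets (path_measurable_space \<beta>)"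
    using J A unfolding sp[symmetric] by measurable
  have "emeasure (distr fdd.lim (path_measurable_space \<beta>) continuous_version) {\<omega> \<in> path_space \<beta>. \<forall>j\<in>J. \<omega> j \<in> A j}
    = emeasure fdd.lim {\<omega> \<in> space fdd.lim. \<forall>j\<in>J. continuous_version \<omega> j \<in> A j}"
    using S continuous_version_in_path_space by (subst emeasure_distr) (auto intro!: arg_cong[where f = "emeasure fdd.lim"])
  also have "\<dots> = emeasure fdd.lim {\<omega> \<in> space fdd.lim. \<forall>j\<in>J. \<omega> j \<in> A j}"
  proof (rule emeasure_eq_AE)
    have "AE \<omega> in fdd.lim. \<forall>j\<in>J. continuous_version \<omega> j = \<omega> j"
      using J by (intro AE_finite_allI AE_continuous_version) auto
    then show "AE \<omega> in fdd.lim. (\<omega> \<in> {\<omega> \<in> space fdd.lim. \<forall>j\<in>J. continuous_version \<omega> j \<in> A j}) = (\<omega> \<in> {\<omega> \<in> space fdd.lim. \<forall>j\<in>J. \<omega> j \<in> A j})"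
      by eventually_elim auto
    have "(\<lambda>\<omega>. continuous_version \<omega> j) \<in> borel_measurable fdd.lim" if "j \<in> J" for j
      by (rule measurable_compose[OF measurable_continuous_version]) (use that in measurable)
    then show "{\<omega> \<in> space fdd.lim. \<forall>j\<in>J. continuous_version \<omega> j \<in> A j} \<in> sets fdd.lim"
      using J A by measurable
    show "{\<omega> \<in> space fdd.lim. \<forall>j\<in>J. \<omega> j \<in> A j} \<in> sets fdd.lim"
      using J A by measurable
  qed
  also have "\<dots> = emeasure (distr fdd.lim (PiM J (\<lambda>_. borel)) (\<lambda>f. restrict f J)) (Pi\<^sub>E J A)"
  proof (subst emeasure_distr)
    show "(\<lambda>f. restrict f J) \<in> fdd.lim \<rightarrow>\<^sub>M PiM J (\<lambda>_. borel)"
      unfolding measurable_cong_sets[OF fdd.sets_lim refl] by (rule measurable_restrict_subset) fact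
    have "{\<omega> \<in> space fdd.lim. \<forall>j\<in>J. \<omega> j \<in> A j} = (\<lambda>f. restrict f J) -` Pi\<^sub>E J A \<inter> space fdd.lim"
      by (auto simp: PiE_iff)
    then show "emeasure fdd.lim {\<omega> \<in> space fdd.lim. \<forall>j\<in>J. \<omega> j \<in> A j} = emeasure fdd.lim ((\<lambda>f. restrict f J) -` Pi\<^sub>E J A \<inter> space fdd.lim)"
      by simp
  qed (use J A in auto)
  also have "\<dots> = ennreal (1 / heat_kernel \<beta> x y) * bridge_fdd 0 x (map (\<lambda>t. (t, A t)) (sorted_list_of_set J)) \<beta> y"
    unfolding distr_lim[OF J] using J A by (simp add: emeasure_fdd bridge_fdd_eq_integral comp_def)
  finally show "emeasure (scale_measure (ennreal (heat_kernel \<beta> x y)) (distr fdd.lim (path_measurable_space \<beta>) continuous_version)) {\<omega> \<in> path_space \<beta>. \<forall>j\<in>J. \<omega> j \<in> A j}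
     = bridge_fdd 0 x (map (\<lambda>t. (t, A t)) (sorted_list_of_set J)) \<beta> y"
    using heat_kernel_pos[OF \<beta>_pos, of x y] by (simp add: mult.assoc[symmetric] ennreal_mult[symmetric])
qed simp

end

section \<open>Integration against the bridge measure\<close>

text \<open>Existence makes the choice in \<open>brownian_bridge\<close> meaningful; from here on
  the chosen measure is known through its defining property.\<close>

lemma is_brownian_bridge:
  assumes "\<beta> > 0" shows "is_brownian_bridge \<beta> x y (brownian_bridge \<beta> x y)"
proof -
  interpret bridge_parameters \<beta> x y by unfold_locales fact
  show ?thesis unfolding brownian_bridge_def by (rule someI[of "is_brownian_bridge \<beta> x y"]) (rule is_brownian_bridge_exists)
qed

text \<open>The defining property speaks of rectangles only. These determine the image of the bridge
  under restriction to \<open>J\<close>, which is therefore a multiple of \<open>fdd J\<close>, and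
  products of arbitrary nonnegative functions can be integrated.\<close>

lemma nn_integral_brownian_bridge_prod:
  fixes F :: "real \<Rightarrow> 'a::euclidean_space \<Rightarrow> ennreal"
  assumes \<beta>: "\<beta> > 0" and J: "finite J" "J \<subseteq> {0<..<\<beta>}" and F: "\<And>j. j \<in> J \<Longrightarrow> F j \<in> borel_measurable borel"
  shows "(\<integral>\<^sup>+\<omega>. (\<Prod>j\<in>J. F j (\<omega> j)) \<partial>brownian_bridge \<beta> x y)
     = bridge_integral 0 x (map (\<lambda>t. (t, F t)) (sorted_list_of_set J)) \<beta> y"
proof -
  interpret bridge_parameters \<beta> x y by unfold_locales fact
  let ?\<mu> = "brownian_bridge \<beta> x y" and ?c = "ennreal (heat_kernel \<beta> x y)"
  have bb: "sets ?\<mu> = sets (path_measurable_space \<beta>)"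
    and fd: "\<And>J A. finite J \<Longrightarrow> J \<subseteq> {0<..<\<beta>} \<Longrightarrow> (\<And>j. j \<in> J \<Longrightarrow> A j \<in> sets borel) \<Longrightarrow>
      emeasure ?\<mu> {\<omega> \<in> path_space \<beta>. \<forall>j\<in>J. \<omega> j \<in> A j} = bridge_fdd 0 x (map (\<lambda>t. (t, A t)) (sorted_list_of_set J)) \<beta> y"
    using is_brownian_bridge[OF \<beta>, of x y] unfolding is_brownian_bridge_def by auto
  have sp: "space ?\<mu> = path_space \<beta>"
    using sets_eq_imp_space_eq[OF bb] by (auto simp: path_measurable_space_def space_restrict_space path_space_def)
  have mr [measurable]: "(\<lambda>f. restrict f J) \<in> ?\<mu> \<rightarrow>\<^sub>M PiM J (\<lambda>_. borel)"
    unfolding measurable_cong_sets[OF bb refl] path_measurable_space_def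
  proof (rule measurable_restrict_space1)
    have "(\<lambda>f. restrict f J) \<in> PiM {0..\<beta>} (\<lambda>_. borel) \<rightarrow>\<^sub>M PiM J (\<lambda>_. borel :: 'a measure)"
      by (rule measurable_restrict_subset) (use J in force)
    also have "measurable (PiM {0..\<beta>} (\<lambda>_. borel)) (PiM J (\<lambda>_. borel)) = measurable (PiM {0..\<beta>} (\<lambda>_. lborel)) (PiM J (\<lambda>_. borel :: 'a measure))"
      by (intro measurable_cong_sets sets_PiM_cong) auto
    finally show "(\<lambda>f. restrict f J) \<in> PiM {0..\<beta>} (\<lambda>_. lborel) \<rightarrow>\<^sub>M PiM J (\<lambda>_. borel :: 'a measure)" .
  qed
  have "distr ?\<mu> (PiM J (\<lambda>_. borel)) (\<lambda>f. restrict f J) = scale_measure ?c (fdd J)"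
  proof (rule measure_eqI_PiM_finite[of J _ "\<lambda>_. borel" _ "\<lambda>_. space (PiM J (\<lambda>_. borel))"])
    fix A :: "real \<Rightarrow> 'a set" assume A: "\<And>j. j \<in> J \<Longrightarrow> A j \<in> sets borel"
    have "emeasure (distr ?\<mu> (PiM J (\<lambda>_. borel)) (\<lambda>f. restrict f J)) (Pi\<^sub>E J A) = emeasure ?\<mu> {\<omega> \<in> path_space \<beta>. \<forall>j\<in>J. \<omega> j \<in> A j}"
    proof (subst emeasure_distr)
      have "(\<lambda>f. restrict f J) -` Pi\<^sub>E J A \<inter> space ?\<mu> = {\<omega> \<in> path_space \<beta>. \<forall>j\<in>J. \<omega> j \<in> A j}"
        by (auto simp: sp PiE_iff)
      then show "emeasure ?\<mu> ((\<lambda>f. restrict f J) -` Pi\<^sub>E J A \<inter> space ?\<mu>) = emeasure ?\<mu> {\<omega> \<in> path_space \<beta>. \<forall>j\<in>J. \<omega> j \<in> A j}"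
        by simp
    qed (use J A in auto)
    also have "\<dots> = ?c * (ennreal (1 / heat_kernel \<beta> x y) * bridge_integral 0 x (map (\<lambda>t. (t, indicator (A t))) (sorted_list_of_set J)) \<beta> y)"
      using J A heat_kernel_pos[OF \<beta>, of x y]
      by (simp add: fd bridge_fdd_eq_integral comp_def mult.assoc[symmetric] ennreal_mult[symmetric])
    also have "\<dots> = emeasure (scale_measure ?c (fdd J)) (Pi\<^sub>E J A)"
      using J A by (simp add: emeasure_fdd)
    finally show "emeasure (distr ?\<mu> (PiM J (\<lambda>_. borel)) (\<lambda>f. restrict f J)) (Pi\<^sub>E J A) = emeasure (scale_measure ?c (fdd J)) (Pi\<^sub>E J A)" .
  next
    have "emeasure (distr ?\<mu> (PiM J (\<lambda>_. borel)) (\<lambda>f. restrict f J)) (space (PiM J (\<lambda>_. borel))) = emeasure ?\<mu> (space ?\<mu>)"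
    proof (subst emeasure_distr)
      show "emeasure ?\<mu> ((\<lambda>f. restrict f J) -` space (PiM J (\<lambda>_. borel)) \<inter> space ?\<mu>) = emeasure ?\<mu> (space ?\<mu>)"
        by (rule arg_cong[where f = "emeasure ?\<mu>"]) (auto simp: space_PiM)
    qed (rule mr, rule sets.top)
    also have "\<dots> = bridge_fdd 0 x [] \<beta> y" using fd[of "{}"] by (simp add: sp)
    finally show "emeasure (distr ?\<mu> (PiM J (\<lambda>_. borel)) (\<lambda>f. restrict f J)) (space (PiM J (\<lambda>_. borel))) \<noteq> \<infinity>"
      by simp
  qed (use J in \<open>auto intro!: prod_algebraI_finite simp: space_PiM\<close>)
  note d = this
  have [measurable]: "(\<lambda>\<omega>. \<Prod>j\<in>J. F j (\<omega> j)) \<in> borel_measurable (PiM J (\<lambda>_. borel))"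
    using F by (intro borel_measurable_prod_ennreal) (auto intro!: measurable_compose[OF measurable_component_singleton])
  have "(\<integral>\<^sup>+\<omega>. (\<Prod>j\<in>J. F j (\<omega> j)) \<partial>?\<mu>) = (\<integral>\<^sup>+\<omega>. (\<Prod>j\<in>J. F j (restrict \<omega> J j)) \<partial>?\<mu>)"
    by (intro nn_integral_cong prod.cong) auto
  also have "\<dots> = (\<integral>\<^sup>+\<omega>. (\<Prod>j\<in>J. F j (\<omega> j)) \<partial>distr ?\<mu> (PiM J (\<lambda>_. borel)) (\<lambda>f. restrict f J))"
    by (subst nn_integral_distr) auto
  also have "\<dots> = ?c * (ennreal (1 / heat_kernel \<beta> x y) * bridge_integral 0 x (map (\<lambda>t. (t, F t)) (sorted_list_of_set J)) \<beta> y)"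
    unfolding d by (subst nn_integral_scale_measure) (use J F in \<open>simp_all add: nn_integral_fdd_prod\<close>)
  also have "\<dots> = bridge_integral 0 x (map (\<lambda>t. (t, F t)) (sorted_list_of_set J)) \<beta> y"
    using heat_kernel_pos[OF \<beta>, of x y] by (simp add: mult.assoc[symmetric] ennreal_mult[symmetric])
  finally show ?thesis .
qed

text \<open>The total mass is the marginal for the empty set of times, which is the bare heat
  kernel.\<close>

lemma brownian_bridge_measure:
  assumes \<beta>: "\<beta> > 0"
  shows sets_brownian_bridge: "sets (brownian_bridge \<beta> x y) = sets (path_measurable_space \<beta>)"
    and space_brownian_bridge: "space (brownian_bridge \<beta> x (y::'a::euclidean_space)) = path_space \<beta>"
    and emeasure_space_brownian_bridge: "emeasure (brownian_bridge \<beta> x y) (space (brownian_bridge \<beta> x y)) = ennreal (heat_kernel \<beta> x y)"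
    and finite_measure_brownian_bridge: "finite_measure (brownian_bridge \<beta> x y)"
proof -
  show 1: "sets (brownian_bridge \<beta> x y) = sets (path_measurable_space \<beta>)"
    using is_brownian_bridge[OF \<beta>, of x y] unfolding is_brownian_bridge_def by auto
  show 2: "space (brownian_bridge \<beta> x y) = path_space \<beta>"
    using sets_eq_imp_space_eq[OF 1] by (auto simp: path_measurable_space_def space_restrict_space path_space_def)
  have "\<forall>J A. finite J \<and> J \<subseteq> {0<..<\<beta>} \<and> (\<forall>j\<in>J. A j \<in> sets (lborel :: 'a measure)) \<longrightarrow>
        emeasure (brownian_bridge \<beta> x y) {\<omega> \<in> path_space \<beta>. \<forall>j\<in>J. \<omega> j \<in> A j}
          = bridge_fdd 0 x (map (\<lambda>t. (t, A t)) (sorted_list_of_set J)) \<beta> y"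
    using is_brownian_bridge[OF \<beta>, of x y] unfolding is_brownian_bridge_def by auto
  from this[rule_format, of "{}"] show 3: "emeasure (brownian_bridge \<beta> x y) (space (brownian_bridge \<beta> x y)) = ennreal (heat_kernel \<beta> x y)"
    unfolding 2 by simp
  show "finite_measure (brownian_bridge \<beta> x y)" by (rule finite_measureI) (simp add: 3)
qed

lemma measurable_brownian_bridge_component:
  assumes \<beta>: "\<beta> > 0" and t: "t \<in> {0..\<beta>}"
  shows "(\<lambda>\<omega>. \<omega> t) \<in> borel_measurable (brownian_bridge \<beta> x (y::'a::euclidean_space))"
  unfolding measurable_cong_sets[OF sets_brownian_bridge[OF \<beta>] refl] path_measurable_space_def
  using measurable_component_singleton[OF t, of "\<lambda>_. lborel :: 'a measure"] by (intro measurable_restrict_space1) simp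

section \<open>The Trotter approximation\<close>

text \<open>The index counts the interior grid points: n + 1 heat steps of length h with a weight
  between consecutive steps and none at the two endpoints, as the interior marginals of the bridge
  dictate.\<close>

fun trotter_kernel :: "real \<Rightarrow> ('a::euclidean_space \<Rightarrow> ennreal) \<Rightarrow> nat \<Rightarrow> 'a \<Rightarrow> 'a \<Rightarrow> ennreal" where
  "trotter_kernel h w 0 x y = ennreal (heat_kernel h x y)"
| "trotter_kernel h w (Suc n) x y = (\<integral>\<^sup>+z. ennreal (heat_kernel h x z) * w z * trotter_kernel h w n z y \<partial>lborel)"

lemma bridge_integral_grid:
  "bridge_integral s x (map (\<lambda>i. (s + real i * h, w)) [1..<Suc n]) (s + real (Suc n) * h) y = trotter_kernel h w n x y"
proof (induction n arbitrary: s x)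
  case (Suc n)
  have "map (\<lambda>i. (s + real i * h, w)) [1..<Suc (Suc n)] = map (\<lambda>i. (s + real (Suc i) * h, w)) [0..<Suc n]"
    by (simp add: map_Suc_upt[symmetric] comp_def del: upt_Suc)
  also have "\<dots> = (s + h, w) # map (\<lambda>i. (s + h + real i * h, w)) [1..<Suc n]"
    by (subst upt_conv_Cons) (auto simp: algebra_simps)
  finally show ?case
    using Suc.IH[of "s + h"] by (simp add: algebra_simps del: upt_Suc)
qed (simp add: algebra_simps)

lemma nn_integral_brownian_bridge_grid:
  fixes w :: "'a::euclidean_space \<Rightarrow> ennreal"
  assumes \<beta>: "\<beta> > 0" and w: "w \<in> borel_measurable borel" and h: "h = \<beta> / real (Suc n)"
  shows "(\<integral>\<^sup>+\<omega>. (\<Prod>i=1..n. w (\<omega> (real i * h))) \<partial>brownian_bridge \<beta> x y) = trotter_kernel h w n x y"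
proof -
  let ?J = "(\<lambda>i. real i * h) ` {1..n}"
  have h0: "h > 0" using \<beta> h by simp
  have J: "finite ?J" "?J \<subseteq> {0<..<\<beta>}"
  proof -
    have "real i * h < \<beta>" if "i \<le> n" for i
    proof -
      have "real i * h < real (Suc n) * h" using that h0 by (intro mult_strict_right_mono) auto
      then show ?thesis using h by simp
    qed
    then show "?J \<subseteq> {0<..<\<beta>}" using h0 by auto
  qed simp
  have inj: "inj_on (\<lambda>i. real i * h) {1..n}" using h0 by (auto simp: inj_on_def)
  have s: "sorted_list_of_set ?J = map (\<lambda>i. real i * h) [1..<Suc n]"
  proof (rule sorted_distinct_set_unique)
    show "sorted (map (\<lambda>i. real i * h) [1..<Suc n])"
      unfolding sorted_map
      by (rule sorted_wrt_mono_rel[OF _ sorted_upt]) (use h0 in \<open>auto intro: mult_right_mono\<close>)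
    show "distinct (map (\<lambda>i. real i * h) [1..<Suc n])"
      using h0 by (simp add: distinct_map inj_on_def)
  qed (auto simp: atLeastLessThanSuc_atLeastAtMost)
  have "(\<Prod>i=1..n. w (\<omega> (real i * h))) = (\<Prod>j\<in>?J. w (\<omega> j))" for \<omega> :: "real \<Rightarrow> 'a"
    by (subst prod.reindex[OF inj]) (simp add: comp_def)
  then have "(\<integral>\<^sup>+\<omega>. (\<Prod>i=1..n. w (\<omega> (real i * h))) \<partial>brownian_bridge \<beta> x y)
     = bridge_integral 0 x (map (\<lambda>t. (t, w)) (sorted_list_of_set ?J)) \<beta> y"
    using nn_integral_brownian_bridge_prod[OF \<beta> J, of "\<lambda>_. w" x y] w by simp
  also have "\<dots> = bridge_integral 0 x (map (\<lambda>i. (0 + real i * h, w)) [1..<Suc n]) (0 + real (Suc n) * h) y"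
    unfolding s using h by (simp add: comp_def del: upt_Suc)
  also have "\<dots> = trotter_kernel h w n x y" by (rule bridge_integral_grid)
  finally show ?thesis .
qed

lemma measurable_trotter_kernel [measurable (raw)]:
  assumes w: "w \<in> borel_measurable borel" and "f \<in> borel_measurable M" "g \<in> borel_measurable M"
  shows "(\<lambda>p. trotter_kernel h w n (f p) (g p :: 'a::euclidean_space)) \<in> borel_measurable M"
proof -
  note w[measurable]
  have "(\<lambda>p::'a \<times> 'a. trotter_kernel h w n (fst p) (snd p)) \<in> borel_measurable (borel \<Otimes>\<^sub>M borel)"
  proof (induction n)
    case (Suc n)
    have "(\<lambda>q::('a \<times> 'a) \<times> 'a. trotter_kernel h w n (fst (snd q, snd (fst q))) (snd (snd q, snd (fst q)))) \<in> borel_measurable ((borel \<Otimes>\<^sub>M borel) \<Otimes>\<^sub>M lborel)"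
      by (rule measurable_compose[OF _ Suc]) measurable
    then have [measurable]: "(\<lambda>q::('a \<times> 'a) \<times> 'a. trotter_kernel h w n (snd q) (snd (fst q))) \<in> borel_measurable ((borel \<Otimes>\<^sub>M borel) \<Otimes>\<^sub>M lborel)"
      by simp
    show ?case by simp
  qed simp
  then have "(\<lambda>p. trotter_kernel h w n (fst (f p, g p)) (snd (f p, g p))) \<in> borel_measurable M"
    by (rule measurable_compose[rotated]) (use assms in measurable)
  then show ?thesis by simp
qed

text \<open>The grid has n + 1 intervals but the sum runs over its n interior points. It is the
  left-endpoint sum without the term at 0, and that term vanishes in the limit; uniform continuity
  handles the full sum.\<close>

lemma riemann_sum_tendsto:
  fixes f :: "real \<Rightarrow> real"
  assumes \<beta>: "\<beta> > 0" and f: "continuous_on {0..\<beta>} f"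
  shows "(\<lambda>n. (\<beta> / real (Suc n)) * (\<Sum>i=1..n. f (real i * (\<beta> / real (Suc n))))) \<longlonglongrightarrow> integral {0..\<beta>} f"
proof -
  let ?h = "\<lambda>n. \<beta> / real (Suc n)"
  have full: "(\<lambda>n. ?h n * (\<Sum>i<Suc n. f (real i * ?h n))) \<longlonglongrightarrow> integral {0..\<beta>} f"
  proof (rule LIMSEQ_I)
    fix r :: real assume r: "r > 0"
    define e where "e = r / (2 * \<beta>)"
    have e: "e > 0" using r \<beta> by (simp add: e_def)
    have "uniformly_continuous_on {0..\<beta>} f" using f by (intro compact_uniformly_continuous) auto
    then obtain d where d: "d > 0" and uc: "\<And>s t. s \<in> {0..\<beta>} \<Longrightarrow> t \<in> {0..\<beta>} \<Longrightarrow> dist s t < d \<Longrightarrow> dist (f s) (f t) < e"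
      using e unfolding uniformly_continuous_on_def by metis
    have "(\<lambda>n. ?h n) \<longlonglongrightarrow> 0" by (rule LIMSEQ_Suc, rule lim_const_over_n)
    then have "\<forall>\<^sub>F n in sequentially. ?h n < d" using d by (intro order_tendstoD) auto
    then obtain N where N: "\<And>n. n \<ge> N \<Longrightarrow> ?h n < d" by (auto simp: eventually_sequentially)
    show "\<exists>no. \<forall>n\<ge>no. norm (?h n * (\<Sum>i<Suc n. f (real i * ?h n)) - integral {0..\<beta>} f) < r"
    proof (intro exI[of _ N] allI impI)
      fix n assume n: "N \<le> n"
      define h where "h = ?h n"
      have h: "h > 0" "h < d" using \<beta> N[OF n] by (auto simp: h_def)
      have hn: "real (Suc n) * h = \<beta>" by (simp add: h_def)
      have sub: "{real i * h .. real (Suc i) * h} \<subseteq> {0..\<beta>}" if "i < Suc n" for i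
      proof -
        have "real (Suc i) * h \<le> real (Suc n) * h" using that h by (intro mult_right_mono) auto
        then show ?thesis using hn h by auto
      qed
      have int: "f integrable_on S" if "S = {u..v}" "S \<subseteq> {0..\<beta>}" for u v S
        using that f by (auto intro!: integrable_continuous_interval intro: continuous_on_subset simp del: atLeastatMost_subset_iff)
      have split: "integral {0..real k * h} f = (\<Sum>i<k. integral {real i * h .. real (Suc i) * h} f)" if "k \<le> Suc n" for k
        using that
      proof (induction k)
        case (Suc k)
        have "integral {0..real k * h} f + integral {real k * h..real (Suc k) * h} f = integral {0..real (Suc k) * h} f"
        proof (rule Henstock_Kurzweil_Integration.integral_combine)
          have "{0..real (Suc k) * h} \<subseteq> {0..\<beta>}"
            using Suc.prems h hn mult_right_mono[of "real (Suc k)" "real (Suc n)" h] by auto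
          then show "f integrable_on {0..real (Suc k) * h}" by (intro int) auto
        qed (use h in \<open>auto intro: mult_right_mono\<close>)
        then show ?case using Suc by simp
      qed simp
      have piece: "norm (integral {real i * h .. real (Suc i) * h} f - h * f (real i * h)) \<le> e * h" if i: "i < Suc n" for i
      proof -
        have c: "measure lborel {real i * h .. real (Suc i) * h} = h" using h by (simp add: algebra_simps)
        have "((\<lambda>t. f t - f (real i * h)) has_integral (integral {real i * h .. real (Suc i) * h} f - h *\<^sub>R f (real i * h))) {real i * h .. real (Suc i) * h}"
          using has_integral_const_real[of "f (real i * h)" "real i * h" "real (Suc i) * h"] h
          by (intro has_integral_diff integrable_integral int[OF refl sub[OF i]]) (simp add: algebra_simps)
        then have "norm (integral {real i * h .. real (Suc i) * h} f - h *\<^sub>R f (real i * h)) \<le> e * measure lborel {real i * h .. real (Suc i) * h}"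
        proof (rule has_integral_bound_real[rotated 2])
          fix t assume t: "t \<in> {real i * h .. real (Suc i) * h} - {}"
          have "t \<in> {0..\<beta>}" "real i * h \<in> {0..\<beta>}"
            by (rule subsetD[OF sub[OF i]]; use t h in \<open>simp add: algebra_simps\<close>)+
          then have "dist (f t) (f (real i * h)) < e"
            using t h by (intro uc) (auto simp: dist_real_def algebra_simps)
          then show "norm (f t - f (real i * h)) \<le> e" by (simp add: dist_norm)
        qed (use e in auto)
        then show ?thesis unfolding c by simp
      qed
      have "norm (h * (\<Sum>i<Suc n. f (real i * h)) - integral {0..\<beta>} f) = norm (\<Sum>i<Suc n. integral {real i * h .. real (Suc i) * h} f - h * f (real i * h))"
        using split[of "Suc n"] hn by (simp add: sum_subtractf sum_distrib_left norm_minus_commute del: sum.lessThan_Suc of_nat_Suc)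
      also have "\<dots> \<le> (\<Sum>i<Suc n. e * h)"
        by (rule sum_norm_le) (use piece in auto)
      also have "\<dots> = e * \<beta>" using hn by (simp add: mult.commute mult.left_commute)
      also have "\<dots> < r" using r \<beta> by (simp add: e_def)
      finally show "norm (?h n * (\<Sum>i<Suc n. f (real i * ?h n)) - integral {0..\<beta>} f) < r" by (simp add: h_def)
    qed
  qed
  have "(\<lambda>n. ?h n * f 0) \<longlonglongrightarrow> 0 * f 0"
    by (intro tendsto_mult tendsto_const, rule LIMSEQ_Suc, rule lim_const_over_n)
  with full have "(\<lambda>n. ?h n * (\<Sum>i<Suc n. f (real i * ?h n)) - ?h n * f 0) \<longlonglongrightarrow> integral {0..\<beta>} f - 0 * f 0"
    by (rule tendsto_diff)
  moreover have "?h n * (\<Sum>i<Suc n. f (real i * ?h n)) - ?h n * f 0 = ?h n * (\<Sum>i=1..n. f (real i * ?h n))" for n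
  proof -
    have "{..<Suc n} = insert 0 {1..n}" by auto
    then have "(\<Sum>i<Suc n. f (real i * ?h n)) = f 0 + (\<Sum>i=1..n. f (real i * ?h n))" by simp
    then show ?thesis by (simp add: distrib_left)
  qed
  ultimately show ?thesis by simp
qed

section \<open>The Feynman-Kac kernel of the box\<close>

locale box_potential =
  fixes \<beta> :: real and a b :: "'a::euclidean_space" and W :: "'a \<Rightarrow> ereal"
  assumes \<beta>_pos: "\<beta> > 0"
    and box_nonempty: "\<forall>i\<in>Basis. a \<bullet> i < b \<bullet> i"
    and W_finite: "\<forall>x\<in>cbox a b. \<bar>W x\<bar> \<noteq> \<infinity>"
    and W_continuous: "continuous_on (cbox a b) (\<lambda>x. real_of_ereal (W x))"
    and W_infinite: "\<forall>x. x \<notin> cbox a b \<longrightarrow> W x = \<infinity>"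
begin

abbreviation V :: "'a \<Rightarrow> real" where "V x \<equiv> real_of_ereal (W x)"

text \<open>The value 0 off the box is exp of minus infinity: the hard wall acts as a weight that
  kills the path.\<close>

definition boltzmann :: "real \<Rightarrow> 'a \<Rightarrow> ennreal" where
  "boltzmann h x = (if x \<in> cbox a b then ennreal (exp (- h * V x)) else 0)"

text \<open>The bound holds on the whole space because \<open>real_of_ereal\<close> sends infinity
  to 0, so \<open>V\<close> vanishes off the box.\<close>

lemma V_bounded: obtains C where "C > 0" "\<And>x. \<bar>V x\<bar> \<le> C"
proof -
  have "bounded (V ` cbox a b)"
    by (intro compact_imp_bounded compact_continuous_image W_continuous) simp
  then obtain C where C: "C > 0" "\<And>x. x \<in> cbox a b \<Longrightarrow> \<bar>V x\<bar> \<le> C"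
    by (auto simp: bounded_pos)
  have "\<bar>V x\<bar> \<le> C" for x
    using C W_infinite by (cases "x \<in> cbox a b") auto
  then show ?thesis using C(1) that by blast
qed

lemma V_measurable [measurable]: "V \<in> borel_measurable borel"
proof -
  have "(\<lambda>x. indicator (cbox a b) x *\<^sub>R V x) \<in> borel_measurable borel"
    by (rule borel_measurable_continuous_on_indicator) (use W_continuous in auto)
  also have "(\<lambda>x. indicator (cbox a b) x *\<^sub>R V x) = V"
    using W_infinite by (auto simp: indicator_def fun_eq_iff)
  finally show ?thesis .
qed

lemma boltzmann_measurable [measurable]: "boltzmann h \<in> borel_measurable borel"
  unfolding boltzmann_def by measurable

text \<open>For a path inside the box the exponents are Riemann sums. A path outside the box at some
  time is outside on a whole time interval, since the complement is open; fine grids have an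
  interior point in it, and then the product is exactly 0.\<close>

lemma boltzmann_prod_tendsto:
  assumes \<omega>: "\<omega> \<in> path_space \<beta>"
  shows "(\<lambda>n. \<Prod>i=1..n. boltzmann (\<beta> / real (Suc n)) (\<omega> (real i * (\<beta> / real (Suc n))))) \<longlonglongrightarrow> path_weight \<beta> W \<omega>"
proof -
  have c: "continuous_on {0..\<beta>} \<omega>" using \<omega> by (simp add: path_space_def)
  let ?h = "\<lambda>n. \<beta> / real (Suc n)"
  have inI: "real i * ?h n \<in> {0..\<beta>}" if "i \<le> Suc n" for i n
    using that \<beta>_pos by (auto simp: divide_simps)
  show ?thesis
  proof (cases "\<forall>s\<in>{0..\<beta>}. \<omega> s \<in> cbox a b")
    case True
    then have w: "path_weight \<beta> W \<omega> = ennreal (exp (- integral {0..\<beta>} (\<lambda>s. V (\<omega> s))))"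
      using W_finite by (force simp: path_weight_def)
    have "continuous_on {0..\<beta>} (\<lambda>s. V (\<omega> s))"
      by (rule continuous_on_compose2[OF W_continuous c]) (use True in auto)
    then have lim: "(\<lambda>n. ?h n * (\<Sum>i=1..n. V (\<omega> (real i * ?h n)))) \<longlonglongrightarrow> integral {0..\<beta>} (\<lambda>s. V (\<omega> s))"
      by (rule riemann_sum_tendsto[OF \<beta>_pos])
    have e: "(\<Prod>i=1..n. boltzmann (?h n) (\<omega> (real i * ?h n))) = ennreal (exp (- (?h n * (\<Sum>i=1..n. V (\<omega> (real i * ?h n))))))" for n
    proof -
      have "(\<Prod>i=1..n. boltzmann (?h n) (\<omega> (real i * ?h n))) = (\<Prod>i=1..n. ennreal (exp (- ?h n * V (\<omega> (real i * ?h n)))))"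
        using True inI[of _ n] by (intro prod.cong) (auto simp: boltzmann_def)
      also have "\<dots> = ennreal (exp (\<Sum>i=1..n. - ?h n * V (\<omega> (real i * ?h n))))"
        by (subst exp_sum) (auto simp: prod_ennreal)
      finally show ?thesis by (simp add: sum_distrib_left sum_negf)
    qed
    show ?thesis unfolding w e by (intro tendsto_ennrealI tendsto_exp tendsto_minus lim)
  next
    case False
    then obtain s where s: "s \<in> {0..\<beta>}" "\<omega> s \<notin> cbox a b" by auto
    then have w: "path_weight \<beta> W \<omega> = 0" using W_infinite by (auto simp: path_weight_def)
    have "open (- cbox a b)" by (simp add: closed_cbox open_Compl)
    then obtain d where d: "d > 0" "\<And>t. t \<in> {0..\<beta>} \<Longrightarrow> dist t s < d \<Longrightarrow> \<omega> t \<notin> cbox a b"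
    proof -
      obtain e where e: "e > 0" "\<And>u. dist u (\<omega> s) < e \<Longrightarrow> u \<in> - cbox a b"
        using \<open>open (- cbox a b)\<close> s(2) unfolding open_dist by blast
      obtain d where "d > 0" "\<And>t. t \<in> {0..\<beta>} \<Longrightarrow> dist t s < d \<Longrightarrow> dist (\<omega> t) (\<omega> s) < e"
        using c[unfolded continuous_on_iff, rule_format, OF s(1) e(1)] by blast
      then show ?thesis using e that by blast
    qed
    have "(\<lambda>n. ?h n) \<longlonglongrightarrow> 0" by (rule LIMSEQ_Suc, rule lim_const_over_n)
    then have "\<forall>\<^sub>F n in sequentially. ?h n < min d (\<beta> / 2)" using d \<beta>_pos by (intro order_tendstoD) auto
    then have "\<forall>\<^sub>F n in sequentially. (\<Prod>i=1..n. boltzmann (?h n) (\<omega> (real i * ?h n))) = 0"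
    proof eventually_elim
      case (elim n)
      define h where "h = ?h n"
      have h: "0 < h" "h < d" "h < \<beta> / 2" using elim \<beta>_pos by (auto simp: h_def)
      have "real (Suc n) * h = \<beta>" by (simp add: h_def)
      then have hn: "real n * h + h = \<beta>" by (simp add: algebra_simps)
      have n: "n \<ge> 1" using hn h by (cases n) auto
      define k where "k = nat \<lfloor>s / h\<rfloor>"
      have k: "real k \<le> s / h" "s / h < real k + 1"
        using s h by (auto simp: k_def)
      have k': "real k * h \<le> s" "s < real k * h + h"
        using k h by (auto simp: field_simps)
      have kn: "k \<le> Suc n"
      proof -
        have "real k * h \<le> real (Suc n) * h" using k' s hn by (simp add: algebra_simps)
        then show ?thesis using h by simp
      qed
      \<comment> \<open>Rounding the exit time down may hit an endpoint of the time interval, which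
        is not an interior grid point; its interior neighbour is still within one mesh
        width.\<close>
      obtain i where i: "i \<in> {1..n}" "\<bar>real i * h - s\<bar> \<le> h"
      proof -
        consider "k = 0" | "1 \<le> k" "k \<le> n" | "k = Suc n" using kn by linarith
        then show ?thesis
        proof cases
          case 1 then show ?thesis using k' s n h by (intro that[of 1]) auto
        next
          case 2 then show ?thesis using k' by (intro that[of k]) auto
        next
          case 3 then show ?thesis using k' s hn n h by (intro that[of n]) (auto simp: algebra_simps)
        qed
      qed
      have "\<omega> (real i * h) \<notin> cbox a b"
        using i h inI[of i n] by (intro d(2)) (auto simp: dist_real_def h_def)
      then have "boltzmann h (\<omega> (real i * h)) = 0" by (simp add: boltzmann_def)
      then show ?case using i(1) unfolding h_def[symmetric] by (intro prod_zero) auto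
    qed
    then show ?thesis unfolding w by (rule tendsto_eventually)
  qed
qed

lemma path_weight_measurable [measurable]: "path_weight \<beta> W \<in> borel_measurable (brownian_bridge \<beta> x y)"
proof (rule borel_measurable_LIMSEQ_order)
  show "(\<lambda>n. \<Prod>i=1..n. boltzmann (\<beta> / real (Suc n)) (\<omega> (real i * (\<beta> / real (Suc n))))) \<longlonglongrightarrow> path_weight \<beta> W \<omega>"
    if "\<omega> \<in> space (brownian_bridge \<beta> x y)" for \<omega>
    using that by (intro boltzmann_prod_tendsto) (simp add: space_brownian_bridge[OF \<beta>_pos])
  have "(\<lambda>\<omega>. boltzmann (\<beta> / real (Suc n)) (\<omega> (real i * (\<beta> / real (Suc n))))) \<in> borel_measurable (brownian_bridge \<beta> x y)"
    if "i \<in> {1..n}" for n i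
  proof (rule measurable_compose[OF measurable_brownian_bridge_component[OF \<beta>_pos] boltzmann_measurable])
    show "real i * (\<beta> / real (Suc n)) \<in> {0..\<beta>}" using that \<beta>_pos by (auto simp: divide_simps)
  qed
  then show "(\<lambda>\<omega>. \<Prod>i=1..n. boltzmann (\<beta> / real (Suc n)) (\<omega> (real i * (\<beta> / real (Suc n))))) \<in> borel_measurable (brownian_bridge \<beta> x y)" for n
    by (intro borel_measurable_prod_ennreal)
qed

definition fk_kernel :: "'a \<Rightarrow> 'a \<Rightarrow> ennreal" where
  "fk_kernel x y = (\<integral>\<^sup>+\<omega>. path_weight \<beta> W \<omega> \<partial>brownian_bridge \<beta> x y)"

text \<open>Dominated convergence on a finite measure: the n weights with mesh
  \<open>\<beta> / (n + 1)\<close> multiply to at most \<open>exp (\<beta> * C)\<close>.\<close>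

lemma trotter_tendsto:
  "(\<lambda>n. trotter_kernel (\<beta> / real (Suc n)) (boltzmann (\<beta> / real (Suc n))) n x y) \<longlonglongrightarrow> fk_kernel x y"
proof -
  obtain C where C: "C > 0" "\<And>x. \<bar>V x\<bar> \<le> C" using V_bounded by blast
  let ?h = "\<lambda>n. \<beta> / real (Suc n)"
  let ?u = "\<lambda>n \<omega>. \<Prod>i=1..n. boltzmann (?h n) (\<omega> (real i * ?h n))"
  have "(\<lambda>n. \<integral>\<^sup>+\<omega>. ?u n \<omega> \<partial>brownian_bridge \<beta> x y) \<longlonglongrightarrow> (\<integral>\<^sup>+\<omega>. path_weight \<beta> W \<omega> \<partial>brownian_bridge \<beta> x y)"
  proof (rule nn_integral_dominated_convergence[where w = "\<lambda>_. ennreal (exp (\<beta> * C))"])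
    fix n
    have "(\<lambda>\<omega>. boltzmann (\<beta> / real (Suc n)) (\<omega> (real i * (\<beta> / real (Suc n))))) \<in> borel_measurable (brownian_bridge \<beta> x y)"
      if "i \<in> {1..n}" for i
    proof (rule measurable_compose[OF measurable_brownian_bridge_component[OF \<beta>_pos] boltzmann_measurable])
      show "real i * (\<beta> / real (Suc n)) \<in> {0..\<beta>}" using that \<beta>_pos by (auto simp: divide_simps)
    qed
    then show "?u n \<in> borel_measurable (brownian_bridge \<beta> x y)"
      by (intro borel_measurable_prod_ennreal)
    have "?u n \<omega> \<le> ennreal (exp (\<beta> * C))" for \<omega>
    proof -
      have "?u n \<omega> \<le> (\<Prod>i=1..n. ennreal (exp (?h n * C)))"
      proof (intro prod_mono_ennreal)
        fix i
        have "?h n * (- V (\<omega> (real i * ?h n))) \<le> ?h n * C"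
          using abs_le_D2[OF C(2)] \<beta>_pos by (intro mult_left_mono) auto
        then show "boltzmann (?h n) (\<omega> (real i * ?h n)) \<le> ennreal (exp (?h n * C))"
          by (auto simp: boltzmann_def intro!: ennreal_leI)
      qed
      also have "\<dots> = ennreal (exp (real n * (?h n * C)))"
        by (simp add: ennreal_power exp_of_nat_mult[symmetric])
      also have "\<dots> \<le> ennreal (exp (\<beta> * C))"
        using \<beta>_pos C(1) by (intro ennreal_leI) (simp add: divide_simps)
      finally show ?thesis .
    qed
    then show "AE \<omega> in brownian_bridge \<beta> x y. ?u n \<omega> \<le> ennreal (exp (\<beta> * C))" by simp
  next
    show "(\<integral>\<^sup>+\<omega>. ennreal (exp (\<beta> * C)) \<partial>brownian_bridge \<beta> x y) < \<infinity>"
      by (simp add: emeasure_space_brownian_bridge[OF \<beta>_pos] ennreal_mult[symmetric])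
    show "AE \<omega> in brownian_bridge \<beta> x y. (\<lambda>n. ?u n \<omega>) \<longlonglongrightarrow> path_weight \<beta> W \<omega>"
      by (intro AE_I2 boltzmann_prod_tendsto) (simp add: space_brownian_bridge[OF \<beta>_pos])
  qed (simp_all add: path_weight_measurable)
  moreover have "(\<integral>\<^sup>+\<omega>. ?u n \<omega> \<partial>brownian_bridge \<beta> x y) = trotter_kernel (?h n) (boltzmann (?h n)) n x y" for n
    by (rule nn_integral_brownian_bridge_grid[OF \<beta>_pos boltzmann_measurable refl])
  ultimately show ?thesis unfolding fk_kernel_def by simp
qed

text \<open>For fixed endpoints the particles are independent, so the integral over the product of
  bridge measures factors into Feynman-Kac kernels.\<close>

lemma trace_sym_eq:
  "trace_sym \<beta> W N = ennreal (1 / fact N) *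
     (\<Sum>\<sigma> \<in> {\<sigma>. \<sigma> permutes {..<N}}. \<integral>\<^sup>+ x. (\<Prod>i<N. fk_kernel (x i) (x (\<sigma> i))) \<partial>PiM {..<N} (\<lambda>_. lborel))"
proof -
  have "(\<integral>\<^sup>+ \<omega>. (\<Prod>i<N. path_weight \<beta> W (\<omega> i)) \<partial>(PiM {..<N} (\<lambda>i. brownian_bridge \<beta> (x i) (x (\<sigma> i)))))
    = (\<Prod>i<N. fk_kernel (x i) (x (\<sigma> i)))" for x and \<sigma> :: "nat \<Rightarrow> nat"
  proof -
    interpret product_sigma_finite "\<lambda>i. brownian_bridge \<beta> (x i) (x (\<sigma> i))"
      by (intro product_sigma_finite.intro finite_measure.axioms(1) finite_measure_brownian_bridge[OF \<beta>_pos])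
    show ?thesis unfolding fk_kernel_def by (rule product_nn_integral_prod) auto
  qed
  then show ?thesis unfolding trace_sym_def by simp
qed

end

section \<open>Sums over permutations\<close>

abbreviation kernel_measurable :: "('a::euclidean_space \<Rightarrow> 'a \<Rightarrow> ennreal) \<Rightarrow> bool" where
  "kernel_measurable k \<equiv> (\<lambda>p. k (fst p) (snd p)) \<in> borel_measurable (borel \<Otimes>\<^sub>M borel)"

lemma kernel_measurable_compose:
  assumes "kernel_measurable k" "f \<in> borel_measurable M" "g \<in> borel_measurable M"
  shows "(\<lambda>x. k (f x) (g x)) \<in> borel_measurable M"
proof -
  have "(\<lambda>x. (f x, g x)) \<in> M \<rightarrow>\<^sub>M borel \<Otimes>\<^sub>M borel" using assms by measurable
  from measurable_compose[OF this assms(1)] show ?thesis by simp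
qed

definition kcomp :: "('a::euclidean_space \<Rightarrow> 'a \<Rightarrow> ennreal) \<Rightarrow> ('a \<Rightarrow> 'a \<Rightarrow> ennreal) \<Rightarrow> 'a \<Rightarrow> 'a \<Rightarrow> ennreal" where
  "kcomp k l x y = (\<integral>\<^sup>+z. k x z * l z y \<partial>lborel)"

definition ktrace :: "('a::euclidean_space \<Rightarrow> 'a \<Rightarrow> ennreal) \<Rightarrow> ennreal" where
  "ktrace k = (\<integral>\<^sup>+x. k x x \<partial>lborel)"

text \<open>With this indexing \<open>kpower k n\<close> is the power of exponent \<open>n + 1\<close>.\<close>

fun kpower :: "('a::euclidean_space \<Rightarrow> 'a \<Rightarrow> ennreal) \<Rightarrow> nat \<Rightarrow> 'a \<Rightarrow> 'a \<Rightarrow> ennreal" where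
  "kpower k 0 = k"
| "kpower k (Suc n) = kcomp k (kpower k n)"

lemma kernel_measurable_kcomp:
  assumes "kernel_measurable k" "kernel_measurable l" shows "kernel_measurable (kcomp k l)"
proof -
  note kernel_measurable_compose[OF assms(1), measurable (raw)] kernel_measurable_compose[OF assms(2), measurable (raw)]
  show ?thesis unfolding kcomp_def by measurable
qed

lemma kernel_measurable_kpower:
  "kernel_measurable k \<Longrightarrow> kernel_measurable (kpower k n)"
  by (induction n) (auto intro: kernel_measurable_kcomp)

lemma kcomp_assoc:
  assumes "kernel_measurable k" "kernel_measurable l" "kernel_measurable m"
  shows "kcomp (kcomp k l) m = kcomp k (kcomp l m)"
proof (intro ext)
  note assms[THEN kernel_measurable_compose, measurable (raw)]
  fix x y
  have "kcomp (kcomp k l) m x y = (\<integral>\<^sup>+z. (\<integral>\<^sup>+u. k x u * l u z * m z y \<partial>lborel) \<partial>lborel)"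
    unfolding kcomp_def by (simp add: nn_integral_multc)
  also have "\<dots> = (\<integral>\<^sup>+u. (\<integral>\<^sup>+z. k x u * l u z * m z y \<partial>lborel) \<partial>lborel)"
    by (rule lborel_pair.Fubini') measurable
  also have "\<dots> = kcomp k (kcomp l m) x y"
    unfolding kcomp_def by (simp add: nn_integral_cmult mult.assoc)
  finally show "kcomp (kcomp k l) m x y = kcomp k (kcomp l m) x y" .
qed

lemma kcomp_kpower:
  "kernel_measurable k \<Longrightarrow> kcomp (kpower k m) (kpower k n) = kpower k (m + n + 1)"
  by (induction m) (simp_all add: kcomp_assoc kernel_measurable_kpower)

lemma kpower_kpower:
  assumes "kernel_measurable k"
  shows "kpower (kpower k m) n = kpower k (Suc m * Suc n - 1)"
proof (induction n)
  case (Suc n)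
  have "m + (Suc m * Suc n - 1) + 1 = Suc m * Suc (Suc n) - 1" by simp
  then show ?case using Suc by (simp only: kpower.simps kcomp_kpower[OF assms])
qed simp

text \<open>Each label carries its own kernel, because removing a label composes its kernel with
  that of another label and leaves the rest unchanged.\<close>

definition perm_integral :: "'i set \<Rightarrow> ('i \<Rightarrow> 'a::euclidean_space \<Rightarrow> 'a \<Rightarrow> ennreal) \<Rightarrow> ennreal" where
  "perm_integral S k = (\<Sum>\<sigma> | \<sigma> permutes S. \<integral>\<^sup>+x. (\<Prod>i\<in>S. k i (x i) (x (\<sigma> i))) \<partial>PiM S (\<lambda>_. lborel))"

lemma perm_integral_empty: "perm_integral {} k = 1"
  by (simp add: perm_integral_def space_PiM)

text \<open>Integrating out the point with label \<open>a\<close> either splits off a fixed point of the permutation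
  or merges \<open>a\<close> into its predecessor \<open>j\<close> on the cycle.\<close>

lemma perm_integral_insert:
  fixes k :: "'i \<Rightarrow> 'a::euclidean_space \<Rightarrow> 'a \<Rightarrow> ennreal"
  assumes S: "finite S" "a \<notin> S" and k: "\<And>i. kernel_measurable (k i)"
  shows "perm_integral (insert a S) k
    = ktrace (k a) * perm_integral S k + (\<Sum>j\<in>S. perm_integral S (k(j := kcomp (k j) (k a))))"
proof -
  have comp: "(\<lambda>x. x i) \<in> borel_measurable (PiM T (\<lambda>_. lborel :: 'a measure))" if "i \<in> T" for i and T :: "'i set"
    using measurable_component_singleton[OF that, of "\<lambda>_. lborel :: 'a measure"] by simp
  have meas: "(\<lambda>x. \<Prod>i\<in>T. l i (x i) (x (\<sigma> i))) \<in> borel_measurable (PiM T (\<lambda>_. lborel :: 'a measure))"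
    if "\<sigma> permutes T" "\<And>i. kernel_measurable (l i)" for T \<sigma> and l :: "'i \<Rightarrow> 'a \<Rightarrow> 'a \<Rightarrow> ennreal"
  proof (rule borel_measurable_prod_ennreal)
    fix i assume "i \<in> T"
    then show "(\<lambda>x. l i (x i) (x (\<sigma> i))) \<in> borel_measurable (PiM T (\<lambda>_. lborel :: 'a measure))"
      by (intro kernel_measurable_compose[of "l i" "\<lambda>x. x i" _ "\<lambda>x. x (\<sigma> i)"] that comp) (simp_all add: permutes_in_image[OF that(1)])
  qed
  let ?I = "\<lambda>\<sigma>. \<integral>\<^sup>+x. (\<Prod>i\<in>insert a S. k i (x i) (x (\<sigma> i))) \<partial>PiM (insert a S) (\<lambda>_. lborel)"
  have ins: "?I \<sigma> = (\<integral>\<^sup>+x. (\<integral>\<^sup>+y. (\<Prod>i\<in>insert a S. k i ((fun_upd x a y) i) ((fun_upd x a y) (\<sigma> i))) \<partial>lborel) \<partial>PiM S (\<lambda>_. lborel))"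
    if "\<sigma> permutes insert a S" for \<sigma>
    by (rule lborel_product.product_nn_integral_insert[OF S meas[OF that k]])
  have fixed: "?I (Transposition.transpose a a \<circ> q) = ktrace (k a) * (\<integral>\<^sup>+x. (\<Prod>i\<in>S. k i (x i) (x (q i))) \<partial>PiM S (\<lambda>_. lborel))"
    if q: "q permutes S" for q
  proof -
    have qa: "q a = a" using q S by (simp add: permutes_def)
    have nq: "q i \<noteq> a" "i \<noteq> a" if "i \<in> S" for i using that q S permutes_in_image[OF q, of i] by auto
    have "?I q = (\<integral>\<^sup>+x. (\<integral>\<^sup>+y. k a y y * (\<Prod>i\<in>S. k i (x i) (x (q i))) \<partial>lborel) \<partial>PiM S (\<lambda>_. lborel))"
    proof (subst ins)
      show "q permutes insert a S" using q by (rule permutes_subset) auto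
      have "(\<Prod>i\<in>insert a S. k i ((fun_upd x a y) i) ((fun_upd x a y) (q i))) = k a y y * (\<Prod>i\<in>S. k i (x i) (x (q i)))" for x y
        using S qa nq by (simp cong: prod.cong)
      then show "(\<integral>\<^sup>+x. (\<integral>\<^sup>+y. (\<Prod>i\<in>insert a S. k i ((fun_upd x a y) i) ((fun_upd x a y) (q i))) \<partial>lborel) \<partial>PiM S (\<lambda>_. lborel))
        = (\<integral>\<^sup>+x. (\<integral>\<^sup>+y. k a y y * (\<Prod>i\<in>S. k i (x i) (x (q i))) \<partial>lborel) \<partial>PiM S (\<lambda>_. lborel))" by simp
    qed
    also have "\<dots> = ktrace (k a) * (\<integral>\<^sup>+x. (\<Prod>i\<in>S. k i (x i) (x (q i))) \<partial>PiM S (\<lambda>_. lborel))"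
    proof -
      have "(\<lambda>y. k a y y) \<in> borel_measurable lborel"
        by (rule kernel_measurable_compose[OF k]) simp_all
      then show ?thesis using meas[OF q k] unfolding ktrace_def
        by (simp add: nn_integral_multc nn_integral_cmult)
    qed
    finally show ?thesis by simp
  qed
  \<comment> \<open>Every permutation of the enlarged set is a transposition of \<open>a\<close>
    with some \<open>b\<close> after a permutation \<open>q\<close> of \<open>S\<close>. For
    \<open>b\<close> in \<open>S\<close> it maps \<open>j = inv q b\<close> to \<open>a\<close> and
    \<open>a\<close> to \<open>b\<close>, so \<open>a\<close> sits on the cycle between
    \<open>j\<close> and \<open>b\<close>; integrating over its point composes the two adjacent
    kernels.\<close>
  have moved: "?I (Transposition.transpose a b \<circ> q) = (\<integral>\<^sup>+x. (\<Prod>i\<in>S. (k(inv q b := kcomp (k (inv q b)) (k a))) i (x i) (x (q i))) \<partial>PiM S (\<lambda>_. lborel))"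
    if q: "q permutes S" and b: "b \<in> S" for q b
  proof -
    define j where "j = inv q b"
    define \<sigma> where "\<sigma> = Transposition.transpose a b \<circ> q"
    have j: "j \<in> S" "q j = b" using q b unfolding j_def
      by (auto simp: permutes_inverses permutes_in_image[OF permutes_inv])
    have ba: "b \<noteq> a" using b S by auto
    have qa: "q a = a" using q S by (simp add: permutes_def)
    have nq: "q i \<noteq> a" "i \<noteq> a" if "i \<in> S" for i using that q S permutes_in_image[OF q, of i] by auto
    have qb: "q i = b \<longleftrightarrow> i = j" for i using j permutes_inj[OF q] by (auto dest: injD)
    have \<sigma>: "\<sigma> permutes insert a S"
      unfolding \<sigma>_def by (rule permutes_compose[OF permutes_subset[OF q]]) (use b in \<open>auto intro: permutes_swap_id\<close>)
    have "?I \<sigma> = (\<integral>\<^sup>+x. (\<integral>\<^sup>+y. (k j (x j) y * k a y (x b)) * (\<Prod>i\<in>S - {j}. k i (x i) (x (q i))) \<partial>lborel) \<partial>PiM S (\<lambda>_. lborel))"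
    proof (subst ins[OF \<sigma>], intro nn_integral_cong)
      fix x and y :: 'a
      have "(\<Prod>i\<in>insert a S. k i ((fun_upd x a y) i) ((fun_upd x a y) (\<sigma> i)))
         = k a y (x b) * (\<Prod>i\<in>S. k i ((fun_upd x a y) i) ((fun_upd x a y) (\<sigma> i)))"
        using S ba by (simp add: \<sigma>_def qa)
      also have "(\<Prod>i\<in>S. k i ((fun_upd x a y) i) ((fun_upd x a y) (\<sigma> i)))
        = k j (x j) y * (\<Prod>i\<in>S - {j}. k i ((fun_upd x a y) i) ((fun_upd x a y) (\<sigma> i)))"
        using S j nq by (subst prod.remove[of S j]) (auto simp: \<sigma>_def)
      also have "(\<Prod>i\<in>S - {j}. k i ((fun_upd x a y) i) ((fun_upd x a y) (\<sigma> i))) = (\<Prod>i\<in>S - {j}. k i (x i) (x (q i)))"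
        using nq qb by (intro prod.cong) (auto simp: \<sigma>_def Transposition.transpose_def)
      finally show "(\<Prod>i\<in>insert a S. k i ((fun_upd x a y) i) ((fun_upd x a y) (\<sigma> i))) = (k j (x j) y * k a y (x b)) * (\<Prod>i\<in>S - {j}. k i (x i) (x (q i)))"
        by (simp add: mult_ac)
    qed
    also have "\<dots> = (\<integral>\<^sup>+x. kcomp (k j) (k a) (x j) (x b) * (\<Prod>i\<in>S - {j}. k i (x i) (x (q i))) \<partial>PiM S (\<lambda>_. lborel))"
    proof (intro nn_integral_cong)
      fix x :: "'i \<Rightarrow> 'a"
      have "(\<lambda>y. k j (x j) y) \<in> borel_measurable lborel" "(\<lambda>y. k a y (x b)) \<in> borel_measurable lborel"
        by (rule kernel_measurable_compose[OF k]; simp)+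
      then show "(\<integral>\<^sup>+y. (k j (x j) y * k a y (x b)) * (\<Prod>i\<in>S - {j}. k i (x i) (x (q i))) \<partial>lborel)
        = kcomp (k j) (k a) (x j) (x b) * (\<Prod>i\<in>S - {j}. k i (x i) (x (q i)))"
        unfolding kcomp_def by (intro nn_integral_multc) simp
    qed
    also have "\<dots> = (\<integral>\<^sup>+x. (\<Prod>i\<in>S. (k(j := kcomp (k j) (k a))) i (x i) (x (q i))) \<partial>PiM S (\<lambda>_. lborel))"
    proof (intro nn_integral_cong)
      fix x :: "'i \<Rightarrow> 'a"
      have "(\<Prod>i\<in>S. (k(j := kcomp (k j) (k a))) i (x i) (x (q i)))
        = (k(j := kcomp (k j) (k a))) j (x j) (x (q j)) * (\<Prod>i\<in>S - {j}. (k(j := kcomp (k j) (k a))) i (x i) (x (q i)))"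
        by (rule prod.remove) (use S j in auto)
      also have "(\<Prod>i\<in>S - {j}. (k(j := kcomp (k j) (k a))) i (x i) (x (q i))) = (\<Prod>i\<in>S - {j}. k i (x i) (x (q i)))"
        by (rule prod.cong) auto
      finally show "kcomp (k j) (k a) (x j) (x b) * (\<Prod>i\<in>S - {j}. k i (x i) (x (q i))) = (\<Prod>i\<in>S. (k(j := kcomp (k j) (k a))) i (x i) (x (q i)))"
        using j by simp
    qed
    finally show ?thesis by (simp add: \<sigma>_def j_def)
  qed
  have "perm_integral (insert a S) k = (\<Sum>b\<in>insert a S. \<Sum>q | q permutes S. ?I (Transposition.transpose a b \<circ> q))"
    unfolding perm_integral_def by (rule sum_over_permutations_insert) (use S in auto)
  also have "\<dots> = (\<Sum>q | q permutes S. ?I (Transposition.transpose a a \<circ> q)) + (\<Sum>b\<in>S. \<Sum>q | q permutes S. ?I (Transposition.transpose a b \<circ> q))"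
    using S by simp
  also have "(\<Sum>q | q permutes S. ?I (Transposition.transpose a a \<circ> q)) = ktrace (k a) * perm_integral S k"
    unfolding perm_integral_def sum_distrib_left by (intro sum.cong fixed) auto
  also have "(\<Sum>b\<in>S. \<Sum>q | q permutes S. ?I (Transposition.transpose a b \<circ> q)) = (\<Sum>q | q permutes S. \<Sum>b\<in>S. ?I (Transposition.transpose a b \<circ> q))"
    by (rule sum.swap)
  also have "\<dots> = (\<Sum>q | q permutes S. \<Sum>j\<in>S. \<integral>\<^sup>+x. (\<Prod>i\<in>S. (k(j := kcomp (k j) (k a))) i (x i) (x (q i))) \<partial>PiM S (\<lambda>_. lborel))"
  proof (rule sum.cong[OF refl])
    fix q assume "q \<in> {q. q permutes S}"
    then have q: "q permutes S" by simp
    show "(\<Sum>b\<in>S. ?I (Transposition.transpose a b \<circ> q)) = (\<Sum>j\<in>S. \<integral>\<^sup>+x. (\<Prod>i\<in>S. (k(j := kcomp (k j) (k a))) i (x i) (x (q i))) \<partial>PiM S (\<lambda>_. lborel))"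
      \<comment> \<open>For fixed \<open>q\<close> the successor \<open>b\<close> and the
        predecessor \<open>inv q b\<close> determine each other, so the sum over \<open>b\<close>
        becomes a sum over the label whose kernel is changed.\<close>
      by (rule sum.reindex_bij_witness[of _ q "inv q"])
        (use q in \<open>auto simp: permutes_inverses permutes_in_image permutes_in_image[OF permutes_inv] moved simp del: fun_upd_apply o_apply\<close>)
  qed
  also have "\<dots> = (\<Sum>j\<in>S. perm_integral S (k(j := kcomp (k j) (k a))))"
    unfolding perm_integral_def by (rule sum.swap)
  finally show ?thesis .
qed

lemma perm_integral_kpower_insert:
  fixes m :: "'i \<Rightarrow> nat"
  assumes "finite S" "a \<notin> S" "kernel_measurable k"
  shows "perm_integral (insert a S) (\<lambda>i. kpower k (m i))
    = ktrace (kpower k (m a)) * perm_integral S (\<lambda>i. kpower k (m i))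
      + (\<Sum>j\<in>S. perm_integral S (\<lambda>i. kpower k ((m(j := m j + m a + 1)) i)))"
proof -
  have "(\<lambda>i. kpower k (m i))(j := kcomp (kpower k (m j)) (kpower k (m a))) = (\<lambda>i. kpower k ((m(j := m j + m a + 1)) i))" for j
    using kcomp_kpower[OF assms(3)] by auto
  then show ?thesis
    using perm_integral_insert[OF assms(1,2), of "\<lambda>i. kpower k (m i)"] kernel_measurable_kpower[OF assms(3)] by simp
qed

text \<open>As \<open>m i + 1\<close> is the exponent attached to label \<open>i\<close>, merging
  conserves the total exponent. This invariant drives both inductions on the label set.\<close>

lemma sum_merge:
  fixes m :: "'i \<Rightarrow> nat"
  assumes "finite S" "a \<notin> S" "j \<in> S"
  shows "(\<Sum>i\<in>S. (m(j := m j + m a + 1)) i + 1) = (\<Sum>i\<in>insert a S. m i + 1)"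
proof -
  have "(\<Sum>i\<in>S. (m(j := m j + m a + 1)) i + 1) = (m j + m a + 2) + (\<Sum>i\<in>S - {j}. (m(j := m j + m a + 1)) i + 1)"
    using assms by (subst sum.remove[of S j]) auto
  also have "(\<Sum>i\<in>S - {j}. (m(j := m j + m a + 1)) i + 1) = (\<Sum>i\<in>S - {j}. m i + 1)"
    by (rule sum.cong) auto
  also have "(m j + m a + 2) + \<dots> = (m a + 1) + ((m j + 1) + (\<Sum>i\<in>S - {j}. m i + 1))" by simp
  also have "\<dots> = (\<Sum>i\<in>insert a S. m i + 1)"
    using assms by (simp add: sum.remove[of S j])
  finally show ?thesis .
qed

text \<open>Removing a label gives a factor \<open>C\<close> when it is a fixed point, plus one term
  for each of the \<open>card S\<close> labels it can merge with. All terms carry the same power of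
  \<open>r\<close>, so the factor gained is \<open>C + card S\<close>, the next factor of the
  Pochhammer symbol.\<close>

lemma perm_integral_kpower_le:
  fixes m :: "'i \<Rightarrow> nat"
  assumes k: "kernel_measurable k" and C: "C > 0" "r \<ge> 0"
    and tr: "\<And>n. ktrace (kpower k n) \<le> ennreal (C * r ^ (n + 1))" and S: "finite S"
  shows "perm_integral S (\<lambda>i. kpower k (m i)) \<le> ennreal (pochhammer C (card S) * r ^ (\<Sum>i\<in>S. m i + 1))"
  using S
proof (induction S arbitrary: m rule: finite_induct)
  case empty
  then show ?case by (simp add: perm_integral_empty)
next
  case (insert a S)
  let ?P = "pochhammer C (card S)" and ?s = "\<Sum>i\<in>insert a S. m i + 1"
  have P0: "?P \<ge> 0" using C by (intro pochhammer_nonneg) auto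
  have "perm_integral (insert a S) (\<lambda>i. kpower k (m i))
    \<le> ennreal (C * r ^ (m a + 1)) * ennreal (?P * r ^ (\<Sum>i\<in>S. m i + 1)) + (\<Sum>j\<in>S. ennreal (?P * r ^ ?s))"
    unfolding perm_integral_kpower_insert[OF insert(1,2) k]
  proof (intro add_mono mult_mono sum_mono tr insert.IH)
    fix j assume "j \<in> S"
    from insert.IH[of "m(j := m j + m a + 1)"] show "perm_integral S (\<lambda>i. kpower k ((m(j := m j + m a + 1)) i)) \<le> ennreal (?P * r ^ ?s)"
      unfolding sum_merge[OF insert(1,2) \<open>j \<in> S\<close>] .
  qed auto
  also have "\<dots> = ennreal (C * r ^ (m a + 1) * (?P * r ^ (\<Sum>i\<in>S. m i + 1)) + real (card S) * (?P * r ^ ?s))"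
    using C P0 by (simp add: ennreal_mult[symmetric] ennreal_plus[symmetric] ennreal_of_nat_eq_real_of_nat del: ennreal_plus)
  also have "C * r ^ (m a + 1) * (?P * r ^ (\<Sum>i\<in>S. m i + 1)) = C * ?P * r ^ ?s"
    using insert(1,2) by (simp add: power_add mult_ac)
  also have "C * ?P * r ^ ?s + real (card S) * (?P * r ^ ?s) = pochhammer C (card (insert a S)) * r ^ ?s"
    using insert(1,2) by (simp add: pochhammer_Suc distrib_left distrib_right mult_ac del: sum.insert)
  finally show ?case .
qed

text \<open>Keeping only the merging terms of the recursion keeps the permutations with a single
  cycle; the successive numbers of choices multiply to the factorial.\<close>

lemma perm_integral_kpower_ge:
  fixes m :: "'i \<Rightarrow> nat"
  assumes k: "kernel_measurable k" and S: "finite S" "S \<noteq> {}"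
  shows "ennreal (fact (card S - 1)) * ktrace (kpower k ((\<Sum>i\<in>S. m i + 1) - 1)) \<le> perm_integral S (\<lambda>i. kpower k (m i))"
  using S
proof (induction S arbitrary: m rule: finite_ne_induct)
  case (singleton a)
  then show ?case using perm_integral_kpower_insert[of "{}" a k m] k by (simp add: perm_integral_empty)
next
  case (insert a S)
  let ?t = "ktrace (kpower k ((\<Sum>i\<in>insert a S. m i + 1) - 1))"
  have "(\<Sum>j\<in>S. ennreal (fact (card S - 1)) * ?t) \<le> (\<Sum>j\<in>S. perm_integral S (\<lambda>i. kpower k ((m(j := m j + m a + 1)) i)))"
  proof (intro sum_mono)
    fix j assume "j \<in> S"
    from insert.IH[of "m(j := m j + m a + 1)"] show "ennreal (fact (card S - 1)) * ?t \<le> perm_integral S (\<lambda>i. kpower k ((m(j := m j + m a + 1)) i))"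
      unfolding sum_merge[OF insert(1,3) \<open>j \<in> S\<close>] .
  qed
  also have "\<dots> \<le> perm_integral (insert a S) (\<lambda>i. kpower k (m i))"
    unfolding perm_integral_kpower_insert[OF insert(1,3) k] by simp
  also have "(\<Sum>j\<in>S. ennreal (fact (card S - 1)) * ?t) = ennreal (real (card S) * fact (card S - 1)) * ?t"
    by (simp add: ennreal_mult ennreal_of_nat_eq_real_of_nat mult.assoc)
  also have "real (card S) * fact (card S - 1) = fact (card (insert a S) - 1)"
    using insert by (simp add: fact_reduce card_gt_0_iff)
  finally show ?case .
qed

section \<open>Traces of powers of kernels\<close>

lemma trotter_kernel_Suc_right:
  fixes w :: "'a::euclidean_space \<Rightarrow> ennreal"
  assumes w [measurable]: "w \<in> borel_measurable borel"
  shows "trotter_kernel h w (Suc n) x y = (\<integral>\<^sup>+z. trotter_kernel h w n x z * w z * ennreal (heat_kernel h z y) \<partial>lborel)"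
proof (induction n arbitrary: x)
  case (Suc n)
  have "trotter_kernel h w (Suc (Suc n)) x y
     = (\<integral>\<^sup>+u. (\<integral>\<^sup>+z. ennreal (heat_kernel h x u) * w u * (trotter_kernel h w n u z * w z * ennreal (heat_kernel h z y)) \<partial>lborel) \<partial>lborel)"
    by (subst trotter_kernel.simps, subst Suc.IH) (simp add: nn_integral_cmult)
  also have "\<dots> = (\<integral>\<^sup>+z. (\<integral>\<^sup>+u. ennreal (heat_kernel h x u) * w u * (trotter_kernel h w n u z * w z * ennreal (heat_kernel h z y)) \<partial>lborel) \<partial>lborel)"
    by (rule lborel_pair.Fubini') measurable
  also have "\<dots> = (\<integral>\<^sup>+z. (\<integral>\<^sup>+u. (ennreal (heat_kernel h x u) * w u * trotter_kernel h w n u z) * (w z * ennreal (heat_kernel h z y)) \<partial>lborel) \<partial>lborel)"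
    by (simp add: mult.assoc)
  also have "\<dots> = (\<integral>\<^sup>+z. trotter_kernel h w (Suc n) x z * w z * ennreal (heat_kernel h z y) \<partial>lborel)"
    by (subst nn_integral_multc) (auto simp: mult.assoc)
  finally show ?case .
qed simp

lemma trotter_kernel_commute:
  fixes w :: "'a::euclidean_space \<Rightarrow> ennreal"
  assumes w: "w \<in> borel_measurable borel"
  shows "trotter_kernel h w n x y = trotter_kernel h w n y x"
proof (induction n arbitrary: x y)
  case (Suc n)
  show ?case
    unfolding trotter_kernel_Suc_right[OF w, of h n x y] trotter_kernel.simps(2)[of h w n y x]
    by (intro nn_integral_cong) (simp add: Suc[of x] heat_kernel_commute[of h y] mult_ac)
qed (simp add: heat_kernel_commute)

lemma trotter_kernel_le:
  fixes w :: "'a::euclidean_space \<Rightarrow> ennreal"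
  assumes "h > 0" "c \<ge> 0" "\<And>z. w z \<le> ennreal c"
  shows "trotter_kernel h w n x y \<le> ennreal (c ^ n * heat_kernel (real (Suc n) * h) x y)"
proof (induction n arbitrary: x)
  case (Suc n)
  have "trotter_kernel h w (Suc n) x y \<le> (\<integral>\<^sup>+z. ennreal (heat_kernel h x z) * ennreal c * ennreal (c ^ n * heat_kernel (real (Suc n) * h) z y) \<partial>lborel)"
    unfolding trotter_kernel.simps by (intro nn_integral_mono mult_mono Suc assms) auto
  also have "\<dots> = (\<integral>\<^sup>+z. ennreal (c ^ Suc n) * (ennreal (heat_kernel h x z) * ennreal (heat_kernel (real (Suc n) * h) z y)) \<partial>lborel)"
    using assms by (intro nn_integral_cong) (simp add: ennreal_mult mult_ac)
  also have "\<dots> = ennreal (c ^ Suc n) * ennreal (heat_kernel (h + real (Suc n) * h) x y)"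
    using assms by (subst nn_integral_cmult) (auto simp: heat_kernel_Chapman_Kolmogorov)
  also have "h + real (Suc n) * h = real (Suc (Suc n)) * h" by (simp add: algebra_simps)
  finally show ?case using assms by (simp add: ennreal_mult)
qed (simp)

lemma ktrace_kcomp_transpose:
  assumes G: "kernel_measurable G"
  shows "ktrace (kcomp G (\<lambda>x y. G y x)) = (\<integral>\<^sup>+z. (\<integral>\<^sup>+u. (G u z)\<^sup>2 \<partial>lborel) \<partial>lborel)"
proof -
  note G[THEN kernel_measurable_compose, measurable (raw)]
  have "ktrace (kcomp G (\<lambda>x y. G y x)) = (\<integral>\<^sup>+u. (\<integral>\<^sup>+z. (G u z)\<^sup>2 \<partial>lborel) \<partial>lborel)"
    by (simp add: ktrace_def kcomp_def power2_eq_square)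
  also have "\<dots> = (\<integral>\<^sup>+z. (\<integral>\<^sup>+u. (G u z)\<^sup>2 \<partial>lborel) \<partial>lborel)"
    by (rule lborel_pair.Fubini') measurable
  finally show ?thesis .
qed

text \<open>An operator bound tested on nonnegative functions, which is what the columns of
  nonnegative kernels are.\<close>

definition form_bound :: "('a::euclidean_space \<Rightarrow> 'a \<Rightarrow> ennreal) \<Rightarrow> ennreal \<Rightarrow> bool" where
  "form_bound A \<theta> \<longleftrightarrow> (\<forall>g\<in>borel_measurable borel.
     (\<integral>\<^sup>+x. (\<integral>\<^sup>+y. g x * A x y * g y \<partial>lborel) \<partial>lborel) \<le> \<theta> * (\<integral>\<^sup>+x. (g x)\<^sup>2 \<partial>lborel))"

text \<open>By Fubini the trace of A G G^T is the integral over z of the quadratic form of A at the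
  column \<open>G x z\<close>, viewed as a function of x; without A the same computation yields the
  squared norms of the columns.\<close>

lemma ktrace_kcomp_form_bound:
  assumes A: "kernel_measurable A" and G: "kernel_measurable G" and FB: "form_bound A \<theta>"
  shows "ktrace (kcomp A (kcomp G (\<lambda>x y. G y x))) \<le> \<theta> * ktrace (kcomp G (\<lambda>x y. G y x))"
proof -
  note A[THEN kernel_measurable_compose, measurable (raw)] G[THEN kernel_measurable_compose, measurable (raw)]
  have "ktrace (kcomp A (kcomp G (\<lambda>x y. G y x))) = (\<integral>\<^sup>+x. (\<integral>\<^sup>+y. (\<integral>\<^sup>+z. G x z * A x y * G y z \<partial>lborel) \<partial>lborel) \<partial>lborel)"
    by (simp add: ktrace_def kcomp_def nn_integral_cmult[symmetric] mult_ac)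
  also have "\<dots> = (\<integral>\<^sup>+x. (\<integral>\<^sup>+z. (\<integral>\<^sup>+y. G x z * A x y * G y z \<partial>lborel) \<partial>lborel) \<partial>lborel)"
    by (intro nn_integral_cong lborel_pair.Fubini') measurable
  also have "\<dots> = (\<integral>\<^sup>+z. (\<integral>\<^sup>+x. (\<integral>\<^sup>+y. G x z * A x y * G y z \<partial>lborel) \<partial>lborel) \<partial>lborel)"
    by (rule lborel_pair.Fubini') measurable
  also have "\<dots> \<le> (\<integral>\<^sup>+z. \<theta> * (\<integral>\<^sup>+x. (G x z)\<^sup>2 \<partial>lborel) \<partial>lborel)"
    using FB unfolding form_bound_def by (intro nn_integral_mono) auto
  also have "\<dots> = \<theta> * ktrace (kcomp G (\<lambda>x y. G y x))"
    unfolding ktrace_kcomp_transpose[OF G] by (rule nn_integral_cmult) measurable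
  finally show ?thesis .
qed

lemma kcomp_transpose: "kcomp k l x y = kcomp (\<lambda>x y. l y x) (\<lambda>x y. k y x) y x"
  by (simp add: kcomp_def mult.commute)

lemma kpower_commute:
  assumes k: "kernel_measurable k" and sym: "\<And>x y. k x y = k y x"
  shows "kpower k n x y = kpower k n y x"
proof (induction n arbitrary: x y)
  case (Suc n)
  have e: "(\<lambda>x y. kpower k n y x) = kpower k n" "(\<lambda>x y. k y x) = k" using Suc sym by auto
  have "kpower k (Suc n) x y = kcomp (\<lambda>x y. kpower k n y x) (\<lambda>x y. k y x) y x"
    unfolding kpower.simps by (rule kcomp_transpose)
  also have "\<dots> = kpower k (Suc n) y x"
    unfolding e using kcomp_kpower[OF k, of n 0] by simp
  finally show ?case .
qed (simp, rule sym)

text \<open>A square root \<open>S\<close> of \<open>A\<close> is only needed to pass from odd to even powers.\<close>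

lemma ktrace_kpower_step:
  assumes A: "kernel_measurable A" and S: "kernel_measurable S"
    and AS: "A = kcomp S (\<lambda>x y. S y x)" and FB: "form_bound A \<theta>" and m: "m \<ge> 1"
  shows "ktrace (kpower A (Suc m)) \<le> \<theta> * ktrace (kpower A m)"
proof -
  have sym: "A x y = A y x" for x y
    unfolding AS by (simp add: kcomp_def mult.commute)
  have T: "kernel_measurable (\<lambda>x y. G y x)" if "kernel_measurable G" for G :: "'a \<Rightarrow> 'a \<Rightarrow> ennreal"
    by (rule kernel_measurable_compose[OF that]) auto
  \<comment> \<open>\<open>kpower A m\<close> has exponent m + 1. For odd m this exponent is even
    and half of the power serves as G; for even m the middle copy of A is split into S and its
    transpose.\<close>
  have "\<exists>G. kernel_measurable G \<and> kpower A m = kcomp G (\<lambda>x y. G y x)"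
  proof (cases "odd m")
    case True
    then obtain i where i: "m = 2 * i + 1" by (rule oddE)
    have "(\<lambda>x y. kpower A i y x) = kpower A i"
      by (intro ext) (rule kpower_commute[OF A sym, symmetric])
    then show ?thesis using kcomp_kpower[OF A, of i i] i
      by (intro exI[of _ "kpower A i"]) (simp add: kernel_measurable_kpower[OF A] mult_2)
  next
    case False
    then obtain j where "m = 2 * j" by (auto elim: evenE)
    then obtain i where i: "m = 2 * i + 2" using m by (cases j) auto
    let ?G = "kcomp (kpower A i) S"
    have "(\<lambda>x y. kpower A i y x) = kpower A i"
      by (intro ext) (rule kpower_commute[OF A sym, symmetric])
    then have t: "(\<lambda>x y. ?G y x) = kcomp (\<lambda>x y. S y x) (kpower A i)"
      by (intro ext) (simp add: kcomp_transpose[of "kpower A i"])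
    note meas = A S T[OF S] kernel_measurable_kpower[OF A] kernel_measurable_kcomp
    have "kcomp ?G (\<lambda>x y. ?G y x) = kcomp (kpower A i) (kcomp (kcomp S (\<lambda>x y. S y x)) (kpower A i))"
      unfolding t by (simp add: kcomp_assoc meas)
    also have "\<dots> = kpower A m" using kcomp_kpower[OF A, of i "Suc i"] i
      unfolding AS[symmetric] by (simp add: mult_2)
    finally show ?thesis by (intro exI[of _ ?G]) (simp add: meas)
  qed
  then obtain G where "kernel_measurable G" "kpower A m = kcomp G (\<lambda>x y. G y x)" by blast
  then show ?thesis using ktrace_kcomp_form_bound[OF A _ FB, of G] by simp
qed

lemma ktrace_kpower_add_le:
  assumes "kernel_measurable A" "kernel_measurable S"
    and "A = kcomp S (\<lambda>x y. S y x)" "form_bound A \<theta>" "m \<ge> 1"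
  shows "ktrace (kpower A (m + j)) \<le> \<theta> ^ j * ktrace (kpower A m)"
proof (induction j)
  case (Suc j)
  have "ktrace (kpower A (m + Suc j)) \<le> \<theta> * ktrace (kpower A (m + j))"
    using ktrace_kpower_step[OF assms(1-4), of "m + j"] assms(5) by simp
  also have "\<dots> \<le> \<theta> * (\<theta> ^ j * ktrace (kpower A m))" by (intro mult_left_mono Suc) simp
  finally show ?case by (simp add: mult.assoc)
qed simp

section \<open>Convergence of powers and traces\<close>

text \<open>The uniform bound on a set of finite measure is part of the induction, since it is the
  dominating function for the next composition.\<close>

lemma kpower_tendsto:
  fixes k :: "nat \<Rightarrow> 'a::euclidean_space \<Rightarrow> 'a \<Rightarrow> ennreal"
  assumes meas: "\<And>n. kernel_measurable (k n)" "kernel_measurable l"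
    and lim: "\<And>x y. (\<lambda>n. k n x y) \<longlonglongrightarrow> l x y"
    and B: "B \<in> sets borel" "emeasure lborel B < \<infinity>"
    and bound: "\<And>n x y. k n x y \<le> ennreal M * indicator B x * indicator B y"
  shows "\<exists>M'. (\<forall>n x y. kpower (k n) j x y \<le> ennreal M' * indicator B x * indicator B y) \<and>
           (\<forall>x y. (\<lambda>n. kpower (k n) j x y) \<longlonglongrightarrow> kpower l j x y)"
proof (induction j)
  case (Suc j)
  then obtain M' where M': "\<And>n x y. kpower (k n) j x y \<le> ennreal M' * indicator B x * indicator B y"
    and lim': "\<And>x y. (\<lambda>n. kpower (k n) j x y) \<longlonglongrightarrow> kpower l j x y" by blast
  obtain L where L: "emeasure lborel B = ennreal L" "L \<ge> 0" using B by (cases "emeasure lborel B") auto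
  have pb: "k n x z * kpower (k n) j z y \<le> ennreal M * ennreal M' * indicator B x * indicator B y * indicator B z" for n x y z
  proof -
    have "k n x z * kpower (k n) j z y \<le> (ennreal M * indicator B x * indicator B z) * (ennreal M' * indicator B z * indicator B y)"
      by (intro mult_mono bound M') auto
    also have "\<dots> = ennreal M * ennreal M' * indicator B x * indicator B y * indicator B z"
      by (auto simp: indicator_def)
    finally show ?thesis .
  qed
  \<comment> \<open>The maxima with 0 are there because \<open>ennreal\<close> truncates negative
    reals, and the signs of \<open>M\<close> and \<open>M'\<close> are not fixed.\<close>
  have ki: "(\<integral>\<^sup>+z. ennreal M * ennreal M' * indicator B x * indicator B y * indicator B z \<partial>lborel) = ennreal (max 0 M * max 0 M' * L) * indicator B x * indicator B y" for x y
    using B L by (subst nn_integral_cmult) (auto simp: ennreal_mult ennreal_max_0 mult_ac)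
  show ?case
  proof (intro exI[of _ "max 0 M * max 0 M' * L"] conjI allI)
    fix n x y
    have "kpower (k n) (Suc j) x y \<le> (\<integral>\<^sup>+z. ennreal M * ennreal M' * indicator B x * indicator B y * indicator B z \<partial>lborel)"
      unfolding kpower.simps kcomp_def by (intro nn_integral_mono pb)
    then show "kpower (k n) (Suc j) x y \<le> ennreal (max 0 M * max 0 M' * L) * indicator B x * indicator B y"
      unfolding ki .
  next
    fix x y
    note km = kernel_measurable_compose[OF meas(1)] kernel_measurable_compose[OF meas(2)]
      kernel_measurable_compose[OF kernel_measurable_kpower[OF meas(1)]] kernel_measurable_compose[OF kernel_measurable_kpower[OF meas(2)]]
    show "(\<lambda>n. kpower (k n) (Suc j) x y) \<longlonglongrightarrow> kpower l (Suc j) x y"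
      unfolding kpower.simps kcomp_def
    proof (rule nn_integral_dominated_convergence[where w = "\<lambda>z. ennreal M * ennreal M' * indicator B x * indicator B y * indicator B z"])
      show "(\<lambda>z. k n x z * kpower (k n) j z y) \<in> borel_measurable lborel" for n
        by (intro borel_measurable_times_ennreal; rule km; simp)
      show "(\<lambda>z. l x z * kpower l j z y) \<in> borel_measurable lborel"
        by (intro borel_measurable_times_ennreal; rule km; simp)
      show "(\<integral>\<^sup>+z. ennreal M * ennreal M' * indicator B x * indicator B y * indicator B z \<partial>lborel) < \<infinity>"
        unfolding ki by (auto simp: indicator_def)
      \<comment> \<open>Multiplication in \<open>ennreal\<close> is not continuous where 0 meets
        infinity, so the limits must first be seen to be finite.\<close>
      have lt: "l x z \<noteq> \<top>" "kpower l j z y \<noteq> \<top>" for z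
      proof -
        have "k n x z \<le> ennreal M" "kpower (k n) j z y \<le> ennreal M'" for n
          by (rule order_trans[OF bound], simp add: indicator_def) (rule order_trans[OF M'], simp add: indicator_def)
        then have "l x z \<le> ennreal M" "kpower l j z y \<le> ennreal M'"
          using LIMSEQ_le_const2[OF lim] LIMSEQ_le_const2[OF lim'] by blast+
        then show "l x z \<noteq> \<top>" "kpower l j z y \<noteq> \<top>" by (auto simp: top_unique)
      qed
      show "AE z in lborel. (\<lambda>n. k n x z * kpower (k n) j z y) \<longlonglongrightarrow> l x z * kpower l j z y"
        by (intro AE_I2 tendsto_mult_ennreal lim lim') (use lt in auto)
    qed (use B pb in auto)
  qed
qed (use bound lim in \<open>auto intro!: exI[of _ M]\<close>)

lemma ktrace_kpower_tendsto:
  fixes k :: "nat \<Rightarrow> 'a::euclidean_space \<Rightarrow> 'a \<Rightarrow> ennreal"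
  assumes meas: "\<And>n. kernel_measurable (k n)" "kernel_measurable l"
    and lim: "\<And>x y. (\<lambda>n. k n x y) \<longlonglongrightarrow> l x y"
    and B: "B \<in> sets borel" "emeasure lborel B < \<infinity>"
    and bound: "\<And>n x y. k n x y \<le> ennreal M * indicator B x * indicator B y"
  shows "(\<lambda>n. ktrace (kpower (k n) j)) \<longlonglongrightarrow> ktrace (kpower l j)"
proof -
  obtain M' where M': "\<And>n x y. kpower (k n) j x y \<le> ennreal M' * indicator B x * indicator B y"
    and lim': "\<And>x y. (\<lambda>n. kpower (k n) j x y) \<longlonglongrightarrow> kpower l j x y" using kpower_tendsto[OF assms] by blast
  show ?thesis unfolding ktrace_def
  proof (rule nn_integral_dominated_convergence[where w = "\<lambda>x. ennreal M' * indicator B x"])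
    show "(\<lambda>x. kpower (k n) j x x) \<in> borel_measurable lborel" for n
      by (rule kernel_measurable_compose[OF kernel_measurable_kpower[OF meas(1)]]) auto
    show "(\<lambda>x. kpower l j x x) \<in> borel_measurable lborel"
      by (rule kernel_measurable_compose[OF kernel_measurable_kpower[OF meas(2)]]) auto
    show "AE x in lborel. kpower (k n) j x x \<le> ennreal M' * indicator B x" for n
      using M'[of n] by (intro AE_I2) (metis (no_types, lifting) indicator_simps mult.right_neutral mult_zero_right)
    show "(\<integral>\<^sup>+x. ennreal M' * indicator B x \<partial>lborel) < \<infinity>"
      using B by (subst nn_integral_cmult_indicator) (auto simp: ennreal_mult_less_top)
  qed (use B lim' in auto)
qed

section \<open>The symmetrised Trotter step\<close>

context box_potential
begin

text \<open>Half of the weight is placed at each end. The kernel is then symmetric, and at an inner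
  point of a power the two halves recombine to a full Boltzmann factor.\<close>

definition step_kernel :: "real \<Rightarrow> 'a \<Rightarrow> 'a \<Rightarrow> ennreal" where
  "step_kernel h x y = boltzmann (h / 2) x * ennreal (heat_kernel h x y) * boltzmann (h / 2) y"

lemma boltzmann_half: "boltzmann (h / 2) z * boltzmann (h / 2) z = boltzmann h z"
  by (simp add: boltzmann_def ennreal_mult[symmetric] exp_add[symmetric])

lemma kernel_measurable_step: "kernel_measurable (step_kernel h)"
  unfolding step_kernel_def by measurable

lemma kpower_step_kernel:
  "kpower (step_kernel h) n x y = boltzmann (h / 2) x * trotter_kernel h (boltzmann h) n x y * boltzmann (h / 2) y"
proof (induction n arbitrary: x)
  case (Suc n)
  have "kpower (step_kernel h) (Suc n) x y = (\<integral>\<^sup>+z. (boltzmann (h / 2) x * boltzmann (h / 2) y) * (ennreal (heat_kernel h x z) * (boltzmann (h / 2) z * boltzmann (h / 2) z) * trotter_kernel h (boltzmann h) n z y) \<partial>lborel)"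
    by (simp add: kcomp_def Suc step_kernel_def mult_ac)
  also have "\<dots> = (boltzmann (h / 2) x * boltzmann (h / 2) y) * trotter_kernel h (boltzmann h) (Suc n) x y"
    unfolding boltzmann_half by (simp add: nn_integral_cmult)
  finally show ?case by (simp add: mult_ac)
qed (simp add: step_kernel_def)

text \<open>A square root in the sense A = S S^T: the heat step is split into two steps of half the
  length, with no weight at the intermediate point.\<close>

definition sqrt_step :: "real \<Rightarrow> 'a \<Rightarrow> 'a \<Rightarrow> ennreal" where
  "sqrt_step h x z = boltzmann (h / 2) x * ennreal (heat_kernel (h / 2) x z)"

lemma kernel_measurable_sqrt_step: "kernel_measurable (sqrt_step h)"
  unfolding sqrt_step_def by measurable

lemma step_kernel_eq_sqrt:
  assumes "h > 0" shows "step_kernel h = kcomp (sqrt_step h) (\<lambda>x y. sqrt_step h y x)"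
proof (intro ext)
  fix x y
  have "kcomp (sqrt_step h) (\<lambda>x y. sqrt_step h y x) x y
     = (\<integral>\<^sup>+z. (boltzmann (h / 2) x * boltzmann (h / 2) y) * (ennreal (heat_kernel (h / 2) x z) * ennreal (heat_kernel (h / 2) z y)) \<partial>lborel)"
    by (simp add: kcomp_def sqrt_step_def heat_kernel_commute[of "h / 2" y] mult_ac)
  also have "\<dots> = step_kernel h x y"
    using heat_kernel_Chapman_Kolmogorov[of "h / 2" "h / 2" x y] assms
    by (simp add: nn_integral_cmult step_kernel_def) (simp add: mult_ac)
  finally show "step_kernel h x y = kcomp (sqrt_step h) (\<lambda>x y. sqrt_step h y x) x y" ..
qed

lemma fk_kernel_measurable: "kernel_measurable fk_kernel"
  by (rule borel_measurable_LIMSEQ_order[OF trotter_tendsto]) measurable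

text \<open>The prescribed marginals concern interior times, so the starting point of the path is
  not directly available and the Trotter approximants are estimated instead. Their first step must
  jump from x into the box, over a distance at least d. The fourth-power bound makes this cost
  O(h^2) while doubling the time of that step, and the remaining factors stay bounded.\<close>

lemma fk_kernel_outside: assumes x: "x \<notin> cbox a b" shows "fk_kernel x y = 0"
proof -
  obtain C where C: "C > 0" "\<And>x. \<bar>V x\<bar> \<le> C" using V_bounded by blast
  have "open (- cbox a b)" by (simp add: closed_cbox open_Compl)
  then obtain d where d: "d > 0" "\<And>z. z \<in> cbox a b \<Longrightarrow> d \<le> norm (z - x)"
    using x unfolding open_dist by (metis ComplI ComplD dist_norm not_less)
  let ?h = "\<lambda>n. \<beta> / real (Suc n)"
  have bb: "boltzmann (?h n) z \<le> ennreal (exp (?h n * C)) * indicator (cbox a b) z" for n z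
  proof -
    have "?h n * (- V z) \<le> ?h n * C" using abs_le_D2[OF C(2)] \<beta>_pos by (intro mult_left_mono) auto
    then show ?thesis by (auto simp: boltzmann_def intro!: ennreal_leI)
  qed
  define K where "K = gauss4 TYPE('a) / d ^ 4 * exp (\<beta> * C) * (4 * pi * \<beta>) powr (- real DIM('a) / 2)"
  \<comment> \<open>Shifted by one, because the approximant of index 0 is a bare heat kernel without
    an intermediate point in the box.\<close>
  have est: "trotter_kernel (?h (Suc n)) (boltzmann (?h (Suc n))) (Suc n) x y \<le> ennreal (K * (?h (Suc n))\<^sup>2)" for n
  proof -
    define h where "h = ?h (Suc n)"
    have h: "h > 0" "real (Suc (Suc n)) * h = \<beta>" using \<beta>_pos by (auto simp: h_def)
    have h2: "2 * h + real (Suc n) * h \<ge> \<beta>" "real (Suc n) * h \<le> \<beta>" using h by (auto simp: algebra_simps)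
    have bb1: "boltzmann h z \<le> ennreal (exp (h * C))" for z
      using bb[of "Suc n" z] unfolding h_def[symmetric] by (rule order_trans) (auto simp: indicator_def)
    have "trotter_kernel h (boltzmann h) (Suc n) x y
      \<le> (\<integral>\<^sup>+z. ennreal (exp (h * C) ^ Suc n * (gauss4 TYPE('a) / d ^ 4 * h\<^sup>2)) * (ennreal (heat_kernel (2 * h) x z) * ennreal (heat_kernel (real (Suc n) * h) z y)) \<partial>lborel)"
      unfolding trotter_kernel.simps
    proof (intro nn_integral_mono)
      fix z
      have 1: "ennreal (heat_kernel h x z) * indicator (cbox a b) z \<le> ennreal (gauss4 TYPE('a) / d ^ 4 * h\<^sup>2 * heat_kernel (2 * h) x z)"
      proof (cases "z \<in> cbox a b")
        case True
        have "d ^ 4 * heat_kernel h x z \<le> norm (z - x) ^ 4 * heat_kernel h 0 (z - x)"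
          unfolding heat_kernel_diff[of h x] using d(1) d(2)[OF True] by (intro mult_right_mono power_mono) auto
        also have "\<dots> \<le> gauss4 TYPE('a) * h\<^sup>2 * heat_kernel (2 * h) 0 (z - x)"
          using norm4_heat_kernel_le[OF h(1), of "z - x"] by (simp add: gauss4_def mult_ac)
        finally have "heat_kernel h x z \<le> gauss4 TYPE('a) * h\<^sup>2 * heat_kernel (2 * h) 0 (z - x) / d ^ 4"
          using d(1) by (simp add: le_divide_eq mult.commute)
        then show ?thesis using True
          by (auto simp: heat_kernel_diff[of "2 * h" x] intro!: ennreal_leI)
      qed simp
      have "ennreal (heat_kernel h x z) * boltzmann h z * trotter_kernel h (boltzmann h) n z y
        \<le> ennreal (heat_kernel h x z) * (ennreal (exp (h * C)) * indicator (cbox a b) z) * ennreal (exp (h * C) ^ n * heat_kernel (real (Suc n) * h) z y)"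
        using bb[of "Suc n" z] bb1 h(1) unfolding h_def[symmetric]
        by (intro mult_mono trotter_kernel_le) auto
      also have "\<dots> = (ennreal (heat_kernel h x z) * indicator (cbox a b) z) * ennreal (exp (h * C) ^ Suc n * heat_kernel (real (Suc n) * h) z y)"
        by (simp add: ennreal_mult mult_ac)
      also have "\<dots> \<le> ennreal (gauss4 TYPE('a) / d ^ 4 * h\<^sup>2 * heat_kernel (2 * h) x z) * ennreal (exp (h * C) ^ Suc n * heat_kernel (real (Suc n) * h) z y)"
        by (intro mult_right_mono 1) auto
      also have "\<dots> = ennreal (exp (h * C) ^ Suc n * (gauss4 TYPE('a) / d ^ 4 * h\<^sup>2)) * (ennreal (heat_kernel (2 * h) x z) * ennreal (heat_kernel (real (Suc n) * h) z y))"
        using gauss4_pos[where 'a = 'a] d(1) by (simp add: ennreal_mult[symmetric] mult_ac less_imp_le)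
      finally show "ennreal (heat_kernel h x z) * boltzmann h z * trotter_kernel h (boltzmann h) n z y \<le> \<dots>" .
    qed
    also have "\<dots> = ennreal (exp (h * C) ^ Suc n * (gauss4 TYPE('a) / d ^ 4 * h\<^sup>2)) * ennreal (heat_kernel (2 * h + real (Suc n) * h) x y)"
      using h(1) by (subst nn_integral_cmult) (auto simp: heat_kernel_Chapman_Kolmogorov)
    also have "\<dots> = ennreal (exp (h * C) ^ Suc n * (gauss4 TYPE('a) / d ^ 4 * h\<^sup>2) * heat_kernel (2 * h + real (Suc n) * h) x y)"
      using gauss4_pos[where 'a = 'a] d(1) by (intro ennreal_mult[symmetric]) (auto simp: less_imp_le)
    also have "\<dots> \<le> ennreal (exp (\<beta> * C) * (gauss4 TYPE('a) / d ^ 4 * h\<^sup>2) * (4 * pi * \<beta>) powr (- real DIM('a) / 2))"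
    proof (intro ennreal_leI mult_mono)
      have "exp (h * C) ^ Suc n = exp ((real (Suc n) * h) * C)" by (simp add: exp_of_nat_mult[symmetric] mult.assoc del: of_nat_Suc power_Suc)
      also have "\<dots> \<le> exp (\<beta> * C)" using h2(2) C(1) by simp
      finally show "exp (h * C) ^ Suc n \<le> exp (\<beta> * C)" .
      have "heat_kernel (2 * h + real (Suc n) * h) x y \<le> (4 * pi * (2 * h + real (Suc n) * h)) powr (- real DIM('a) / 2)"
        using h by (intro heat_kernel_le) auto
      also have "\<dots> \<le> (4 * pi * \<beta>) powr (- real DIM('a) / 2)"
        using h2(1) \<beta>_pos by (intro powr_mono2') auto
      finally show "heat_kernel (2 * h + real (Suc n) * h) x y \<le> (4 * pi * \<beta>) powr (- real DIM('a) / 2)" .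
    qed (use gauss4_pos[where 'a = 'a] in \<open>auto simp: less_imp_le\<close>)
    finally show ?thesis by (simp add: K_def h_def mult_ac)
  qed
  have "(\<lambda>n. trotter_kernel (?h (Suc n)) (boltzmann (?h (Suc n))) (Suc n) x y) \<longlonglongrightarrow> 0"
  proof (rule tendsto_sandwich[OF _ _ tendsto_const])
    have "(\<lambda>n. ?h n) \<longlonglongrightarrow> 0" by (rule LIMSEQ_Suc, rule lim_const_over_n)
    from LIMSEQ_Suc[OF this] have "(\<lambda>n. ennreal (K * (?h (Suc n))\<^sup>2)) \<longlonglongrightarrow> ennreal (K * 0\<^sup>2)"
      by (intro tendsto_ennrealI tendsto_intros)
    then show "(\<lambda>n. ennreal (K * (?h (Suc n))\<^sup>2)) \<longlonglongrightarrow> 0" by simp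
  qed (use est in auto)
  with LIMSEQ_Suc[OF trotter_tendsto[of x y]] show ?thesis by (rule LIMSEQ_unique)
qed

lemma fk_kernel_commute: "fk_kernel x y = fk_kernel y x"
  using trotter_tendsto[of y x] trotter_tendsto[of x y]
  by (subst (asm) (1) trotter_kernel_commute[OF boltzmann_measurable]) (rule LIMSEQ_unique)

definition mesh :: "nat \<Rightarrow> real" where "mesh n = \<beta> / real (Suc n)"

lemma mesh_pos: "mesh n > 0" using \<beta>_pos by (simp add: mesh_def)

text \<open>For points of the box the two half weights at the ends tend to 1, so the symmetrised
  power has the same limit as the Trotter kernel. Off the box both the powers and the limit are
  0.\<close>

lemma step_kpower_tendsto: "(\<lambda>n. kpower (step_kernel (mesh n)) n x y) \<longlonglongrightarrow> fk_kernel x y"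
proof (cases "x \<in> cbox a b \<and> y \<in> cbox a b")
  case True
  have mesh0: "mesh \<longlonglongrightarrow> 0" unfolding mesh_def[abs_def] by (rule LIMSEQ_Suc, rule lim_const_over_n)
  have b: "(\<lambda>n. boltzmann (mesh n / 2) z) \<longlonglongrightarrow> 1" if "z \<in> cbox a b" for z
  proof -
    have "(\<lambda>n. ennreal (exp (- (mesh n / 2) * V z))) \<longlonglongrightarrow> ennreal (exp (- (0 / 2) * V z))"
      by (intro tendsto_ennrealI tendsto_intros mesh0) simp
    then show ?thesis using that by (simp add: boltzmann_def)
  qed
  have tr: "(\<lambda>n. trotter_kernel (mesh n) (boltzmann (mesh n)) n x y) \<longlonglongrightarrow> fk_kernel x y"
    unfolding mesh_def by (rule trotter_tendsto)
  have "(\<lambda>n. boltzmann (mesh n / 2) x * trotter_kernel (mesh n) (boltzmann (mesh n)) n x y * boltzmann (mesh n / 2) y) \<longlonglongrightarrow> 1 * fk_kernel x y * 1"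
    using True by (intro tendsto_mult_ennreal b tr) auto
  then show ?thesis by (simp add: kpower_step_kernel)
next
  case False
  then have "fk_kernel x y = 0" using fk_kernel_outside[of x y] fk_kernel_outside[of y x] fk_kernel_commute[of x y] by auto
  moreover have "kpower (step_kernel (mesh n)) n x y = 0" for n
    using False by (auto simp: kpower_step_kernel boltzmann_def)
  ultimately show ?thesis by simp
qed

text \<open>The two half weights and the n interior weights together contribute at most
  \<open>exp (\<beta> * C)\<close>, whatever n is, and the heat kernel has total time
  \<open>\<beta>\<close>.\<close>

lemma step_kpower_bound:
  "\<exists>M\<ge>0. \<forall>n x y. kpower (step_kernel (mesh n)) n x y \<le> ennreal M * indicator (cbox a b) x * indicator (cbox a b) y"
proof -
  obtain C where C: "C > 0" "\<And>x. \<bar>V x\<bar> \<le> C" using V_bounded by blast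
  define M where "M = exp (\<beta> * C) * (4 * pi * \<beta>) powr (- real DIM('a) / 2)"
  have "kpower (step_kernel (mesh n)) n x y \<le> ennreal M * indicator (cbox a b) x * indicator (cbox a b) y" for n x y
  proof -
    define h where "h = mesh n"
    have h: "h > 0" "real (Suc n) * h = \<beta>" using mesh_pos by (auto simp: h_def mesh_def)
    have bb: "boltzmann t z \<le> ennreal (exp (t * C)) * indicator (cbox a b) z" if "t > 0" for t z
    proof -
      have "t * (- V z) \<le> t * C" using abs_le_D2[OF C(2)] that by (intro mult_left_mono) auto
      then show ?thesis by (auto simp: boltzmann_def intro!: ennreal_leI)
    qed
    have bb1: "boltzmann h z \<le> ennreal (exp (h * C))" for z
      using bb[OF h(1), of z] by (rule order_trans) (auto simp: indicator_def)
    have "kpower (step_kernel h) n x y \<le> (ennreal (exp (h / 2 * C)) * indicator (cbox a b) x) * ennreal (exp (h * C) ^ n * heat_kernel (real (Suc n) * h) x y) * (ennreal (exp (h / 2 * C)) * indicator (cbox a b) y)"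
      unfolding kpower_step_kernel using h(1) by (intro mult_mono bb bb1 trotter_kernel_le) auto
    also have "\<dots> = ennreal (exp (h / 2 * C) * exp (h / 2 * C) * exp (h * C) ^ n * heat_kernel \<beta> x y) * indicator (cbox a b) x * indicator (cbox a b) y"
      unfolding h(2) by (simp add: ennreal_mult mult_ac)
    also have "exp (h / 2 * C) * exp (h / 2 * C) * exp (h * C) ^ n = exp (h * C) ^ Suc n"
      by (simp add: exp_add[symmetric])
    also have "\<dots> = exp (\<beta> * C)" unfolding h(2)[symmetric] by (simp add: exp_of_nat_mult[symmetric] mult.assoc del: of_nat_Suc power_Suc)
    also have "ennreal (exp (\<beta> * C) * heat_kernel \<beta> x y) * indicator (cbox a b) x * indicator (cbox a b) y \<le> ennreal M * indicator (cbox a b) x * indicator (cbox a b) y"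
      unfolding M_def using \<beta>_pos by (intro mult_right_mono ennreal_leI mult_left_mono heat_kernel_le) auto
    finally show ?thesis by (simp add: h_def)
  qed
  moreover have "M \<ge> 0" by (simp add: M_def)
  ultimately show ?thesis by blast
qed

lemma ktrace_step_tendsto:
  "(\<lambda>n. ktrace (kpower (step_kernel (mesh n)) (Suc n * Suc j - 1))) \<longlonglongrightarrow> ktrace (kpower fk_kernel j)"
proof -
  obtain M where bound: "\<forall>n x y. kpower (step_kernel (mesh n)) n x y \<le> ennreal M * indicator (cbox a b) x * indicator (cbox a b) y"
    using step_kpower_bound by blast
  from ktrace_kpower_tendsto[OF kernel_measurable_kpower[OF kernel_measurable_step] fk_kernel_measurable step_kpower_tendsto _ _ bound[rule_format], of j]
  show ?thesis
    by (simp add: kpower_kpower[OF kernel_measurable_step] emeasure_lborel_cbox_eq less_top[symmetric])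
qed

end

section \<open>Mollifiers\<close>

text \<open>The classical flat function exp(-1/u), divided by powers of u: differentiation maps the
  family into its own linear span.\<close>

definition flat_exp :: "nat \<Rightarrow> real \<Rightarrow> real" where
  "flat_exp n u = (if u > 0 then exp (- 1 / u) / u ^ n else 0)"

lemma flat_exp_nonneg: "0 \<le> flat_exp n u" by (simp add: flat_exp_def)

text \<open>One term of the series of exp(1/u) bounds exp(1/u) from below; this is flatness of every
  order at 0.\<close>

lemma flat_exp_le: "flat_exp n u \<le> fact (n + k) * \<bar>u\<bar> ^ k"
proof (cases "u > 0")
  case True
  have "(1 / u) ^ (n + k) / fact (n + k) \<le> exp (1 / u)"
  proof -
    have s: "(\<lambda>m. (1 / u) ^ m /\<^sub>R fact m) sums exp (1 / u)" by (rule exp_converges)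
    from sum_le_suminf[OF sums_summable[OF s], of "{n + k}"] sums_unique[OF s] True show ?thesis
      by (simp add: divide_inverse mult.commute)
  qed
  then have "exp (- 1 / u) \<le> fact (n + k) * u ^ (n + k)"
    using True by (simp add: exp_minus field_simps)
  then show ?thesis using True by (simp add: flat_exp_def power_add field_simps)
qed (simp add: flat_exp_def)

lemma flat_exp_has_derivative:
  "(flat_exp n has_real_derivative (flat_exp (n + 2) u - real n * flat_exp (n + 1) u)) (at u)"
proof -
  consider "u > 0" | "u < 0" | "u = 0" by linarith
  then show ?thesis
  proof cases
    case 1
    have "((\<lambda>u. exp (- 1 / u) / u ^ n) has_real_derivative (flat_exp (n + 2) u - real n * flat_exp (n + 1) u)) (at u)"
      using 1 by (auto intro!: derivative_eq_intros simp: flat_exp_def field_simps power2_eq_square) (cases n; simp add: field_simps)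
    moreover have "\<forall>\<^sub>F v in nhds u. exp (- 1 / v) / v ^ n = flat_exp n v"
      using eventually_nhds_in_open[of "{0<..}" u] 1 by (auto simp: flat_exp_def elim!: eventually_mono)
    ultimately show ?thesis by (rule DERIV_cong_ev[OF refl _ refl, THEN iffD1, rotated])
  next
    case 2
    have "((\<lambda>u. 0) has_real_derivative (flat_exp (n + 2) u - real n * flat_exp (n + 1) u)) (at u)"
      using 2 by (simp add: flat_exp_def)
    moreover have "\<forall>\<^sub>F v in nhds u. 0 = flat_exp n v"
      using eventually_nhds_in_open[of "{..<0}" u] 2 by (auto simp: flat_exp_def elim!: eventually_mono)
    ultimately show ?thesis by (rule DERIV_cong_ev[OF refl _ refl, THEN iffD1, rotated])
  next
    case 3
    \<comment> \<open>At the gluing point the bound with k = 2 makes the difference quotient O(h),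
      so the derivative is 0 and the two branches fit.\<close>
    have "((\<lambda>h. (flat_exp n (0 + h) - flat_exp n 0) / h) \<longlongrightarrow> 0) (at 0)"
    proof (rule Lim_null_comparison)
      show "\<forall>\<^sub>F h in at 0. norm ((flat_exp n (0 + h) - flat_exp n 0) / h) \<le> fact (n + 2) * \<bar>h\<bar>"
      proof (rule always_eventually, intro allI)
        fix h :: real
        show "norm ((flat_exp n (0 + h) - flat_exp n 0) / h) \<le> fact (n + 2) * \<bar>h\<bar>"
          using flat_exp_le[of n h 2] flat_exp_nonneg[of n h]
          by (cases "h = 0") (auto simp: flat_exp_def[of n 0] divide_le_eq power2_eq_square mult.assoc)
      qed
      show "((\<lambda>h::real. fact (n + 2) * \<bar>h\<bar>) \<longlongrightarrow> 0) (at 0)"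
        using tendsto_mult[OF tendsto_const[of "fact (n + 2)"] tendsto_rabs[OF tendsto_ident_at[of "0::real" UNIV]]] by simp
    qed
    then show ?thesis using 3 by (simp add: DERIV_def flat_exp_def)
  qed
qed

text \<open>This class is closed under differentiation, which gives smoothness of its members and of convolutions
  with them by induction on the order.\<close>

inductive bump_class :: "real \<Rightarrow> ('a::euclidean_space \<Rightarrow> real) \<Rightarrow> bool" for q :: real where
  base: "bump_class q (\<lambda>x. flat_exp n (1 - q * (x \<bullet> x)))"
| coord: "bump_class q u \<Longrightarrow> bump_class q (\<lambda>x. (x \<bullet> i) * u x)"
| scale: "bump_class q u \<Longrightarrow> bump_class q (\<lambda>x. c * u x)"
| add: "bump_class q u \<Longrightarrow> bump_class q v \<Longrightarrow> bump_class q (\<lambda>x. u x + v x)"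

lemma bump_class_has_derivative:
  assumes "bump_class q u"
  shows "\<exists>D. (\<forall>x. (u has_derivative D x) (at x)) \<and> (\<forall>v. bump_class q (\<lambda>x. D x v))"
  using assms
proof induction
  case (base n)
  let ?f' = "\<lambda>x::'a. flat_exp (n + 2) (1 - q * (x \<bullet> x)) - real n * flat_exp (n + 1) (1 - q * (x \<bullet> x))"
  show ?case
  proof (intro exI[of _ "\<lambda>x v. ?f' x * (- 2 * q * (x \<bullet> v))"] conjI allI)
    fix x :: 'a
    have "((\<lambda>x. 1 - q * (x \<bullet> x)) has_derivative (\<lambda>v. - 2 * q * (x \<bullet> v))) (at x)"
      by (auto intro!: derivative_eq_intros simp: inner_commute algebra_simps)
    from DERIV_compose_FDERIV[OF flat_exp_has_derivative this, of n]
    show "((\<lambda>x. flat_exp n (1 - q * (x \<bullet> x))) has_derivative (\<lambda>v. ?f' x * (- 2 * q * (x \<bullet> v)))) (at x)"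
      by (simp add: mult.commute)
  next
    fix v :: 'a
    have "bump_class q (\<lambda>x. (- 2 * q) * ((x \<bullet> v) * (flat_exp (n + 2) (1 - q * (x \<bullet> x)) + (- real n) * flat_exp (n + 1) (1 - q * (x \<bullet> x)))))"
      by (intro bump_class.intros)
    then show "bump_class q (\<lambda>x. ?f' x * (- 2 * q * (x \<bullet> v)))" by (simp add: mult_ac)
  qed
next
  case (coord u i)
  then obtain D where D: "\<And>x. (u has_derivative D x) (at x)" "\<And>v. bump_class q (\<lambda>x. D x v)" by blast
  show ?case
  proof (intro exI[of _ "\<lambda>x v. (v \<bullet> i) * u x + (x \<bullet> i) * D x v"] conjI allI)
    show "((\<lambda>x. (x \<bullet> i) * u x) has_derivative (\<lambda>v. (v \<bullet> i) * u x + (x \<bullet> i) * D x v)) (at x)" for x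
      by (auto intro!: derivative_eq_intros D)
    show "bump_class q (\<lambda>x. (v \<bullet> i) * u x + (x \<bullet> i) * D x v)" for v
      by (intro bump_class.add bump_class.scale bump_class.coord coord D)
  qed
next
  case (scale u c)
  then obtain D where D: "\<And>x. (u has_derivative D x) (at x)" "\<And>v. bump_class q (\<lambda>x. D x v)" by blast
  show ?case
    by (intro exI[of _ "\<lambda>x v. c * D x v"] conjI allI bump_class.scale D has_derivative_mult_right)
next
  case (add u v)
  then obtain D D' where D: "\<And>x. (u has_derivative D x) (at x)" "\<And>v. bump_class q (\<lambda>x. D x v)"
    and D': "\<And>x. (v has_derivative D' x) (at x)" "\<And>v. bump_class q (\<lambda>x. D' x v)" by blast
  show ?case
    by (intro exI[of _ "\<lambda>x v. D x v + D' x v"] conjI allI bump_class.add D D' has_derivative_add)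
qed

lemma bump_class_outside:
  assumes "bump_class q u" "1 \<le> q * (x \<bullet> x)" shows "u x = 0"
  using assms by induction (auto simp: flat_exp_def)

lemma bump_class_continuous: "bump_class q u \<Longrightarrow> continuous_on UNIV u"
  using bump_class_has_derivative[of q u] has_derivative_continuous
  by (metis continuous_at_imp_continuous_on)

lemma bump_class_bounded:
  fixes u :: "'a::euclidean_space \<Rightarrow> real"
  assumes "bump_class q u" "q > 0" shows "\<exists>B>0. \<forall>x. \<bar>u x\<bar> \<le> B"
proof -
  have "compact (u ` cball 0 (sqrt (1 / q)))"
    by (intro compact_continuous_image continuous_on_subset[OF bump_class_continuous[OF assms(1)]]) auto
  then have "bounded (u ` cball 0 (sqrt (1 / q)))" by (rule compact_imp_bounded)
  then obtain B where "B > 0" and B': "\<forall>y\<in>u ` cball 0 (sqrt (1 / q)). norm y \<le> B" unfolding bounded_pos by blast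
  then have B: "B > 0" "\<And>x. norm x \<le> sqrt (1 / q) \<Longrightarrow> \<bar>u x\<bar> \<le> B" by auto
  have "\<bar>u x\<bar> \<le> B" for x
  proof (cases "norm x \<le> sqrt (1 / q)")
    case False
    then have "sqrt (1 / q) < norm x" by simp
    then have "(sqrt (1 / q))\<^sup>2 \<le> (norm x)\<^sup>2" using assms(2) by (intro power_mono) auto
    then have "1 \<le> q * (x \<bullet> x)" using assms(2) by (simp add: power2_norm_eq_inner field_simps)
    then show ?thesis using bump_class_outside[OF assms(1)] B(1) by simp
  qed (use B in auto)
  then show ?thesis using B(1) by blast
qed

lemma bump_class_derivative_bounded:
  fixes u :: "'a::euclidean_space \<Rightarrow> real"
  assumes "\<And>x. (u has_derivative D x) (at x)" "\<And>v. bump_class q (\<lambda>x. D x v)" "q > 0"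
  shows "\<exists>B>0. \<forall>x v. \<bar>D x v\<bar> \<le> B * norm v"
proof -
  have "\<forall>i. \<exists>B>0. \<forall>x. \<bar>D x i\<bar> \<le> B" using bump_class_bounded[OF assms(2,3)] by blast
  then obtain B where B: "\<And>i. B i > 0" "\<And>i x. \<bar>D x i\<bar> \<le> B i" by metis
  have "\<bar>D x v\<bar> \<le> (\<Sum>i\<in>Basis. B i) * norm v" for x v
  proof -
    have lin: "linear (D x)" using assms(1) has_derivative_linear by blast
    have "D x v = D x (\<Sum>i\<in>Basis. (v \<bullet> i) *\<^sub>R i)" by (simp add: euclidean_representation)
    also have "\<dots> = (\<Sum>i\<in>Basis. (v \<bullet> i) * D x i)" by (simp add: linear_sum[OF lin] linear_cmul[OF lin])
    also have "\<bar>\<dots>\<bar> \<le> (\<Sum>i\<in>Basis. \<bar>(v \<bullet> i) * D x i\<bar>)" by (rule sum_abs)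
    also have "\<dots> \<le> (\<Sum>i\<in>Basis. norm v * B i)"
      unfolding abs_mult by (intro sum_mono mult_mono B) (auto simp: Basis_le_norm)
    finally show ?thesis by (simp add: sum_distrib_left mult.commute)
  qed
  moreover have "(\<Sum>i\<in>(Basis::'a set). B i) > 0" by (intro sum_pos B) auto
  ultimately show ?thesis by blast
qed

text \<open>Partial derivatives are again in the class, so their own derivatives are bounded and
  \<open>D\<close> is Lipschitz. The mean value inequality for \<open>u - D x\<close> along the
  segment from x to x + z then gives the quadratic remainder.\<close>

lemma bump_class_Taylor:
  fixes u :: "'a::euclidean_space \<Rightarrow> real"
  assumes D: "\<And>x. (u has_derivative D x) (at x)" "\<And>v. bump_class q (\<lambda>x. D x v)" and q: "q > 0"
  shows "\<exists>B>0. \<forall>x z. \<bar>u (x + z) - u x - D x z\<bar> \<le> B * (norm z)\<^sup>2"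
proof -
  have "\<forall>i. \<exists>B>0. \<forall>x z. \<bar>D (x + z) i - D x i\<bar> \<le> B * norm z"
  proof
    fix i
    obtain D2 where D2: "\<And>x. ((\<lambda>x. D x i) has_derivative D2 x) (at x)" "\<And>v. bump_class q (\<lambda>x. D2 x v)"
      using bump_class_has_derivative[OF D(2)[of i]] by blast
    obtain B where B: "B > 0" "\<And>x v. \<bar>D2 x v\<bar> \<le> B * norm v"
      using bump_class_derivative_bounded[OF D2 q] by blast
    have "norm (D (x + z) i - D x i) \<le> B * norm ((x + z) - x)" for x z
    proof (rule differentiable_bound[of UNIV "\<lambda>x. D x i" D2])
      show "onorm (D2 x) \<le> B" for x using B by (intro onorm_le) auto
    qed (use D2 in auto)
    then show "\<exists>B>0. \<forall>x z. \<bar>D (x + z) i - D x i\<bar> \<le> B * norm z" using B(1) by auto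
  qed
  then obtain B where B: "\<And>i. B i > 0" "\<And>i x z. \<bar>D (x + z) i - D x i\<bar> \<le> B i * norm z" by metis
  define K where "K = (\<Sum>i\<in>(Basis::'a set). B i)"
  have K: "K > 0" unfolding K_def by (intro sum_pos B) auto
  have DK: "\<bar>D (x + z) v - D x v\<bar> \<le> K * norm z * norm v" for x z v
  proof -
    have lin: "linear (D x)" for x using D(1) has_derivative_linear by blast
    have e: "D x v = (\<Sum>i\<in>Basis. (v \<bullet> i) * D x i)" for x
    proof -
      have "D x v = D x (\<Sum>i\<in>Basis. (v \<bullet> i) *\<^sub>R i)" by (simp add: euclidean_representation)
      also have "\<dots> = (\<Sum>i\<in>Basis. (v \<bullet> i) * D x i)" by (simp add: linear_sum[OF lin] linear_cmul[OF lin])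
      finally show ?thesis .
    qed
    have "D (x + z) v - D x v = (\<Sum>i\<in>Basis. (v \<bullet> i) * (D (x + z) i - D x i))"
      unfolding e[of "x + z"] e[of x] by (simp add: sum_subtractf right_diff_distrib)
    also have "\<bar>\<dots>\<bar> \<le> (\<Sum>i\<in>Basis. \<bar>(v \<bullet> i) * (D (x + z) i - D x i)\<bar>)" by (rule sum_abs)
    also have "\<dots> \<le> (\<Sum>i\<in>Basis. norm v * (B i * norm z))"
      unfolding abs_mult by (intro sum_mono mult_mono B) (auto simp: Basis_le_norm)
    finally show ?thesis by (simp add: K_def sum_distrib_left sum_distrib_right mult_ac)
  qed
  have "\<bar>u (x + z) - u x - D x z\<bar> \<le> K * (norm z)\<^sup>2" for x z
  proof -
    have "norm ((u (x + z) - D x (x + z)) - (u x - D x x)) \<le> (K * norm z) * norm ((x + z) - x)"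
    proof (rule differentiable_bound[of "closed_segment x (x + z)" "\<lambda>w. u w - D x w" "\<lambda>w v. D w v - D x v"])
      fix w assume "w \<in> closed_segment x (x + z)"
      have bl: "bounded_linear (D x)" using D(1) has_derivative_bounded_linear by blast
      show "((\<lambda>w. u w - D x w) has_derivative (\<lambda>v. D w v - D x v)) (at w within closed_segment x (x + z))"
        by (intro has_derivative_diff has_derivative_at_withinI[OF D(1)] bounded_linear_imp_has_derivative bl)
      have nw: "norm (w - x) \<le> norm z"
        using segment_bound1[OF \<open>w \<in> closed_segment x (x + z)\<close>] by simp
      show "onorm (\<lambda>v. D w v - D x v) \<le> K * norm z"
      proof (rule onorm_le)
        fix v
        have "\<bar>D w v - D x v\<bar> \<le> K * norm (w - x) * norm v" using DK[of x "w - x" v] by simp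
        also have "\<dots> \<le> K * norm z * norm v" using nw K by (intro mult_right_mono mult_left_mono) auto
        finally show "norm (D w v - D x v) \<le> K * norm z * norm v" by simp
      qed
    qed auto
    moreover have "D x (x + z) = D x x + D x z"
      using D(1) has_derivative_linear linear_add by blast
    ultimately show ?thesis by (simp add: power2_eq_square mult.assoc algebra_simps)
  qed
  then show ?thesis using K by blast
qed

section \<open>Convolution with bump functions, and gradients of smooth functions\<close>

definition conv :: "('a::euclidean_space \<Rightarrow> real) \<Rightarrow> ('a \<Rightarrow> real) \<Rightarrow> 'a \<Rightarrow> real" where
  "conv \<rho> g x = (\<integral>y. \<rho> (x - y) * g y \<partial>lborel)"

lemma bump_class_conv_integrable:
  fixes g :: "'a::euclidean_space \<Rightarrow> real"
  assumes "bump_class q u" "q > 0" "integrable lborel g"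
  shows "integrable lborel (\<lambda>y. u (x - y) * g y)"
proof -
  obtain B where B: "B > 0" "\<And>x. \<bar>u x\<bar> \<le> B" using bump_class_bounded[OF assms(1,2)] by blast
  have [measurable]: "u \<in> borel_measurable borel"
    by (rule borel_measurable_continuous_onI) (rule bump_class_continuous[OF assms(1)])
  show ?thesis
  proof (rule Bochner_Integration.integrable_bound)
    show "integrable lborel (\<lambda>y. B * g y)" using assms by simp
    show "(\<lambda>y. u (x - y) * g y) \<in> borel_measurable lborel" using assms(3) by measurable
    show "AE y in lborel. norm (u (x - y) * g y) \<le> norm (B * g y)"
      using B by (auto simp: abs_mult intro!: mult_right_mono AE_I2)
  qed
qed

text \<open>The Taylor bounds of the bump function are integrated against \<open>g\<close>. The
  constant is independent of \<open>g\<close>, which enters through its L1 norm only; this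
  uniformity is essential when \<open>g\<close> varies with the mesh.\<close>

lemma conv_Taylor:
  fixes g :: "'a::euclidean_space \<Rightarrow> real"
  assumes D: "\<And>x. (u has_derivative D x) (at x)" "\<And>v. bump_class q (\<lambda>x. D x v)" and u: "bump_class q u" and q: "q > 0"
  shows "\<exists>B>0. \<forall>g x z. integrable lborel g \<longrightarrow>
      \<bar>conv u g (x + z) - conv u g x - conv (\<lambda>w. D w z) g x\<bar> \<le> B * (norm z)\<^sup>2 * (\<integral>y. \<bar>g y\<bar> \<partial>lborel) \<and>
      \<bar>conv (\<lambda>w. D w z) g x\<bar> \<le> B * norm z * (\<integral>y. \<bar>g y\<bar> \<partial>lborel)"
proof -
  obtain B1 where B1: "B1 > 0" "\<And>x z. \<bar>u (x + z) - u x - D x z\<bar> \<le> B1 * (norm z)\<^sup>2"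
    using bump_class_Taylor[OF D q] by blast
  obtain B2 where B2: "B2 > 0" "\<And>x v. \<bar>D x v\<bar> \<le> B2 * norm v"
    using bump_class_derivative_bounded[OF D q] by blast
  have "\<bar>conv u g (x + z) - conv u g x - conv (\<lambda>w. D w z) g x\<bar> \<le> max B1 B2 * (norm z)\<^sup>2 * (\<integral>y. \<bar>g y\<bar> \<partial>lborel) \<and>
      \<bar>conv (\<lambda>w. D w z) g x\<bar> \<le> max B1 B2 * norm z * (\<integral>y. \<bar>g y\<bar> \<partial>lborel)" if g: "integrable lborel g" for g x z
  proof
    note int = bump_class_conv_integrable[OF u q g] bump_class_conv_integrable[OF D(2) q g]
    have "conv u g (x + z) - conv u g x - conv (\<lambda>w. D w z) g x
       = (\<integral>y. (u (x - y + z) - u (x - y) - D (x - y) z) * g y \<partial>lborel)"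
      unfolding conv_def using int(1)[of "x + z"] int(1)[of x] int(2)[of x z]
      by (simp add: left_diff_distrib algebra_simps)
    also have "\<bar>\<dots>\<bar> \<le> (\<integral>y. max B1 B2 * (norm z)\<^sup>2 * \<bar>g y\<bar> \<partial>lborel)"
    proof (rule integral_abs_bound_integral)
      show "integrable lborel (\<lambda>y. (u (x - y + z) - u (x - y) - D (x - y) z) * g y)"
        using int(1)[of "x + z"] int(1)[of x] int(2)[of x z]
        by (simp add: left_diff_distrib algebra_simps)
      show "integrable lborel (\<lambda>y. max B1 B2 * (norm z)\<^sup>2 * \<bar>g y\<bar>)" using g by simp
      fix y
      have "\<bar>u (x - y + z) - u (x - y) - D (x - y) z\<bar> \<le> max B1 B2 * (norm z)\<^sup>2"
        by (rule order_trans[OF B1(2)]) (intro mult_right_mono, auto)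
      then show "\<bar>(u (x - y + z) - u (x - y) - D (x - y) z) * g y\<bar> \<le> max B1 B2 * (norm z)\<^sup>2 * \<bar>g y\<bar>"
        unfolding abs_mult by (rule mult_right_mono) simp
    qed
    finally show "\<bar>conv u g (x + z) - conv u g x - conv (\<lambda>w. D w z) g x\<bar> \<le> max B1 B2 * (norm z)\<^sup>2 * (\<integral>y. \<bar>g y\<bar> \<partial>lborel)"
      by simp
    have "\<bar>conv (\<lambda>w. D w z) g x\<bar> \<le> (\<integral>y. max B1 B2 * norm z * \<bar>g y\<bar> \<partial>lborel)"
      unfolding conv_def
    proof (rule integral_abs_bound_integral)
      fix y
      have "\<bar>D (x - y) z\<bar> \<le> max B1 B2 * norm z"
        by (rule order_trans[OF B2(2)]) (intro mult_right_mono, auto)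
      then show "\<bar>D (x - y) z * g y\<bar> \<le> max B1 B2 * norm z * \<bar>g y\<bar>"
        unfolding abs_mult by (rule mult_right_mono) simp
    qed (use int g in auto)
    then show "\<bar>conv (\<lambda>w. D w z) g x\<bar> \<le> max B1 B2 * norm z * (\<integral>y. \<bar>g y\<bar> \<partial>lborel)"
      by simp
  qed
  then show ?thesis using B1(1) by (intro exI[of _ "max B1 B2"]) auto
qed

lemma conv_has_derivative:
  fixes g :: "'a::euclidean_space \<Rightarrow> real"
  assumes D: "\<And>x. (u has_derivative D x) (at x)" "\<And>v. bump_class q (\<lambda>x. D x v)" and u: "bump_class q u" and q: "q > 0"
    and g: "integrable lborel g"
  shows "(conv u g has_derivative (\<lambda>v. conv (\<lambda>w. D w v) g x)) (at x)"
proof -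
  obtain B where B: "B > 0" "\<And>x z. \<bar>conv u g (x + z) - conv u g x - conv (\<lambda>w. D w z) g x\<bar> \<le> B * (norm z)\<^sup>2 * (\<integral>y. \<bar>g y\<bar> \<partial>lborel)"
    "\<And>x z. \<bar>conv (\<lambda>w. D w z) g x\<bar> \<le> B * norm z * (\<integral>y. \<bar>g y\<bar> \<partial>lborel)"
    using conv_Taylor[OF D u q] g by blast
  note int = bump_class_conv_integrable[OF D(2) q g]
  show ?thesis unfolding has_derivative_at
  proof
    show "bounded_linear (\<lambda>v. conv (\<lambda>w. D w v) g x)"
    proof (rule bounded_linear_intro[where K = "B * (\<integral>y. \<bar>g y\<bar> \<partial>lborel)"])
      have lin: "linear (D x)" for x using D(1) has_derivative_linear by blast
      show "conv (\<lambda>w. D w (v + v')) g x = conv (\<lambda>w. D w v) g x + conv (\<lambda>w. D w v') g x" for v v'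
        unfolding conv_def by (simp add: linear_add[OF lin] distrib_right int)
      show "conv (\<lambda>w. D w (r *\<^sub>R v)) g x = r *\<^sub>R conv (\<lambda>w. D w v) g x" for r v
        unfolding conv_def by (simp add: linear_cmul[OF lin] mult.assoc)
      show "norm (conv (\<lambda>w. D w v) g x) \<le> norm v * (B * (\<integral>y. \<bar>g y\<bar> \<partial>lborel))" for v
        using B(3)[of v x] by (simp add: mult_ac)
    qed
    show "((\<lambda>h. norm (conv u g (x + h) - conv u g x - conv (\<lambda>w. D w h) g x) / norm h) \<longlongrightarrow> 0) (at 0)"
    proof (rule Lim_null_comparison)
      show "\<forall>\<^sub>F h in at 0. norm (norm (conv u g (x + h) - conv u g x - conv (\<lambda>w. D w h) g x) / norm h) \<le> B * (\<integral>y. \<bar>g y\<bar> \<partial>lborel) * norm h"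
      proof (rule always_eventually, rule allI)
        fix h
        show "norm (norm (conv u g (x + h) - conv u g x - conv (\<lambda>w. D w h) g x) / norm h) \<le> B * (\<integral>y. \<bar>g y\<bar> \<partial>lborel) * norm h"
          using B(2)[of x h] B(1) by (cases "h = 0") (auto simp: divide_le_eq power2_eq_square mult_ac)
      qed
      show "((\<lambda>h::'a. B * (\<integral>y. \<bar>g y\<bar> \<partial>lborel) * norm h) \<longlongrightarrow> 0) (at 0)"
        by (auto intro!: tendsto_eq_intros)
    qed
  qed
qed

lemma conv_smooth:
  assumes u: "bump_class q u" and q: "q > 0" and g: "integrable lborel g"
  shows "smooth_fun (conv u g)"
proof -
  have "C_k k (conv u g)" for k
    using u
  proof (induction k arbitrary: u)
    case 0
    obtain D where D: "\<And>x. (u has_derivative D x) (at x)" "\<And>v. bump_class q (\<lambda>x. D x v)"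
      using bump_class_has_derivative[OF 0] by blast
    show ?case using has_derivative_continuous[OF conv_has_derivative[OF D 0 q g]]
      by (auto simp: continuous_on_eq_continuous_at)
  next
    case (Suc k)
    obtain D where D: "\<And>x. (u has_derivative D x) (at x)" "\<And>v. bump_class q (\<lambda>x. D x v)"
      using bump_class_has_derivative[OF Suc.prems] by blast
    note d = conv_has_derivative[OF D Suc.prems q g]
    have "frechet_derivative (conv u g) (at x) i = conv (\<lambda>w. D w i) g x" for x i
      by (simp add: frechet_derivative_at[OF d, symmetric])
    then show ?case using d Suc.IH[OF D(2)] by (auto simp: differentiable_def)
  qed
  then show ?thesis by (simp add: smooth_fun_def)
qed

lemma C_k_affine:
  assumes "C_k k f" shows "C_k k (\<lambda>x. c * f (p + r *\<^sub>R x))"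
  using assms
proof (induction k arbitrary: f c)
  case 0
  then show ?case by (auto intro!: continuous_intros continuous_on_compose2[of UNIV f])
next
  case (Suc k)
  have df: "(f has_derivative frechet_derivative f (at y)) (at y)" for y
    using Suc.prems by (auto intro: frechet_derivative_works[THEN iffD1])
  have aff: "((\<lambda>x. p + r *\<^sub>R x) has_derivative (\<lambda>v. r *\<^sub>R v)) (at x)" for x
    by (auto intro!: derivative_eq_intros)
  have d: "((\<lambda>x. c * f (p + r *\<^sub>R x)) has_derivative (\<lambda>v. c * frechet_derivative f (at (p + r *\<^sub>R x)) (r *\<^sub>R v))) (at x)" for x
    by (rule has_derivative_mult_right) (rule has_derivative_compose[OF aff df])
  have "frechet_derivative (\<lambda>x. c * f (p + r *\<^sub>R x)) (at x) i = (c * r) * frechet_derivative f (at (p + r *\<^sub>R x)) i" for x i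
    unfolding frechet_derivative_at[OF d, symmetric]
    using linear_cmul[OF has_derivative_linear[OF df]] by simp
  moreover have "C_k k (\<lambda>x. (c * r) * frechet_derivative f (at (p + r *\<^sub>R x)) i)" if "i \<in> Basis" for i
    by (rule Suc.IH) (use Suc.prems that in auto)
  moreover have "(\<lambda>x. c * f (p + r *\<^sub>R x)) differentiable (at x)" for x by (rule differentiableI[OF d])
  ultimately show ?case by simp
qed

lemma smooth_fun_affine: "smooth_fun f \<Longrightarrow> smooth_fun (\<lambda>x. c * f (p + r *\<^sub>R x))"
  by (simp add: smooth_fun_def C_k_affine)

lemma smooth_fun_has_derivative:
  assumes "smooth_fun f" shows "(f has_derivative (\<lambda>v. grad f x \<bullet> v)) (at x)"
proof -
  have "C_k 1 f" using assms by (simp only: smooth_fun_def)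
  then have d: "(f has_derivative frechet_derivative f (at x)) (at x)"
    by (auto intro: frechet_derivative_works[THEN iffD1])
  have "frechet_derivative f (at x) v = grad f x \<bullet> v" for v
  proof -
    have lin: "linear (frechet_derivative f (at x))" using d has_derivative_linear by blast
    have "frechet_derivative f (at x) v = frechet_derivative f (at x) (\<Sum>i\<in>Basis. (v \<bullet> i) *\<^sub>R i)" by (simp add: euclidean_representation)
    also have "\<dots> = (\<Sum>i\<in>Basis. (v \<bullet> i) * frechet_derivative f (at x) i)" by (simp add: linear_sum[OF lin] linear_cmul[OF lin])
    also have "\<dots> = grad f x \<bullet> v" by (simp add: grad_def inner_sum_left inner_commute[of v] mult.commute)
    finally show ?thesis .
  qed
  then show ?thesis using d by (simp add: has_derivative_eq_rhs fun_eq_iff)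
qed

lemma grad_eqI:
  assumes "(f has_derivative (\<lambda>v. w \<bullet> v)) (at x)" shows "grad f x = w"
proof -
  have "frechet_derivative f (at x) = (\<lambda>v. w \<bullet> v)" by (rule frechet_derivative_at[OF assms, symmetric])
  then show ?thesis by (simp add: grad_def euclidean_representation)
qed

lemma grad_continuous:
  assumes "smooth_fun f" shows "continuous_on UNIV (grad f)"
proof -
  have "C_k (Suc 0) f" using assms by (simp only: smooth_fun_def)
  then have "continuous_on UNIV (\<lambda>x. frechet_derivative f (at x) i)" if "i \<in> Basis" for i using that by simp
  then show ?thesis unfolding grad_def[abs_def]
    by (intro continuous_on_sum continuous_on_scaleR continuous_on_const)
qed

lemma grad_affine:
  assumes "smooth_fun f" shows "grad (\<lambda>x. c * f (p + r *\<^sub>R x)) x = (c * r) *\<^sub>R grad f (p + r *\<^sub>R x)"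
proof (rule grad_eqI)
  have aff: "((\<lambda>x. p + r *\<^sub>R x) has_derivative (\<lambda>v. r *\<^sub>R v)) (at x)"
    by (auto intro!: derivative_eq_intros)
  have "((\<lambda>x. c * f (p + r *\<^sub>R x)) has_derivative (\<lambda>v. c * (grad f (p + r *\<^sub>R x) \<bullet> (r *\<^sub>R v)))) (at x)"
    by (rule has_derivative_mult_right) (rule has_derivative_compose[OF aff smooth_fun_has_derivative[OF assms]])
  then show "((\<lambda>x. c * f (p + r *\<^sub>R x)) has_derivative (\<lambda>v. ((c * r) *\<^sub>R grad f (p + r *\<^sub>R x)) \<bullet> v)) (at x)"
    by (simp add: mult.assoc)
qed

section \<open>Energy at positive times\<close>

lemma heat_kernel_moment_integrable:
  fixes i j :: "'a::euclidean_space"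
  assumes s: "s > 0"
  shows "integrable lborel (\<lambda>z. heat_kernel s 0 z * ((z \<bullet> i) * (z \<bullet> j)))"
proof -
  have "integrable lborel (\<lambda>z::'a. heat_kernel s 0 z)"
    using s by (intro integrableI_nonneg) (auto simp: nn_integral_heat_kernel)
  moreover have "integrable lborel (\<lambda>z::'a. norm z ^ 4 * heat_kernel s 0 z)"
  proof (intro integrableI_nonneg)
    show "(\<integral>\<^sup>+z. ennreal (norm (z::'a) ^ 4 * heat_kernel s 0 z) \<partial>lborel) < \<infinity>"
      using nn_integral_norm4_heat_kernel_le[OF s, where 'a = 'a] by (rule le_less_trans) simp
  qed auto
  ultimately have "integrable lborel (\<lambda>z::'a. (norm i * norm j) * (heat_kernel s 0 z + norm z ^ 4 * heat_kernel s 0 z))"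
    by (intro integrable_mult_right Bochner_Integration.integrable_add)
  then show ?thesis
  proof (rule Bochner_Integration.integrable_bound)
    show "AE z in lborel. norm (heat_kernel s 0 z * ((z \<bullet> i) * (z \<bullet> j))) \<le> norm ((norm i * norm j) * (heat_kernel s 0 z + norm z ^ 4 * heat_kernel s 0 z))"
    proof (intro AE_I2)
      fix z :: 'a
      have "\<bar>(z \<bullet> i) * (z \<bullet> j)\<bar> \<le> (norm z * norm i) * (norm z * norm j)"
        unfolding abs_mult by (intro mult_mono Cauchy_Schwarz_ineq2) auto
      also have "\<dots> = (norm i * norm j) * (norm z)\<^sup>2" by (simp add: power2_eq_square)
      also have "\<dots> \<le> (norm i * norm j) * (1 + norm z ^ 4)"
      proof (intro mult_left_mono)
        have "0 \<le> ((norm z)\<^sup>2 - 1)\<^sup>2 + (norm z)\<^sup>2" by simp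
        then show "(norm z)\<^sup>2 \<le> 1 + norm z ^ 4" by (simp add: power2_eq_square power4_eq_xxxx algebra_simps)
      qed auto
      finally have "heat_kernel s 0 z * \<bar>(z \<bullet> i) * (z \<bullet> j)\<bar> \<le> heat_kernel s 0 z * ((norm i * norm j) * (1 + norm z ^ 4))"
        by (intro mult_left_mono) auto
      then show "norm (heat_kernel s 0 z * ((z \<bullet> i) * (z \<bullet> j))) \<le> norm ((norm i * norm j) * (heat_kernel s 0 z + norm z ^ 4 * heat_kernel s 0 z))"
        by (simp add: abs_mult algebra_simps)
    qed
  qed auto
qed

lemma heat_kernel_moment_diag:
  fixes i :: "'a::euclidean_space"
  assumes s: "s > 0" and i: "i \<in> Basis"
  shows "(\<integral>z. heat_kernel s 0 z * ((z \<bullet> i) * (z \<bullet> i)) \<partial>lborel) = 2 * s"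
proof -
  let ?nd = "normal_density 0 (sqrt (2 * s))"
  let ?f = "\<lambda>b u. ennreal (?nd u) * (if b = i then ennreal (u\<^sup>2) else 1)"
  have m2: "has_bochner_integral lborel (\<lambda>x. ?nd x * x ^ 2) (2 * s)"
    using normal_moment_even[of "sqrt (2 * s)" 0 1] s by (simp add: fact_numeral)
  have one: "(\<integral>\<^sup>+u. ?f b u \<partial>lborel) = (if b = i then ennreal (2 * s) else 1)" for b
  proof (cases "b = i")
    case True
    have "(\<integral>\<^sup>+u. ennreal (?nd u * u\<^sup>2) \<partial>lborel) = ennreal (2 * s)"
      using m2 by (subst nn_integral_eq_integral) (auto simp: has_bochner_integral_iff)
    then show ?thesis using True by (simp add: ennreal_mult)
  next
    case False
    then show ?thesis using s by (simp add: nn_integral_eq_integral)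
  qed
  have "(\<integral>\<^sup>+z. ennreal (heat_kernel s 0 z * ((z \<bullet> i) * (z \<bullet> i))) \<partial>lborel) = (\<integral>\<^sup>+z. (\<Prod>b\<in>Basis. ?f b (z \<bullet> b)) \<partial>lborel)"
  proof (intro nn_integral_cong)
    fix z :: 'a
    have "(\<Prod>b\<in>Basis. ?f b (z \<bullet> b)) = ennreal (heat_kernel s 0 z) * (\<Prod>b\<in>Basis. if b = i then ennreal ((z \<bullet> b)\<^sup>2) else 1)"
      unfolding prod.distrib heat_kernel_eq_prod[OF s] by (simp add: prod_ennreal)
    also have "(\<Prod>b\<in>Basis. if b = i then ennreal ((z \<bullet> b)\<^sup>2) else 1) = ennreal ((z \<bullet> i)\<^sup>2)"
      using i by (subst prod.delta) auto
    finally show "ennreal (heat_kernel s 0 z * ((z \<bullet> i) * (z \<bullet> i))) = (\<Prod>b\<in>Basis. ?f b (z \<bullet> b))"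
      by (simp add: ennreal_mult power2_eq_square)
  qed
  also have "\<dots> = (\<Prod>b\<in>(Basis::'a set). (\<integral>\<^sup>+u. ?f b u \<partial>lborel))"
    by (rule nn_integral_lborel_prod) auto
  also have "\<dots> = ennreal (2 * s)" unfolding one using i by (subst prod.delta) auto
  finally show ?thesis
    using s by (subst integral_eq_nn_integral) auto
qed

text \<open>Reflecting the i-th coordinate preserves Lebesgue measure and the heat kernel but
  changes the sign of the integrand.\<close>

lemma heat_kernel_moment_offdiag:
  fixes i j :: "'a::euclidean_space"
  assumes i: "i \<in> Basis" "j \<in> Basis" "i \<noteq> j"
  shows "(\<integral>z. heat_kernel s 0 z * ((z \<bullet> i) * (z \<bullet> j)) \<partial>lborel) = 0"
proof -
  define T where "T x = 0 + (\<Sum>b\<in>Basis. ((if b = i then - 1 else 1) * (x \<bullet> b)) *\<^sub>R b)" for x :: 'a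
  have T: "T x = x - (2 * (x \<bullet> i)) *\<^sub>R i" for x
  proof (rule euclidean_eqI)
    fix b :: 'a assume b: "b \<in> Basis"
    have "T x \<bullet> b = (if b = i then - 1 else 1) * (x \<bullet> b)" using b unfolding T_def by simp
    also have "\<dots> = (x - (2 * (x \<bullet> i)) *\<^sub>R i) \<bullet> b" using b i by (simp add: inner_diff_left inner_Basis)
    finally show "T x \<bullet> b = (x - (2 * (x \<bullet> i)) *\<^sub>R i) \<bullet> b" .
  qed
  have "T = (\<lambda>x. x - (2 * (x \<bullet> i)) *\<^sub>R i)" using T by auto
  then have [measurable]: "T \<in> borel_measurable borel" by simp
  have "lborel = density (distr lborel borel (\<lambda>x. 0 + (\<Sum>b\<in>Basis. ((if b = i then - 1 else 1) * (x \<bullet> b)) *\<^sub>R b)))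
      (\<lambda>_. ennreal (\<Prod>b\<in>(Basis::'a set). \<bar>if b = i then - 1 else 1\<bar>))"
    by (rule lborel_affine_euclidean) auto
  also have "(\<lambda>x. 0 + (\<Sum>b\<in>Basis. ((if b = i then - 1 else 1) * (x \<bullet> b)) *\<^sub>R b)) = T"
    by (simp add: T_def[abs_def])
  also have "(\<Prod>b\<in>(Basis::'a set). \<bar>if b = i then - 1 else 1 :: real\<bar>) = 1" by (intro prod.neutral) auto
  finally have l: "lborel = distr lborel borel T" by (simp add: density_1)
  let ?F = "\<lambda>z::'a. heat_kernel s 0 z * ((z \<bullet> i) * (z \<bullet> j))"
  have n: "norm (T z) = norm z" for z
    unfolding norm_eq_sqrt_inner T using i by (simp add: inner_diff_left inner_diff_right inner_commute)
  have "(\<integral>z. ?F z \<partial>lborel) = (\<integral>z. ?F (T z) \<partial>lborel)"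
    by (subst l, subst integral_distr) auto
  also have "\<dots> = (\<integral>z. - ?F z \<partial>lborel)"
  proof (intro Bochner_Integration.integral_cong refl)
    fix z :: 'a
    have "T z \<bullet> i = - (z \<bullet> i)" "T z \<bullet> j = z \<bullet> j" using i unfolding T by (auto simp: inner_diff_left inner_Basis)
    moreover have "heat_kernel s 0 (T z) = heat_kernel s 0 z" using n by (simp add: heat_kernel_def)
    ultimately show "?F (T z) = - ?F z" by simp
  qed
  finally show ?thesis by simp
qed

text \<open>Expanding the square in coordinates leaves only the diagonal moments, each equal to
  2s.\<close>

lemma nn_integral_heat_kernel_moment2:
  fixes v :: "'a::euclidean_space"
  assumes s: "s > 0"
  shows "(\<integral>\<^sup>+z. ennreal (heat_kernel s 0 z * (v \<bullet> z)\<^sup>2) \<partial>lborel) = ennreal (2 * s * (norm v)\<^sup>2)"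
proof -
  have e: "heat_kernel s 0 z * (v \<bullet> z)\<^sup>2 = (\<Sum>i\<in>Basis. \<Sum>j\<in>Basis. (v \<bullet> i) * (v \<bullet> j) * (heat_kernel s 0 z * ((z \<bullet> i) * (z \<bullet> j))))" for z
    unfolding power2_eq_square euclidean_inner[of v z] sum_product
    by (simp add: sum_distrib_left mult_ac)
  have int: "integrable lborel (\<lambda>z. heat_kernel s 0 z * (v \<bullet> z)\<^sup>2)"
    unfolding e by (intro Bochner_Integration.integrable_sum integrable_mult_right heat_kernel_moment_integrable s)
  have "(\<integral>z. heat_kernel s 0 z * (v \<bullet> z)\<^sup>2 \<partial>lborel) = (\<Sum>i\<in>Basis. \<Sum>j\<in>Basis. (v \<bullet> i) * (v \<bullet> j) * (\<integral>z. heat_kernel s 0 z * ((z \<bullet> i) * (z \<bullet> j)) \<partial>lborel))"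
    unfolding e
    by (intro has_bochner_integral_integral_eq has_bochner_integral_sum has_bochner_integral_mult_right
        has_bochner_integral_integrable heat_kernel_moment_integrable s)
  also have "\<dots> = (\<Sum>i\<in>Basis. \<Sum>j\<in>Basis. if i = j then (v \<bullet> i) * (v \<bullet> i) * (2 * s) else 0)"
    by (intro sum.cong refl) (use heat_kernel_moment_diag[OF s] heat_kernel_moment_offdiag in auto)
  also have "\<dots> = 2 * s * (norm v)\<^sup>2"
    unfolding power2_norm_eq_inner euclidean_inner[of v v] by (simp add: sum_distrib_left mult_ac)
  finally show ?thesis using int by (subst nn_integral_eq_integral) auto
qed

lemma nn_integral_heat_kernel_norm2:
  assumes s: "s > 0"
  shows "(\<integral>\<^sup>+z. ennreal (heat_kernel s 0 z * (norm (z::'a::euclidean_space))\<^sup>2) \<partial>lborel) = ennreal (2 * s * real DIM('a))"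
proof -
  have "(\<integral>\<^sup>+z. ennreal (heat_kernel s 0 z * (norm (z::'a))\<^sup>2) \<partial>lborel) = (\<integral>\<^sup>+z. (\<Sum>i\<in>Basis. ennreal (heat_kernel s 0 z * (i \<bullet> (z::'a))\<^sup>2)) \<partial>lborel)"
  proof (intro nn_integral_cong)
    fix z :: 'a
    have "(norm z)\<^sup>2 = (\<Sum>i\<in>Basis. (i \<bullet> z)\<^sup>2)"
      unfolding power2_norm_eq_inner euclidean_inner[of z z] by (simp add: power2_eq_square inner_commute)
    then show "ennreal (heat_kernel s 0 z * (norm z)\<^sup>2) = (\<Sum>i\<in>Basis. ennreal (heat_kernel s 0 z * (i \<bullet> z)\<^sup>2))"
      by (simp add: sum_distrib_left)
  qed
  also have "\<dots> = (\<Sum>i\<in>(Basis::'a set). ennreal (2 * s * (norm i)\<^sup>2))"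
    by (subst nn_integral_sum) (auto simp: nn_integral_heat_kernel_moment2[OF s])
  also have "\<dots> = ennreal (2 * s * real DIM('a))"
    using s by (subst sum_ennreal) auto
  finally show ?thesis .
qed

text \<open>The cube is interpolated between the square and the fourth power with weight
  \<open>sqrt s\<close>, obtained from the square of r^2 - sqrt(s) r. Both terms then scale like
  s^(3/2), one factor sqrt s better than the energy itself.\<close>

lemma nn_integral_heat_kernel_norm3:
  assumes s: "s > 0"
  shows "(\<integral>\<^sup>+z. ennreal (heat_kernel s 0 z * norm (z::'a::euclidean_space) ^ 3) \<partial>lborel) \<le> ennreal ((gauss4 TYPE('a) + 2 * real DIM('a)) * s * sqrt s)"
proof -
  have r: "sqrt s > 0" "sqrt s * sqrt s = s" using s by auto
  have dq: "s / sqrt s = sqrt s" using s by (simp add: real_div_sqrt)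
  have cube: "norm z ^ 3 \<le> norm z ^ 4 / sqrt s + sqrt s * (norm z)\<^sup>2" for z :: 'a
  proof -
    have "0 \<le> ((norm z)\<^sup>2 - sqrt s * norm z)\<^sup>2" by simp
    also have "((norm z)\<^sup>2 - q * norm z)\<^sup>2 = norm z ^ 4 - 2 * (q * norm z ^ 3) + (q * q) * (norm z)\<^sup>2" for q
      by (simp add: power2_eq_square power4_eq_xxxx power3_eq_cube algebra_simps)
    finally have "2 * (sqrt s * norm z ^ 3) \<le> norm z ^ 4 + s * (norm z)\<^sup>2" unfolding r(2) by simp
    moreover have "0 \<le> sqrt s * norm z ^ 3" using s by simp
    ultimately have "sqrt s * norm z ^ 3 \<le> norm z ^ 4 + s * (norm z)\<^sup>2" by linarith
    then have "norm z ^ 3 \<le> (norm z ^ 4 + s * (norm z)\<^sup>2) / sqrt s" using r by (simp add: le_divide_eq mult.commute)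
    also have "\<dots> = norm z ^ 4 / sqrt s + sqrt s * (norm z)\<^sup>2" 
      using dq times_divide_eq_left[of s "sqrt s" "(norm z)\<^sup>2"] by (simp only: add_divide_distrib)
    finally show ?thesis .
  qed
  have "(\<integral>\<^sup>+z. ennreal (heat_kernel s 0 z * norm (z::'a) ^ 3) \<partial>lborel)
    \<le> (\<integral>\<^sup>+z. ennreal (1 / sqrt s) * ennreal (norm z ^ 4 * heat_kernel s 0 z) + ennreal (sqrt s) * ennreal (heat_kernel s 0 z * (norm (z::'a))\<^sup>2) \<partial>lborel)"
  proof (intro nn_integral_mono)
    fix z :: 'a
    have "heat_kernel s 0 z * norm z ^ 3 \<le> heat_kernel s 0 z * (norm z ^ 4 / sqrt s + sqrt s * (norm z)\<^sup>2)"
      by (intro mult_left_mono cube) auto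
    also have "\<dots> = 1 / sqrt s * (norm z ^ 4 * heat_kernel s 0 z) + sqrt s * (heat_kernel s 0 z * (norm z)\<^sup>2)"
      by (simp add: algebra_simps)
    finally show "ennreal (heat_kernel s 0 z * norm z ^ 3) \<le> ennreal (1 / sqrt s) * ennreal (norm z ^ 4 * heat_kernel s 0 z) + ennreal (sqrt s) * ennreal (heat_kernel s 0 z * (norm (z::'a))\<^sup>2)"
      using s by (simp add: ennreal_mult[symmetric] ennreal_plus[symmetric] ennreal_leI del: ennreal_plus)
  qed
  also have "\<dots> \<le> ennreal (1 / sqrt s) * ennreal (gauss4 TYPE('a) * s\<^sup>2) + ennreal (sqrt s) * ennreal (2 * s * real DIM('a))"
    using nn_integral_norm4_heat_kernel_le[OF s, where 'a = 'a] nn_integral_heat_kernel_norm2[OF s, where 'a = 'a]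
    by (subst nn_integral_add) (auto simp: nn_integral_cmult intro!: add_mono mult_left_mono)
  also have "\<dots> = ennreal ((gauss4 TYPE('a) + 2 * real DIM('a)) * s * sqrt s)"
  proof -
    have "1 / sqrt s * (gauss4 TYPE('a) * s\<^sup>2) = gauss4 TYPE('a) * s * sqrt s"
    proof -
      have "1 / sqrt s * (gauss4 TYPE('a) * s\<^sup>2) = gauss4 TYPE('a) * s * (s / sqrt s)" by (simp add: power2_eq_square)
      then show ?thesis unfolding dq .
    qed
    then have "1 / sqrt s * (gauss4 TYPE('a) * s\<^sup>2) + sqrt s * (2 * s * real DIM('a)) = (gauss4 TYPE('a) + 2 * real DIM('a)) * s * sqrt s"
      by (simp add: algebra_simps)
    then show ?thesis using s gauss4_pos[where 'a = 'a]
      by (simp add: ennreal_mult[symmetric] ennreal_plus[symmetric] less_imp_le del: ennreal_plus)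
  qed
  finally show ?thesis .
qed

section \<open>The energy of a function along the heat flow\<close>

definition sqnorm :: "('a::euclidean_space \<Rightarrow> real) \<Rightarrow> ennreal" where
  "sqnorm g = (\<integral>\<^sup>+x. ennreal ((g x)\<^sup>2) \<partial>lborel)"

definition incr_sq :: "('a::euclidean_space \<Rightarrow> real) \<Rightarrow> 'a \<Rightarrow> ennreal" where
  "incr_sq g z = (\<integral>\<^sup>+x. ennreal ((g (x + z) - g x)\<^sup>2) \<partial>lborel)"

text \<open>The heat kernel has covariance \<open>2 s\<close> times the identity, so \<open>energy s g / (2 s)\<close> approximates the
  Dirichlet energy of \<open>g\<close>.\<close>

definition energy :: "real \<Rightarrow> ('a::euclidean_space \<Rightarrow> real) \<Rightarrow> ennreal" where
  "energy s g = (\<integral>\<^sup>+z. ennreal (heat_kernel s 0 z) * incr_sq g z \<partial>lborel)"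

text \<open>The quadratic form of the heat semigroup at time s; as \<open>ennreal\<close> cuts off
  negative values, it has this meaning for nonnegative \<open>g\<close>.\<close>

definition overlap :: "real \<Rightarrow> ('a::euclidean_space \<Rightarrow> real) \<Rightarrow> ennreal" where
  "overlap s g = (\<integral>\<^sup>+x. (\<integral>\<^sup>+y. ennreal (g x) * ennreal (heat_kernel s x y) * ennreal (g y) \<partial>lborel) \<partial>lborel)"

lemma incr_sq_measurable [measurable]:
  assumes [measurable]: "g \<in> borel_measurable borel" shows "incr_sq g \<in> borel_measurable borel"
  unfolding incr_sq_def by measurable

text \<open>Expanding the squared increment: each of the two squares integrates to the squared norm
  because the heat kernel has mass 1, and the cross term is the overlap. It is stated as a sum
  because subtraction in \<open>ennreal\<close> is truncated.\<close>

lemma energy_add_overlap: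
  fixes g :: "'a::euclidean_space \<Rightarrow> real"
  assumes [measurable]: "g \<in> borel_measurable borel" and g0: "\<And>x. g x \<ge> 0" and s: "s > 0"
  shows "energy s g + 2 * overlap s g = 2 * sqnorm g"
proof -
  have "overlap s g = (\<integral>\<^sup>+x. (\<integral>\<^sup>+z. ennreal (g x) * ennreal (heat_kernel s x (z + x)) * ennreal (g (z + x)) \<partial>lborel) \<partial>lborel)"
    unfolding overlap_def
    by (intro nn_integral_cong nn_integral_translate[symmetric, where f = "\<lambda>y. ennreal (g x) * ennreal (heat_kernel s x y) * ennreal (g y)" for x]) measurable
  also have "\<dots> = (\<integral>\<^sup>+z. (\<integral>\<^sup>+x. ennreal (g x) * ennreal (heat_kernel s x (z + x)) * ennreal (g (z + x)) \<partial>lborel) \<partial>lborel)"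
    by (rule lborel_pair.Fubini') measurable
  also have "\<dots> = (\<integral>\<^sup>+z. ennreal (heat_kernel s 0 z) * (\<integral>\<^sup>+x. ennreal (g x * g (x + z)) \<partial>lborel) \<partial>lborel)"
    using g0 by (intro nn_integral_cong, subst nn_integral_cmult[symmetric], measurable)
      (auto intro!: nn_integral_cong simp: ennreal_mult heat_kernel_diff[of s _ "_ + _"] add.commute mult_ac)
  finally have ov: "overlap s g = (\<integral>\<^sup>+z. ennreal (heat_kernel s 0 z) * (\<integral>\<^sup>+x. ennreal (g x * g (x + z)) \<partial>lborel) \<partial>lborel)" .
  have inner: "incr_sq g z + 2 * (\<integral>\<^sup>+x. ennreal (g x * g (x + z)) \<partial>lborel) = 2 * sqnorm g" for z
  proof -
    have "incr_sq g z + 2 * (\<integral>\<^sup>+x. ennreal (g x * g (x + z)) \<partial>lborel)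
       = (\<integral>\<^sup>+x. ennreal ((g (x + z) - g x)\<^sup>2) + 2 * ennreal (g x * g (x + z)) \<partial>lborel)"
      unfolding incr_sq_def by (subst nn_integral_add) (auto simp: nn_integral_cmult)
    also have "\<dots> = (\<integral>\<^sup>+x. ennreal ((g (x + z))\<^sup>2) + ennreal ((g x)\<^sup>2) \<partial>lborel)"
    proof (intro nn_integral_cong)
      fix x
      have "ennreal ((g (x + z) - g x)\<^sup>2) + 2 * ennreal (g x * g (x + z)) = ennreal ((g (x + z) - g x)\<^sup>2) + ennreal (2 * (g x * g (x + z)))"
        using g0 by (simp add: ennreal_mult)
      also have "\<dots> = ennreal ((g (x + z) - g x)\<^sup>2 + 2 * (g x * g (x + z)))"
        using g0 by (intro ennreal_plus[symmetric]) auto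
      also have "(g (x + z) - g x)\<^sup>2 + 2 * (g x * g (x + z)) = (g (x + z))\<^sup>2 + (g x)\<^sup>2"
        by (simp add: power2_eq_square algebra_simps)
      finally show "ennreal ((g (x + z) - g x)\<^sup>2) + 2 * ennreal (g x * g (x + z)) = ennreal ((g (x + z))\<^sup>2) + ennreal ((g x)\<^sup>2)"
        by simp
    qed
    also have "\<dots> = 2 * sqnorm g"
      unfolding sqnorm_def using nn_integral_translate[of "\<lambda>x. ennreal ((g x)\<^sup>2)" z]
      by (subst nn_integral_add) (auto simp: mult_2)
    finally show ?thesis .
  qed
  have "energy s g + 2 * overlap s g = (\<integral>\<^sup>+z. ennreal (heat_kernel s 0 z) * (incr_sq g z + 2 * (\<integral>\<^sup>+x. ennreal (g x * g (x + z)) \<partial>lborel)) \<partial>lborel)"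
    unfolding energy_def ov distrib_left
    by (subst nn_integral_cmult[symmetric], measurable, subst nn_integral_add[symmetric], measurable) (simp add: mult_ac)
  also have "\<dots> = 2 * sqnorm g"
    unfolding inner using s by (simp add: nn_integral_multc nn_integral_heat_kernel)
  finally show ?thesis .
qed

lemma ennreal_two_mult_le: "2 * (a * b) \<le> a\<^sup>2 + (b::ennreal)\<^sup>2"
proof (cases "a = \<top> \<or> b = \<top>")
  case True
  then show ?thesis by (auto simp: power2_eq_square ennreal_top_mult)
next
  case False
  then obtain r t where "a = ennreal r" "r \<ge> 0" "b = ennreal t" "t \<ge> 0"
    by (metis ennreal_cases)
  moreover have "2 * (r * t) \<le> r\<^sup>2 + t\<^sup>2" using sum_squares_bound[of r t] by simp
  ultimately show ?thesis
    by (simp add: ennreal_mult[symmetric] ennreal_power ennreal_plus[symmetric] ennreal_numeral[symmetric] ennreal_leI del: ennreal_plus ennreal_numeral)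
qed

text \<open>With P the heat operator at time s, the semigroup law gives <g, P^2 g> = |P g|^2, and 2
  <g, P g> is at most |g|^2 + |P g|^2. By the relation between energy and overlap this is the
  claim.\<close>

lemma energy_double:
  fixes g :: "'a::euclidean_space \<Rightarrow> real"
  assumes g [measurable]: "g \<in> borel_measurable borel" and g0: "\<And>x. g x \<ge> 0" and s: "s > 0" and fin: "sqnorm g < \<infinity>"
  shows "energy (2 * s) g \<le> 2 * energy s g"
proof -
  define P where "P u = (\<integral>\<^sup>+y. ennreal (heat_kernel s u y) * ennreal (g y) \<partial>lborel)" for u
  have [measurable]: "P \<in> borel_measurable borel" unfolding P_def by measurable
  have "overlap (2 * s) g = (\<integral>\<^sup>+x. (\<integral>\<^sup>+y. (\<integral>\<^sup>+u. (ennreal (heat_kernel s u x) * ennreal (g x)) * (ennreal (heat_kernel s u y) * ennreal (g y)) \<partial>lborel) \<partial>lborel) \<partial>lborel)"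
    unfolding overlap_def
  proof (intro nn_integral_cong)
    fix x y :: 'a
    have "ennreal (g x) * ennreal (heat_kernel (2 * s) x y) * ennreal (g y) = (ennreal (g x) * ennreal (g y)) * ennreal (heat_kernel (s + s) x y)"
      unfolding mult_2 by (simp only: mult_ac)
    also have "\<dots> = (ennreal (g x) * ennreal (g y)) * (\<integral>\<^sup>+u. ennreal (heat_kernel s x u) * ennreal (heat_kernel s u y) \<partial>lborel)"
      by (simp only: heat_kernel_Chapman_Kolmogorov[OF s s])
    also have "\<dots> = (\<integral>\<^sup>+u. (ennreal (g x) * ennreal (g y)) * (ennreal (heat_kernel s x u) * ennreal (heat_kernel s u y)) \<partial>lborel)"
      by (rule nn_integral_cmult[symmetric]) measurable
    also have "\<dots> = (\<integral>\<^sup>+u. (ennreal (heat_kernel s u x) * ennreal (g x)) * (ennreal (heat_kernel s u y) * ennreal (g y)) \<partial>lborel)"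
    proof (intro nn_integral_cong)
      fix u
      show "(ennreal (g x) * ennreal (g y)) * (ennreal (heat_kernel s x u) * ennreal (heat_kernel s u y)) = (ennreal (heat_kernel s u x) * ennreal (g x)) * (ennreal (heat_kernel s u y) * ennreal (g y))"
        unfolding heat_kernel_commute[of s x u] by (simp only: mult_ac)
    qed
    finally show "ennreal (g x) * ennreal (heat_kernel (2 * s) x y) * ennreal (g y) = \<dots>" .
  qed
  also have "\<dots> = (\<integral>\<^sup>+x. (\<integral>\<^sup>+u. (\<integral>\<^sup>+y. (ennreal (heat_kernel s u x) * ennreal (g x)) * (ennreal (heat_kernel s u y) * ennreal (g y)) \<partial>lborel) \<partial>lborel) \<partial>lborel)"
    by (intro nn_integral_cong lborel_pair.Fubini') measurable
  also have "\<dots> = (\<integral>\<^sup>+u. (\<integral>\<^sup>+x. (\<integral>\<^sup>+y. (ennreal (heat_kernel s u x) * ennreal (g x)) * (ennreal (heat_kernel s u y) * ennreal (g y)) \<partial>lborel) \<partial>lborel) \<partial>lborel)"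
    by (rule lborel_pair.Fubini') measurable
  also have "\<dots> = (\<integral>\<^sup>+u. (P u)\<^sup>2 \<partial>lborel)"
    unfolding P_def power2_eq_square by (simp add: nn_integral_cmult nn_integral_multc)
  finally have o2: "overlap (2 * s) g = (\<integral>\<^sup>+u. (P u)\<^sup>2 \<partial>lborel)" .
  have o1: "overlap s g = (\<integral>\<^sup>+u. ennreal (g u) * P u \<partial>lborel)"
    unfolding overlap_def P_def by (simp add: nn_integral_cmult[symmetric] mult_ac)
  have "2 * overlap s g = (\<integral>\<^sup>+u. 2 * (ennreal (g u) * P u) \<partial>lborel)"
    unfolding o1 by (simp add: nn_integral_cmult)
  also have "\<dots> \<le> (\<integral>\<^sup>+u. (ennreal (g u))\<^sup>2 + (P u)\<^sup>2 \<partial>lborel)"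
    by (intro nn_integral_mono ennreal_two_mult_le)
  also have "\<dots> = sqnorm g + overlap (2 * s) g"
    unfolding o2 sqnorm_def using g0 by (subst nn_integral_add) (auto simp: ennreal_power)
  finally have key: "2 * overlap s g \<le> sqnorm g + overlap (2 * s) g" .
  have e1: "energy s g + 2 * overlap s g = 2 * sqnorm g" by (rule energy_add_overlap[OF g g0 s])
  have e2: "energy (2 * s) g + 2 * overlap (2 * s) g = 2 * sqnorm g" by (rule energy_add_overlap[OF g g0]) (use s in simp)
  have f2: "2 * sqnorm g < \<top>" using fin by (simp add: ennreal_mult_less_top)
  have self: "t \<le> 2 * t" for t :: ennreal by (simp add: mult_2)
  have "energy s g \<le> 2 * sqnorm g" "overlap s g \<le> 2 * sqnorm g"
    unfolding e1[symmetric] by (auto intro: order_trans[OF self])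
  moreover have "energy (2 * s) g \<le> 2 * sqnorm g" "overlap (2 * s) g \<le> 2 * sqnorm g"
    unfolding e2[symmetric] by (auto intro: order_trans[OF self])
  ultimately have lt: "energy s g < \<top>" "overlap s g < \<top>" "energy (2 * s) g < \<top>" "overlap (2 * s) g < \<top>"
    by (auto intro: le_less_trans[OF _ f2])
  define N E1 O1 E2 O2 where "N = enn2real (sqnorm g)" and "E1 = enn2real (energy s g)" and "O1 = enn2real (overlap s g)"
    and "E2 = enn2real (energy (2 * s) g)" and "O2 = enn2real (overlap (2 * s) g)"
  then have r: "sqnorm g = ennreal N" "energy s g = ennreal E1" "overlap s g = ennreal O1" "energy (2 * s) g = ennreal E2" "overlap (2 * s) g = ennreal O2"
    and nn: "N \<ge> 0" "E1 \<ge> 0" "O1 \<ge> 0" "E2 \<ge> 0" "O2 \<ge> 0"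
    using fin lt by simp_all
  have num: "2 * ennreal t = ennreal (2 * t)" if "t \<ge> 0" for t using that by (simp add: ennreal_mult)
  have "E1 + 2 * O1 = 2 * N" "E2 + 2 * O2 = 2 * N" "2 * O1 \<le> N + O2"
    using e1 e2 key nn unfolding r by (simp_all add: num ennreal_plus[symmetric] del: ennreal_plus)
  then have "E2 \<le> 2 * E1" by linarith
  then show ?thesis unfolding r using nn by (simp add: num ennreal_leI)
qed

lemma energy_power2:
  fixes g :: "'a::euclidean_space \<Rightarrow> real"
  assumes "g \<in> borel_measurable borel" "\<And>x. g x \<ge> 0" "s > 0" "sqnorm g < \<infinity>"
  shows "energy (2 ^ k * s) g \<le> 2 ^ k * energy s g"
proof (induction k)
  case (Suc k)
  have "energy (2 * (2 ^ k * s)) g \<le> 2 * energy (2 ^ k * s) g"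
    using assms by (intro energy_double) auto
  also have "\<dots> \<le> 2 * (2 ^ k * energy s g)" by (intro mult_left_mono Suc) auto
  finally show ?case by (simp add: mult.assoc)
qed simp

text \<open>Cauchy-Schwarz with the weight split as sqrt(k) times sqrt(k) |F|; total mass at most 1
  is enough.\<close>

lemma Jensen_square:
  fixes k F :: "'a \<Rightarrow> real"
  assumes [measurable]: "k \<in> borel_measurable M" "F \<in> borel_measurable M" and k: "\<And>y. k y \<ge> 0"
    and one: "(\<integral>\<^sup>+y. ennreal (k y) \<partial>M) \<le> 1"
  shows "ennreal ((\<integral>y. k y * F y \<partial>M)\<^sup>2) \<le> (\<integral>\<^sup>+y. ennreal (k y * (F y)\<^sup>2) \<partial>M)"
proof -
  have "ennreal \<bar>\<integral>y. k y * F y \<partial>M\<bar> \<le> (\<integral>\<^sup>+y. ennreal \<bar>k y * F y\<bar> \<partial>M)"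
  proof (cases "integrable M (\<lambda>y. k y * F y)")
    case True
    then show ?thesis using integral_norm_bound_ennreal[OF True] by simp
  \<comment> \<open>A product that is not integrable has Bochner integral 0, so the bound is
    trivial.\<close>
  qed (simp add: not_integrable_integral_eq)
  also have "\<dots> = (\<integral>\<^sup>+y. ennreal (sqrt (k y)) * ennreal (sqrt (k y) * \<bar>F y\<bar>) \<partial>M)"
    using k by (intro nn_integral_cong) (simp add: ennreal_mult[symmetric] abs_mult mult.assoc[symmetric])
  finally have "(ennreal \<bar>\<integral>y. k y * F y \<partial>M\<bar>)\<^sup>2 \<le> (\<integral>\<^sup>+y. ennreal (sqrt (k y)) * ennreal (sqrt (k y) * \<bar>F y\<bar>) \<partial>M)\<^sup>2"
    by (rule power_mono) simp
  also have "\<dots> \<le> (\<integral>\<^sup>+y. (ennreal (sqrt (k y)))\<^sup>2 \<partial>M) * (\<integral>\<^sup>+y. (ennreal (sqrt (k y) * \<bar>F y\<bar>))\<^sup>2 \<partial>M)"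
    by (rule Cauchy_Schwarz_nn_integral) measurable
  also have "\<dots> = (\<integral>\<^sup>+y. ennreal (k y) \<partial>M) * (\<integral>\<^sup>+y. ennreal (k y * (F y)\<^sup>2) \<partial>M)"
    using k by (simp add: ennreal_power power_mult_distrib)
  also have "\<dots> \<le> 1 * (\<integral>\<^sup>+y. ennreal (k y * (F y)\<^sup>2) \<partial>M)"
    by (intro mult_right_mono one) simp
  finally show ?thesis by (simp add: ennreal_power)
qed

text \<open>The width is tied to the heat kernel at time \<open>\<epsilon>\<^sup>2\<close>: on the
  support the Gaussian exponent is at least -1/4, so the rescaled bump is dominated with a constant
  \<open>K\<close> that does not depend on the width. This lets energies control mollification
  errors.\<close>

lemma exists_mollifier:
  "\<exists>K>0. \<forall>\<epsilon>>0. \<exists>\<rho>::'a::euclidean_space \<Rightarrow> real. bump_class (1 / \<epsilon>\<^sup>2) \<rho> \<and> (\<forall>u. 0 \<le> \<rho> u) \<and>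
      (\<integral>\<^sup>+u. ennreal (\<rho> u) \<partial>lborel) = 1 \<and> (\<forall>u. \<rho> u \<le> K * heat_kernel (\<epsilon>\<^sup>2) 0 u)"
proof -
  define b where "b x = flat_exp 0 (1 - x \<bullet> x)" for x :: 'a
  have bc: "bump_class 1 b" using bump_class.base[of 1 0, where 'a = 'a] by (simp add: b_def[abs_def])
  have [measurable]: "b \<in> borel_measurable borel"
    by (rule borel_measurable_continuous_onI) (rule bump_class_continuous[OF bc])
  have b0: "0 \<le> b x" for x by (simp add: b_def flat_exp_nonneg)
  have f1: "flat_exp 0 u \<le> 1" for u by (simp add: flat_exp_def)
  have b1: "b x \<le> indicator (cball 0 1) x" for x
  proof (cases "norm x \<le> 1")
    case False
    then have "1\<^sup>2 \<le> (norm x)\<^sup>2" by (intro power_mono) auto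
    then have "b x = 0" using bump_class_outside[OF bc, of x] by (simp add: power2_norm_eq_inner)
    then show ?thesis by simp
  qed (simp add: b_def f1)
  have "(\<integral>\<^sup>+x. ennreal (b x) \<partial>lborel) \<le> (\<integral>\<^sup>+x. indicator (cball 0 1) (x::'a) \<partial>lborel)"
  proof (rule nn_integral_mono)
    fix x show "ennreal (b x) \<le> indicator (cball 0 1) x"
      using b1[of x] by (auto simp: indicator_def ennreal_le_1 ennreal_neg split: if_splits)
  qed
  also have "\<dots> < \<infinity>" using emeasure_bounded_finite[of "cball 0 1 :: 'a set"] by simp
  finally have fin: "(\<integral>\<^sup>+x. ennreal (b x) \<partial>lborel) < \<infinity>" .
  \<comment> \<open>Positive mass: on the ball of radius 1/2 the argument of \<open>flat_exp\<close>
    is at least 3/4, where exp(-1/u) is at least exp(-4/3) and so exceeds exp(-2).\<close>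
  have "ennreal (exp (- 2)) * emeasure lborel (ball 0 (1/2) :: 'a set) = (\<integral>\<^sup>+x. ennreal (exp (- 2)) * indicator (ball 0 (1/2)) (x::'a) \<partial>lborel)"
    by (subst nn_integral_cmult_indicator) auto
  also have "\<dots> \<le> (\<integral>\<^sup>+x. ennreal (b x) \<partial>lborel)"
  proof (intro nn_integral_mono)
    fix x :: 'a
    show "ennreal (exp (- 2)) * indicator (ball 0 (1/2)) x \<le> ennreal (b x)"
    proof (cases "norm x < 1/2")
      case True
      then have "(norm x)\<^sup>2 \<le> (1/2)\<^sup>2" by (intro power_mono) auto
      then have v: "x \<bullet> x \<le> 1/4" unfolding power2_norm_eq_inner by (simp add: power2_eq_square)
      then have "- 2 \<le> - 1 / (1 - x \<bullet> x)" by (simp add: field_simps)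
      then have "exp (- 2) \<le> b x" using v by (simp add: b_def flat_exp_def)
      then show ?thesis using b0[of x] by (auto simp: indicator_def intro!: ennreal_leI)
    qed simp
  qed
  finally have "0 < (\<integral>\<^sup>+x. ennreal (b x) \<partial>lborel)"
  proof (rule less_le_trans[rotated])
    have "emeasure lborel (ball 0 (1/2) :: 'a set) \<noteq> 0"
      using content_ball_pos[of "1/2" "0::'a"] by (auto simp: measure_def)
    then show "0 < ennreal (exp (- 2)) * emeasure lborel (ball 0 (1/2) :: 'a set)"
      by (simp add: ennreal_zero_less_mult_iff zero_less_iff_neq_zero)
  qed
  then obtain I where I: "(\<integral>\<^sup>+x. ennreal (b x) \<partial>lborel) = ennreal I" "I > 0"
    using fin by (cases "\<integral>\<^sup>+x. ennreal (b x) \<partial>lborel") auto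
  define K where "K = exp (1/4) * (4 * pi) powr (real DIM('a) / 2) / I"
  have "\<exists>\<rho>::'a \<Rightarrow> real. bump_class (1 / \<epsilon>\<^sup>2) \<rho> \<and> (\<forall>u. 0 \<le> \<rho> u) \<and>
      (\<integral>\<^sup>+u. ennreal (\<rho> u) \<partial>lborel) = 1 \<and> (\<forall>u. \<rho> u \<le> K * heat_kernel (\<epsilon>\<^sup>2) 0 u)" if e: "\<epsilon> > 0" for \<epsilon> :: real
  proof (intro exI[of _ "\<lambda>u. (1 / (I * \<epsilon> ^ DIM('a))) * flat_exp 0 (1 - (1 / \<epsilon>\<^sup>2) * (u \<bullet> u))"] conjI allI)
    show bc': "bump_class (1 / \<epsilon>\<^sup>2) (\<lambda>u. (1 / (I * \<epsilon> ^ DIM('a))) * flat_exp 0 (1 - (1 / \<epsilon>\<^sup>2) * (u \<bullet> u)))"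
      by (intro bump_class.scale bump_class.base)
    show "0 \<le> (1 / (I * \<epsilon> ^ DIM('a))) * flat_exp 0 (1 - (1 / \<epsilon>\<^sup>2) * (u \<bullet> u))" for u :: 'a
      using I e by (intro mult_nonneg_nonneg flat_exp_nonneg) auto
    have "(\<integral>\<^sup>+u. ennreal ((1 / (I * \<epsilon> ^ DIM('a))) * flat_exp 0 (1 - (1 / \<epsilon>\<^sup>2) * ((u::'a) \<bullet> u))) \<partial>lborel)
      = (\<integral>\<^sup>+u. ennreal (1 / (I * \<epsilon> ^ DIM('a))) * ennreal (b (0 + (1 / \<epsilon>) *\<^sub>R u)) \<partial>lborel)"
      using I e by (intro nn_integral_cong) (simp add: b_def ennreal_mult[symmetric] flat_exp_nonneg power2_eq_square)
    also have "\<dots> = ennreal (1 / (I * \<epsilon> ^ DIM('a))) * (ennreal ((1 / (1 / \<epsilon>)) ^ DIM('a)) * ennreal I)"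
      using e by (subst nn_integral_cmult, measurable, subst nn_integral_scale[of "\<lambda>u. ennreal (b u)"]) (auto simp: I)
    also have "\<dots> = 1" using I e by (simp add: ennreal_mult[symmetric])
    finally show "(\<integral>\<^sup>+u. ennreal ((1 / (I * \<epsilon> ^ DIM('a))) * flat_exp 0 (1 - (1 / \<epsilon>\<^sup>2) * ((u::'a) \<bullet> u))) \<partial>lborel) = 1" .
    fix u :: 'a
    show "(1 / (I * \<epsilon> ^ DIM('a))) * flat_exp 0 (1 - (1 / \<epsilon>\<^sup>2) * (u \<bullet> u)) \<le> K * heat_kernel (\<epsilon>\<^sup>2) 0 u"
    proof (cases "1 \<le> (1 / \<epsilon>\<^sup>2) * (u \<bullet> u)")
      case True
      then have "flat_exp 0 (1 - (1 / \<epsilon>\<^sup>2) * (u \<bullet> u)) = 0" by (simp add: flat_exp_def)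
      then show ?thesis using I by (simp add: K_def)
    next
      case False
      then have "(norm u)\<^sup>2 \<le> \<epsilon>\<^sup>2" using e by (simp add: power2_norm_eq_inner divide_less_eq not_le)
      then have "exp (- (1/4)) \<le> exp (- (norm (0 - u))\<^sup>2 / (4 * \<epsilon>\<^sup>2))" using e by (simp add: divide_le_eq)
      then have ex: "1 \<le> exp (1/4) * exp (- (norm (0 - u))\<^sup>2 / (4 * \<epsilon>\<^sup>2))"
        using mult_left_mono[of "exp (- (1/4))" "exp (- (norm (0 - u))\<^sup>2 / (4 * \<epsilon>\<^sup>2))" "exp (1/4)"] by (simp add: exp_add[symmetric])
      have pw: "(4 * pi * \<epsilon>\<^sup>2) powr (- real DIM('a) / 2) = (4 * pi) powr (- real DIM('a) / 2) * (1 / \<epsilon> ^ DIM('a))"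
      proof -
        have "(\<epsilon>\<^sup>2) powr (- real DIM('a) / 2) = \<epsilon> powr (- real DIM('a))"
        proof -
          have "\<epsilon>\<^sup>2 = \<epsilon> powr 2" using e by simp
          then show ?thesis by (simp only: powr_powr) simp
        qed
        also have "\<dots> = 1 / \<epsilon> ^ DIM('a)" using e by (simp add: powr_minus_divide powr_realpow)
        finally show ?thesis by (simp add: powr_mult)
      qed
      have "K * heat_kernel (\<epsilon>\<^sup>2) 0 u = (exp (1/4) * exp (- (norm (0 - u))\<^sup>2 / (4 * \<epsilon>\<^sup>2))) * (1 / (I * \<epsilon> ^ DIM('a))) * ((4 * pi) powr (real DIM('a) / 2) * (4 * pi) powr (- real DIM('a) / 2))"
        unfolding K_def heat_kernel_def pw by (simp add: mult_ac)
      also have "(4 * pi) powr (real DIM('a) / 2) * (4 * pi) powr (- real DIM('a) / 2) = 1"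
        by (simp add: powr_add[symmetric])
      finally have "K * heat_kernel (\<epsilon>\<^sup>2) 0 u = (exp (1/4) * exp (- (norm (0 - u))\<^sup>2 / (4 * \<epsilon>\<^sup>2))) * (1 / (I * \<epsilon> ^ DIM('a)))" by simp
      moreover have "(1 / (I * \<epsilon> ^ DIM('a))) * flat_exp 0 (1 - (1 / \<epsilon>\<^sup>2) * (u \<bullet> u)) \<le> (1 / (I * \<epsilon> ^ DIM('a))) * (exp (1/4) * exp (- (norm (0 - u))\<^sup>2 / (4 * \<epsilon>\<^sup>2)))"
        using I e by (intro mult_left_mono order_trans[OF f1 ex]) auto
      ultimately show ?thesis by (simp add: mult_ac)
    qed
  qed
  moreover have "K > 0" using I by (simp add: K_def)
  ultimately show ?thesis by blast
qed

lemma lborel_integral_translate: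
  fixes f :: "'a::euclidean_space \<Rightarrow> real"
  assumes [measurable]: "f \<in> borel_measurable borel"
  shows "(\<integral>y. f (y + z) \<partial>lborel) = (\<integral>y. f y \<partial>lborel)"
proof -
  have "(\<integral>y. f y \<partial>lborel) = (\<integral>y. f y \<partial>distr lborel borel ((+) z))" by (simp add: lborel_distr_plus)
  also have "\<dots> = (\<integral>y. f (y + z) \<partial>lborel)" by (subst integral_distr) (auto simp: add.commute)
  finally show ?thesis ..
qed

lemma lborel_integrable_translate:
  fixes f :: "'a::euclidean_space \<Rightarrow> real"
  assumes "integrable lborel f"
  shows "integrable lborel (\<lambda>y. f (y + z))"
proof -
  have [measurable]: "f \<in> borel_measurable borel" using assms by auto
  have "integrable (distr lborel borel ((+) z)) f" using assms by (simp add: lborel_distr_plus)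
  then show ?thesis by (subst (asm) integrable_distr_eq) (auto simp: add.commute)
qed

section \<open>Effect of mollification on energy and norm\<close>

context
  fixes q :: real and \<rho> g :: "'a::euclidean_space \<Rightarrow> real"
  assumes \<rho>: "bump_class q \<rho>" and q: "q > 0" and \<rho>_nonneg: "\<And>u. 0 \<le> \<rho> u"
    and \<rho>_one: "(\<integral>\<^sup>+u. ennreal (\<rho> u) \<partial>lborel) = 1"
    and g: "integrable lborel g"
begin

lemma conv_measurables: "\<rho> \<in> borel_measurable borel" "g \<in> borel_measurable borel" "conv \<rho> g \<in> borel_measurable borel"
proof -
  show r [measurable]: "\<rho> \<in> borel_measurable borel"
    by (rule borel_measurable_continuous_onI) (rule bump_class_continuous[OF \<rho>])
  show g' [measurable]: "g \<in> borel_measurable borel" using g by auto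
  show "conv \<rho> g \<in> borel_measurable borel" unfolding conv_def[abs_def] by measurable
qed

lemma mollifier_reflected: "(\<integral>\<^sup>+y. ennreal (\<rho> (x - y)) \<partial>lborel) = 1"
  using nn_integral_reflect[of "\<lambda>u. ennreal (\<rho> u)" x] conv_measurables(1) \<rho>_one by simp

lemma mollifier_translated: "(\<integral>\<^sup>+x. ennreal (\<rho> (x - y)) \<partial>lborel) = 1"
  using nn_integral_translate[of "\<lambda>u. ennreal (\<rho> u)" "- y"] conv_measurables(1) \<rho>_one by simp

lemma mollifier_integral: "integrable lborel (\<lambda>y. \<rho> (x - y))" "(\<integral>y. \<rho> (x - y) \<partial>lborel) = 1"
proof -
  note conv_measurables(1)[measurable]
  show "integrable lborel (\<lambda>y. \<rho> (x - y))"
    using \<rho>_nonneg by (intro integrableI_nonneg) (auto simp: mollifier_reflected)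
  show "(\<integral>y. \<rho> (x - y) \<partial>lborel) = 1"
    using \<rho>_nonneg by (subst integral_eq_nn_integral) (auto simp: mollifier_reflected)
qed

lemma nn_integral_mollified:
  fixes F :: "'a \<Rightarrow> real"
  assumes [measurable]: "F \<in> borel_measurable borel" and "\<And>y. F y \<ge> 0"
  shows "(\<integral>\<^sup>+x. (\<integral>\<^sup>+y. ennreal (\<rho> (x - y) * F y) \<partial>lborel) \<partial>lborel) = (\<integral>\<^sup>+y. ennreal (F y) \<partial>lborel)"
proof -
  note conv_measurables(1)[measurable]
  have "(\<integral>\<^sup>+x. (\<integral>\<^sup>+y. ennreal (\<rho> (x - y) * F y) \<partial>lborel) \<partial>lborel) = (\<integral>\<^sup>+y. (\<integral>\<^sup>+x. ennreal (\<rho> (x - y) * F y) \<partial>lborel) \<partial>lborel)"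
    by (rule lborel_pair.Fubini') measurable
  also have "\<dots> = (\<integral>\<^sup>+y. (\<integral>\<^sup>+x. ennreal (\<rho> (x - y)) \<partial>lborel) * ennreal (F y) \<partial>lborel)"
    using assms(2) \<rho>_nonneg by (simp add: ennreal_mult nn_integral_multc)
  finally show ?thesis by (simp add: mollifier_translated)
qed

text \<open>Convolution commutes with translation, so the increment of the mollified function is an
  average of increments of \<open>g\<close>; Jensen's inequality and Fubini conclude.\<close>

lemma incr_sq_conv_le: "incr_sq (conv \<rho> g) z \<le> incr_sq g z"
proof -
  note conv_measurables[measurable]
  have "conv \<rho> g (x + z) - conv \<rho> g x = (\<integral>y. \<rho> (x - y) * (g (y + z) - g y) \<partial>lborel)" for x
  proof -
    have "conv \<rho> g (x + z) = (\<integral>y. \<rho> (x + z - (y + z)) * g (y + z) \<partial>lborel)"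
      unfolding conv_def by (rule lborel_integral_translate[symmetric, where f = "\<lambda>y. \<rho> (x + z - y) * g y"]) measurable
    also have "\<dots> = (\<integral>y. \<rho> (x - y) * g (y + z) \<partial>lborel)" by simp
    finally have "conv \<rho> g (x + z) = (\<integral>y. \<rho> (x - y) * g (y + z) \<partial>lborel)" .
    then show ?thesis
      using bump_class_conv_integrable[OF \<rho> q g, of x] bump_class_conv_integrable[OF \<rho> q lborel_integrable_translate[OF g, of z], of x]
      by (simp add: conv_def right_diff_distrib)
  qed
  then have "incr_sq (conv \<rho> g) z = (\<integral>\<^sup>+x. ennreal ((\<integral>y. \<rho> (x - y) * (g (y + z) - g y) \<partial>lborel)\<^sup>2) \<partial>lborel)"
    by (simp add: incr_sq_def)
  also have "\<dots> \<le> (\<integral>\<^sup>+x. (\<integral>\<^sup>+y. ennreal (\<rho> (x - y) * (g (y + z) - g y)\<^sup>2) \<partial>lborel) \<partial>lborel)"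
    using \<rho>_nonneg by (intro nn_integral_mono Jensen_square) (auto simp: mollifier_reflected)
  also have "\<dots> = incr_sq g z"
    unfolding incr_sq_def by (rule nn_integral_mollified) auto
  finally show ?thesis .
qed

lemma energy_conv_le: "energy s (conv \<rho> g) \<le> energy s g"
  unfolding energy_def by (intro nn_integral_mono mult_left_mono incr_sq_conv_le) simp

lemma sqnorm_conv_le: "sqnorm (conv \<rho> g) \<le> sqnorm g"
proof -
  note conv_measurables[measurable]
  have "sqnorm (conv \<rho> g) \<le> (\<integral>\<^sup>+x. (\<integral>\<^sup>+y. ennreal (\<rho> (x - y) * (g y)\<^sup>2) \<partial>lborel) \<partial>lborel)"
    unfolding sqnorm_def conv_def using \<rho>_nonneg by (intro nn_integral_mono Jensen_square) (auto simp: mollifier_reflected)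
  also have "\<dots> = sqnorm g"
    unfolding sqnorm_def by (rule nn_integral_mollified) auto
  finally show ?thesis .
qed

text \<open>The difference is an average of increments of \<open>g\<close> with weight
  \<open>\<rho>\<close>. After Jensen's inequality the weight is replaced by the dominating heat
  kernel, which turns the double integral into the energy.\<close>

lemma sqnorm_conv_diff_le:
  assumes K: "K \<ge> 0" "\<And>u. \<rho> u \<le> K * heat_kernel s 0 u"
  shows "sqnorm (\<lambda>x. conv \<rho> g x - g x) \<le> ennreal K * energy s g"
proof -
  note conv_measurables[measurable]
  have "conv \<rho> g x - g x = (\<integral>y. \<rho> (x - y) * (g y - g x) \<partial>lborel)" for x
    using bump_class_conv_integrable[OF \<rho> q g, of x] mollifier_integral[of x]
    by (simp add: conv_def right_diff_distrib)
  then have "sqnorm (\<lambda>x. conv \<rho> g x - g x) = (\<integral>\<^sup>+x. ennreal ((\<integral>y. \<rho> (x - y) * (g y - g x) \<partial>lborel)\<^sup>2) \<partial>lborel)"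
    by (simp add: sqnorm_def)
  also have "\<dots> \<le> (\<integral>\<^sup>+x. (\<integral>\<^sup>+y. ennreal (\<rho> (x - y) * (g y - g x)\<^sup>2) \<partial>lborel) \<partial>lborel)"
    using \<rho>_nonneg by (intro nn_integral_mono Jensen_square) (auto simp: mollifier_reflected)
  also have "\<dots> \<le> (\<integral>\<^sup>+x. (\<integral>\<^sup>+y. ennreal (K * heat_kernel s 0 (y - x)) * ennreal ((g y - g x)\<^sup>2) \<partial>lborel) \<partial>lborel)"
  proof (intro nn_integral_mono)
    fix x y
    have "\<rho> (x - y) * (g y - g x)\<^sup>2 \<le> (K * heat_kernel s 0 (y - x)) * (g y - g x)\<^sup>2"
      using K(2)[of "x - y"] heat_kernel_uminus[of s "y - x"] by (intro mult_right_mono) auto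
    then show "ennreal (\<rho> (x - y) * (g y - g x)\<^sup>2) \<le> ennreal (K * heat_kernel s 0 (y - x)) * ennreal ((g y - g x)\<^sup>2)"
      using K(1) by (simp add: ennreal_mult[symmetric] ennreal_leI)
  qed
  also have "\<dots> = (\<integral>\<^sup>+x. (\<integral>\<^sup>+z. ennreal (K * heat_kernel s 0 z) * ennreal ((g (x + z) - g x)\<^sup>2) \<partial>lborel) \<partial>lborel)"
  proof (rule nn_integral_cong)
    fix x
    show "(\<integral>\<^sup>+y. ennreal (K * heat_kernel s 0 (y - x)) * ennreal ((g y - g x)\<^sup>2) \<partial>lborel) = (\<integral>\<^sup>+z. ennreal (K * heat_kernel s 0 z) * ennreal ((g (x + z) - g x)\<^sup>2) \<partial>lborel)"
      using nn_integral_translate[of "\<lambda>y. ennreal (K * heat_kernel s 0 (y - x)) * ennreal ((g y - g x)\<^sup>2)" x]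
      by (simp add: add.commute)
  qed
  also have "\<dots> = (\<integral>\<^sup>+z. (\<integral>\<^sup>+x. ennreal (K * heat_kernel s 0 z) * ennreal ((g (x + z) - g x)\<^sup>2) \<partial>lborel) \<partial>lborel)"
    by (rule lborel_pair.Fubini') measurable
  also have "\<dots> = ennreal K * energy s g"
    unfolding energy_def incr_sq_def using K(1)
    by (subst nn_integral_cmult[symmetric], measurable) (simp add: nn_integral_cmult ennreal_mult mult.assoc)
  finally show ?thesis .
qed

end

section \<open>Energy compared with the Dirichlet integral\<close>

text \<open>The quadratic error of the Taylor expansion contributes \<open>O(\<bar>z\<bar>\<^sup>3)\<close> to the squared increment.\<close>

lemma energy_ge_gradient:
  fixes \<phi> :: "'a::euclidean_space \<Rightarrow> real" and w :: "'a \<Rightarrow> 'a"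
  assumes s: "s > 0" and A: "A \<ge> 0"
    and T: "\<And>x z. \<bar>\<phi> (x + z) - \<phi> x - w x \<bullet> z\<bar> \<le> A * (norm z)\<^sup>2" "\<And>x z. \<bar>w x \<bullet> z\<bar> \<le> A * norm z"
    and [measurable]: "\<phi> \<in> borel_measurable borel" "w \<in> borel_measurable borel" "S \<in> sets borel"
    and L: "emeasure lborel S \<le> ennreal L" "L \<ge> 0"
  shows "ennreal (2 * s) * (\<integral>\<^sup>+x. ennreal ((norm (w x))\<^sup>2) * indicator S x \<partial>lborel)
     \<le> energy s \<phi> + ennreal (2 * A\<^sup>2 * L * ((gauss4 TYPE('a) + 2 * real DIM('a)) * s * sqrt s))"
proof -
  have pt: "(w x \<bullet> z)\<^sup>2 \<le> (\<phi> (x + z) - \<phi> x)\<^sup>2 + 2 * A\<^sup>2 * norm z ^ 3" for x z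
  proof -
    define p r where "p = w x \<bullet> z" and "r = \<phi> (x + z) - \<phi> x"
    have "p\<^sup>2 - r\<^sup>2 = 2 * (p * (p - r)) - (p - r)\<^sup>2" by (simp add: power2_eq_square algebra_simps)
    also have "\<dots> \<le> 2 * (p * (p - r))" by simp
    also have "\<dots> \<le> 2 * (\<bar>p\<bar> * \<bar>r - p\<bar>)"
      by (metis abs_ge_self abs_minus_commute abs_mult mult_left_mono zero_le_numeral)
    also have "\<dots> \<le> 2 * ((A * norm z) * (A * (norm z)\<^sup>2))"
      using T[of x z] A unfolding p_def r_def by (intro mult_left_mono mult_mono) auto
    also have "\<dots> = 2 * A\<^sup>2 * norm z ^ 3" by (simp add: power2_eq_square power3_eq_cube)
    finally show ?thesis by (simp add: p_def r_def)
  qed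
  have "ennreal (2 * s) * (\<integral>\<^sup>+x. ennreal ((norm (w x))\<^sup>2) * indicator S x \<partial>lborel)
      = (\<integral>\<^sup>+x. (\<integral>\<^sup>+z. ennreal (heat_kernel s 0 z * (w x \<bullet> z)\<^sup>2) * indicator S x \<partial>lborel) \<partial>lborel)"
  proof -
    have "(\<integral>\<^sup>+z. ennreal (heat_kernel s 0 z * (w x \<bullet> z)\<^sup>2) * indicator S x \<partial>lborel) = ennreal (2 * s) * (ennreal ((norm (w x))\<^sup>2) * indicator S x)" for x
      using s ennreal_mult[of "2 * s" "(norm (w x))\<^sup>2"]
      by (subst nn_integral_multc, measurable, subst nn_integral_heat_kernel_moment2[OF s]) (simp add: mult.assoc)
    then show ?thesis by (simp only:) (rule nn_integral_cmult[symmetric], measurable)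
  qed
  \<comment> \<open>The cubic error carries the indicator of \<open>S\<close>, so it is charged on a
    set of finite volume; the main term is estimated on the whole space.\<close>
  also have "\<dots> \<le> (\<integral>\<^sup>+x. (\<integral>\<^sup>+z. ennreal (heat_kernel s 0 z) * ennreal ((\<phi> (x + z) - \<phi> x)\<^sup>2) + ennreal (2 * A\<^sup>2) * indicator S x * ennreal (heat_kernel s 0 z * norm (z::'a) ^ 3) \<partial>lborel) \<partial>lborel)"
  proof (intro nn_integral_mono)
    fix x z
    have "heat_kernel s 0 z * (w x \<bullet> z)\<^sup>2 \<le> heat_kernel s 0 z * ((\<phi> (x + z) - \<phi> x)\<^sup>2 + 2 * A\<^sup>2 * norm z ^ 3)"
      by (intro mult_left_mono pt) simp
    also have "\<dots> = heat_kernel s 0 z * (\<phi> (x + z) - \<phi> x)\<^sup>2 + 2 * A\<^sup>2 * (heat_kernel s 0 z * norm z ^ 3)" by (simp add: algebra_simps)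
    finally have "ennreal (heat_kernel s 0 z * (w x \<bullet> z)\<^sup>2) \<le> ennreal (heat_kernel s 0 z) * ennreal ((\<phi> (x + z) - \<phi> x)\<^sup>2) + ennreal (2 * A\<^sup>2) * ennreal (heat_kernel s 0 z * norm z ^ 3)"
      by (simp add: ennreal_mult[symmetric] ennreal_plus[symmetric] ennreal_leI del: ennreal_plus)
    then show "ennreal (heat_kernel s 0 z * (w x \<bullet> z)\<^sup>2) * indicator S x \<le> ennreal (heat_kernel s 0 z) * ennreal ((\<phi> (x + z) - \<phi> x)\<^sup>2) + ennreal (2 * A\<^sup>2) * indicator S x * ennreal (heat_kernel s 0 z * norm (z::'a) ^ 3)"
      by (auto simp: indicator_def)
  qed
  also have "\<dots> = (\<integral>\<^sup>+x. (\<integral>\<^sup>+z. ennreal (heat_kernel s 0 z) * ennreal ((\<phi> (x + z) - \<phi> x)\<^sup>2) \<partial>lborel)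
      + (\<integral>\<^sup>+z. ennreal (2 * A\<^sup>2) * indicator S x * ennreal (heat_kernel s 0 z * norm (z::'a) ^ 3) \<partial>lborel) \<partial>lborel)"
    by (rule nn_integral_cong, rule nn_integral_add) measurable
  also have "\<dots> = (\<integral>\<^sup>+x. (\<integral>\<^sup>+z. ennreal (heat_kernel s 0 z) * ennreal ((\<phi> (x + z) - \<phi> x)\<^sup>2) \<partial>lborel) \<partial>lborel)
      + (\<integral>\<^sup>+x. (\<integral>\<^sup>+z. ennreal (2 * A\<^sup>2) * indicator S x * ennreal (heat_kernel s 0 z * norm (z::'a) ^ 3) \<partial>lborel) \<partial>lborel)"
    by (rule nn_integral_add) measurable
  also have "(\<integral>\<^sup>+x. (\<integral>\<^sup>+z. ennreal (heat_kernel s 0 z) * ennreal ((\<phi> (x + z) - \<phi> x)\<^sup>2) \<partial>lborel) \<partial>lborel) = (\<integral>\<^sup>+z. (\<integral>\<^sup>+x. ennreal (heat_kernel s 0 z) * ennreal ((\<phi> (x + z) - \<phi> x)\<^sup>2) \<partial>lborel) \<partial>lborel)"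
    by (rule lborel_pair.Fubini') measurable
  also have "\<dots> = energy s \<phi>" unfolding energy_def incr_sq_def by (simp add: nn_integral_cmult)
  also have "(\<integral>\<^sup>+x. (\<integral>\<^sup>+z. ennreal (2 * A\<^sup>2) * indicator S x * ennreal (heat_kernel s 0 z * norm (z::'a) ^ 3) \<partial>lborel) \<partial>lborel)
     = ennreal (2 * A\<^sup>2) * emeasure lborel S * (\<integral>\<^sup>+z. ennreal (heat_kernel s 0 z * norm (z::'a) ^ 3) \<partial>lborel)"
    by (simp add: nn_integral_cmult nn_integral_multc)
  also have "\<dots> \<le> ennreal (2 * A\<^sup>2) * ennreal L * ennreal ((gauss4 TYPE('a) + 2 * real DIM('a)) * s * sqrt s)"
    by (intro mult_mono L nn_integral_heat_kernel_norm3 s) auto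
  also have "\<dots> = ennreal (2 * A\<^sup>2 * L * ((gauss4 TYPE('a) + 2 * real DIM('a)) * s * sqrt s))"
    using L s gauss4_pos[where 'a = 'a] by (simp add: ennreal_mult[symmetric] less_imp_le)
  finally show ?thesis by (simp add: add_mono)
qed

text \<open>The increment is the integral of the derivative along the segment. Jensen's inequality
  in the parameter and translation invariance bound its square by the directional derivative, and
  the second moment of the heat kernel averages over directions.\<close>

lemma energy_le_gradient:
  fixes \<phi> :: "'a::euclidean_space \<Rightarrow> real"
  assumes s: "s > 0" and \<phi>: "smooth_fun \<phi>"
  shows "energy s \<phi> \<le> ennreal (2 * s) * (\<integral>\<^sup>+x. ennreal ((norm (grad \<phi> x))\<^sup>2) \<partial>lborel)"
proof -
  note d = smooth_fun_has_derivative[OF \<phi>] and c = grad_continuous[OF \<phi>]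
  have [measurable]: "grad \<phi> \<in> borel_measurable borel" by (rule borel_measurable_continuous_onI[OF c])
  have incr: "incr_sq \<phi> z \<le> (\<integral>\<^sup>+x. ennreal ((grad \<phi> x \<bullet> z)\<^sup>2) \<partial>lborel)" for z
  proof -
    have "ennreal ((\<phi> (x + z) - \<phi> x)\<^sup>2) \<le> (\<integral>\<^sup>+t. ennreal (indicator {0..1::real} t * (grad \<phi> (x + t *\<^sub>R z) \<bullet> z)\<^sup>2) \<partial>lborel)" for x
    proof -
      have "(\<integral>t. (grad \<phi> (x + t *\<^sub>R z) \<bullet> z) * indicator {0..1::real} t \<partial>lborel) = \<phi> (x + 1 *\<^sub>R z) - \<phi> (x + 0 *\<^sub>R z)"
      proof (rule integral_FTC_Icc_real)
        fix t :: real
        have "((\<lambda>t. x + t *\<^sub>R z) has_derivative (\<lambda>r. r *\<^sub>R z)) (at t)" by (auto intro!: derivative_eq_intros)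
        from has_derivative_compose[OF this d]
        show "((\<lambda>t. \<phi> (x + t *\<^sub>R z)) has_real_derivative grad \<phi> (x + t *\<^sub>R z) \<bullet> z) (at t)"
          by (simp add: has_field_derivative_def mult.commute[of _ "_ \<bullet> _"])
        have "continuous_on UNIV (\<lambda>t::real. grad \<phi> (x + t *\<^sub>R z) \<bullet> z)"
          by (intro continuous_intros continuous_on_compose2[OF c]) auto
        then show "isCont (\<lambda>t. grad \<phi> (x + t *\<^sub>R z) \<bullet> z) t" by (simp add: continuous_on_eq_continuous_at)
      qed simp
      then have "\<phi> (x + z) - \<phi> x = (\<integral>t. indicator {0..1::real} t * (grad \<phi> (x + t *\<^sub>R z) \<bullet> z) \<partial>lborel)"
        by (simp add: mult.commute)
      also have "ennreal (\<dots>\<^sup>2) \<le> (\<integral>\<^sup>+t. ennreal (indicator {0..1::real} t * (grad \<phi> (x + t *\<^sub>R z) \<bullet> z)\<^sup>2) \<partial>lborel)"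
      proof (rule Jensen_square)
        have "(\<integral>\<^sup>+t. ennreal (indicator {0..1::real} t) \<partial>lborel) = (\<integral>\<^sup>+t. indicator {0..1::real} t \<partial>lborel)"
          by (intro nn_integral_cong) (auto simp: indicator_def)
        also have "\<dots> = 1" by simp
        finally show "(\<integral>\<^sup>+t. ennreal (indicator {0..1::real} t) \<partial>lborel) \<le> 1" by simp
      qed auto
      finally show ?thesis .
    qed
    then have "incr_sq \<phi> z \<le> (\<integral>\<^sup>+x. (\<integral>\<^sup>+t. ennreal (indicator {0..1::real} t * (grad \<phi> (x + t *\<^sub>R z) \<bullet> z)\<^sup>2) \<partial>lborel) \<partial>lborel)"
      unfolding incr_sq_def by (intro nn_integral_mono)
    also have "\<dots> = (\<integral>\<^sup>+t. (\<integral>\<^sup>+x. ennreal (indicator {0..1::real} t * (grad \<phi> (x + t *\<^sub>R z) \<bullet> z)\<^sup>2) \<partial>lborel) \<partial>lborel)"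
      by (rule pair_sigma_finite.Fubini'[of lborel lborel]) (auto intro: pair_sigma_finite.intro sigma_finite_lborel)
    also have "\<dots> = (\<integral>\<^sup>+t. indicator {0..1::real} t * (\<integral>\<^sup>+x. ennreal ((grad \<phi> x \<bullet> z)\<^sup>2) \<partial>lborel) \<partial>lborel)"
    proof (intro nn_integral_cong)
      fix t :: real
      have "(\<integral>\<^sup>+x. ennreal ((grad \<phi> (x + t *\<^sub>R z) \<bullet> z)\<^sup>2) \<partial>lborel) = (\<integral>\<^sup>+x. ennreal ((grad \<phi> x \<bullet> z)\<^sup>2) \<partial>lborel)"
        by (rule nn_integral_translate[of "\<lambda>x. ennreal ((grad \<phi> x \<bullet> z)\<^sup>2)"]) measurable
      then show "(\<integral>\<^sup>+x. ennreal (indicator {0..1::real} t * (grad \<phi> (x + t *\<^sub>R z) \<bullet> z)\<^sup>2) \<partial>lborel) = indicator {0..1::real} t * (\<integral>\<^sup>+x. ennreal ((grad \<phi> x \<bullet> z)\<^sup>2) \<partial>lborel)"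
        by (auto simp: indicator_def)
    qed
    also have "\<dots> = (\<integral>\<^sup>+x. ennreal ((grad \<phi> x \<bullet> z)\<^sup>2) \<partial>lborel)"
      by (simp add: nn_integral_multc)
    finally show ?thesis .
  qed
  have "energy s \<phi> \<le> (\<integral>\<^sup>+z. (\<integral>\<^sup>+x. ennreal (heat_kernel s 0 z) * ennreal ((grad \<phi> x \<bullet> z)\<^sup>2) \<partial>lborel) \<partial>lborel)"
    unfolding energy_def by (simp add: nn_integral_cmult) (intro nn_integral_mono mult_left_mono incr, simp)
  also have "\<dots> = (\<integral>\<^sup>+x. (\<integral>\<^sup>+z. ennreal (heat_kernel s 0 z * (grad \<phi> x \<bullet> z)\<^sup>2) \<partial>lborel) \<partial>lborel)"
    by (subst lborel_pair.Fubini') (auto simp: ennreal_mult)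
  also have "\<dots> = ennreal (2 * s) * (\<integral>\<^sup>+x. ennreal ((norm (grad \<phi> x))\<^sup>2) \<partial>lborel)"
    unfolding nn_integral_heat_kernel_moment2[OF s] using s by (simp add: ennreal_mult'' nn_integral_cmult)
  finally show ?thesis .
qed

section \<open>The Dirichlet eigenvalue and the step kernel\<close>

lemma lborel_integral_scale:
  fixes f :: "'a::euclidean_space \<Rightarrow> real"
  assumes [measurable]: "f \<in> borel_measurable borel" and r: "r > 0"
  shows "(\<integral>x. f (p + r *\<^sub>R x) \<partial>lborel) = (1 / r) ^ DIM('a) * (\<integral>x. f x \<partial>lborel)"
proof -
  have "lborel = density (distr lborel borel (\<lambda>x. p + r *\<^sub>R x)) (\<lambda>_. ennreal (\<bar>r\<bar>^DIM('a)))"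
    by (rule lborel_affine) (use r in auto)
  then have "(\<integral>x. f x \<partial>lborel) = (\<integral>x. f x \<partial>density (distr lborel borel (\<lambda>x. p + r *\<^sub>R x)) (\<lambda>_. ennreal (\<bar>r\<bar>^DIM('a))))"
    by simp
  also have "\<dots> = r ^ DIM('a) * (\<integral>x. f (p + r *\<^sub>R x) \<partial>lborel)"
    using r by (subst integral_density, simp, simp, simp) (subst integral_distr, simp, simp, simp)
  finally show ?thesis using r by (simp add: power_divide)
qed

lemma conv_support:
  assumes u: "bump_class q u" and x: "conv u g x \<noteq> 0"
  shows "\<exists>y. g y \<noteq> 0 \<and> q * (norm (x - y))\<^sup>2 < 1"
proof (rule ccontr)
  assume "\<nexists>y. g y \<noteq> 0 \<and> q * (norm (x - y))\<^sup>2 < 1"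
  then have "(\<lambda>y. u (x - y) * g y) = (\<lambda>_. 0)"
    using bump_class_outside[OF u] by (auto simp: power2_norm_eq_inner not_less fun_eq_iff)
  then show False using x by (simp add: conv_def)
qed

lemma sqnorm_finite_integrable:
  assumes "g \<in> borel_measurable borel" "sqnorm g < \<infinity>"
  shows "integrable lborel (\<lambda>x. (g x)\<^sup>2)" "sqnorm g = ennreal (\<integral>x. (g x)\<^sup>2 \<partial>lborel)"
proof -
  show i: "integrable lborel (\<lambda>x. (g x)\<^sup>2)"
    using assms unfolding sqnorm_def by (intro integrableI_nonneg) auto
  show "sqnorm g = ennreal (\<integral>x. (g x)\<^sup>2 \<partial>lborel)"
    unfolding sqnorm_def by (rule nn_integral_eq_integral[OF i]) auto
qed

section \<open>Rayleigh quotients on the box\<close>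

context box_potential
begin

definition eigen :: real where "eigen = dirichlet_eigenvalue (cbox a b) (\<lambda>x. - V x)"

lemma integrable_V_mult:
  assumes "integrable lborel (\<lambda>x. (f x)\<^sup>2)" "T \<in> borel_measurable borel"
  shows "integrable lborel (\<lambda>x. V (T x) * (f x)\<^sup>2)"
proof -
  obtain C where C: "C > 0" "\<And>x. \<bar>V x\<bar> \<le> C" using V_bounded by blast
  note assms(2)[measurable]
  show ?thesis
  proof (rule Bochner_Integration.integrable_bound[where f = "\<lambda>x. C * (f x)\<^sup>2"])
    show "(\<lambda>x. V (T x) * (f x)\<^sup>2) \<in> borel_measurable lborel" using assms by measurable
    show "AE x in lborel. norm (V (T x) * (f x)\<^sup>2) \<le> norm (C * (f x)\<^sup>2)"
    proof (intro AE_I2)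
      fix x
      have "\<bar>V (T x)\<bar> * (f x)\<^sup>2 \<le> C * (f x)\<^sup>2" by (intro mult_right_mono C) auto
      then show "norm (V (T x) * (f x)\<^sup>2) \<le> norm (C * (f x)\<^sup>2)"
        by (simp only: real_norm_def abs_mult abs_power2 abs_of_pos[OF C(1)])
    qed
  qed (use assms in simp)
qed

definition rayleigh_set :: "real set" where
  "rayleigh_set = {(\<integral>x. - V x * (\<phi> x)\<^sup>2 \<partial>lborel) - (\<integral>x. (norm (grad \<phi> x))\<^sup>2 \<partial>lborel) | \<phi>.
            smooth_fun \<phi> \<and> closure {x. \<phi> x \<noteq> 0} \<subseteq> cbox a b \<and> (\<integral>x. (\<phi> x)\<^sup>2 \<partial>lborel) = 1}"

lemma eigen_eq: "eigen = Sup rayleigh_set"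
  by (simp add: eigen_def dirichlet_eigenvalue_def rayleigh_set_def)

text \<open>A supremum of reals is meaningful only for a nonempty set bounded above. The gradient
  term has a favourable sign and the potential is bounded.\<close>

lemma rayleigh_bdd_above: "bdd_above rayleigh_set"
proof -
  obtain C where C: "C > 0" "\<And>x. \<bar>V x\<bar> \<le> C" using V_bounded by blast
  show ?thesis
  proof (rule bdd_aboveI[of _ C])
    fix r assume "r \<in> rayleigh_set"
    then obtain \<phi> where r: "r = (\<integral>x. - V x * (\<phi> x)\<^sup>2 \<partial>lborel) - (\<integral>x. (norm (grad \<phi> x))\<^sup>2 \<partial>lborel)"
      and one: "(\<integral>x. (\<phi> x)\<^sup>2 \<partial>lborel) = 1" unfolding rayleigh_set_def by blast
    \<comment> \<open>A function that is not integrable would have integral 0 instead of 1.\<close>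
    have i: "integrable lborel (\<lambda>x. (\<phi> x)\<^sup>2)" using one not_integrable_integral_eq by fastforce
    have "(\<integral>x. - V x * (\<phi> x)\<^sup>2 \<partial>lborel) \<le> (\<integral>x. C * (\<phi> x)\<^sup>2 \<partial>lborel)"
    proof (rule integral_mono)
      show "integrable lborel (\<lambda>x. - V x * (\<phi> x)\<^sup>2)" using integrable_V_mult[OF i, of "\<lambda>x. x"] by simp
      show "- V x * (\<phi> x)\<^sup>2 \<le> C * (\<phi> x)\<^sup>2" for x
        using abs_le_D2[OF C(2)[of x]] by (intro mult_right_mono) auto
    qed (use i in simp)
    moreover have "(\<integral>x. C * (\<phi> x)\<^sup>2 \<partial>lborel) = C" using one by simp
    moreover have "0 \<le> (\<integral>x. (norm (grad \<phi> x))\<^sup>2 \<partial>lborel)" by simp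
    ultimately show "r \<le> C" unfolding r by linarith
  qed
qed

text \<open>The homogeneous form of the variational principle, obtained by normalising
  \<open>\<psi>\<close>; for norm 0 the potential term vanishes and only the sign of the gradient
  term is left.\<close>

lemma rayleigh_le:
  assumes \<psi>: "smooth_fun \<psi>" and supp: "closure {x. \<psi> x \<noteq> 0} \<subseteq> cbox a b"
    and int: "integrable lborel (\<lambda>x. (\<psi> x)\<^sup>2)"
  shows "- (\<integral>x. V x * (\<psi> x)\<^sup>2 \<partial>lborel) - (\<integral>x. (norm (grad \<psi> x))\<^sup>2 \<partial>lborel) \<le> eigen * (\<integral>x. (\<psi> x)\<^sup>2 \<partial>lborel)"
proof -
  define N where "N = (\<integral>x. (\<psi> x)\<^sup>2 \<partial>lborel)"
  have N0: "N \<ge> 0" by (simp add: N_def)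
  show ?thesis
  proof (cases "N = 0")
    case True
    then have "AE x in lborel. (\<psi> x)\<^sup>2 = 0"
      using int unfolding N_def by (subst (asm) integral_nonneg_eq_0_iff_AE) auto
    then have "(\<integral>x. V x * (\<psi> x)\<^sup>2 \<partial>lborel) = 0"
      by (intro integral_eq_zero_AE) (auto elim!: eventually_mono)
    moreover have "0 \<le> (\<integral>x. (norm (grad \<psi> x))\<^sup>2 \<partial>lborel)" by simp
    ultimately show ?thesis using True by (simp add: N_def)
  next
    case False
    then have N: "N > 0" using N0 by simp
    define t where "t = 1 / sqrt N"
    have t: "t\<^sup>2 = 1 / N" using N by (simp add: t_def power_divide)
    \<comment> \<open>The trivial affine map puts the normalised function into the shape required by
      \<open>smooth_fun_affine\<close>.\<close>
    define \<phi> where "\<phi> x = t * \<psi> (0 + 1 *\<^sub>R x)" for x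
    have sm: "smooth_fun \<phi>" unfolding \<phi>_def by (rule smooth_fun_affine[OF \<psi>])
    have gr: "grad \<phi> x = t *\<^sub>R grad \<psi> x" for x
      unfolding \<phi>_def[abs_def] using grad_affine[OF \<psi>, of t 0 1 x] by simp
    have "{x. \<phi> x \<noteq> 0} \<subseteq> {x. \<psi> x \<noteq> 0}" by (auto simp: \<phi>_def)
    then have sp: "closure {x. \<phi> x \<noteq> 0} \<subseteq> cbox a b" using supp closure_mono by blast
    have sq: "(\<phi> x)\<^sup>2 = (1 / N) * (\<psi> x)\<^sup>2" for x by (simp add: \<phi>_def power_mult_distrib t)
    have one: "(\<integral>x. (\<phi> x)\<^sup>2 \<partial>lborel) = 1" unfolding sq using N by (simp add: N_def[symmetric])
    have "(\<integral>x. - V x * (\<phi> x)\<^sup>2 \<partial>lborel) - (\<integral>x. (norm (grad \<phi> x))\<^sup>2 \<partial>lborel) \<le> eigen"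
      unfolding eigen_eq by (rule cSup_upper[OF _ rayleigh_bdd_above]) (use sm sp one in \<open>auto simp: rayleigh_set_def\<close>)
    moreover have "(\<integral>x. - V x * (\<phi> x)\<^sup>2 \<partial>lborel) = (1 / N) * - (\<integral>x. V x * (\<psi> x)\<^sup>2 \<partial>lborel)"
      unfolding sq by (subst mult.left_commute) simp
    moreover have "(\<integral>x. (norm (grad \<phi> x))\<^sup>2 \<partial>lborel) = (1 / N) * (\<integral>x. (norm (grad \<psi> x))\<^sup>2 \<partial>lborel)"
      unfolding gr by (simp add: power_mult_distrib t)
    ultimately have "(1 / N) * (- (\<integral>x. V x * (\<psi> x)\<^sup>2 \<partial>lborel) - (\<integral>x. (norm (grad \<psi> x))\<^sup>2 \<partial>lborel)) \<le> eigen"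
      by (simp only: right_diff_distrib)
    then show ?thesis using N by (simp add: N_def[symmetric] divide_le_eq)
  qed
qed

definition halfwidth :: real where "halfwidth = Min ((\<lambda>i. (b - a) \<bullet> i / 2) ` Basis)"
definition center :: 'a where "center = (1/2) *\<^sub>R (a + b)"
text \<open>\<open>V\<close> drops to 0 off the box. Composing with the nearest-point projection
  extends it uniformly continuously, so that values at points of the mollified support outside the
  box can be compared with values inside.\<close>

definition clampV :: "'a \<Rightarrow> real" where "clampV x = V (closest_point (cbox a b) x)"
text \<open>A ball of this radius about the centre contains the neighbourhood of width 1 of the box,
  hence the supports of all mollifications of width at most 1.\<close>

definition fat_radius :: real where "fat_radius = norm (b - a) + 1"

lemma halfwidth_pos: "halfwidth > 0"
  unfolding halfwidth_def using box_nonempty by (subst Min_gr_iff) (auto simp: inner_diff_left)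

lemma halfwidth_le: "i \<in> Basis \<Longrightarrow> halfwidth \<le> (b - a) \<bullet> i / 2"
  unfolding halfwidth_def by (intro Min_le) auto

lemma box_ne: "cbox a b \<noteq> {}"
  using box_nonempty by (auto simp: box_ne_empty less_imp_le)

lemma mem_box_center: "x \<in> cbox a b \<longleftrightarrow> (\<forall>i\<in>Basis. \<bar>(x - center) \<bullet> i\<bar> \<le> (b - a) \<bullet> i / 2)"
  unfolding mem_box by (intro ball_cong refl) (auto simp: center_def inner_diff_left inner_add_left abs_le_iff field_simps)

lemma box_radius: "y \<in> cbox a b \<Longrightarrow> norm (y - center) \<le> norm (b - a)"
proof -
  assume y: "y \<in> cbox a b"
  have "\<bar>(y - center) \<bullet> i\<bar> \<le> \<bar>(b - a) \<bullet> i\<bar>" if i: "i \<in> Basis" for i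
    using y i box_nonempty unfolding mem_box_center by (force simp: inner_diff_left)
  then show ?thesis by (rule norm_le_componentwise)
qed

lemma closest_in_box: "closest_point (cbox a b) x \<in> cbox a b"
  by (rule closest_point_in_set) (use box_ne in auto)

lemma clampV_eq: "x \<in> cbox a b \<Longrightarrow> clampV x = V x"
  by (simp add: clampV_def closest_point_self)

lemma closest_point_measurable [measurable]: "closest_point (cbox a b) \<in> borel_measurable borel"
  by (rule borel_measurable_continuous_onI, rule continuous_on_closest_point) (use box_ne in auto)

text \<open>Uniform continuity on the compact box, combined with the fact that the nearest-point
  projection does not increase distances.\<close>

lemma clampV_modulus:
  assumes "\<eta> > 0"
  shows "\<exists>d>0. \<forall>x\<in>cbox a b. \<forall>y. norm (x - y) < d \<longrightarrow> \<bar>V x - clampV y\<bar> \<le> \<eta>"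
proof -
  have "uniformly_continuous_on (cbox a b) V"
    by (rule compact_uniformly_continuous[OF W_continuous]) simp
  then obtain d where d: "d > 0" "\<And>x y. x \<in> cbox a b \<Longrightarrow> y \<in> cbox a b \<Longrightarrow> dist y x < d \<Longrightarrow> dist (V y) (V x) < \<eta>"
    using assms unfolding uniformly_continuous_on_def by metis
  have "\<bar>V x - clampV y\<bar> \<le> \<eta>" if x: "x \<in> cbox a b" "norm (x - y) < d" for x y
  proof -
    have "dist (closest_point (cbox a b) x) (closest_point (cbox a b) y) \<le> dist x y"
      by (rule closest_point_lipschitz) (use box_ne in auto)
    then have "dist x (closest_point (cbox a b) y) < d"
      using x by (simp add: closest_point_self dist_norm)
    then have "dist (V x) (V (closest_point (cbox a b) y)) < \<eta>" by (intro d closest_in_box x)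
    then show ?thesis by (simp add: clampV_def dist_real_def)
  qed
  then show ?thesis using d(1) by blast
qed

definition admissible :: "('a \<Rightarrow> real) \<Rightarrow> bool" where
  "admissible g \<longleftrightarrow> g \<in> borel_measurable borel \<and> (\<forall>x. 0 \<le> g x) \<and> (\<forall>x. x \<notin> cbox a b \<longrightarrow> g x = 0) \<and> sqnorm g < \<infinity>"

lemma admissible_integrable:
  assumes g: "admissible g"
  shows "integrable lborel g"
    and "(\<integral>y. \<bar>g y\<bar> \<partial>lborel)\<^sup>2 \<le> measure lborel (cbox a b) * (\<integral>x. (g x)\<^sup>2 \<partial>lborel)"
proof -
  have [measurable]: "g \<in> borel_measurable borel" and g0: "\<And>x. 0 \<le> g x" and gs: "\<And>x. x \<notin> cbox a b \<Longrightarrow> g x = 0"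
    and fin: "sqnorm g < \<infinity>" using g by (auto simp: admissible_def)
  have L: "emeasure lborel (cbox a b) = ennreal (measure lborel (cbox a b))"
    using emeasure_lborel_cbox_finite[of a b] by (simp add: emeasure_eq_ennreal_measure)
  have "(\<integral>\<^sup>+x. ennreal (g x) \<partial>lborel)\<^sup>2 = (\<integral>\<^sup>+x. indicator (cbox a b) x * ennreal (g x) \<partial>lborel)\<^sup>2"
    using gs by (intro arg_cong[where f = "\<lambda>x. x\<^sup>2"] nn_integral_cong) (auto simp: indicator_def)
  also have "\<dots> \<le> (\<integral>\<^sup>+x. (indicator (cbox a b) x)\<^sup>2 \<partial>lborel) * (\<integral>\<^sup>+x. (ennreal (g x))\<^sup>2 \<partial>lborel)"
    by (rule Cauchy_Schwarz_nn_integral) measurable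
  also have "(\<integral>\<^sup>+x. (indicator (cbox a b) x)\<^sup>2 \<partial>lborel) = (\<integral>\<^sup>+x. indicator (cbox a b) x \<partial>lborel)"
    by (intro nn_integral_cong) (auto simp: indicator_def)
  also have "(\<integral>\<^sup>+x. (ennreal (g x))\<^sup>2 \<partial>lborel) = sqnorm g" using g0 by (simp add: sqnorm_def ennreal_power)
  finally have cs: "(\<integral>\<^sup>+x. ennreal (g x) \<partial>lborel)\<^sup>2 \<le> ennreal (measure lborel (cbox a b)) * sqnorm g"
    using L by simp
  also have "\<dots> < \<top>" using fin by (simp add: ennreal_mult_less_top)
  finally have "(\<integral>\<^sup>+x. ennreal (g x) \<partial>lborel) < \<infinity>" 
    by (cases "(\<integral>\<^sup>+x. ennreal (g x) \<partial>lborel) = \<top>") (auto simp: power2_eq_square less_top)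
  then show i: "integrable lborel g" using g0 by (intro integrableI_nonneg) auto
  have e: "(\<integral>\<^sup>+x. ennreal (g x) \<partial>lborel) = ennreal (\<integral>y. \<bar>g y\<bar> \<partial>lborel)"
    using g0 nn_integral_eq_integral[OF i] by simp
  have "ennreal ((\<integral>y. \<bar>g y\<bar> \<partial>lborel)\<^sup>2) \<le> ennreal (measure lborel (cbox a b) * (\<integral>x. (g x)\<^sup>2 \<partial>lborel))"
    using cs unfolding e sqnorm_finite_integrable(2)[OF \<open>g \<in> borel_measurable borel\<close> fin] by (simp add: ennreal_power ennreal_mult)
  then show "(\<integral>y. \<bar>g y\<bar> \<partial>lborel)\<^sup>2 \<le> measure lborel (cbox a b) * (\<integral>x. (g x)\<^sup>2 \<partial>lborel)"
    by (subst (asm) ennreal_le_iff) auto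
qed

text \<open>In each coordinate the neighbourhood has half-width at most H +
  \<open>\<epsilon>\<close>, where H is that of the box, and \<open>\<kappa>\<close> is chosen so
  that this is at most \<open>\<kappa>\<close> H even for the shortest side.\<close>

lemma dilation_into_box:
  assumes \<epsilon>: "\<epsilon> > 0" and \<kappa>: "\<kappa> = 1 + \<epsilon> / halfwidth" and y: "y \<in> cbox a b" and u: "norm (u - y) < \<epsilon>"
  shows "center + (1 / \<kappa>) *\<^sub>R (u - center) \<in> cbox a b"
  unfolding mem_box_center
proof
  fix i :: 'a assume i: "i \<in> Basis"
  define H where "H = (b - a) \<bullet> i / 2"
  have k: "\<kappa> > 0" using \<epsilon> halfwidth_pos by (simp add: \<kappa> add_pos_pos)
  have H: "halfwidth \<le> H" using halfwidth_le[OF i] by (simp add: H_def)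
  have "\<bar>(u - center) \<bullet> i\<bar> \<le> \<bar>(u - y) \<bullet> i\<bar> + \<bar>(y - center) \<bullet> i\<bar>" by (simp add: inner_diff_left)
  also have "\<dots> \<le> \<epsilon> + H"
    using y i u Basis_le_norm[OF i, of "u - y"] unfolding mem_box_center H_def by (intro add_mono) auto
  also have "\<dots> \<le> \<kappa> * H"
  proof -
    have "\<epsilon> * halfwidth \<le> \<epsilon> * H" using H \<epsilon> by simp
    then have "\<epsilon> \<le> \<epsilon> / halfwidth * H" using halfwidth_pos by (simp add: le_divide_eq)
    then show ?thesis by (simp add: \<kappa> distrib_right)
  qed
  finally have "\<bar>(u - center) \<bullet> i\<bar> / \<kappa> \<le> H" using k by (simp add: divide_le_eq mult.commute)
  then show "\<bar>(center + (1 / \<kappa>) *\<^sub>R (u - center) - center) \<bullet> i\<bar> \<le> (b - a) \<bullet> i / 2"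
    using k by (simp add: H_def abs_mult)
qed

text \<open>The order of choice matters: the width \<open>\<epsilon>\<close> and the mollifier are
  fixed first, and \<open>B\<close> depends on them but not on \<open>s\<close> or \<open>g\<close>,
  so the term with sqrt s can be made small afterwards. The factor \<open>\<kappa>\<^sup>2\<close>
  comes from the gradient of the dilated function, \<open>\<eta>\<close> from moving the argument of
  the potential, and the last term from replacing the mollification by \<open>g\<close> in the
  zeroth-order terms.\<close>

lemma mollified_energy_bound:
  fixes \<rho> :: "'a \<Rightarrow> real"
  assumes \<epsilon>: "0 < \<epsilon>" "\<epsilon> \<le> 1" and \<kappa>: "\<kappa> = 1 + \<epsilon> / halfwidth" and \<eta>: "\<eta> > 0"
    and mod: "\<And>x y. x \<in> cbox a b \<Longrightarrow> norm (x - y) \<le> \<epsilon> / halfwidth * fat_radius \<Longrightarrow> \<bar>V x - clampV y\<bar> \<le> \<eta>"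
    and K: "K > 0" and C: "\<And>x. \<bar>V x\<bar> \<le> C" "C > 0"
    and \<rho>: "bump_class (1 / \<epsilon>\<^sup>2) \<rho>" "\<And>u. 0 \<le> \<rho> u" "(\<integral>\<^sup>+u. ennreal (\<rho> u) \<partial>lborel) = 1" "\<And>u. \<rho> u \<le> K * heat_kernel (\<epsilon>\<^sup>2) 0 u"
  shows "\<exists>B>0. \<forall>s>0. \<forall>g. admissible g \<longrightarrow>
    - eigen * (\<integral>x. (g x)\<^sup>2 \<partial>lborel) - (\<integral>x. V x * (g x)\<^sup>2 \<partial>lborel)
     \<le> \<kappa>\<^sup>2 * (enn2real (energy s g) / (2 * s) + B * sqrt s * (\<integral>x. (g x)\<^sup>2 \<partial>lborel)) + \<eta> * (\<integral>x. (g x)\<^sup>2 \<partial>lborel)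
       + (\<bar>eigen\<bar> + C) * (K * enn2real (energy (\<epsilon>\<^sup>2) g) / (2 * \<epsilon>) + 2 * \<epsilon> * (\<integral>x. (g x)\<^sup>2 \<partial>lborel))"
proof -
  let ?q = "1 / \<epsilon>\<^sup>2"
  have q: "?q > 0" using \<epsilon> by simp
  obtain D where D: "\<And>x. (\<rho> has_derivative D x) (at x)" "\<And>v. bump_class ?q (\<lambda>x. D x v)"
    using bump_class_has_derivative[OF \<rho>(1)] by blast
  obtain B0 where B0: "B0 > 0" and Tay: "\<And>g x z. integrable lborel g \<Longrightarrow>
      \<bar>conv \<rho> g (x + z) - conv \<rho> g x - conv (\<lambda>w. D w z) g x\<bar> \<le> B0 * (norm z)\<^sup>2 * (\<integral>y. \<bar>g y\<bar> \<partial>lborel)"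
      "\<And>g x z. integrable lborel g \<Longrightarrow> \<bar>conv (\<lambda>w. D w z) g x\<bar> \<le> B0 * norm z * (\<integral>y. \<bar>g y\<bar> \<partial>lborel)"
    using conv_Taylor[OF D \<rho>(1) q] by blast
  define S where "S = cball center fat_radius"
  define L where "L = measure lborel S"
  have "emeasure lborel S < \<infinity>" by (rule emeasure_bounded_finite) (simp add: S_def)
  then have LS: "emeasure lborel S = ennreal L" "L \<ge> 0"
    unfolding L_def by (auto intro!: emeasure_eq_ennreal_measure)
  define c3 where "c3 = gauss4 TYPE('a) + 2 * real DIM('a)"
  have c3: "c3 > 0" using gauss4_pos[where 'a = 'a] by (simp add: c3_def add_pos_nonneg)
  \<comment> \<open>The Taylor error involves the squared L1 norm of \<open>g\<close>, which is at
    most the volume of the box times its squared L2 norm; \<open>L\<close> is the volume on which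
    the error is charged. The summand 1 secures positivity.\<close>
  define B where "B = B0\<^sup>2 * measure lborel (cbox a b) * L * c3 + 1"
  have B: "B > 0" using B0 LS c3 by (simp add: B_def add_nonneg_pos)
  have k1: "\<kappa> \<ge> 1" using \<epsilon> halfwidth_pos by (simp add: \<kappa>)
  show ?thesis
  proof (intro exI[of _ B] conjI B allI impI)
    fix s :: real and g :: "'a \<Rightarrow> real"
    assume s: "s > 0" and g: "admissible g"
    define G where "G = (\<integral>x. (g x)\<^sup>2 \<partial>lborel)"
    define \<phi> where "\<phi> = conv \<rho> g"
    define m where "m = (\<integral>y. \<bar>g y\<bar> \<partial>lborel)"
    have [measurable]: "g \<in> borel_measurable borel" and g0: "\<And>x. 0 \<le> g x" and gs: "\<And>x. x \<notin> cbox a b \<Longrightarrow> g x = 0"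
      and fin: "sqnorm g < \<infinity>" using g by (auto simp: admissible_def)
    note gi = admissible_integrable(1)[OF g]
    have m2: "m\<^sup>2 \<le> measure lborel (cbox a b) * G" using admissible_integrable(2)[OF g] by (simp add: m_def G_def)
    have m0: "m \<ge> 0" by (simp add: m_def)
    have G0: "G \<ge> 0" by (simp add: G_def)
    note cl = \<rho>(1) q \<rho>(2) \<rho>(3) gi
    have [measurable]: "\<phi> \<in> borel_measurable borel" unfolding \<phi>_def by (rule conv_measurables(3)[OF cl])
    have sm: "smooth_fun \<phi>" unfolding \<phi>_def by (rule conv_smooth[OF \<rho>(1) q gi])
    have dgr: "grad \<phi> x \<bullet> v = conv (\<lambda>w. D w v) g x" for x v
      using has_derivative_unique[OF smooth_fun_has_derivative[OF sm] conv_has_derivative[OF D \<rho>(1) q gi, folded \<phi>_def]]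
      by (rule fun_cong)
    have supp: "\<exists>y\<in>cbox a b. norm (x - y) < \<epsilon>" if u: "bump_class ?q u" "conv u g x \<noteq> 0" for u x
    proof -
      obtain y where y: "g y \<noteq> 0" "?q * (norm (x - y))\<^sup>2 < 1" using conv_support[OF u] by blast
      then have "(norm (x - y))\<^sup>2 < \<epsilon>\<^sup>2" using \<epsilon> by (simp add: divide_less_eq)
      then have "norm (x - y) < \<epsilon>" using \<epsilon> by (simp add: power_less_imp_less_base)
      then show ?thesis using y gs by blast
    qed
    have suppS: "norm (x - center) \<le> fat_radius" if "y \<in> cbox a b" "norm (x - y) < \<epsilon>" for x y
      using box_radius[OF that(1)] norm_triangle_ineq[of "x - y" "y - center"] that(2) \<epsilon> by (simp add: fat_radius_def)
    have grS: "grad \<phi> x = 0" if "x \<notin> S" for x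
    proof -
      have "conv (\<lambda>w. D w v) g x = 0" for v
        using supp[OF D(2), of v x] suppS[of _ x] that by (auto simp: S_def dist_norm norm_minus_commute)
      then have "grad \<phi> x \<bullet> grad \<phi> x = 0" unfolding dgr by simp
      then show ?thesis by simp
    qed
    have [measurable]: "grad \<phi> \<in> borel_measurable borel"
      by (rule borel_measurable_continuous_onI[OF grad_continuous[OF sm]])
    have efin: "energy r g \<le> 2 * sqnorm g" if "r > 0" for r
      unfolding energy_add_overlap[OF \<open>g \<in> borel_measurable borel\<close> g0 that, symmetric] by simp
    have sq: "sqnorm g = ennreal G" unfolding G_def by (rule sqnorm_finite_integrable(2)) (use fin in auto)
    have en: "energy r g = ennreal (enn2real (energy r g))" if "r > 0" for r
      using efin[OF that] sq by (subst ennreal_enn2real) (auto simp: less_top[symmetric] ennreal_mult_eq_top_iff top_unique)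
    define I where "I = (\<integral>x. (norm (grad \<phi> x))\<^sup>2 \<partial>lborel)"
    have "ennreal (2 * s) * (\<integral>\<^sup>+x. ennreal ((norm (grad \<phi> x))\<^sup>2) * indicator S x \<partial>lborel)
       \<le> energy s \<phi> + ennreal (2 * (B0 * m)\<^sup>2 * L * (c3 * s * sqrt s))"
      unfolding c3_def
    proof (rule energy_ge_gradient[OF s])
      show "\<bar>\<phi> (x + z) - \<phi> x - grad \<phi> x \<bullet> z\<bar> \<le> B0 * m * (norm z)\<^sup>2" for x z
        using Tay(1)[OF gi, of x z] unfolding dgr by (simp add: \<phi>_def m_def mult_ac)
      show "\<bar>grad \<phi> x \<bullet> z\<bar> \<le> B0 * m * norm z" for x z
        using Tay(2)[OF gi, of z x] unfolding dgr by (simp add: m_def mult_ac)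
    qed (use B0 m0 LS in \<open>auto simp: S_def\<close>)
    also have "(\<integral>\<^sup>+x. ennreal ((norm (grad \<phi> x))\<^sup>2) * indicator S x \<partial>lborel) = (\<integral>\<^sup>+x. ennreal ((norm (grad \<phi> x))\<^sup>2) \<partial>lborel)"
      by (intro nn_integral_cong) (use grS in \<open>auto simp: indicator_def\<close>)
    also have "energy s \<phi> + ennreal (2 * (B0 * m)\<^sup>2 * L * (c3 * s * sqrt s)) \<le> ennreal (enn2real (energy s g)) + ennreal (2 * (B0 * m)\<^sup>2 * L * (c3 * s * sqrt s))"
      using energy_conv_le[OF cl, of s] en[OF s] unfolding \<phi>_def by (intro add_right_mono) simp
    finally have gI: "ennreal (2 * s) * (\<integral>\<^sup>+x. ennreal ((norm (grad \<phi> x))\<^sup>2) \<partial>lborel) \<le> ennreal (enn2real (energy s g) + 2 * (B0 * m)\<^sup>2 * L * (c3 * s * sqrt s))"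
      using LS c3 s by (subst ennreal_plus) auto
    have gfin: "(\<integral>\<^sup>+x. ennreal ((norm (grad \<phi> x))\<^sup>2) \<partial>lborel) \<noteq> \<top>"
    proof
      assume "(\<integral>\<^sup>+x. ennreal ((norm (grad \<phi> x))\<^sup>2) \<partial>lborel) = \<top>"
      then show False using gI s by (simp add: ennreal_mult_top top_unique)
    qed
    have Inn: "(\<integral>\<^sup>+x. ennreal ((norm (grad \<phi> x))\<^sup>2) \<partial>lborel) = ennreal I"
      unfolding I_def using gfin by (subst integral_eq_nn_integral) (auto simp: less_top[symmetric])
    have I0: "I \<ge> 0" by (simp add: I_def)
    have "2 * s * I \<le> enn2real (energy s g) + 2 * (B0 * m)\<^sup>2 * L * (c3 * s * sqrt s)"
    proof -
      have "ennreal (2 * s * I) \<le> ennreal (enn2real (energy s g) + 2 * (B0 * m)\<^sup>2 * L * (c3 * s * sqrt s))"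
        using gI s I0 unfolding Inn by (simp add: ennreal_mult[symmetric] del: ennreal_plus)
      then show ?thesis using s LS c3 by (subst (asm) ennreal_le_iff) auto
    qed
    also have "\<dots> \<le> enn2real (energy s g) + 2 * s * (B * sqrt s * G)"
    proof -
      have "(B0 * m)\<^sup>2 * L * c3 \<le> B0\<^sup>2 * (measure lborel (cbox a b) * G) * L * c3"
        unfolding power_mult_distrib using m2 LS c3 by (intro mult_right_mono mult_left_mono) auto
      also have "\<dots> \<le> B0\<^sup>2 * (measure lborel (cbox a b) * G) * L * c3 + G" using G0 by simp
      also have "\<dots> = B * G" by (simp add: B_def distrib_right)
      finally have "(2 * s * sqrt s) * ((B0 * m)\<^sup>2 * L * c3) \<le> (2 * s * sqrt s) * (B * G)"
        using s by (intro mult_left_mono) auto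
      then show ?thesis by (simp add: mult_ac)
    qed
    finally have Ile: "I \<le> enn2real (energy s g) / (2 * s) + B * sqrt s * G"
      using s by (simp add: field_simps)
    have sq\<phi>: "sqnorm \<phi> \<le> ennreal G" using sqnorm_conv_le[OF cl] unfolding \<phi>_def sq .
    then have fin\<phi>: "sqnorm \<phi> < \<infinity>" by (rule le_less_trans) simp
    note i\<phi> = sqnorm_finite_integrable[OF _ fin\<phi>] and ig = sqnorm_finite_integrable[OF _ fin]
    have i\<phi>2: "integrable lborel (\<lambda>x. (\<phi> x)\<^sup>2)" and ig2: "integrable lborel (\<lambda>x. (g x)\<^sup>2)"
      by (rule i\<phi>; simp) (rule ig; simp)
    define F where "F = (\<integral>x. (\<phi> x)\<^sup>2 \<partial>lborel)"
    have F: "0 \<le> F" "F \<le> G"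
      using sq\<phi> i\<phi>(2) G0 by (auto simp: F_def)
    \<comment> \<open>The mollification spills over the box; dilating by \<open>1 / \<kappa>\<close> about the centre makes it admissible for the Rayleigh quotient.\<close>
    define p where "p = center - \<kappa> *\<^sub>R center"
    define \<psi> where "\<psi> x = 1 * \<phi> (p + \<kappa> *\<^sub>R x)" for x
    define T where "T u = (1 / \<kappa>) *\<^sub>R (u - p)" for u
    have Tinv: "T (p + \<kappa> *\<^sub>R x) = x" for x using k1 by (simp add: T_def)
    have Tc: "T u = center + (1 / \<kappa>) *\<^sub>R (u - center)" for u
      using k1 by (simp add: T_def p_def algebra_simps)
    have [measurable]: "T \<in> borel_measurable borel" unfolding T_def[abs_def] by measurable
    have sm\<psi>: "smooth_fun \<psi>" unfolding \<psi>_def by (rule smooth_fun_affine[OF sm])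
    have gr\<psi>: "grad \<psi> x = \<kappa> *\<^sub>R grad \<phi> (p + \<kappa> *\<^sub>R x)" for x
      unfolding \<psi>_def[abs_def] using grad_affine[OF sm, of 1 p \<kappa> x] by simp
    have supp\<psi>: "closure {x. \<psi> x \<noteq> 0} \<subseteq> cbox a b"
    proof (rule closure_minimal)
      show "{x. \<psi> x \<noteq> 0} \<subseteq> cbox a b"
      proof
        fix x assume "x \<in> {x. \<psi> x \<noteq> 0}"
        then have "conv \<rho> g (p + \<kappa> *\<^sub>R x) \<noteq> 0" by (simp add: \<psi>_def \<phi>_def)
        from supp[OF \<rho>(1) this] obtain y where "y \<in> cbox a b" "norm (p + \<kappa> *\<^sub>R x - y) < \<epsilon>" by blast
        from dilation_into_box[OF \<epsilon>(1) \<kappa> this] show "x \<in> cbox a b"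
          unfolding Tc[symmetric] Tinv .
      qed
    qed (rule closed_cbox)
    define d where "d = (1 / \<kappa>) ^ DIM('a)"
    have d0: "d > 0" using k1 by (simp add: d_def)
    have sc: "(\<integral>x. f (p + \<kappa> *\<^sub>R x) \<partial>lborel) = d * (\<integral>x. f x \<partial>lborel)" if "f \<in> borel_measurable borel" for f :: "'a \<Rightarrow> real"
      unfolding d_def by (rule lborel_integral_scale[OF that]) (use k1 in simp)
    have i\<psi>: "integrable lborel (\<lambda>x. (\<psi> x)\<^sup>2)"
    proof (rule integrableI_nonneg)
      have "(\<integral>\<^sup>+x. ennreal ((\<psi> x)\<^sup>2) \<partial>lborel) = ennreal ((1 / \<kappa>) ^ DIM('a)) * sqnorm \<phi>"
        unfolding \<psi>_def sqnorm_def using k1 nn_integral_scale[of "\<lambda>u. ennreal ((\<phi> u)\<^sup>2)" \<kappa> p] by simp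
      also have "\<dots> < \<infinity>" using fin\<phi> by (simp add: ennreal_mult_less_top)
      finally show "(\<integral>\<^sup>+x. ennreal ((\<psi> x)\<^sup>2) \<partial>lborel) < \<infinity>" .
      show "(\<lambda>x. (\<psi> x)\<^sup>2) \<in> borel_measurable lborel" unfolding \<psi>_def by measurable
    qed simp
    have r1: "(\<integral>x. (\<psi> x)\<^sup>2 \<partial>lborel) = d * F" unfolding \<psi>_def F_def using sc[of "\<lambda>u. (\<phi> u)\<^sup>2"] by simp
    have r2: "(\<integral>x. V x * (\<psi> x)\<^sup>2 \<partial>lborel) = d * (\<integral>x. V (T x) * (\<phi> x)\<^sup>2 \<partial>lborel)"
      unfolding \<psi>_def using sc[of "\<lambda>u. V (T u) * (\<phi> u)\<^sup>2"] by (simp add: Tinv)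
    have r3: "(\<integral>x. (norm (grad \<psi> x))\<^sup>2 \<partial>lborel) = d * (\<kappa>\<^sup>2 * I)"
      unfolding gr\<psi> I_def using sc[of "\<lambda>u. (norm (grad \<phi> u))\<^sup>2"] by (simp add: power_mult_distrib)
    \<comment> \<open>All three integrals of the dilated function carry the same Jacobian
      \<open>d\<close>, which cancels; only the gradient keeps the extra
      \<open>\<kappa>\<^sup>2\<close>.\<close>
    have "d * (- (\<integral>x. V (T x) * (\<phi> x)\<^sup>2 \<partial>lborel) - \<kappa>\<^sup>2 * I) \<le> d * (eigen * F)"
      using rayleigh_le[OF sm\<psi> supp\<psi> i\<psi>] unfolding r1 r2 r3 by (simp add: right_diff_distrib mult.left_commute)
    then have ray: "- (\<integral>x. V (T x) * (\<phi> x)\<^sup>2 \<partial>lborel) - \<kappa>\<^sup>2 * I \<le> eigen * F"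
      using d0 by (simp only: mult_le_cancel_left_pos)
    have iV: "integrable lborel (\<lambda>x. V (T x) * (\<phi> x)\<^sup>2)" "integrable lborel (\<lambda>x. clampV x * (\<phi> x)\<^sup>2)"
      "integrable lborel (\<lambda>x. clampV x * (g x)\<^sup>2)"
      unfolding clampV_def by (intro integrable_V_mult i\<phi>2 ig2; measurable)+
    have v1: "(\<integral>x. V (T x) * (\<phi> x)\<^sup>2 \<partial>lborel) \<le> (\<integral>x. clampV x * (\<phi> x)\<^sup>2 \<partial>lborel) + \<eta> * G"
    proof -
      have "(\<integral>x. V (T x) * (\<phi> x)\<^sup>2 \<partial>lborel) \<le> (\<integral>x. clampV x * (\<phi> x)\<^sup>2 + \<eta> * (\<phi> x)\<^sup>2 \<partial>lborel)"
      proof (rule integral_mono)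
        fix x
        show "V (T x) * (\<phi> x)\<^sup>2 \<le> clampV x * (\<phi> x)\<^sup>2 + \<eta> * (\<phi> x)\<^sup>2"
        proof (cases "\<phi> x = 0")
          case False
          then have "conv \<rho> g x \<noteq> 0" by (simp add: \<phi>_def)
          from supp[OF \<rho>(1) this] obtain y where y: "y \<in> cbox a b" "norm (x - y) < \<epsilon>" by blast
          have Tb: "T x \<in> cbox a b" unfolding Tc by (rule dilation_into_box[OF \<epsilon>(1) \<kappa> y])
          have "T x - x = - (1 - 1 / \<kappa>) *\<^sub>R (x - center)" unfolding Tc by (simp add: algebra_simps)
          then have "norm (T x - x) = (1 - 1 / \<kappa>) * norm (x - center)" using k1 by simp
          also have "\<dots> \<le> (\<epsilon> / halfwidth) * fat_radius"
          proof (intro mult_mono suppS[OF y])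
            have "1 - 1 / \<kappa> = (\<kappa> - 1) / \<kappa>" using k1 by (simp add: field_simps)
            also have "\<dots> \<le> \<kappa> - 1" using k1 by (simp add: divide_le_eq mult_left_mono mult_right_mono mult_le_cancel_left1)
            finally show "1 - 1 / \<kappa> \<le> \<epsilon> / halfwidth" by (simp add: \<kappa>)
          qed (use \<epsilon> halfwidth_pos in auto)
          finally have "\<bar>V (T x) - clampV x\<bar> \<le> \<eta>" by (rule mod[OF Tb])
          then have "V (T x) \<le> clampV x + \<eta>" by linarith
          then have "V (T x) * (\<phi> x)\<^sup>2 \<le> (clampV x + \<eta>) * (\<phi> x)\<^sup>2" by (rule mult_right_mono) simp
          then show ?thesis by (simp add: distrib_right)
        qed simp
      qed (use iV i\<phi>2 in auto)
      also have "\<dots> = (\<integral>x. clampV x * (\<phi> x)\<^sup>2 \<partial>lborel) + \<eta> * F"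
        using iV i\<phi>2 by (simp add: F_def)
      also have "\<dots> \<le> (\<integral>x. clampV x * (\<phi> x)\<^sup>2 \<partial>lborel) + \<eta> * G" using F \<eta> by simp
      finally show ?thesis .
    qed
    have vg: "(\<integral>x. clampV x * (g x)\<^sup>2 \<partial>lborel) = (\<integral>x. V x * (g x)\<^sup>2 \<partial>lborel)"
    proof (rule Bochner_Integration.integral_cong[OF refl])
      fix x show "clampV x * (g x)\<^sup>2 = V x * (g x)\<^sup>2"
        using clampV_eq[of x] gs[of x] by (cases "x \<in> cbox a b") auto
    qed
    define Df where "Df = (\<integral>x. (\<phi> x - g x)\<^sup>2 \<partial>lborel)"
    have sd: "sqnorm (\<lambda>x. \<phi> x - g x) \<le> ennreal (K * enn2real (energy (\<epsilon>\<^sup>2) g))"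
    proof -
      have "sqnorm (\<lambda>x. \<phi> x - g x) \<le> ennreal K * energy (\<epsilon>\<^sup>2) g"
        unfolding \<phi>_def by (rule sqnorm_conv_diff_le[OF cl]) (use K \<rho>(4) in auto)
      also have "\<dots> = ennreal (K * enn2real (energy (\<epsilon>\<^sup>2) g))"
        using en[of "\<epsilon>\<^sup>2"] \<epsilon> K by (subst ennreal_mult) auto
      finally show ?thesis .
    qed
    have idf: "integrable lborel (\<lambda>x. (\<phi> x - g x)\<^sup>2)" and Df: "Df \<le> K * enn2real (energy (\<epsilon>\<^sup>2) g)"
    proof -
      have f: "sqnorm (\<lambda>x. \<phi> x - g x) < \<infinity>" using sd by (rule le_less_trans) simp
      note z = sqnorm_finite_integrable[OF _ f]
      show "integrable lborel (\<lambda>x. (\<phi> x - g x)\<^sup>2)" by (rule z) simp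
      show "Df \<le> K * enn2real (energy (\<epsilon>\<^sup>2) g)"
        using sd z(2) K by (simp add: Df_def)
    qed
    \<comment> \<open>Treating \<open>eigen + clampV\<close> as one bounded coefficient avoids a
      case distinction on the sign of \<open>eigen\<close>. The difference of the squares is split
      by the arithmetic-geometric mean inequality with weight \<open>\<epsilon>\<close>.\<close>
    have v2: "- (\<integral>x. (eigen + clampV x) * (g x)\<^sup>2 \<partial>lborel) \<le> - (\<integral>x. (eigen + clampV x) * (\<phi> x)\<^sup>2 \<partial>lborel)
        + (\<bar>eigen\<bar> + C) * (Df / (2 * \<epsilon>) + 2 * \<epsilon> * G)"
    proof -
      have ii: "integrable lborel (\<lambda>x. (eigen + clampV x) * (\<phi> x)\<^sup>2)" "integrable lborel (\<lambda>x. (eigen + clampV x) * (g x)\<^sup>2)"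
        unfolding distrib_right using iV i\<phi>2 ig2 by auto
      have "(\<integral>x. (eigen + clampV x) * (\<phi> x)\<^sup>2 \<partial>lborel) - (\<integral>x. (eigen + clampV x) * (g x)\<^sup>2 \<partial>lborel)
         = (\<integral>x. (eigen + clampV x) * (\<phi> x)\<^sup>2 - (eigen + clampV x) * (g x)\<^sup>2 \<partial>lborel)"
        using ii by simp
      also have "\<dots> \<le> (\<integral>x. (\<bar>eigen\<bar> + C) * ((1 / (2 * \<epsilon>)) * (\<phi> x - g x)\<^sup>2 + \<epsilon> * ((\<phi> x)\<^sup>2 + (g x)\<^sup>2)) \<partial>lborel)"
      proof (rule integral_mono)
        fix x
        have "(eigen + clampV x) * (\<phi> x)\<^sup>2 - (eigen + clampV x) * (g x)\<^sup>2 = (eigen + clampV x) * ((\<phi> x - g x) * (\<phi> x + g x))"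
          by (simp add: power2_eq_square algebra_simps)
        also have "\<dots> \<le> \<bar>eigen + clampV x\<bar> * \<bar>(\<phi> x - g x) * (\<phi> x + g x)\<bar>"
          by (metis abs_ge_self abs_mult)
        also have "\<dots> \<le> (\<bar>eigen\<bar> + C) * ((1 / (2 * \<epsilon>)) * (\<phi> x - g x)\<^sup>2 + \<epsilon> * ((\<phi> x)\<^sup>2 + (g x)\<^sup>2))"
        proof (intro mult_mono)
          show "\<bar>eigen + clampV x\<bar> \<le> \<bar>eigen\<bar> + C" using C(1) by (intro order_trans[OF abs_triangle_ineq] add_left_mono) (simp only: clampV_def)
          define r t where "r = \<bar>\<phi> x - g x\<bar>" and "t = \<bar>\<phi> x + g x\<bar>"
          have "0 \<le> (r - \<epsilon> * t)\<^sup>2" by simp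
          then have "2 * \<epsilon> * (r * t) \<le> r\<^sup>2 + \<epsilon>\<^sup>2 * t\<^sup>2" by (simp add: power2_eq_square algebra_simps)
          then have "r * t \<le> (r\<^sup>2 + \<epsilon>\<^sup>2 * t\<^sup>2) / (2 * \<epsilon>)" using \<epsilon> by (simp add: le_divide_eq mult_ac)
          also have "\<dots> = (1 / (2 * \<epsilon>)) * r\<^sup>2 + \<epsilon> / 2 * t\<^sup>2" using \<epsilon> by (simp add: add_divide_distrib power2_eq_square)
          also have "\<epsilon> / 2 * t\<^sup>2 \<le> \<epsilon> * ((\<phi> x)\<^sup>2 + (g x)\<^sup>2)"
          proof -
            have "0 \<le> (\<phi> x - g x)\<^sup>2" by simp
            then have "t\<^sup>2 \<le> 2 * ((\<phi> x)\<^sup>2 + (g x)\<^sup>2)" by (simp add: t_def power2_eq_square algebra_simps)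
            then have "\<epsilon> / 2 * t\<^sup>2 \<le> \<epsilon> / 2 * (2 * ((\<phi> x)\<^sup>2 + (g x)\<^sup>2))" using \<epsilon> by (intro mult_left_mono) auto
            moreover have "\<epsilon> / 2 * (2 * X) = \<epsilon> * X" for X by simp
            ultimately show ?thesis by (simp only:)
          qed
          finally show "\<bar>(\<phi> x - g x) * (\<phi> x + g x)\<bar> \<le> (1 / (2 * \<epsilon>)) * (\<phi> x - g x)\<^sup>2 + \<epsilon> * ((\<phi> x)\<^sup>2 + (g x)\<^sup>2)"
            by (simp add: r_def t_def abs_mult)
        qed (use C in auto)
        finally show "(eigen + clampV x) * (\<phi> x)\<^sup>2 - (eigen + clampV x) * (g x)\<^sup>2 \<le> (\<bar>eigen\<bar> + C) * ((1 / (2 * \<epsilon>)) * (\<phi> x - g x)\<^sup>2 + \<epsilon> * ((\<phi> x)\<^sup>2 + (g x)\<^sup>2))" .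
      qed (use ii idf i\<phi>2 ig2 in \<open>auto intro!: integrable_mult_right Bochner_Integration.integrable_add\<close>)
      also have "\<dots> = (\<bar>eigen\<bar> + C) * (Df / (2 * \<epsilon>) + \<epsilon> * (F + G))"
        using idf i\<phi>2 ig2 by (simp add: Df_def F_def G_def)
      also have "\<dots> \<le> (\<bar>eigen\<bar> + C) * (Df / (2 * \<epsilon>) + 2 * \<epsilon> * G)"
      proof (intro mult_left_mono add_left_mono)
        have "\<epsilon> * (F + G) \<le> \<epsilon> * (G + G)" using F \<epsilon> by (intro mult_left_mono) auto
        then show "\<epsilon> * (F + G) \<le> 2 * \<epsilon> * G" by (simp add: algebra_simps)
      qed (use C in auto)
      finally show ?thesis by linarith
    qed
    have sp1: "(\<integral>x. (eigen + clampV x) * (g x)\<^sup>2 \<partial>lborel) = eigen * G + (\<integral>x. V x * (g x)\<^sup>2 \<partial>lborel)"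
      unfolding distrib_right vg[symmetric] G_def using iV ig2 by simp
    have sp2: "(\<integral>x. (eigen + clampV x) * (\<phi> x)\<^sup>2 \<partial>lborel) = eigen * F + (\<integral>x. clampV x * (\<phi> x)\<^sup>2 \<partial>lborel)"
      unfolding distrib_right F_def using iV i\<phi>2 by simp
    have kI: "\<kappa>\<^sup>2 * I \<le> \<kappa>\<^sup>2 * (enn2real (energy s g) / (2 * s) + B * sqrt s * G)"
      by (intro mult_left_mono Ile) simp
    have D3: "(\<bar>eigen\<bar> + C) * (Df / (2 * \<epsilon>) + 2 * \<epsilon> * G) \<le> (\<bar>eigen\<bar> + C) * (K * enn2real (energy (\<epsilon>\<^sup>2) g) / (2 * \<epsilon>) + 2 * \<epsilon> * G)"
      using Df \<epsilon> C by (intro mult_left_mono add_right_mono divide_right_mono) auto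
    show "- eigen * (\<integral>x. (g x)\<^sup>2 \<partial>lborel) - (\<integral>x. V x * (g x)\<^sup>2 \<partial>lborel)
     \<le> \<kappa>\<^sup>2 * (enn2real (energy s g) / (2 * s) + B * sqrt s * (\<integral>x. (g x)\<^sup>2 \<partial>lborel)) + \<eta> * (\<integral>x. (g x)\<^sup>2 \<partial>lborel)
       + (\<bar>eigen\<bar> + C) * (K * enn2real (energy (\<epsilon>\<^sup>2) g) / (2 * \<epsilon>) + 2 * \<epsilon> * (\<integral>x. (g x)\<^sup>2 \<partial>lborel))"
      using ray v1 v2 kI D3 unfolding sp1 sp2 G_def[symmetric] by (simp only: minus_add_distrib mult_minus_left)
  qed
qed

text \<open>For functions of large energy the inequality is trivial; for the others the mollification
  error is of order \<open>\<epsilon>\<close>, because the ratio of energy to time is decreasing along dyadic times.\<close>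

lemma eigen_energy_inequality:
  assumes \<delta>: "\<delta> > 0"
  shows "\<exists>m0. \<forall>m\<ge>m0. \<forall>g. admissible g \<longrightarrow>
    - eigen * (\<integral>x. (g x)\<^sup>2 \<partial>lborel) - (\<integral>x. V x * (g x)\<^sup>2 \<partial>lborel)
     \<le> enn2real (energy (\<beta> / 2 ^ m) g) / (2 * (\<beta> / 2 ^ m)) + \<delta> * (\<integral>x. (g x)\<^sup>2 \<partial>lborel)"
proof -
  obtain C where C: "C > 0" "\<And>x. \<bar>V x\<bar> \<le> C" using V_bounded by blast
  obtain K where K: "K > 0" and moll: "\<And>\<epsilon>. \<epsilon> > 0 \<Longrightarrow> \<exists>\<rho>::'a \<Rightarrow> real. bump_class (1 / \<epsilon>\<^sup>2) \<rho> \<and> (\<forall>u. 0 \<le> \<rho> u) \<and>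
      (\<integral>\<^sup>+u. ennreal (\<rho> u) \<partial>lborel) = 1 \<and> (\<forall>u. \<rho> u \<le> K * heat_kernel (\<epsilon>\<^sup>2) 0 u)"
    using exists_mollifier[where 'a = 'a] by blast
  obtain d where d: "d > 0" "\<And>x y. x \<in> cbox a b \<Longrightarrow> norm (x - y) < d \<Longrightarrow> \<bar>V x - clampV y\<bar> \<le> \<delta> / 4"
    using clampV_modulus[of "\<delta> / 4"] \<delta> by auto
  \<comment> \<open>The threshold between large and small energy: the left-hand side of the claim is
    always at most \<open>C1\<close> times the squared norm.\<close>
  define C1 where "C1 = \<bar>eigen\<bar> + C"
  have C1: "C1 > 0" using C by (simp add: C1_def add_nonneg_pos)
  have R: "fat_radius > 0" by (simp add: fat_radius_def add_nonneg_pos)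
  have e0: "(\<lambda>n. sqrt (\<beta> / 2 ^ n)) \<longlonglongrightarrow> 0"
  proof -
    have "(\<lambda>n. \<beta> * (1 / 2) ^ n) \<longlonglongrightarrow> \<beta> * 0"
      by (intro tendsto_mult tendsto_const LIMSEQ_realpow_zero) auto
    then have "(\<lambda>n. sqrt (\<beta> * (1 / 2) ^ n)) \<longlonglongrightarrow> sqrt (\<beta> * 0)" by (rule tendsto_real_sqrt)
    then show ?thesis by (simp add: power_divide)
  qed
  have lim1: "(\<lambda>n. sqrt (\<beta> / 2 ^ n) / halfwidth * fat_radius) \<longlonglongrightarrow> 0 / halfwidth * fat_radius"
    using halfwidth_pos by (intro tendsto_intros e0) auto
  have lim2: "(\<lambda>n. ((1 + sqrt (\<beta> / 2 ^ n) / halfwidth)\<^sup>2 - 1) * C1) \<longlonglongrightarrow> ((1 + 0 / halfwidth)\<^sup>2 - 1) * C1"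
    using halfwidth_pos by (intro tendsto_intros e0) auto
  have lim3: "(\<lambda>n. C1 * (K * C1 + 2) * sqrt (\<beta> / 2 ^ n)) \<longlonglongrightarrow> C1 * (K * C1 + 2) * 0"
    by (intro tendsto_intros e0)
  have "\<forall>\<^sub>F n in sequentially. sqrt (\<beta> / 2 ^ n) < 1 \<and> sqrt (\<beta> / 2 ^ n) / halfwidth * fat_radius < d
     \<and> ((1 + sqrt (\<beta> / 2 ^ n) / halfwidth)\<^sup>2 - 1) * C1 < \<delta> / 4 \<and> C1 * (K * C1 + 2) * sqrt (\<beta> / 2 ^ n) < \<delta> / 4"
    using order_tendstoD(2)[OF e0, of 1] order_tendstoD(2)[OF lim1, of d] order_tendstoD(2)[OF lim2, of "\<delta>/4"]
      order_tendstoD(2)[OF lim3, of "\<delta>/4"] d(1) \<delta> by (intro eventually_conj) auto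
  then obtain n where n: "sqrt (\<beta> / 2 ^ n) < 1" "sqrt (\<beta> / 2 ^ n) / halfwidth * fat_radius < d"
     "((1 + sqrt (\<beta> / 2 ^ n) / halfwidth)\<^sup>2 - 1) * C1 < \<delta> / 4" "C1 * (K * C1 + 2) * sqrt (\<beta> / 2 ^ n) < \<delta> / 4"
    unfolding eventually_sequentially by blast
  \<comment> \<open>With this width the time \<open>\<epsilon>\<^sup>2\<close> of the dominating
    heat kernel is itself dyadic, so finitely many doublings lead from the small time to it. The
    four requirements on \<open>n\<close> give a width at most 1, a modulus of continuity
    \<open>\<delta> / 4\<close>, and errors \<open>\<delta> / 4\<close> from the dilation and from
    the mollification; the last quarter is spent on sqrt s.\<close>
  define \<epsilon> where "\<epsilon> = sqrt (\<beta> / 2 ^ n)"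
  define \<kappa> where "\<kappa> = 1 + \<epsilon> / halfwidth"
  have \<epsilon>: "0 < \<epsilon>" "\<epsilon> \<le> 1" using n(1) \<beta>_pos by (auto simp: \<epsilon>_def)
  have \<epsilon>2: "\<epsilon>\<^sup>2 = \<beta> / 2 ^ n" using \<beta>_pos by (simp add: \<epsilon>_def)
  have k1: "\<kappa> \<ge> 1" using \<epsilon> halfwidth_pos by (simp add: \<kappa>_def)
  obtain \<rho> :: "'a \<Rightarrow> real" where \<rho>: "bump_class (1 / \<epsilon>\<^sup>2) \<rho>" "\<And>u. 0 \<le> \<rho> u" "(\<integral>\<^sup>+u. ennreal (\<rho> u) \<partial>lborel) = 1" "\<And>u. \<rho> u \<le> K * heat_kernel (\<epsilon>\<^sup>2) 0 u"
    using moll[OF \<epsilon>(1)] by blast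
  have mod: "\<bar>V x - clampV y\<bar> \<le> \<delta> / 4" if "x \<in> cbox a b" "norm (x - y) \<le> \<epsilon> / halfwidth * fat_radius" for x y
    using that n(2) by (intro d(2)) (auto simp: \<epsilon>_def)
  have "\<delta> / 4 > 0" using \<delta> by simp
  obtain B where B: "B > 0" and bound: "\<And>s g. s > 0 \<Longrightarrow> admissible g \<Longrightarrow>
    - eigen * (\<integral>x. (g x)\<^sup>2 \<partial>lborel) - (\<integral>x. V x * (g x)\<^sup>2 \<partial>lborel)
     \<le> \<kappa>\<^sup>2 * (enn2real (energy s g) / (2 * s) + B * sqrt s * (\<integral>x. (g x)\<^sup>2 \<partial>lborel)) + \<delta> / 4 * (\<integral>x. (g x)\<^sup>2 \<partial>lborel)
       + (\<bar>eigen\<bar> + C) * (K * enn2real (energy (\<epsilon>\<^sup>2) g) / (2 * \<epsilon>) + 2 * \<epsilon> * (\<integral>x. (g x)\<^sup>2 \<partial>lborel))"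
    using mollified_energy_bound[OF \<epsilon> \<kappa>_def \<open>\<delta> / 4 > 0\<close> mod K C(2) C(1) \<rho>] by blast
  have "(\<lambda>m. \<kappa>\<^sup>2 * (B * sqrt (\<beta> / 2 ^ m))) \<longlonglongrightarrow> \<kappa>\<^sup>2 * (B * 0)" by (intro tendsto_intros e0)
  then have "\<forall>\<^sub>F m in sequentially. \<kappa>\<^sup>2 * (B * sqrt (\<beta> / 2 ^ m)) < \<delta> / 4"
    using \<delta> by (intro order_tendstoD) auto
  then obtain m1 where m1: "\<And>m. m \<ge> m1 \<Longrightarrow> \<kappa>\<^sup>2 * (B * sqrt (\<beta> / 2 ^ m)) < \<delta> / 4" unfolding eventually_sequentially by blast
  show ?thesis
  proof (intro exI[of _ "max n m1"] allI impI)
    fix m g assume m: "max n m1 \<le> m" and g: "admissible g"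
    define h where "h = \<beta> / 2 ^ m"
    define G where "G = (\<integral>x. (g x)\<^sup>2 \<partial>lborel)"
    define E where "E = enn2real (energy h g) / (2 * h)"
    have h: "h > 0" using \<beta>_pos by (simp add: h_def)
    have [measurable]: "g \<in> borel_measurable borel" and g0: "\<And>x. 0 \<le> g x" and fin: "sqnorm g < \<infinity>"
      using g by (auto simp: admissible_def)
    have G0: "G \<ge> 0" by (simp add: G_def)
    have E0: "E \<ge> 0" using h by (simp add: E_def)
    have ig2: "integrable lborel (\<lambda>x. (g x)\<^sup>2)" by (rule sqnorm_finite_integrable(1)[OF _ fin]) simp
    have iV: "integrable lborel (\<lambda>x. V x * (g x)\<^sup>2)" by (rule integrable_V_mult[OF ig2]) simp
    have "- (\<integral>x. V x * (g x)\<^sup>2 \<partial>lborel) \<le> (\<integral>x. C * (g x)\<^sup>2 \<partial>lborel)"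
    proof -
      have "(\<integral>x. - (V x * (g x)\<^sup>2) \<partial>lborel) \<le> (\<integral>x. C * (g x)\<^sup>2 \<partial>lborel)"
      proof (rule integral_mono)
        fix x
        have "- V x * (g x)\<^sup>2 \<le> C * (g x)\<^sup>2" using abs_le_D2[OF C(2)[of x]] by (intro mult_right_mono) auto
        then show "- (V x * (g x)\<^sup>2) \<le> C * (g x)\<^sup>2" by simp
      qed (use iV ig2 in auto)
      then show ?thesis by simp
    qed
    then have VC: "- (\<integral>x. V x * (g x)\<^sup>2 \<partial>lborel) \<le> C * G" by (simp add: G_def)
    have "- eigen * G - (\<integral>x. V x * (g x)\<^sup>2 \<partial>lborel) \<le> E + \<delta> * G"
    proof (cases "E \<le> C1 * G")
      case False
      have "- eigen * G \<le> \<bar>eigen\<bar> * G" using G0 by (intro mult_right_mono) auto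
      then have "- eigen * G - (\<integral>x. V x * (g x)\<^sup>2 \<partial>lborel) \<le> C1 * G" using VC by (simp add: C1_def distrib_right)
      also have "\<dots> \<le> E" using False by simp
      also have "\<dots> \<le> E + \<delta> * G" using \<delta> G0 by simp
      finally show ?thesis .
    next
      case True
      have fe: "energy r g < \<top>" if "r > 0" for r
      proof -
        have "energy r g \<le> 2 * sqnorm g" unfolding energy_add_overlap[OF \<open>g \<in> borel_measurable borel\<close> g0 that, symmetric] by simp
        also have "\<dots> < \<top>" using fin by (simp add: ennreal_mult_less_top)
        finally show ?thesis .
      qed
      have two: "(2::ennreal) ^ k = ennreal (2 ^ k)" for k by (simp add: ennreal_power[symmetric])
      \<comment> \<open>This is where the large time is reached: the error divided by
        \<open>\<epsilon>\<close> becomes \<open>\<epsilon>\<close> times the normalised energy,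
        which is bounded in this case.\<close>
      have "energy (2 ^ (m - n) * h) g \<le> 2 ^ (m - n) * energy h g"
        by (rule energy_power2) (use g0 h fin in auto)
      also have "2 ^ (m - n) * h = \<epsilon>\<^sup>2" using m by (simp add: \<epsilon>2 h_def power_diff)
      finally have "enn2real (energy (\<epsilon>\<^sup>2) g) \<le> enn2real (2 ^ (m - n) * energy h g)"
        using fe[OF h] by (intro enn2real_mono) (auto simp: two ennreal_mult_less_top)
      also have "\<dots> = 2 ^ (m - n) * (2 * h * E)" using h by (simp add: two enn2real_mult E_def)
      also have "\<dots> = 2 * \<epsilon>\<^sup>2 * E" using m by (simp add: \<epsilon>2 h_def power_diff)
      finally have eE: "enn2real (energy (\<epsilon>\<^sup>2) g) \<le> 2 * \<epsilon>\<^sup>2 * E" .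
      have "K * enn2real (energy (\<epsilon>\<^sup>2) g) / (2 * \<epsilon>) \<le> K * (2 * \<epsilon>\<^sup>2 * E) / (2 * \<epsilon>)"
        using eE K \<epsilon> by (intro divide_right_mono mult_left_mono) auto
      also have "\<dots> = K * \<epsilon> * E" using \<epsilon> by (simp add: power2_eq_square)
      also have "\<dots> \<le> K * \<epsilon> * (C1 * G)" using K \<epsilon> True by (intro mult_left_mono) auto
      finally have "C1 * (K * enn2real (energy (\<epsilon>\<^sup>2) g) / (2 * \<epsilon>) + 2 * \<epsilon> * G) \<le> C1 * (K * \<epsilon> * (C1 * G) + 2 * \<epsilon> * G)"
        using C1 by (intro mult_left_mono add_right_mono) auto
      also have "\<dots> = (C1 * (K * C1 + 2) * \<epsilon>) * G" by (simp add: algebra_simps)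
      also have "\<dots> \<le> \<delta> / 4 * G" using n(4) G0 by (intro mult_right_mono) (auto simp: \<epsilon>_def)
      finally have t1: "C1 * (K * enn2real (energy (\<epsilon>\<^sup>2) g) / (2 * \<epsilon>) + 2 * \<epsilon> * G) \<le> \<delta> / 4 * G" .
      have "\<kappa>\<^sup>2 * (B * sqrt h) * G \<le> \<delta> / 4 * G" using m1[of m] m G0 by (intro mult_right_mono) (auto simp: h_def)
      moreover have "\<kappa>\<^sup>2 * E \<le> E + \<delta> / 4 * G"
      proof -
        have "\<kappa>\<^sup>2 * E = E + (\<kappa>\<^sup>2 - 1) * E" by (simp add: algebra_simps)
        also have "\<dots> \<le> E + (\<kappa>\<^sup>2 - 1) * (C1 * G)" using True k1 by (intro add_left_mono mult_left_mono) auto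
        also have "(\<kappa>\<^sup>2 - 1) * (C1 * G) = ((\<kappa>\<^sup>2 - 1) * C1) * G" by simp
        also have "\<dots> \<le> \<delta> / 4 * G" using n(3) G0 by (intro mult_right_mono) (auto simp: \<kappa>_def \<epsilon>_def)
        finally show ?thesis by simp
      qed
      moreover have "\<kappa>\<^sup>2 * (E + B * sqrt h * G) = \<kappa>\<^sup>2 * E + \<kappa>\<^sup>2 * (B * sqrt h) * G" by (simp add: algebra_simps)
      ultimately show ?thesis
        using bound[OF h g, folded G_def E_def C1_def] t1 by linarith
    qed
    then show "- eigen * (\<integral>x. (g x)\<^sup>2 \<partial>lborel) - (\<integral>x. V x * (g x)\<^sup>2 \<partial>lborel)
     \<le> enn2real (energy (\<beta> / 2 ^ m) g) / (2 * (\<beta> / 2 ^ m)) + \<delta> * (\<integral>x. (g x)\<^sup>2 \<partial>lborel)"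
      by (simp only: G_def E_def h_def)
  qed
qed

text \<open>Absorbing the half weights into the function turns the form into an overlap, that is,
  squared norm minus half the energy. The energy inequality bounds it by the integral of (1 +
  h(\<open>\<mu>\<close> + V)) g^2, and 1 + u \<le> exp u cancels the factor exp(-hV) that g^2
  carries.\<close>

lemma form_bound_step_kernel:
  assumes \<mu>: "\<mu> > eigen"
  shows "\<exists>m0. \<forall>m\<ge>m0. form_bound (step_kernel (\<beta> / 2 ^ m)) (ennreal (exp (\<beta> / 2 ^ m * \<mu>)))"
proof -
  obtain m0 where m0: "\<And>m g. m \<ge> m0 \<Longrightarrow> admissible g \<Longrightarrow>
    - eigen * (\<integral>x. (g x)\<^sup>2 \<partial>lborel) - (\<integral>x. V x * (g x)\<^sup>2 \<partial>lborel)
     \<le> enn2real (energy (\<beta> / 2 ^ m) g) / (2 * (\<beta> / 2 ^ m)) + (\<mu> - eigen) * (\<integral>x. (g x)\<^sup>2 \<partial>lborel)"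
    using eigen_energy_inequality[of "\<mu> - eigen"] \<mu> by auto
  show ?thesis
  proof (intro exI[of _ m0] allI impI)
    fix m assume m: "m0 \<le> m"
    define h where "h = \<beta> / 2 ^ m"
    have h: "h > 0" using \<beta>_pos by (simp add: h_def)
    obtain C where C: "C > 0" "\<And>x. \<bar>V x\<bar> \<le> C" using V_bounded by blast
    show "form_bound (step_kernel (\<beta> / 2 ^ m)) (ennreal (exp (\<beta> / 2 ^ m * \<mu>)))"
      unfolding form_bound_def h_def[symmetric]
    proof
      fix f :: "'a \<Rightarrow> ennreal" assume f [measurable]: "f \<in> borel_measurable borel"
      show "(\<integral>\<^sup>+x. (\<integral>\<^sup>+y. f x * step_kernel h x y * f y \<partial>lborel) \<partial>lborel) \<le> ennreal (exp (h * \<mu>)) * (\<integral>\<^sup>+x. (f x)\<^sup>2 \<partial>lborel)"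
      proof (cases "(\<integral>\<^sup>+x. (f x)\<^sup>2 \<partial>lborel) = \<top>")
        case True
        then show ?thesis by (simp add: ennreal_mult_top)
      next
        case False
        then have "AE x in lborel. (f x)\<^sup>2 \<noteq> \<infinity>" by (intro nn_integral_noteq_infinite) auto
        \<comment> \<open>Square integrability makes \<open>f\<close> finite almost everywhere, so
          it can be replaced by a real-valued function.\<close>
        then have fAE: "AE x in lborel. f x = ennreal (enn2real (f x))"
          by eventually_elim (auto simp: power2_eq_square less_top[symmetric] ennreal_mult_eq_top_iff)
        define F where "F x = enn2real (f x)" for x
        have [measurable]: "F \<in> borel_measurable borel" unfolding F_def[abs_def] by measurable
        define w where "w x = (if x \<in> cbox a b then exp (- (h / 2) * V x) else 0)" for x
        have [measurable]: "w \<in> borel_measurable borel" unfolding w_def[abs_def] by measurable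
        have bw: "boltzmann (h / 2) x = ennreal (w x)" for x by (simp add: boltzmann_def w_def)
        define g where "g x = F x * w x" for x
        have g0: "0 \<le> g x" for x by (simp add: g_def F_def w_def)
        have [measurable]: "g \<in> borel_measurable borel" unfolding g_def[abs_def] by measurable
        have F2: "(\<integral>\<^sup>+x. ennreal ((F x)\<^sup>2) \<partial>lborel) = (\<integral>\<^sup>+x. (f x)\<^sup>2 \<partial>lborel)"
          by (rule nn_integral_cong_AE) (use fAE in \<open>eventually_elim, auto simp: F_def ennreal_power[symmetric]\<close>)
        have gle: "(g x)\<^sup>2 \<le> exp (h * C) * (F x)\<^sup>2" for x
        proof (cases "x \<in> cbox a b")
          case True
          have "(w x)\<^sup>2 = exp (h * (- V x))" using True by (simp add: w_def power2_eq_square exp_add[symmetric])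
          also have "\<dots> \<le> exp (h * C)" using abs_le_D2[OF C(2)[of x]] h by (subst exp_le_cancel_iff) (intro mult_left_mono, auto)
          finally show ?thesis unfolding g_def power_mult_distrib by (subst mult.commute) (intro mult_right_mono, auto)
        qed (simp add: g_def w_def)
        have "sqnorm g \<le> (\<integral>\<^sup>+x. ennreal (exp (h * C)) * ennreal ((F x)\<^sup>2) \<partial>lborel)"
          unfolding sqnorm_def using gle by (intro nn_integral_mono) (simp add: ennreal_mult[symmetric] ennreal_leI)
        also have "\<dots> = ennreal (exp (h * C)) * (\<integral>\<^sup>+x. (f x)\<^sup>2 \<partial>lborel)" by (simp add: nn_integral_cmult F2)
        also have "\<dots> < \<infinity>" using False by (simp add: ennreal_mult_less_top less_top)
        finally have fin: "sqnorm g < \<infinity>" .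
        have adm: "admissible g" using g0 fin by (simp add: admissible_def g_def w_def)
        define G where "G = (\<integral>x. (g x)\<^sup>2 \<partial>lborel)"
        have sq: "sqnorm g = ennreal G" unfolding G_def by (rule sqnorm_finite_integrable(2)[OF _ fin]) simp
        have ig2: "integrable lborel (\<lambda>x. (g x)\<^sup>2)" by (rule sqnorm_finite_integrable(1)[OF _ fin]) simp
        have iV: "integrable lborel (\<lambda>x. V x * (g x)\<^sup>2)" by (rule integrable_V_mult[OF ig2]) simp
        have iF: "integrable lborel (\<lambda>x. (F x)\<^sup>2)"
          using False F2 by (intro integrableI_nonneg) (auto simp: less_top)
        have G0: "G \<ge> 0" by (simp add: G_def)
        have eo: "energy h g + 2 * overlap h g = 2 * sqnorm g" by (rule energy_add_overlap) (use g0 h in auto)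
        have self: "t \<le> 2 * t" for t :: ennreal by (simp add: mult_2)
        have tf: "2 * sqnorm g < \<top>" using fin by (simp add: ennreal_mult_less_top)
        have "energy h g < \<top>" "overlap h g < \<top>"
          by (rule le_less_trans[OF _ tf], unfold eo[symmetric], auto intro: order_trans[OF self])+
        define e v where "e = enn2real (energy h g)" and "v = enn2real (overlap h g)"
        have ev: "energy h g = ennreal e" "overlap h g = ennreal v" "e \<ge> 0" "v \<ge> 0"
          using \<open>energy h g < \<top>\<close> \<open>overlap h g < \<top>\<close> by (auto simp: e_def v_def)
        have num: "2 * ennreal t = ennreal (2 * t)" if "t \<ge> 0" for t using that by (simp add: ennreal_mult)
        have ev2: "e + 2 * v = 2 * G" using eo ev G0 unfolding ev sq by (simp add: num ennreal_plus[symmetric] del: ennreal_plus)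
        have "- eigen * G - (\<integral>x. V x * (g x)\<^sup>2 \<partial>lborel) \<le> e / (2 * h) + (\<mu> - eigen) * G"
          using m0[OF m adm] by (simp only: G_def e_def h_def)
        then have "- \<mu> * G - (\<integral>x. V x * (g x)\<^sup>2 \<partial>lborel) \<le> e / (2 * h)" by (simp add: left_diff_distrib)
        then have "h * (- \<mu> * G - (\<integral>x. V x * (g x)\<^sup>2 \<partial>lborel)) \<le> h * (e / (2 * h))" using h by (intro mult_left_mono) auto
        also have "h * (e / (2 * h)) = e / 2" using h by simp
        finally have "v \<le> G + h * \<mu> * G + h * (\<integral>x. V x * (g x)\<^sup>2 \<partial>lborel)"
          using ev2 by (simp add: algebra_simps)
        also have "\<dots> = (\<integral>x. (g x)\<^sup>2 + h * \<mu> * (g x)\<^sup>2 + h * (V x * (g x)\<^sup>2) \<partial>lborel)"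
          using ig2 iV by (simp add: G_def)
        also have "\<dots> \<le> (\<integral>x. exp (h * \<mu>) * (F x)\<^sup>2 \<partial>lborel)"
        proof (rule integral_mono)
          fix x
          show "(g x)\<^sup>2 + h * \<mu> * (g x)\<^sup>2 + h * (V x * (g x)\<^sup>2) \<le> exp (h * \<mu>) * (F x)\<^sup>2"
          proof (cases "x \<in> cbox a b")
            case True
            have w2: "(w x)\<^sup>2 = exp (- (h * V x))" using True by (simp add: w_def power2_eq_square exp_add[symmetric])
            have "(g x)\<^sup>2 + h * \<mu> * (g x)\<^sup>2 + h * (V x * (g x)\<^sup>2) = (1 + (h * \<mu> + h * V x)) * (g x)\<^sup>2" by (simp add: algebra_simps)
            also have "\<dots> \<le> exp (h * \<mu> + h * V x) * (g x)\<^sup>2" by (intro mult_right_mono exp_ge_add_one_self) simp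
            also have "\<dots> = exp (h * \<mu>) * (exp (h * V x) * exp (- (h * V x))) * (F x)\<^sup>2"
              unfolding g_def power_mult_distrib w2 by (simp add: exp_add)
            also have "\<dots> = exp (h * \<mu>) * (F x)\<^sup>2" by (simp add: exp_minus)
            finally show ?thesis .
          qed (simp add: g_def w_def)
        qed (use ig2 iV iF in auto)
        also have "\<dots> = exp (h * \<mu>) * (\<integral>x. (F x)\<^sup>2 \<partial>lborel)" by simp
        finally have vle: "v \<le> exp (h * \<mu>) * (\<integral>x. (F x)\<^sup>2 \<partial>lborel)" .
        have "(\<integral>\<^sup>+x. (\<integral>\<^sup>+y. f x * step_kernel h x y * f y \<partial>lborel) \<partial>lborel) = overlap h g"
          unfolding overlap_def
        proof (rule nn_integral_cong_AE, use fAE in eventually_elim)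
          fix x assume x: "f x = ennreal (enn2real (f x))"
          show "(\<integral>\<^sup>+y. f x * step_kernel h x y * f y \<partial>lborel) = (\<integral>\<^sup>+y. ennreal (g x) * ennreal (heat_kernel h x y) * ennreal (g y) \<partial>lborel)"
          proof (rule nn_integral_cong_AE, use fAE in eventually_elim)
            fix y assume y: "f y = ennreal (enn2real (f y))"
            have w0: "0 \<le> w z" "0 \<le> F z" for z by (auto simp: w_def F_def)
            show "f x * step_kernel h x y * f y = ennreal (g x) * ennreal (heat_kernel h x y) * ennreal (g y)"
              unfolding step_kernel_def bw g_def ennreal_mult[OF w0(2) w0(1)] using x y by (simp add: F_def mult_ac)
          qed
        qed
        also have "\<dots> \<le> ennreal (exp (h * \<mu>) * (\<integral>x. (F x)\<^sup>2 \<partial>lborel))" unfolding ev by (rule ennreal_leI[OF vle])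
        also have "\<dots> = ennreal (exp (h * \<mu>)) * (\<integral>\<^sup>+x. (f x)\<^sup>2 \<partial>lborel)"
          unfolding F2[symmetric] using nn_integral_eq_integral[OF iF] by (simp add: ennreal_mult)
        finally show ?thesis .
      qed
    qed
  qed
qed

end

section \<open>Growth of the traces\<close>

lemma incr_sq_abs_le: "incr_sq (\<lambda>x. \<bar>\<phi> x\<bar>) z \<le> incr_sq \<phi> z"
  unfolding incr_sq_def
proof (intro nn_integral_mono ennreal_leI)
  fix x
  have "\<bar>\<bar>\<phi> (x + z)\<bar> - \<bar>\<phi> x\<bar>\<bar> \<le> \<bar>\<phi> (x + z) - \<phi> x\<bar>" by (rule abs_triangle_ineq3)
  then show "(\<bar>\<phi> (x + z)\<bar> - \<bar>\<phi> x\<bar>)\<^sup>2 \<le> (\<phi> (x + z) - \<phi> x)\<^sup>2" by (simp add: abs_le_square_iff[symmetric])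
qed

text \<open>Test functions may change sign whereas forms and overlaps are for nonnegative functions;
  passing to the absolute value does not increase the energy.\<close>

lemma energy_abs_le: "energy s (\<lambda>x. \<bar>\<phi> x\<bar>) \<le> energy s \<phi>"
  unfolding energy_def by (intro nn_integral_mono mult_left_mono incr_sq_abs_le) simp

section \<open>Traces of dyadic powers from below\<close>

definition kform :: "('a::euclidean_space \<Rightarrow> 'a \<Rightarrow> ennreal) \<Rightarrow> ('a \<Rightarrow> ennreal) \<Rightarrow> ennreal" where
  "kform k \<psi> = (\<integral>\<^sup>+u. \<psi> u * (\<integral>\<^sup>+y. k u y * \<psi> y \<partial>lborel) \<partial>lborel)"

text \<open>Cauchy-Schwarz bounds <psi, k psi>^2 by |psi|^2 |k psi|^2. For symmetric k the second
  factor is the form of k^2; a further Cauchy-Schwarz in the inner variable bounds it by the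
  Hilbert-Schmidt norm, which is the trace of k^2.\<close>

lemma kform_square_le:
  assumes k: "kernel_measurable k" and sym: "\<And>x y. k x y = k y x" and \<psi> [measurable]: "\<psi> \<in> borel_measurable borel"
  shows "(kform k \<psi>)\<^sup>2 \<le> (\<integral>\<^sup>+u. (\<psi> u)\<^sup>2 \<partial>lborel) * kform (kcomp k k) \<psi>"
    and "(kform k \<psi>)\<^sup>2 \<le> (\<integral>\<^sup>+u. (\<psi> u)\<^sup>2 \<partial>lborel)\<^sup>2 * ktrace (kcomp k k)"
proof -
  note k[THEN kernel_measurable_compose, measurable (raw)]
  define P where "P u = (\<integral>\<^sup>+y. k u y * \<psi> y \<partial>lborel)" for u
  have [measurable]: "P \<in> borel_measurable borel" unfolding P_def by measurable
  have cs: "(kform k \<psi>)\<^sup>2 \<le> (\<integral>\<^sup>+u. (\<psi> u)\<^sup>2 \<partial>lborel) * (\<integral>\<^sup>+u. (P u)\<^sup>2 \<partial>lborel)"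
    unfolding kform_def P_def[symmetric] by (rule Cauchy_Schwarz_nn_integral) measurable
  have "kform (kcomp k k) \<psi> = (\<integral>\<^sup>+x. (\<integral>\<^sup>+y. (\<integral>\<^sup>+u. (k u x * \<psi> x) * (k u y * \<psi> y) \<partial>lborel) \<partial>lborel) \<partial>lborel)"
  proof -
    have "kform (kcomp k k) \<psi> = (\<integral>\<^sup>+x. (\<integral>\<^sup>+y. \<psi> x * ((\<integral>\<^sup>+u. k x u * k u y \<partial>lborel) * \<psi> y) \<partial>lborel) \<partial>lborel)"
      unfolding kform_def kcomp_def by (rule nn_integral_cong, rule nn_integral_cmult[symmetric]) measurable
    also have "\<dots> = (\<integral>\<^sup>+x. (\<integral>\<^sup>+y. (\<integral>\<^sup>+u. (k u x * \<psi> x) * (k u y * \<psi> y) \<partial>lborel) \<partial>lborel) \<partial>lborel)"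
    proof (rule nn_integral_cong, rule nn_integral_cong)
      fix x y
      have "\<psi> x * ((\<integral>\<^sup>+u. k x u * k u y \<partial>lborel) * \<psi> y) = (\<psi> x * \<psi> y) * (\<integral>\<^sup>+u. k x u * k u y \<partial>lborel)" by (simp only: mult_ac)
      also have "\<dots> = (\<integral>\<^sup>+u. (\<psi> x * \<psi> y) * (k x u * k u y) \<partial>lborel)" by (rule nn_integral_cmult[symmetric]) measurable
      also have "\<dots> = (\<integral>\<^sup>+u. (k u x * \<psi> x) * (k u y * \<psi> y) \<partial>lborel)"
        by (rule nn_integral_cong) (simp only: sym[of x] mult_ac)
      finally show "\<psi> x * ((\<integral>\<^sup>+u. k x u * k u y \<partial>lborel) * \<psi> y) = (\<integral>\<^sup>+u. (k u x * \<psi> x) * (k u y * \<psi> y) \<partial>lborel)" .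
    qed
    finally show ?thesis .
  qed
  also have "\<dots> = (\<integral>\<^sup>+x. (\<integral>\<^sup>+u. (\<integral>\<^sup>+y. (k u x * \<psi> x) * (k u y * \<psi> y) \<partial>lborel) \<partial>lborel) \<partial>lborel)"
    by (rule nn_integral_cong, rule lborel_pair.Fubini') measurable
  also have "\<dots> = (\<integral>\<^sup>+u. (\<integral>\<^sup>+x. (\<integral>\<^sup>+y. (k u x * \<psi> x) * (k u y * \<psi> y) \<partial>lborel) \<partial>lborel) \<partial>lborel)"
    by (rule lborel_pair.Fubini') measurable
  also have "\<dots> = (\<integral>\<^sup>+u. (P u)\<^sup>2 \<partial>lborel)"
    unfolding P_def power2_eq_square by (simp add: nn_integral_cmult nn_integral_multc)
  finally have P2: "kform (kcomp k k) \<psi> = (\<integral>\<^sup>+u. (P u)\<^sup>2 \<partial>lborel)" .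
  show "(kform k \<psi>)\<^sup>2 \<le> (\<integral>\<^sup>+u. (\<psi> u)\<^sup>2 \<partial>lborel) * kform (kcomp k k) \<psi>" using cs unfolding P2 .
  have "(\<integral>\<^sup>+u. (P u)\<^sup>2 \<partial>lborel) \<le> (\<integral>\<^sup>+u. (\<integral>\<^sup>+y. (k u y)\<^sup>2 \<partial>lborel) * (\<integral>\<^sup>+u. (\<psi> u)\<^sup>2 \<partial>lborel) \<partial>lborel)"
    unfolding P_def by (intro nn_integral_mono Cauchy_Schwarz_nn_integral) measurable
  also have "\<dots> = (\<integral>\<^sup>+u. (\<integral>\<^sup>+y. (k u y)\<^sup>2 \<partial>lborel) \<partial>lborel) * (\<integral>\<^sup>+u. (\<psi> u)\<^sup>2 \<partial>lborel)"
    by (rule nn_integral_multc) measurable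
  also have "(\<integral>\<^sup>+u. (\<integral>\<^sup>+y. (k u y)\<^sup>2 \<partial>lborel) \<partial>lborel) = ktrace (kcomp k k)"
    unfolding ktrace_def kcomp_def power2_eq_square
    by (rule nn_integral_cong, rule nn_integral_cong) (simp add: sym)
  finally have "(\<integral>\<^sup>+u. (P u)\<^sup>2 \<partial>lborel) \<le> ktrace (kcomp k k) * (\<integral>\<^sup>+u. (\<psi> u)\<^sup>2 \<partial>lborel)" .
  then have "(\<integral>\<^sup>+u. (\<psi> u)\<^sup>2 \<partial>lborel) * (\<integral>\<^sup>+u. (P u)\<^sup>2 \<partial>lborel) \<le> (\<integral>\<^sup>+u. (\<psi> u)\<^sup>2 \<partial>lborel) * (ktrace (kcomp k k) * (\<integral>\<^sup>+u. (\<psi> u)\<^sup>2 \<partial>lborel))"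
    by (rule mult_left_mono) simp
  with cs show "(kform k \<psi>)\<^sup>2 \<le> (\<integral>\<^sup>+u. (\<psi> u)\<^sup>2 \<partial>lborel)\<^sup>2 * ktrace (kcomp k k)"
    by (simp add: power2_eq_square mult_ac)
qed

text \<open>The first inequality is iterated while the exponent doubles; the second is used in the
  last doubling to pass from the form to the trace.\<close>

lemma ktrace_dyadic_ge:
  fixes A :: "'a::euclidean_space \<Rightarrow> 'a \<Rightarrow> ennreal"
  assumes A: "kernel_measurable A" and sym: "\<And>x y. A x y = A y x" and \<psi>: "\<psi> \<in> borel_measurable borel"
  shows "(kform A \<psi>) ^ (2 ^ Suc i) \<le> (\<integral>\<^sup>+u. (\<psi> u)\<^sup>2 \<partial>lborel) ^ (2 ^ Suc i) * ktrace (kpower A (2 ^ Suc i - 1))"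
proof -
  let ?N = "\<integral>\<^sup>+u. (\<psi> u)\<^sup>2 \<partial>lborel"
  have pow_ge: "1 \<le> (2::nat) ^ i" for i by simp
  have dbl: "kcomp (kpower A (2 ^ i - 1)) (kpower A (2 ^ i - 1)) = kpower A (2 ^ Suc i - 1)" for i
  proof -
    have "(2 ^ i - 1) + (2 ^ i - 1) + 1 = (2::nat) ^ Suc i - 1"
      using pow_ge[of i] unfolding power_Suc by linarith
    then show ?thesis unfolding kcomp_kpower[OF A] by simp
  qed
  note ks = kform_square_le[OF kernel_measurable_kpower[OF A] kpower_commute[OF A sym] \<psi>]
  have step: "(kform A \<psi>) ^ (2 ^ i) \<le> ?N ^ (2 ^ i - 1) * kform (kpower A (2 ^ i - 1)) \<psi>" for i
  proof (induction i)
    case (Suc i)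
    have "(kform A \<psi>) ^ (2 ^ Suc i) = ((kform A \<psi>) ^ (2 ^ i))\<^sup>2" by (simp add: power_mult[symmetric] mult.commute)
    also have "\<dots> \<le> (?N ^ (2 ^ i - 1) * kform (kpower A (2 ^ i - 1)) \<psi>)\<^sup>2" by (intro power_mono Suc) simp
    also have "\<dots> = ?N ^ (2 * (2 ^ i - 1)) * (kform (kpower A (2 ^ i - 1)) \<psi>)\<^sup>2" by (simp add: power_mult_distrib power_mult[symmetric] mult.commute)
    also have "\<dots> \<le> ?N ^ (2 * (2 ^ i - 1)) * (?N * kform (kpower A (2 ^ Suc i - 1)) \<psi>)"
      unfolding dbl[symmetric] by (intro mult_left_mono ks(1)) simp
    also have "\<dots> = ?N ^ (2 * (2 ^ i - 1) + 1) * kform (kpower A (2 ^ Suc i - 1)) \<psi>" by (simp add: mult_ac)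
    also have "2 * (2 ^ i - 1) + 1 = (2::nat) ^ Suc i - 1" using pow_ge[of i] unfolding power_Suc by linarith
    finally show ?case .
  qed simp
  have "(kform A \<psi>) ^ (2 ^ Suc i) = ((kform A \<psi>) ^ (2 ^ i))\<^sup>2" by (simp add: power_mult[symmetric] mult.commute)
  also have "\<dots> \<le> (?N ^ (2 ^ i - 1) * kform (kpower A (2 ^ i - 1)) \<psi>)\<^sup>2" by (intro power_mono step) simp
  also have "\<dots> = ?N ^ (2 * (2 ^ i - 1)) * (kform (kpower A (2 ^ i - 1)) \<psi>)\<^sup>2" by (simp add: power_mult_distrib power_mult[symmetric] mult.commute)
  also have "\<dots> \<le> ?N ^ (2 * (2 ^ i - 1)) * (?N\<^sup>2 * ktrace (kpower A (2 ^ Suc i - 1)))"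
    unfolding dbl[symmetric] by (intro mult_left_mono ks(2)) simp
  also have "\<dots> = ?N ^ (2 * (2 ^ i - 1) + 2) * ktrace (kpower A (2 ^ Suc i - 1))" by (simp add: power_add mult_ac power2_eq_square)
  also have "2 * (2 ^ i - 1) + 2 = (2::nat) ^ Suc i" using pow_ge[of i] unfolding power_Suc by linarith
  finally show ?thesis .
qed

text \<open>Bernoulli's inequality compares c + N with (N + 1) ((N + 2)/(N + 1))^c, and these
  factors telescope. The parameter is a natural number so that the growth is visibly
  polynomial.\<close>

lemma pochhammer_le:
  fixes c :: nat
  assumes "c \<ge> 1"
  shows "pochhammer (real c) N \<le> fact N * (real N + 1) ^ c"
proof (induction N)
  case (Suc N)
  have "1 + real c * (1 / (real N + 1)) \<le> (1 + 1 / (real N + 1)) ^ c"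
    by (rule Bernoulli_inequality) (simp add: le_divide_eq)
  moreover have "1 + 1 / (real N + 1) = (real N + 2) / (real N + 1)" by (simp add: field_simps)
  ultimately have "(real N + 1) * (1 + real c * (1 / (real N + 1))) \<le> (real N + 1) * ((real N + 2) / (real N + 1)) ^ c"
    by (intro mult_left_mono) auto
  moreover have "(real N + 1) * (1 + real c * (1 / (real N + 1))) = real N + 1 + real c"
    by (simp add: distrib_left)
  ultimately have "real c + real N \<le> (real N + 1) * ((real N + 2) / (real N + 1)) ^ c" by linarith
  then have "(real c + real N) * (real N + 1) ^ c \<le> (real N + 1) * ((real N + 2) / (real N + 1)) ^ c * (real N + 1) ^ c"
    by (rule mult_right_mono) simp
  also have "\<dots> = (real N + 1) * (real N + 2) ^ c" by (simp add: power_divide)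
  finally have b: "(real c + real N) * (real N + 1) ^ c \<le> (real N + 1) * (real N + 2) ^ c" .
  have "pochhammer (real c) (Suc N) = (real c + real N) * pochhammer (real c) N" by (simp add: pochhammer_Suc)
  also have "\<dots> \<le> (real c + real N) * (fact N * (real N + 1) ^ c)" by (intro mult_left_mono Suc) auto
  also have "\<dots> = fact N * ((real c + real N) * (real N + 1) ^ c)" by simp
  also have "\<dots> \<le> fact N * ((real N + 1) * (real N + 2) ^ c)" by (intro mult_left_mono b) auto
  also have "\<dots> = fact (Suc N) * (real (Suc N) + 1) ^ c" by (simp add: algebra_simps)
  finally show ?case .
qed simp

section \<open>Growth rate of the Feynman-Kac traces\<close>

context box_potential
begin

lemma smooth_test_function:
  assumes \<phi>: "smooth_fun \<phi>" and supp: "closure {x. \<phi> x \<noteq> 0} \<subseteq> cbox a b"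
  shows "x \<notin> cbox a b \<Longrightarrow> \<phi> x = 0" and "integrable lborel (\<lambda>x. (norm (grad \<phi> x))\<^sup>2)"
    and "\<phi> \<in> borel_measurable borel"
proof -
  show z: "\<phi> x = 0" if "x \<notin> cbox a b" for x using supp closure_subset[of "{x. \<phi> x \<noteq> 0}"] that by auto
  have gz: "grad \<phi> x = 0" if x: "x \<notin> cbox a b" for x
  proof (rule grad_eqI)
    have "((\<lambda>_. 0) has_derivative (\<lambda>v. 0)) (at x)" by simp
    then have "(\<phi> has_derivative (\<lambda>v. 0)) (at x)"
      by (rule has_derivative_transform_within_open[of _ _ _ _ "- cbox a b"]) (use x z closed_cbox in auto)
    then show "(\<phi> has_derivative (\<lambda>v. 0 \<bullet> v)) (at x)" by simp
  qed
  have c: "continuous_on UNIV (\<lambda>x. (norm (grad \<phi> x))\<^sup>2)"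
    by (intro continuous_intros grad_continuous \<phi>)
  have "integrable lborel (\<lambda>x. indicator (cbox a b) x *\<^sub>R (norm (grad \<phi> x))\<^sup>2)"
    using borel_integrable_compact[of "cbox a b" "\<lambda>x. (norm (grad \<phi> x))\<^sup>2"] continuous_on_subset[OF c] by (simp add: set_integrable_def)
  also have "(\<lambda>x. indicator (cbox a b) x *\<^sub>R (norm (grad \<phi> x))\<^sup>2) = (\<lambda>x. (norm (grad \<phi> x))\<^sup>2)"
    using gz by (auto simp: indicator_def fun_eq_iff)
  finally show "integrable lborel (\<lambda>x. (norm (grad \<phi> x))\<^sup>2)" .
  have "continuous_on UNIV \<phi>"
    by (intro continuous_at_imp_continuous_on ballI has_derivative_continuous[OF smooth_fun_has_derivative[OF \<phi>]])
  then show "\<phi> \<in> borel_measurable borel" by (rule borel_measurable_continuous_onI)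
qed

text \<open>The convolution of two bumps of radius half of \<open>halfwidth\<close>, one of them
  moved to the centre, is supported in the box, and its smoothness is already known from
  \<open>conv_smooth\<close>. Its integral is 1, so it is not almost everywhere 0 and can be
  normalised.\<close>

lemma rayleigh_set_nonempty: "rayleigh_set \<noteq> {}"
proof -
  obtain K where "\<And>\<epsilon>. \<epsilon> > 0 \<Longrightarrow> \<exists>\<rho>::'a \<Rightarrow> real. bump_class (1 / \<epsilon>\<^sup>2) \<rho> \<and> (\<forall>u. 0 \<le> \<rho> u) \<and>
      (\<integral>\<^sup>+u. ennreal (\<rho> u) \<partial>lborel) = 1 \<and> (\<forall>u. \<rho> u \<le> K * heat_kernel (\<epsilon>\<^sup>2) 0 u)"
    using exists_mollifier[where 'a = 'a] by blast
  from this[of "halfwidth / 2"] obtain \<rho> :: "'a \<Rightarrow> real" where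
    \<rho>: "bump_class (1 / (halfwidth / 2)\<^sup>2) \<rho>" "\<And>u. 0 \<le> \<rho> u" "(\<integral>\<^sup>+u. ennreal (\<rho> u) \<partial>lborel) = 1"
    using halfwidth_pos by auto
  have q: "1 / (halfwidth / 2)\<^sup>2 > 0" using halfwidth_pos by simp
  define g :: "'a \<Rightarrow> real" where "g = (\<lambda>x. \<rho> (x - center))"
  have [measurable]: "\<rho> \<in> borel_measurable borel"
    by (rule borel_measurable_continuous_onI) (rule bump_class_continuous[OF \<rho>(1)])
  have [measurable]: "g \<in> borel_measurable borel" unfolding g_def by measurable
  have g1: "(\<integral>\<^sup>+x. ennreal (g x) \<partial>lborel) = 1"
    unfolding g_def using nn_integral_translate[of "\<lambda>u. ennreal (\<rho> u)" "- center"] \<rho>(3) by simp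
  have gi: "integrable lborel g" using \<rho>(2) g1 by (intro integrableI_nonneg) (auto simp: g_def)
  define f where "f = conv \<rho> g"
  have sm: "smooth_fun f" unfolding f_def by (rule conv_smooth[OF \<rho>(1) q gi])
  have fs: "x \<in> cbox a b" if fx: "f x \<noteq> 0" for x
  proof -
    obtain y where y: "g y \<noteq> 0" "1 / (halfwidth / 2)\<^sup>2 * (norm (x - y))\<^sup>2 < 1"
      using conv_support[OF \<rho>(1), of g x] fx unfolding f_def by blast
    have lt: "norm u < halfwidth / 2" if "1 / (halfwidth / 2)\<^sup>2 * (norm u)\<^sup>2 < 1" for u :: 'a
    proof -
      have "(norm u)\<^sup>2 < (halfwidth / 2)\<^sup>2" using that halfwidth_pos by (simp add: divide_less_eq)
      then show ?thesis by (rule power_less_imp_less_base) (use halfwidth_pos in simp)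
    qed
    have "norm (y - center) < halfwidth / 2"
    proof (rule lt, rule ccontr)
      assume "\<not> 1 / (halfwidth / 2)\<^sup>2 * (norm (y - center))\<^sup>2 < 1"
      then have "\<rho> (y - center) = 0" by (intro bump_class_outside[OF \<rho>(1)]) (simp add: power2_norm_eq_inner)
      then show False using y by (simp add: g_def)
    qed
    then have n: "norm (x - center) < halfwidth"
      using lt[OF y(2)] norm_triangle_ineq[of "x - y" "y - center"] by simp
    show ?thesis unfolding mem_box_center
    proof
      fix i :: 'a assume i: "i \<in> Basis"
      show "\<bar>(x - center) \<bullet> i\<bar> \<le> (b - a) \<bullet> i / 2"
        using Basis_le_norm[OF i, of "x - center"] n halfwidth_le[OF i] by linarith
    qed
  qed
  have supp: "closure {x. f x \<noteq> 0} \<subseteq> cbox a b"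
    by (rule closure_minimal) (use fs closed_cbox in auto)
  note t = smooth_test_function[OF sm supp]
  have cf: "continuous_on UNIV f"
    by (intro continuous_at_imp_continuous_on ballI has_derivative_continuous[OF smooth_fun_has_derivative[OF sm]])
  have i2: "integrable lborel (\<lambda>x. (f x)\<^sup>2)"
  proof -
    have "integrable lborel (\<lambda>x. indicator (cbox a b) x *\<^sub>R (f x)\<^sup>2)"
      using borel_integrable_compact[of "cbox a b" "\<lambda>x. (f x)\<^sup>2"] continuous_on_subset[OF continuous_on_power[OF cf]] by (simp add: set_integrable_def)
    also have "(\<lambda>x. indicator (cbox a b) x *\<^sub>R (f x)\<^sup>2) = (\<lambda>x. (f x)\<^sup>2)"
      using t(1) by (auto simp: indicator_def fun_eq_iff)
    finally show ?thesis .
  qed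
  define N where "N = (\<integral>x. (f x)\<^sup>2 \<partial>lborel)"
  have "N \<noteq> 0"
  proof
    assume "N = 0"
    then have ae: "AE x in lborel. f x = 0"
      using i2 unfolding N_def by (subst (asm) integral_nonneg_eq_0_iff_AE) auto
    have "(\<integral>\<^sup>+x. ennreal (f x) \<partial>lborel) = (\<integral>\<^sup>+x. (\<integral>\<^sup>+y. ennreal (\<rho> (x - y) * g y) \<partial>lborel) \<partial>lborel)"
      unfolding f_def conv_def using bump_class_conv_integrable[OF \<rho>(1) q gi] \<rho>(2)
      by (intro nn_integral_cong nn_integral_eq_integral[symmetric]) (auto simp: g_def)
    also have "\<dots> = 1"
      using nn_integral_mollified[OF \<rho>(1) q \<rho>(2) \<rho>(3) gi, of g] \<rho>(2) g1 by (simp add: g_def)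
    finally have "(\<integral>\<^sup>+x. ennreal (f x) \<partial>lborel) = 1" .
    moreover have "(\<integral>\<^sup>+x. ennreal (f x) \<partial>lborel) = (\<integral>\<^sup>+x. 0 \<partial>(lborel::'a measure))"
      by (rule nn_integral_cong_AE) (use ae in auto)
    ultimately show False by simp
  qed
  then have N: "N > 0" unfolding N_def by (simp add: less_le)
  define \<phi> where "\<phi> x = (1 / sqrt N) * f (0 + 1 *\<^sub>R x)" for x
  have "smooth_fun \<phi>" unfolding \<phi>_def by (rule smooth_fun_affine[OF sm])
  moreover have "closure {x. \<phi> x \<noteq> 0} \<subseteq> cbox a b"
    using N supp by (simp add: \<phi>_def)
  moreover have "(\<integral>x. (\<phi> x)\<^sup>2 \<partial>lborel) = 1"
    using N by (simp add: \<phi>_def power_divide power_mult_distrib N_def[symmetric])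
  ultimately show ?thesis unfolding rayleigh_set_def by blast
qed

text \<open>The step kernel is tested on |\<open>\<phi>\<close>| divided by the half weight: the
  form becomes the overlap of |\<open>\<phi>\<close>|, at least 1 - h I, while the squared norm is
  at most 1 + h P up to O(h^2). The quotient raised to the power \<open>\<beta>\<close> 2^l / h
  tends to the claimed exponential as the mesh is refined.\<close>

lemma ktrace_fk_dyadic_ge:
  assumes r: "r \<in> rayleigh_set"
  shows "ennreal (exp (2 ^ l * \<beta> * r)) \<le> ktrace (kpower fk_kernel (2 ^ l - 1))"
proof -
  obtain \<phi> where r_eq: "r = (\<integral>x. - V x * (\<phi> x)\<^sup>2 \<partial>lborel) - (\<integral>x. (norm (grad \<phi> x))\<^sup>2 \<partial>lborel)"
    and sm: "smooth_fun \<phi>" and supp: "closure {x. \<phi> x \<noteq> 0} \<subseteq> cbox a b" and one: "(\<integral>x. (\<phi> x)\<^sup>2 \<partial>lborel) = 1"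
    using r unfolding rayleigh_set_def by blast
  note t = smooth_test_function[OF sm supp]
  note t(3)[measurable]
  obtain C where C: "C > 0" "\<And>x. \<bar>V x\<bar> \<le> C" using V_bounded by blast
  have i2: "integrable lborel (\<lambda>x. (\<phi> x)\<^sup>2)" using one not_integrable_integral_eq by fastforce
  have iV: "integrable lborel (\<lambda>x. V x * (\<phi> x)\<^sup>2)" by (rule integrable_V_mult[OF i2]) simp
  define P where "P = (\<integral>x. V x * (\<phi> x)\<^sup>2 \<partial>lborel)"
  define I where "I = (\<integral>x. (norm (grad \<phi> x))\<^sup>2 \<partial>lborel)"
  have I0: "I \<ge> 0" by (simp add: I_def)
  have rPI: "r = - P - I" unfolding r_eq P_def I_def by simp
  define f where "f x = \<bar>\<phi> x\<bar>" for x
  have [measurable]: "f \<in> borel_measurable borel" unfolding f_def[abs_def] by measurable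
  have f0: "0 \<le> f x" for x by (simp add: f_def)
  have sqf: "sqnorm f = 1"
    unfolding sqnorm_def f_def using nn_integral_eq_integral[OF i2] one by simp
  \<comment> \<open>The second-order errors per unit time: one from the logarithm of 1 - h I, one
    from linearising the weight in the norm.\<close>
  define loss where "loss h = 2 * h * I\<^sup>2 + C * (exp (h * C) - 1)" for h
  have main: "ennreal (exp (2 ^ l * \<beta> * (r - loss h))) \<le> ktrace (kpower (step_kernel h) (2 ^ (m + l) - 1))"
    if h: "h = \<beta> / 2 ^ m" and hI: "h * I \<le> 1 / 2" and m: "m \<ge> 1" for h m
  proof -
    have h0: "h > 0" using \<beta>_pos by (simp add: h)
    define w where "w x = (if x \<in> cbox a b then exp (h / 2 * V x) else 0)" for x
    have [measurable]: "w \<in> borel_measurable borel" unfolding w_def[abs_def] by measurable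
    define \<psi> where "\<psi> x = ennreal (f x * w x)" for x
    have [measurable]: "\<psi> \<in> borel_measurable borel" unfolding \<psi>_def[abs_def] by measurable
    have w0: "0 \<le> w x" for x by (simp add: w_def)
    have bw: "boltzmann (h / 2) x * \<psi> x = ennreal (f x)" for x
    proof (cases "x \<in> cbox a b")
      case True
      have "exp (- (h / 2) * V x) * (f x * exp (h / 2 * V x)) = f x * (exp (- (h / 2 * V x)) * exp (h / 2 * V x))" by simp
      also have "\<dots> = f x" by (simp add: exp_minus)
      finally show ?thesis using True f0[of x] by (simp add: boltzmann_def \<psi>_def w_def ennreal_mult[symmetric])
    qed (use t(1) in \<open>simp add: boltzmann_def f_def\<close>)
    have form: "kform (step_kernel h) \<psi> = overlap h f"
      unfolding kform_def overlap_def
    proof (rule nn_integral_cong)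
      fix x
      have "\<psi> x * (\<integral>\<^sup>+y. step_kernel h x y * \<psi> y \<partial>lborel) = (\<integral>\<^sup>+y. \<psi> x * (step_kernel h x y * \<psi> y) \<partial>lborel)"
        unfolding step_kernel_def by (rule nn_integral_cmult[symmetric]) measurable
      also have "\<dots> = (\<integral>\<^sup>+y. ennreal (f x) * ennreal (heat_kernel h x y) * ennreal (f y) \<partial>lborel)"
      proof (rule nn_integral_cong)
        fix y
        have "\<psi> x * (step_kernel h x y * \<psi> y) = (boltzmann (h / 2) x * \<psi> x) * ennreal (heat_kernel h x y) * (boltzmann (h / 2) y * \<psi> y)"
          by (simp add: step_kernel_def mult_ac)
        then show "\<psi> x * (step_kernel h x y * \<psi> y) = ennreal (f x) * ennreal (heat_kernel h x y) * ennreal (f y)"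
          unfolding bw .
      qed
      finally show "\<psi> x * (\<integral>\<^sup>+y. step_kernel h x y * \<psi> y \<partial>lborel) = (\<integral>\<^sup>+y. ennreal (f x) * ennreal (heat_kernel h x y) * ennreal (f y) \<partial>lborel)" .
    qed
    have eo: "energy h f + 2 * overlap h f = 2"
      using energy_add_overlap[of f h] f0 h0 by (simp add: sqf)
    have "energy h f \<le> energy h \<phi>" unfolding f_def by (rule energy_abs_le)
    also have "\<dots> \<le> ennreal (2 * h) * (\<integral>\<^sup>+x. ennreal ((norm (grad \<phi> x))\<^sup>2) \<partial>lborel)" by (rule energy_le_gradient[OF h0 sm])
    also have "\<dots> = ennreal (2 * h * I)"
      using h0 I0 nn_integral_eq_integral[OF t(2)] by (simp add: I_def[symmetric] ennreal_mult[symmetric])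
    finally have eI: "energy h f \<le> ennreal (2 * h * I)" .
    have self: "s \<le> 2 * s" for s :: ennreal by (simp add: mult_2)
    have "overlap h f \<le> energy h f + 2 * overlap h f" by (rule order_trans[OF self]) simp
    then have "overlap h f < \<top>" unfolding eo by (rule le_less_trans) simp
    then obtain v where v: "overlap h f = ennreal v" "v \<ge> 0" by (cases "overlap h f") auto
    have "ennreal 2 \<le> ennreal (2 * h * I) + ennreal (2 * v)"
      using add_right_mono[OF eI, of "2 * overlap h f"] v unfolding eo by (simp add: ennreal_mult)
    then have "2 \<le> 2 * h * I + 2 * v"
      using h0 I0 v by (subst (asm) ennreal_plus[symmetric]) (auto simp: ennreal_le_iff simp del: ennreal_plus)
    then have v1: "1 - h * I \<le> v" by simp
    \<comment> \<open>Uses ln(1 - x) \<ge> -x - 2 x^2 for x between 0 and 1/2.\<close>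
    have "exp (- (h * I) - 2 * (h * I)\<^sup>2) \<le> exp (ln (1 - h * I))"
      using ln_one_minus_pos_lower_bound[of "h * I"] h0 I0 hI by (subst exp_le_cancel_iff) auto
    also have "\<dots> = 1 - h * I" using hI by simp
    finally have vge: "exp (- (h * I) - 2 * (h * I)\<^sup>2) \<le> v" using v1 by simp
    define Nn where "Nn = (\<integral>x. exp (h * V x) * (\<phi> x)\<^sup>2 \<partial>lborel)"
    have ie: "integrable lborel (\<lambda>x. exp (h * V x) * (\<phi> x)\<^sup>2)"
    proof (rule Bochner_Integration.integrable_bound[where f = "\<lambda>x. exp (h * C) * (\<phi> x)\<^sup>2"])
      show "AE x in lborel. norm (exp (h * V x) * (\<phi> x)\<^sup>2) \<le> norm (exp (h * C) * (\<phi> x)\<^sup>2)"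
      proof (intro AE_I2)
        fix x
        have "h * V x \<le> h * C" using abs_le_D1[OF C(2)[of x]] h0 by (intro mult_left_mono) auto
        then have "exp (h * V x) * (\<phi> x)\<^sup>2 \<le> exp (h * C) * (\<phi> x)\<^sup>2" by (intro mult_right_mono) auto
        then show "norm (exp (h * V x) * (\<phi> x)\<^sup>2) \<le> norm (exp (h * C) * (\<phi> x)\<^sup>2)"
          by (simp only: real_norm_def abs_mult abs_power2 abs_exp_cancel)
      qed
    qed (use i2 in auto)
    have N\<psi>: "(\<integral>\<^sup>+u. (\<psi> u)\<^sup>2 \<partial>lborel) = ennreal Nn"
    proof -
      have "(\<integral>\<^sup>+u. (\<psi> u)\<^sup>2 \<partial>lborel) = (\<integral>\<^sup>+x. ennreal (exp (h * V x) * (\<phi> x)\<^sup>2) \<partial>lborel)"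
      proof (rule nn_integral_cong)
        fix x
        have "(f x * w x)\<^sup>2 = exp (h * V x) * (\<phi> x)\<^sup>2"
        proof (cases "x \<in> cbox a b")
          case True
          have "(w x)\<^sup>2 = exp (h * V x)" using True by (simp add: w_def power2_eq_square exp_add[symmetric])
          then show ?thesis by (simp add: power_mult_distrib f_def mult.commute)
        qed (use t(1) in \<open>simp add: f_def\<close>)
        then show "(\<psi> x)\<^sup>2 = ennreal (exp (h * V x) * (\<phi> x)\<^sup>2)"
          using f0[of x] w0[of x] by (simp add: \<psi>_def ennreal_power)
      qed
      also have "\<dots> = ennreal Nn" unfolding Nn_def by (rule nn_integral_eq_integral[OF ie]) simp
      finally show ?thesis .
    qed
    have Nn_le: "Nn \<le> exp (h * (P + C * (exp (h * C) - 1)))"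
    proof -
      have "Nn \<le> (\<integral>x. (\<phi> x)\<^sup>2 + h * (V x * (\<phi> x)\<^sup>2) + h * (C * (exp (h * C) - 1)) * (\<phi> x)\<^sup>2 \<partial>lborel)"
        unfolding Nn_def
      proof (rule integral_mono)
        fix x
        define u where "u = h * V x"
        have "1 - u \<le> exp (- u)" using exp_ge_add_one_self[of "- u"] by simp
        then have "exp u * (1 - u) \<le> exp u * exp (- u)" by (intro mult_left_mono) auto
        then have e1: "exp u \<le> 1 + u * exp u" by (simp add: exp_minus algebra_simps)
        \<comment> \<open>With exp u \<le> 1 + u + u (exp u - 1), this makes the error of the
          linearisation h times a quantity that vanishes with h. For negative u the bound follows
          from exp u + exp(-u) \<ge> 2.\<close>
        have "\<bar>exp u - 1\<bar> \<le> exp (h * C) - 1"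
        proof (cases "u \<ge> 0")
          case True
          then have "1 \<le> exp u" by simp
          moreover have "u \<le> h * C" unfolding u_def using abs_le_D1[OF C(2)[of x]] h0 by (intro mult_left_mono) auto
          ultimately show ?thesis by simp
        next
          case False
          have uC: "- u \<le> h * C" unfolding u_def using abs_le_D2[OF C(2)[of x]] h0 mult_left_mono[of "- V x" C h] by simp
          have "2 \<le> exp u + exp (- u)"
            using exp_ge_add_one_self[of u] exp_ge_add_one_self[of "- u"] by linarith
          also have "exp (- u) \<le> exp (h * C)" using uC by simp
          finally show ?thesis using False by simp
        qed
        then have "\<bar>V x\<bar> * \<bar>exp u - 1\<bar> \<le> C * (exp (h * C) - 1)" using C by (intro mult_mono) auto
        then have "V x * (exp u - 1) \<le> C * (exp (h * C) - 1)" by (metis abs_ge_self abs_mult order_trans)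
        then have "h * (V x * (exp u - 1)) \<le> h * (C * (exp (h * C) - 1))" using h0 by (intro mult_left_mono) auto
        then have "exp u \<le> 1 + h * V x + h * (C * (exp (h * C) - 1))"
          using e1 by (simp add: u_def algebra_simps)
        then have "exp u * (\<phi> x)\<^sup>2 \<le> (1 + h * V x + h * (C * (exp (h * C) - 1))) * (\<phi> x)\<^sup>2" by (intro mult_right_mono) auto
        then show "exp (h * V x) * (\<phi> x)\<^sup>2 \<le> (\<phi> x)\<^sup>2 + h * (V x * (\<phi> x)\<^sup>2) + h * (C * (exp (h * C) - 1)) * (\<phi> x)\<^sup>2"
          unfolding u_def by (simp only: distrib_right mult_1 mult.assoc)
      qed (use ie i2 iV in auto)
      also have "\<dots> = 1 + h * (P + C * (exp (h * C) - 1))"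
        using i2 iV one by (simp add: P_def distrib_left)
      also have "\<dots> \<le> exp (h * (P + C * (exp (h * C) - 1)))" by (rule exp_ge_add_one_self)
      finally show ?thesis .
    qed
    have Nn0: "Nn \<ge> 0" by (simp add: Nn_def)
    define Q where "Q = (2::nat) ^ (m + l)"
    obtain i where i: "m + l = Suc i" using m by (cases "m + l") auto
    have "(ennreal v) ^ Q \<le> (ennreal Nn) ^ Q * ktrace (kpower (step_kernel h) (Q - 1))"
    proof -
      have "step_kernel h x y = step_kernel h y x" for x y
        unfolding step_kernel_def heat_kernel_commute[of h x y] by (simp only: mult_ac)
      from ktrace_dyadic_ge[OF kernel_measurable_step this, of \<psi> i] show ?thesis
        unfolding N\<psi> form v(1) Q_def i by simp
    qed
    then have "ennreal (v ^ Q) \<le> ennreal (Nn ^ Q) * ktrace (kpower (step_kernel h) (Q - 1))"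
      using v Nn0 by (simp add: ennreal_power)
    moreover have "ennreal (exp (2 ^ l * \<beta> * (r - loss h))) * ennreal (Nn ^ Q) \<le> ennreal (v ^ Q)"
    proof -
      have Qh: "real Q * h = 2 ^ l * \<beta>" by (simp add: Q_def h power_add)
      have "exp (2 ^ l * \<beta> * (r - loss h)) * Nn ^ Q \<le> exp (2 ^ l * \<beta> * (r - loss h)) * exp (h * (P + C * (exp (h * C) - 1))) ^ Q"
        using Nn_le Nn0 by (intro mult_left_mono power_mono) auto
      also have "\<dots> = exp (real Q * h * (r - loss h) + real Q * (h * (P + C * (exp (h * C) - 1))))"
        unfolding Qh by (simp add: exp_of_nat_mult[symmetric] exp_add[symmetric])
      also have "real Q * h * (r - loss h) + real Q * (h * (P + C * (exp (h * C) - 1))) = real Q * (- (h * I) - 2 * (h * I)\<^sup>2)"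
        by (simp add: rPI loss_def power2_eq_square algebra_simps)
      also have "exp \<dots> = exp (- (h * I) - 2 * (h * I)\<^sup>2) ^ Q" by (rule exp_of_nat_mult)
      also have "\<dots> \<le> v ^ Q" by (intro power_mono vge) auto
      finally show ?thesis using Nn0 by (simp add: ennreal_mult[symmetric] ennreal_leI)
    qed
    ultimately have le: "ennreal (Nn ^ Q) * ennreal (exp (2 ^ l * \<beta> * (r - loss h))) \<le> ennreal (Nn ^ Q) * ktrace (kpower (step_kernel h) (Q - 1))"
      by (subst mult.commute) (rule order_trans)
    have "Nn \<noteq> 0"
    proof
      assume "Nn = 0"
      then have "AE x in lborel. exp (h * V x) * (\<phi> x)\<^sup>2 = 0"
        using ie unfolding Nn_def by (subst (asm) integral_nonneg_eq_0_iff_AE) auto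
      then have "AE x in lborel. (\<phi> x)\<^sup>2 = 0" by (auto elim!: eventually_mono)
      then have "(\<integral>x. (\<phi> x)\<^sup>2 \<partial>lborel) = 0" by (rule integral_eq_zero_AE)
      then show False using one by simp
    qed
    then have "Nn ^ Q > 0" using Nn0 by simp
    then have "ennreal (Nn ^ Q) \<noteq> 0" "ennreal (Nn ^ Q) \<noteq> \<top>" by (simp_all only: ennreal_eq_0_iff not_le ennreal_neq_top not_False_eq_True)
    then show ?thesis using le unfolding Q_def by (subst (asm) ennreal_mult_le_mult_iff)
  qed
  \<comment> \<open>The dyadic meshes are the subsequence of indices \<open>2 ^ m - 1\<close> of
    \<open>mesh\<close>, whose denominator is one more than the index.\<close>
  have mesh: "mesh (2 ^ m - 1) = \<beta> / 2 ^ m" for m by (simp add: mesh_def of_nat_diff)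
  have pow2: "Suc (2 ^ m - 1) = 2 ^ m" for m by simp
  have h0: "(\<lambda>m. \<beta> / 2 ^ m) \<longlonglongrightarrow> 0"
  proof -
    have "(\<lambda>n. \<beta> * (1 / 2) ^ n) \<longlonglongrightarrow> \<beta> * 0"
      by (intro tendsto_mult tendsto_const LIMSEQ_realpow_zero) auto
    then show ?thesis by (simp add: power_divide)
  qed
  have sub: "(\<lambda>m. ktrace (kpower (step_kernel (\<beta> / 2 ^ m)) (2 ^ (m + l) - 1))) \<longlonglongrightarrow> ktrace (kpower fk_kernel (2 ^ l - 1))"
  proof -
    have "strict_mono (\<lambda>m. (2::nat) ^ m - 1)" by (rule strict_monoI) (simp add: diff_less_mono)
    from LIMSEQ_subseq_LIMSEQ[OF ktrace_step_tendsto[of "2 ^ l - 1"] this]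
    show ?thesis by (simp only: comp_def mesh pow2 power_add)
  qed
  have "(\<lambda>m. loss (\<beta> / 2 ^ m)) \<longlonglongrightarrow> 2 * 0 * I\<^sup>2 + C * (exp (0 * C) - 1)"
    unfolding loss_def by (intro tendsto_intros h0)
  then have "(\<lambda>m. ennreal (exp (2 ^ l * \<beta> * (r - loss (\<beta> / 2 ^ m))))) \<longlonglongrightarrow> ennreal (exp (2 ^ l * \<beta> * (r - (2 * 0 * I\<^sup>2 + C * (exp (0 * C) - 1)))))"
    by (intro tendsto_ennrealI tendsto_exp tendsto_mult tendsto_diff tendsto_const)
  then have "(\<lambda>m. ennreal (exp (2 ^ l * \<beta> * (r - loss (\<beta> / 2 ^ m))))) \<longlonglongrightarrow> ennreal (exp (2 ^ l * \<beta> * r))"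
    by (simp only: mult_zero_left mult_zero_right exp_zero diff_self add_0 diff_zero)
  then show ?thesis
  proof (rule LIMSEQ_le[OF _ sub])
    have "(\<lambda>m. \<beta> / 2 ^ m * I) \<longlonglongrightarrow> 0 * I" by (intro tendsto_intros h0)
    then have "\<forall>\<^sub>F m in sequentially. \<beta> / 2 ^ m * I < 1 / 2" by (intro order_tendstoD) auto
    then have "\<forall>\<^sub>F m in sequentially. ennreal (exp (2 ^ l * \<beta> * (r - loss (\<beta> / 2 ^ m)))) \<le> ktrace (kpower (step_kernel (\<beta> / 2 ^ m)) (2 ^ (m + l) - 1))"
      using eventually_ge_at_top[of 1] by eventually_elim (rule main, auto)
    then show "\<exists>N. \<forall>m\<ge>N. ennreal (exp (2 ^ l * \<beta> * (r - loss (\<beta> / 2 ^ m)))) \<le> ktrace (kpower (step_kernel (\<beta> / 2 ^ m)) (2 ^ (m + l) - 1))"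
      by (simp add: eventually_sequentially)
  qed
qed

text \<open>One power of the Feynman-Kac kernel corresponds to 2^m steps, each costing
  \<open>exp (\<beta> / 2 ^ m * \<mu>)\<close>. The accumulated factor does not depend on m, and the
  inequality passes to the limit.\<close>

lemma ktrace_fk_add_le:
  assumes \<mu>: "\<mu> > eigen"
  shows "ktrace (kpower fk_kernel (j + i)) \<le> ennreal (exp (\<beta> * \<mu>) ^ i) * ktrace (kpower fk_kernel j)"
proof -
  obtain m0 where m0: "\<And>m. m \<ge> m0 \<Longrightarrow> form_bound (step_kernel (\<beta> / 2 ^ m)) (ennreal (exp (\<beta> / 2 ^ m * \<mu>)))"
    using form_bound_step_kernel[OF \<mu>] by blast
  have mesh: "mesh (2 ^ m - 1) = \<beta> / 2 ^ m" for m by (simp add: mesh_def of_nat_diff)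
  have pow2: "Suc (2 ^ m - 1) = 2 ^ m" for m by simp
  have sub: "(\<lambda>m. ktrace (kpower (step_kernel (\<beta> / 2 ^ m)) (2 ^ m * Suc j - 1))) \<longlonglongrightarrow> ktrace (kpower fk_kernel j)" for j
  proof -
    have "strict_mono (\<lambda>m. (2::nat) ^ m - 1)" by (rule strict_monoI) (simp add: diff_less_mono)
    from LIMSEQ_subseq_LIMSEQ[OF ktrace_step_tendsto[of j] this]
    show ?thesis by (simp only: comp_def mesh pow2)
  qed
  have fin: "ennreal (exp (\<beta> * \<mu>) ^ i) \<noteq> \<top>" by simp
  have "(\<lambda>m. ennreal (exp (\<beta> * \<mu>) ^ i) * ktrace (kpower (step_kernel (\<beta> / 2 ^ m)) (2 ^ m * Suc j - 1))) \<longlonglongrightarrow> ennreal (exp (\<beta> * \<mu>) ^ i) * ktrace (kpower fk_kernel j)"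
    by (intro tendsto_mult_ennreal tendsto_const sub) auto
  then show ?thesis
  proof (rule LIMSEQ_le[OF sub[of "j + i"]])
    have "ktrace (kpower (step_kernel (\<beta> / 2 ^ m)) (2 ^ m * Suc (j + i) - 1)) \<le> ennreal (exp (\<beta> * \<mu>) ^ i) * ktrace (kpower (step_kernel (\<beta> / 2 ^ m)) (2 ^ m * Suc j - 1))"
      if m: "m \<ge> max m0 1" for m
    proof -
      \<comment> \<open>At least two steps are required, so that the initial power has exponent 2 or
        more and can be factored as G G^T.\<close>
      have two: "(2::nat) \<le> 2 ^ m" using m power_increasing[of 1 m "2::nat"] by simp
      have ex: "2 ^ m * Suc (j + i) - 1 = (2 ^ m * Suc j - 1) + 2 ^ m * i" using two by (simp add: algebra_simps)
      have h: "\<beta> / 2 ^ m > 0" using \<beta>_pos by simp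
      have "ktrace (kpower (step_kernel (\<beta> / 2 ^ m)) (2 ^ m * Suc (j + i) - 1)) \<le> (ennreal (exp (\<beta> / 2 ^ m * \<mu>))) ^ (2 ^ m * i) * ktrace (kpower (step_kernel (\<beta> / 2 ^ m)) (2 ^ m * Suc j - 1))"
        unfolding ex
        by (rule ktrace_kpower_add_le[OF kernel_measurable_step kernel_measurable_sqrt_step step_kernel_eq_sqrt[OF h]])
          (use m m0 two in auto)
      also have "(ennreal (exp (\<beta> / 2 ^ m * \<mu>))) ^ (2 ^ m * i) = ennreal (exp (\<beta> * \<mu>) ^ i)"
      proof -
        have "exp (\<beta> / 2 ^ m * \<mu>) ^ (2 ^ m * i) = exp (real (2 ^ m * i) * (\<beta> / 2 ^ m * \<mu>))" by (rule exp_of_nat_mult[symmetric])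
        also have "real (2 ^ m * i) * (\<beta> / 2 ^ m * \<mu>) = real i * (\<beta> * \<mu>)" by simp
        also have "exp \<dots> = exp (\<beta> * \<mu>) ^ i" by (rule exp_of_nat_mult)
        finally show ?thesis by (simp add: ennreal_power)
      qed
      finally show ?thesis .
    qed
    then show "\<exists>N. \<forall>m\<ge>N. ktrace (kpower (step_kernel (\<beta> / 2 ^ m)) (2 ^ m * Suc (j + i) - 1)) \<le> ennreal (exp (\<beta> * \<mu>) ^ i) * ktrace (kpower (step_kernel (\<beta> / 2 ^ m)) (2 ^ m * Suc j - 1))"
      by blast
  qed
qed

lemma ktrace_fk_finite: "ktrace fk_kernel < \<top>"
proof -
  obtain M where "\<forall>n x y. kpower (step_kernel (mesh n)) n x y \<le> ennreal M * indicator (cbox a b) x * indicator (cbox a b) y"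
    using step_kpower_bound by auto
  note M = this[rule_format]
  have "fk_kernel x x \<le> ennreal M * indicator (cbox a b) x * indicator (cbox a b) x" for x
    by (rule LIMSEQ_le_const2[OF step_kpower_tendsto], rule exI[of _ 0], intro allI impI, rule M)
  then have "fk_kernel x x \<le> ennreal M * indicator (cbox a b) x" for x
    by (rule order_trans) (auto simp: indicator_def)
  then have "ktrace fk_kernel \<le> (\<integral>\<^sup>+x. ennreal M * indicator (cbox a b) x \<partial>lborel)"
    unfolding ktrace_def by (intro nn_integral_mono)
  also have "\<dots> < \<top>" using emeasure_lborel_cbox_finite[of a b]
    by (subst nn_integral_cmult_indicator) (auto simp: ennreal_mult_less_top)
  finally show ?thesis .
qed

lemma trace_sym_perm: "trace_sym \<beta> W N = ennreal (1 / fact N) * perm_integral {..<N} (\<lambda>i. kpower fk_kernel 0)"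
  unfolding trace_sym_eq perm_integral_def by simp

text \<open>The rate on the traces holds from exponent one on, so only the constant of the first
  trace enters, rounded up to a natural number for the polynomial bound.\<close>

lemma trace_sym_upper:
  assumes \<mu>: "\<mu> > eigen"
  shows "\<exists>c. \<forall>N. trace_sym \<beta> W N \<le> ennreal ((real N + 1) ^ c * exp (\<beta> * \<mu>) ^ N)"
proof -
  define r where "r = exp (\<beta> * \<mu>)"
  have r: "r > 0" by (simp add: r_def)
  obtain T where T: "ktrace fk_kernel = ennreal T" "T \<ge> 0" using ktrace_fk_finite by (cases "ktrace fk_kernel") auto
  define c where "c = nat \<lceil>T / r\<rceil> + 1"
  have c: "c \<ge> 1" "T / r \<le> real c" by (auto simp: c_def) linarith
  have tr: "ktrace (kpower fk_kernel n) \<le> ennreal (real c * r ^ (n + 1))" for n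
  proof -
    have "ktrace (kpower fk_kernel n) \<le> ennreal (r ^ n) * ennreal T"
      using ktrace_fk_add_le[OF \<mu>, of 0 n] T by (simp add: r_def)
    also have "\<dots> = ennreal (r ^ n * T)" using r T by (simp add: ennreal_mult)
    also have "\<dots> \<le> ennreal (real c * r ^ (n + 1))"
    proof (rule ennreal_leI)
      have "T \<le> real c * r" using c(2) r by (simp add: divide_le_eq)
      then have "r ^ n * T \<le> r ^ n * (real c * r)" using r by (intro mult_left_mono) auto
      then show "r ^ n * T \<le> real c * r ^ (n + 1)" by (simp add: mult_ac)
    qed
    finally show ?thesis .
  qed
  have "trace_sym \<beta> W N \<le> ennreal ((real N + 1) ^ c * r ^ N)" for N
  proof -
    have "perm_integral {..<N} (\<lambda>i. kpower fk_kernel 0) \<le> ennreal (pochhammer (real c) (card {..<N}) * r ^ (\<Sum>i\<in>{..<N}. 0 + 1))"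
      by (rule perm_integral_kpower_le[OF fk_kernel_measurable]) (use c r tr in auto)
    also have "\<dots> \<le> ennreal (fact N * (real N + 1) ^ c * r ^ N)"
      using pochhammer_le[OF c(1), of N] r by (intro ennreal_leI) (simp add: mult_right_mono)
    finally have "trace_sym \<beta> W N \<le> ennreal (1 / fact N) * ennreal (fact N * (real N + 1) ^ c * r ^ N)"
      unfolding trace_sym_perm by (intro mult_left_mono) auto
    also have "\<dots> = ennreal ((real N + 1) ^ c * r ^ N)" using r by (simp add: ennreal_mult[symmetric])
    finally show ?thesis .
  qed
  then show ?thesis unfolding r_def by blast
qed

text \<open>The trace is known from below at the power of two 2^l with N \<le> 2^l < 2N, and coming
  down to N costs the growth bound with \<open>\<mu>\<close>. The two rates differ by less than 2
  \<open>\<delta>\<close>, so the total loss is at most 4 \<open>\<delta>\<close> N; starting from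
  \<open>eigen + \<delta>\<close> this leaves \<open>eigen - 3 * \<delta>\<close>. The 1/N is (N -
  1)!/N!.\<close>

lemma trace_sym_lower:
  assumes \<delta>: "\<delta> > 0" and N: "N \<ge> 1"
  shows "ennreal (exp (real N * (\<beta> * (eigen - 3 * \<delta>))) / real N) \<le> trace_sym \<beta> W N"
proof -
  obtain r where r: "r \<in> rayleigh_set" "r > eigen - \<delta>"
    using less_cSup_iff[OF rayleigh_set_nonempty rayleigh_bdd_above, of "eigen - \<delta>"] \<delta> unfolding eigen_eq[symmetric] by auto
  have rle: "r \<le> eigen" unfolding eigen_eq by (rule cSup_upper[OF r(1) rayleigh_bdd_above])
  define \<mu> where "\<mu> = eigen + \<delta>"
  have \<mu>: "\<mu> > eigen" using \<delta> by (simp add: \<mu>_def)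
  obtain l where l: "N \<le> 2 ^ l" "2 ^ l < 2 * N"
  proof -
    define l where "l = (LEAST l. N \<le> 2 ^ l)"
    have ex: "N \<le> 2 ^ N" by (simp add: less_imp_le)
    have l1: "N \<le> 2 ^ l" unfolding l_def by (rule LeastI[of "\<lambda>l. N \<le> 2 ^ l"]) (rule ex)
    have "2 ^ l < 2 * N"
    proof (cases l)
      case (Suc k)
      then have "\<not> N \<le> 2 ^ k" using not_less_Least[of k "\<lambda>l. N \<le> 2 ^ l"] unfolding l_def by simp
      then show ?thesis using Suc by simp
    qed (use N in simp)
    then show ?thesis using l1 that by blast
  qed
  have Q: "real N \<le> 2 ^ l" "2 ^ l \<le> 2 * real N"
    using of_nat_mono[OF l(1), where 'a = real] of_nat_mono[OF less_imp_le[OF l(2)], where 'a = real] by simp_all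
  define t where "t = ktrace (kpower fk_kernel (N - 1))"
  define i where "i = 2 ^ l - N"
  have i: "2 ^ l - 1 = (N - 1) + i" "real i = 2 ^ l - real N" using l N by (auto simp: i_def of_nat_diff)
  have "ennreal (exp (2 ^ l * \<beta> * r)) \<le> ennreal (exp (\<beta> * \<mu>) ^ i) * t"
    using ktrace_fk_dyadic_ge[OF r(1), of l] ktrace_fk_add_le[OF \<mu>, of "N - 1" i] unfolding i(1) t_def by (rule order_trans)
  then have "ennreal (exp (- (real i * (\<beta> * \<mu>)))) * ennreal (exp (2 ^ l * \<beta> * r)) \<le> ennreal (exp (- (real i * (\<beta> * \<mu>)))) * (ennreal (exp (\<beta> * \<mu>) ^ i) * t)"
    by (rule mult_left_mono) simp
  also have "\<dots> = t"
  proof -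
    have "exp (- (real i * (\<beta> * \<mu>))) * exp (\<beta> * \<mu>) ^ i = 1"
      by (simp add: exp_of_nat_mult[symmetric] exp_minus)
    then show ?thesis by (simp add: mult.assoc[symmetric] ennreal_mult[symmetric])
  qed
  also have "ennreal (exp (- (real i * (\<beta> * \<mu>)))) * ennreal (exp (2 ^ l * \<beta> * r)) = ennreal (exp (- (real i * (\<beta> * \<mu>)) + 2 ^ l * \<beta> * r))"
    by (simp only: ennreal_mult[symmetric] exp_add exp_ge_zero)
  finally have tge: "ennreal (exp (- (real i * (\<beta> * \<mu>)) + 2 ^ l * \<beta> * r)) \<le> t" .
  have "real N * (\<beta> * (eigen - 3 * \<delta>)) \<le> - (real i * (\<beta> * \<mu>)) + 2 ^ l * \<beta> * r"
  proof -
    have "2 ^ l * (\<mu> - r) \<le> (2 * real N) * (\<mu> - r)" using Q(2) rle \<mu> by (intro mult_right_mono) auto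
    also have "\<dots> \<le> (2 * real N) * (2 * \<delta>)" using r(2) by (intro mult_left_mono) (auto simp: \<mu>_def)
    finally have "real N * \<mu> - (2 * real N) * (2 * \<delta>) \<le> real N * \<mu> - 2 ^ l * (\<mu> - r)" by simp
    then have "real N * (eigen - 3 * \<delta>) \<le> - (real i * \<mu>) + 2 ^ l * r"
      by (simp add: i(2) \<mu>_def algebra_simps)
    from mult_left_mono[OF this, of \<beta>] \<beta>_pos show ?thesis by (simp add: algebra_simps)
  qed
  then have t2: "ennreal (exp (real N * (\<beta> * (eigen - 3 * \<delta>)))) \<le> t"
    using tge by (intro order_trans[OF ennreal_leI tge]) simp
  have "ennreal (fact (card {..<N} - 1)) * ktrace (kpower fk_kernel ((\<Sum>i\<in>{..<N}. 0 + 1) - 1)) \<le> perm_integral {..<N} (\<lambda>i. kpower fk_kernel 0)"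
    by (rule perm_integral_kpower_ge[OF fk_kernel_measurable]) (use N in \<open>auto simp: lessThan_empty_iff\<close>)
  then have "ennreal (fact (N - 1)) * t \<le> perm_integral {..<N} (\<lambda>i. kpower fk_kernel 0)" by (simp add: t_def)
  then have "ennreal (1 / fact N) * (ennreal (fact (N - 1)) * t) \<le> trace_sym \<beta> W N"
    unfolding trace_sym_perm by (rule mult_left_mono) simp
  moreover have "ennreal (1 / fact N) * (ennreal (fact (N - 1)) * t) = ennreal (1 / real N) * t"
  proof -
    have "1 / fact N * fact (N - 1) = 1 / real N" using N by (simp add: fact_reduce[of N])
    then show ?thesis by (simp add: mult.assoc[symmetric] ennreal_mult[symmetric])
  qed
  moreover have "ennreal (exp (real N * (\<beta> * (eigen - 3 * \<delta>))) / real N) \<le> ennreal (1 / real N) * t"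
    using mult_left_mono[OF t2, of "ennreal (1 / real N)"] by (simp add: ennreal_mult[symmetric])
  ultimately show ?thesis by (metis order_trans)
qed

lemma trace_sym_log_limit:
  "(\<lambda>N. ln (enn2real (trace_sym \<beta> W N)) / real N) \<longlonglongrightarrow> \<beta> * eigen"
proof (rule LIMSEQ_I)
  fix e :: real assume e: "e > 0"
  \<comment> \<open>Half of e pays for 3 \<open>\<beta>\<close> \<open>\<delta>\<close> in the lower
    bound, the other half for the logarithmic corrections.\<close>
  define \<delta> where "\<delta> = e / (6 * \<beta>)"
  have \<delta>: "\<delta> > 0" "3 * (\<beta> * \<delta>) = e / 2" using e \<beta>_pos by (auto simp: \<delta>_def)
  obtain c where up: "\<And>N. trace_sym \<beta> W N \<le> ennreal ((real N + 1) ^ c * exp (\<beta> * (eigen + \<delta>)) ^ N)"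
    using trace_sym_upper[of "eigen + \<delta>"] \<delta> by auto
  have l1: "(\<lambda>N. real c * ln (real N + 1) / real N) \<longlonglongrightarrow> 0" by real_asymp
  have l2: "(\<lambda>N. ln (real N) / real N) \<longlonglongrightarrow> 0" by real_asymp
  have ev1: "\<forall>\<^sub>F N in sequentially. real c * ln (real N + 1) / real N < e / 2" using order_tendstoD(2)[OF l1, of "e / 2"] e by simp
  have ev2: "\<forall>\<^sub>F N in sequentially. ln (real N) / real N < e / 2" using order_tendstoD(2)[OF l2, of "e / 2"] e by simp
  have "\<forall>\<^sub>F N in sequentially. norm (ln (enn2real (trace_sym \<beta> W N)) / real N - \<beta> * eigen) < e"
    using ev1 ev2 eventually_ge_at_top[of 1]
  proof eventually_elim
    case (elim N)
    then have N: "N \<ge> 1" "real N > 0" by auto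
    define Z where "Z = enn2real (trace_sym \<beta> W N)"
    have "trace_sym \<beta> W N < \<top>" using up[of N] by (rule le_less_trans) simp
    then have Z: "trace_sym \<beta> W N = ennreal Z" "Z \<ge> 0" by (auto simp: Z_def)
    have Zup: "Z \<le> (real N + 1) ^ c * exp (\<beta> * (eigen + \<delta>)) ^ N"
      using up[of N] Z by (simp add: ennreal_le_iff)
    have Zlow: "exp (real N * (\<beta> * (eigen - 3 * \<delta>))) / real N \<le> Z"
      using trace_sym_lower[OF \<delta>(1) N(1)] Z by (simp add: ennreal_le_iff)
    have Zpos: "Z > 0" by (rule less_le_trans[OF _ Zlow]) (use N in simp)
    have "ln Z \<le> ln ((real N + 1) ^ c * exp (\<beta> * (eigen + \<delta>)) ^ N)" using Zup Zpos by (subst ln_le_cancel_iff) auto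
    also have "\<dots> = real c * ln (real N + 1) + real N * (\<beta> * (eigen + \<delta>))"
      by (simp add: ln_mult ln_realpow)
    finally have "ln Z / real N \<le> (real c * ln (real N + 1) + real N * (\<beta> * (eigen + \<delta>))) / real N"
      using N by (intro divide_right_mono) auto
    also have "\<dots> = real c * ln (real N + 1) / real N + \<beta> * (eigen + \<delta>)" using N by (simp add: add_divide_distrib)
    finally have u: "ln Z / real N < e / 2 + \<beta> * (eigen + \<delta>)" using elim by linarith
    have "ln (exp (real N * (\<beta> * (eigen - 3 * \<delta>))) / real N) \<le> ln Z" using Zlow Zpos N by (subst ln_le_cancel_iff) auto
    then have "real N * (\<beta> * (eigen - 3 * \<delta>)) - ln (real N) \<le> ln Z" using N by (simp add: ln_div)
    then have "(real N * (\<beta> * (eigen - 3 * \<delta>)) - ln (real N)) / real N \<le> ln Z / real N" using N by (intro divide_right_mono) auto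
    moreover have "(real N * (\<beta> * (eigen - 3 * \<delta>)) - ln (real N)) / real N = \<beta> * (eigen - 3 * \<delta>) - ln (real N) / real N"
      using N by (simp add: diff_divide_distrib)
    ultimately have lo: "\<beta> * (eigen - 3 * \<delta>) - e / 2 < ln Z / real N" using elim by linarith
    have "\<beta> * \<delta> < e / 2" using \<delta> \<beta>_pos mult_pos_pos[OF \<beta>_pos \<delta>(1)] by linarith
    then have "\<bar>ln Z / real N - \<beta> * eigen\<bar> < e" using u lo \<delta>(2) unfolding abs_less_iff by (simp add: algebra_simps)
    then show ?case by (simp add: Z_def)
  qed
  then show "\<exists>no. \<forall>N\<ge>no. norm (ln (enn2real (trace_sym \<beta> W N)) / real N - \<beta> * eigen) < e"
    by (simp add: eventually_sequentially)
qed

end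

theorem theorem1p6:
  fixes \<beta> :: real and a b :: "'a::euclidean_space" and W :: "'a \<Rightarrow> ereal"
  assumes "\<beta> > 0"
    and "\<forall>i\<in>Basis. a \<bullet> i < b \<bullet> i"
    and "\<forall>x\<in>cbox a b. \<bar>W x\<bar> \<noteq> \<infinity>"
    and "continuous_on (cbox a b) (\<lambda>x. real_of_ereal (W x))"
    and "\<forall>x. x \<notin> cbox a b \<longrightarrow> W x = \<infinity>"
  shows "(\<lambda>N. ln (enn2real (trace_sym \<beta> W N)) / real N)
           \<longlonglongrightarrow> \<beta> * dirichlet_eigenvalue (cbox a b) (\<lambda>x. - real_of_ereal (W x))"
proof -
  interpret box_potential \<beta> a b W by unfold_locales (use assms in auto)
  show ?thesis using trace_sym_log_limit unfolding eigen_def .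
qed

end
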